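(* Let $d,N\ge1$ be integers, $T>0$, $s>\frac d2+1$. There is a constant $C>0$ depending only on $d,N,s$ such that the following holds. Let $A^1,\dots,A^d\in L^\infty([0,T];H^s)$ take values in the symmetric $N\times N$ matrices, let $F\in L^\infty([0,T];H^{s-1})$ and $u_0\in H^{s-1}$. Assume $U\in L^\infty([0,T];H^{s-1})$ is a solution of the linear initial value problem $$\partial_tU+\sum_{a=1}^dA^a(t,x)\partial_aU=F(t,x),\qquad U(0,x)=u_0(x).$$ Then for $t\in[0,T]$ $$\|U(t)\|_{H^{s-1}}^2\le e^{\int_0^t a_s(\tau)\,d\tau}\Big(\|u_0\|_{H^{s-1}}^2+\int_0^t\|F(\tau,\cdot)\|_{H^{s-1}}^2\,d\tau\Big),$$ where $a_s(\tau):=C\sum_{a=1}^d\|A^a(\tau)\|_{H^s}+1$.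
   Context: $H^s$ denotes the usual $L^2$-based Sobolev space on $\mathbb R^d$ (of vector- or matrix-valued functions) of real order $s$ with norm $\|u\|_{H^s}=\|\mathcal F^{-1}(1+|\xi|^2)^{s/2}\mathcal F u\|_{L^2}$; $U$, $F$, $u_0$ are $\mathbb R^N$-valued. Solutions are understood in the distributional sense, $U$ being identified with its representative that is weakly continuous in time (so that $U(t)$ and the initial condition make sense for each $t$). *)

theory Defs
  imports "HOL-Analysis.Analysis"
begin

section \<open>Sobolev spaces\<close>

definition L2 :: "('a::euclidean_space \<Rightarrow> complex) \<Rightarrow> bool" where
  "L2 f \<longleftrightarrow> f \<in> borel_measurable lebesgue \<and> integrable lebesgue (\<lambda>x. (cmod (f x))\<^sup>2)"

definition L2_norm :: "('a::euclidean_space \<Rightarrow> complex) \<Rightarrow> real" where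
  "L2_norm f = sqrt (LINT x|lebesgue. (cmod (f x))\<^sup>2)"

definition fourier_integral :: "('a::euclidean_space \<Rightarrow> complex) \<Rightarrow> 'a \<Rightarrow> complex" where
  "fourier_integral f \<xi> =
     of_real ((2 * pi) powr (- real DIM('a) / 2)) * (LINT x|lebesgue. cis (- (x \<bullet> \<xi>)) * f x)"

text \<open>
  The Fourier--Plancherel transform on \<open>L\<^sup>2\<close>: the limit in \<open>L\<^sup>2\<close> of the Fourier
  integrals over balls, which are absolutely convergent. It is determined up to null sets,
  and every notion below is insensitive to the choice of representative.
\<close>

definition fourier :: "('a::euclidean_space \<Rightarrow> complex) \<Rightarrow> 'a \<Rightarrow> complex" where
  "fourier f = (SOME g. L2 g \<and>
     ((\<lambda>R. L2_norm (\<lambda>\<xi>. g \<xi> - fourier_integral (\<lambda>x. indicator (ball 0 R) x * f x) \<xi>))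
        \<longlongrightarrow> 0) at_top)"

definition inv_fourier :: "('a::euclidean_space \<Rightarrow> complex) \<Rightarrow> 'a \<Rightarrow> complex" where
  "inv_fourier g x = fourier g (- x)"

definition weighted_fourier :: "real \<Rightarrow> ('a::euclidean_space \<Rightarrow> complex) \<Rightarrow> 'a \<Rightarrow> complex" where
  "weighted_fourier s f \<xi> = of_real ((1 + (norm \<xi>)\<^sup>2) powr (s / 2)) * fourier f \<xi>"

definition component :: "'b \<Rightarrow> ('a \<Rightarrow> 'b::euclidean_space) \<Rightarrow> 'a \<Rightarrow> complex" where
  "component b u x = of_real (u x \<bullet> b)"

text \<open>
  Only orders \<open>s \<ge> 0\<close> are meant. Then every element of \<open>H\<^sup>s\<close> is an \<open>L\<^sup>2\<close> function, so
  no tempered distributions are needed. Elements of \<open>H\<^sup>s\<close> are represented by functions,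
  understood up to null sets. Values in \<open>'b\<close> (such as vectors or matrices) are treated
  componentwise with respect to the orthonormal basis.
\<close>

definition sobolev :: "real \<Rightarrow> ('a::euclidean_space \<Rightarrow> 'b::euclidean_space) set" where
  "sobolev s = {u. \<forall>b\<in>Basis. L2 (component b u) \<and> L2 (weighted_fourier s (component b u))}"

definition sobolev_norm :: "real \<Rightarrow> ('a::euclidean_space \<Rightarrow> 'b::euclidean_space) \<Rightarrow> real" where
  "sobolev_norm s u =
     sqrt (\<Sum>b\<in>Basis. (L2_norm (inv_fourier (weighted_fourier s (component b u))))\<^sup>2)"

definition sobolev_dual ::
    "real \<Rightarrow> (('a::euclidean_space \<Rightarrow> 'b::euclidean_space) \<Rightarrow> real) set" where
  "sobolev_dual s = {l.
     (\<forall>u\<in>sobolev s. \<forall>v\<in>sobolev s. l (\<lambda>x. u x + v x) = l u + l v) \<and>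
     (\<forall>c. \<forall>u\<in>sobolev s. l (\<lambda>x. c *\<^sub>R u x) = c * l u) \<and>
     (\<exists>K. \<forall>u\<in>sobolev s. \<bar>l u\<bar> \<le> K * sobolev_norm s u)}"

section \<open>Time-dependent functions with values in a Sobolev space\<close>

text \<open>Strong (Bochner) measurability: almost everywhere a limit in norm of simple functions.\<close>

definition sobolev_measurable ::
    "real \<Rightarrow> real \<Rightarrow> (real \<Rightarrow> 'a::euclidean_space \<Rightarrow> 'b::euclidean_space) \<Rightarrow> bool" where
  "sobolev_measurable s T f \<longleftrightarrow>
     (AE t in lebesgue_on {0..T}. f t \<in> sobolev s) \<and>
     (\<exists>S. (\<forall>n. simple_function (lebesgue_on {0..T}) (S n) \<and> (\<forall>t\<in>{0..T}. S n t \<in> sobolev s)) \<and>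
          (AE t in lebesgue_on {0..T}.
             (\<lambda>n::nat. sobolev_norm s (\<lambda>x. f t x - S n t x)) \<longlonglongrightarrow> 0))"

definition Linf_sobolev ::
    "real \<Rightarrow> real \<Rightarrow> (real \<Rightarrow> 'a::euclidean_space \<Rightarrow> 'b::euclidean_space) \<Rightarrow> bool" where
  "Linf_sobolev s T f \<longleftrightarrow>
     sobolev_measurable s T f \<and>
     (\<exists>K. AE t in lebesgue_on {0..T}. sobolev_norm s (f t) \<le> K)"

definition weakly_continuous ::
    "real \<Rightarrow> real \<Rightarrow> (real \<Rightarrow> 'a::euclidean_space \<Rightarrow> 'b::euclidean_space) \<Rightarrow> bool" where
  "weakly_continuous s T f \<longleftrightarrow>
     (\<forall>t\<in>{0..T}. f t \<in> sobolev s) \<and>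
     (\<forall>l\<in>sobolev_dual s. continuous_on {0..T} (\<lambda>t. l (f t)))"

section \<open>Distributional solutions\<close>

primrec Ck :: "nat \<Rightarrow> ('a::euclidean_space \<Rightarrow> 'b::euclidean_space) \<Rightarrow> bool" where
  "Ck 0 f \<longleftrightarrow> continuous_on UNIV f"
| "Ck (Suc k) f \<longleftrightarrow>
     f differentiable_on UNIV \<and> (\<forall>v. Ck k (\<lambda>x. frechet_derivative f (at x) v))"

definition test_function ::
    "'a set \<Rightarrow> ('a::euclidean_space \<Rightarrow> 'b::euclidean_space) \<Rightarrow> bool" where
  "test_function D \<phi> \<longleftrightarrow>
     (\<forall>k. Ck k \<phi>) \<and> compact (closure {x. \<phi> x \<noteq> 0}) \<and> closure {x. \<phi> x \<noteq> 0} \<subseteq> D"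

definition locally_integrable :: "('a::euclidean_space \<Rightarrow> 'b::euclidean_space) \<Rightarrow> bool" where
  "locally_integrable f \<longleftrightarrow> (\<forall>K. compact K \<longrightarrow> set_integrable lebesgue K f)"

definition weak_partial :: "'d::finite \<Rightarrow> (real^'d \<Rightarrow> 'b::euclidean_space) \<Rightarrow> real^'d \<Rightarrow> 'b" where
  "weak_partial a g = (SOME h. locally_integrable h \<and>
     (\<forall>\<psi>::real^'d \<Rightarrow> real. test_function UNIV \<psi> \<longrightarrow>
        (LINT x|lebesgue. frechet_derivative \<psi> (at x) (axis a 1) *\<^sub>R g x) =
        - (LINT x|lebesgue. \<psi> x *\<^sub>R h x)))"

text \<open>
  The pairing of the distribution \<open>A \<partial>\<^sub>a u\<close> with a vector-valued test function \<open>\<phi>\<close>, namely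
  \<open>\<langle>A \<partial>\<^sub>a u, \<phi>\<rangle> = \<langle>\<partial>\<^sub>a u, A\<^sup>T \<phi>\<rangle> = - \<integral> u \<cdot> \<partial>\<^sub>a(A\<^sup>T \<phi>)\<close>. This form is needed since \<open>\<partial>\<^sub>a u\<close> need
  not be a function: for \<open>u\<close> in \<open>H\<^sup>r\<close> with \<open>r < 1\<close> (possible in dimension one) it is a
  distribution of negative order. When \<open>\<partial>\<^sub>a u\<close> is in \<open>L\<^sup>2\<close> this is the integral of
  \<open>(A \<partial>\<^sub>a u) \<cdot> \<phi>\<close>.
\<close>

definition transport_pairing ::
    "'d::finite \<Rightarrow> (real^'d \<Rightarrow> real^'n^'n) \<Rightarrow> (real^'d \<Rightarrow> real^'n) \<Rightarrow> (real^'d \<Rightarrow> real^'n) \<Rightarrow> real" where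
  "transport_pairing a A u \<phi> =
     - (LINT x|lebesgue. u x \<bullet> weak_partial a (\<lambda>y. transpose (A y) *v \<phi> y) x)"

text \<open>\<open>\<partial>\<^sub>t U + \<Sum>\<^sub>a A\<^sup>a \<partial>\<^sub>a U = F\<close> in the sense of distributions on \<open>(0, T) \<times> \<real>\<^sup>d\<close>.\<close>

definition distributional_solution ::
    "real \<Rightarrow> ('d::finite \<Rightarrow> real \<Rightarrow> real^'d \<Rightarrow> real^'n^'n) \<Rightarrow> (real \<Rightarrow> real^'d \<Rightarrow> real^'n) \<Rightarrow>
     (real \<Rightarrow> real^'d \<Rightarrow> real^'n) \<Rightarrow> bool" where
  "distributional_solution T A F U \<longleftrightarrow>
     (\<forall>\<phi>::real \<times> (real^'d) \<Rightarrow> real^'n. test_function ({0<..<T} \<times> UNIV) \<phi> \<longrightarrow>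
        (LINT t|lebesgue_on {0..T}.
           - (LINT x|lebesgue. U t x \<bullet> frechet_derivative \<phi> (at (t, x)) (1, 0))
           + (\<Sum>a\<in>UNIV. transport_pairing a (A a t) (U t) (\<lambda>x. \<phi> (t, x)))) =
        (LINT t|lebesgue_on {0..T}. LINT x|lebesgue. F t x \<bullet> \<phi> (t, x)))"

end

theory Submission
 imports Defs "HOL-Probability.Probability"
begin

text \<open>
On the Fourier side the equation says that for band-limited test functions \<open>p\<close> the pairing of \<open>U t\<close> with \<open>p\<close> is
absolutely continuous in time. Let \<open>M\<close> be the weight \<open>\<langle>\<xi>\<rangle>\<^sup>2\<^sup>\<sigma>\<close>, \<open>\<sigma> = s - 1\<close>, cut off linearly at \<open>\<langle>\<xi>\<rangle> = R\<close>. Testing with \<open>M\<close> times the transform of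
\<open>U\<close>, the symmetry of the coefficients turns the transport term into a commutator that increments of \<open>M\<close> control
uniformly in \<open>R\<close>. As \<open>U\<close> is Lipschitz in time on bounded frequencies, the resulting
energy inequality can be summed over fine partitions of \<open>[0, t]\<close>; then \<open>R\<close> tends to infinity and Gronwall's lemma applies.
\<close>

section \<open>Square integrable functions\<close>

text \<open>The solution is only in H^(s-1), so its energy cannot simply be differentiated in time,
  and the transport term applied to it loses one derivative. For \<open>d = 1\<close> even the first
  derivatives of \<open>U\<close> need not be square integrable; hence the derivative stays on the
  product of the coefficient with the test function throughout. The cutoff makes every quantity
  finite, at the price of constants that depend on \<open>R\<close>; these survive only in errors
  quadratic in the step length, which disappear before \<open>R\<close> grows. What remains is the
  kernel xi_a M(eta) - eta_a M(xi), with M the cut-off weight. Its bound has three terms, and each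
  of them puts one of the three factors in L^1 and the other two in L^2. Here \<sigma> > d/2 enters,
  as square integrability of the bracket to the power -\<sigma>. The constant is essentially the
  product of the Fourier normalisation, the kernel bound, the three L^1 embeddings and the number of
  matrix entries. The \<open>1\<close> added in \<open>a_s\<close> arises because twice the pairing
  of \<open>F\<close> with \<open>U\<close> is at most the sum of their squared norms.\<close>

definition sqint :: "('a::euclidean_space => complex) => bool" where
 "sqint f \<longleftrightarrow> f \<in> borel_measurable borel \<and> integrable lborel (\<lambda>x. (cmod (f x))\<^sup>2)"

definition nrm :: "('a::euclidean_space => complex) => real" where
 "nrm f = sqrt (LINT x|lborel. (cmod (f x))\<^sup>2)"

lemma sqint_measurable [measurable_dest]: "sqint f \<Longrightarrow> f \<in> borel_measurable borel"
 by (simp add: sqint_def)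

lemma sqint_integrable: "sqint f \<Longrightarrow> integrable lborel (\<lambda>x. (cmod (f x))\<^sup>2)"
 by (simp add: sqint_def)

lemma nrm_nonneg [simp]: "0 \<le> nrm f"
 by (simp add: nrm_def)

lemma nrm_power2: "(nrm f)\<^sup>2 = (LINT x|lborel. (cmod (f x))\<^sup>2)"
 by (simp add: nrm_def)

lemma sqint_bound:
 assumes "sqint g" "f \<in> borel_measurable borel" "AE x in lborel. cmod (f x) \<le> c * cmod (g x)"
 shows "sqint f"
proof -
 have "integrable lborel (\<lambda>x. (cmod (f x))\<^sup>2)"
 proof (rule Bochner_Integration.integrable_bound)
  show "integrable lborel (\<lambda>x. c\<^sup>2 * (cmod (g x))\<^sup>2)"
   using assms(1) by (simp add: sqint_def)
  show "AE x in lborel. norm ((cmod (f x))\<^sup>2) \<le> norm (c\<^sup>2 * (cmod (g x))\<^sup>2)"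
   using assms(3)
  proof eventually_elim
   case (elim x)
   then have "(cmod (f x))\<^sup>2 \<le> (c * cmod (g x))\<^sup>2"
    by (intro power_mono) auto
   then show ?case by (simp add: power_mult_distrib)
  qed
 qed (use assms(2) in measurable)
 then show ?thesis using assms(2) by (simp add: sqint_def)
qed

lemma nrm_bound:
 assumes "sqint g" "f \<in> borel_measurable borel" "AE x in lborel. cmod (f x) \<le> c * cmod (g x)" "0 \<le> c"
 shows "nrm f \<le> c * nrm g"
proof -
 have "(LINT x|lborel. (cmod (f x))\<^sup>2) \<le> (LINT x|lborel. c\<^sup>2 * (cmod (g x))\<^sup>2)"
 proof (rule integral_mono_AE)
  show "AE x in lborel. (cmod (f x))\<^sup>2 \<le> c\<^sup>2 * (cmod (g x))\<^sup>2"
   using assms(3)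
  proof eventually_elim
   case (elim x)
   then have "(cmod (f x))\<^sup>2 \<le> (c * cmod (g x))\<^sup>2"
    by (intro power_mono) auto
   then show ?case by (simp add: power_mult_distrib)
  qed
 qed (use sqint_bound[OF assms(1-3)] assms(1) in \<open>auto simp: sqint_def\<close>)
 then have "(nrm f)\<^sup>2 \<le> (c * nrm g)\<^sup>2"
  by (simp add: nrm_power2 power_mult_distrib)
 then show ?thesis
  using assms(4) by - (rule power2_le_imp_le, auto)
qed

lemma sqint_add: assumes "sqint f" "sqint g" shows "sqint (\<lambda>x. f x + g x)"
proof -
 note [measurable] = sqint_measurable[OF assms(1)] sqint_measurable[OF assms(2)]
 have "integrable lborel (\<lambda>x. (cmod (f x + g x))\<^sup>2)"
 proof (rule Bochner_Integration.integrable_bound)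
  show "integrable lborel (\<lambda>x. 2 * (cmod (f x))\<^sup>2 + 2 * (cmod (g x))\<^sup>2)"
   using assms by (simp add: sqint_def)
  show "AE x in lborel. norm ((cmod (f x + g x))\<^sup>2) \<le> norm (2 * (cmod (f x))\<^sup>2 + 2 * (cmod (g x))\<^sup>2)"
  proof (rule AE_I2)
   fix x
   have "(cmod (f x + g x))\<^sup>2 \<le> (cmod (f x) + cmod (g x))\<^sup>2"
    by (intro power_mono norm_triangle_ineq) auto
   also have "\<dots> \<le> 2 * (cmod (f x))\<^sup>2 + 2 * (cmod (g x))\<^sup>2"
    using sum_squares_bound[of "cmod (f x)" "cmod (g x)"] by (simp add: power2_sum)
   finally show "norm ((cmod (f x + g x))\<^sup>2) \<le> norm (2 * (cmod (f x))\<^sup>2 + 2 * (cmod (g x))\<^sup>2)"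
    by simp
  qed
 qed measurable
 then show ?thesis by (simp add: sqint_def)
qed

lemma sqint_cmult: "sqint f \<Longrightarrow> sqint (\<lambda>x. c * f x)"
 by (rule sqint_bound[where c="cmod c"]) (auto simp: norm_mult sqint_def)

lemma sqint_minus: "sqint f \<Longrightarrow> sqint (\<lambda>x. - f x)"
 using sqint_cmult[of f "-1"] by simp

lemma sqint_diff: "sqint f \<Longrightarrow> sqint g \<Longrightarrow> sqint (\<lambda>x. f x - g x)"
 using sqint_add[of f "\<lambda>x. - g x"] sqint_minus[of g] by simp

lemma sqint_zero [simp]: "sqint (\<lambda>x. 0)"
 by (simp add: sqint_def)

lemma sqint_sum: "(\<And>i. i \<in> I \<Longrightarrow> sqint (f i)) \<Longrightarrow> sqint (\<lambda>x. \<Sum>i\<in>I. f i x)"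
 by (induction I rule: infinite_finite_induct) (auto intro: sqint_add)

lemma borel_measurable_cnj [measurable]: "cnj \<in> borel_measurable borel"
 by (intro borel_measurable_continuous_onI continuous_intros)

lemma sqint_cnj: "sqint f \<Longrightarrow> sqint (\<lambda>x. cnj (f x))"
 by (rule sqint_bound[where c=1]) (auto simp: sqint_def)

lemma sqint_indicator:
 assumes "sqint f" "A \<in> sets borel" shows "sqint (\<lambda>x. indicator A x * f x)"
 by (rule sqint_bound[OF assms(1), where c=1])
   (use assms in \<open>auto simp: sqint_def norm_mult indicator_def\<close>)

lemma nrm_zero [simp]: "nrm (\<lambda>x. 0) = 0"
 by (simp add: nrm_def)

lemma nrm_cnj [simp]: "nrm (\<lambda>x. cnj (f x)) = nrm f"
 by (simp add: nrm_def)

lemma nrm_minus [simp]: "nrm (\<lambda>x. - f x) = nrm f"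
 by (simp add: nrm_def)

lemma nrm_commute: "nrm (\<lambda>x. f x - g x) = nrm (\<lambda>x. g x - f x)"
 by (simp add: nrm_def norm_minus_commute)

lemma nrm_cmult: "nrm (\<lambda>x. c * f x) = cmod c * nrm f"
 by (simp add: nrm_def norm_mult power_mult_distrib real_sqrt_mult)

lemma nrm_cong_AE:
 assumes "f \<in> borel_measurable borel" "g \<in> borel_measurable borel" "AE x in lborel. f x = g x"
 shows "nrm f = nrm g"
 unfolding nrm_def
 by (intro arg_cong[where f=sqrt] integral_cong_AE) (use assms in \<open>auto elim: eventually_mono\<close>)

lemma sqint_cong_AE:
 assumes "sqint g" "f \<in> borel_measurable borel" "AE x in lborel. f x = g x"
 shows "sqint f"
 by (rule sqint_bound[OF assms(1), where c=1]) (use assms in \<open>auto elim: eventually_mono\<close>)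

lemma nrm_eq_0_iff: assumes "sqint f" shows "nrm f = 0 \<longleftrightarrow> (AE x in lborel. f x = 0)"
 unfolding nrm_def using sqint_integrable[OF assms]
 by (simp add: integral_nonneg_eq_0_iff_AE)

lemma Cauchy_Schwarz_real:
 fixes f g :: "'a => real"
 assumes [measurable]: "f \<in> borel_measurable M" "g \<in> borel_measurable M"
  and "integrable M (\<lambda>x. (f x)\<^sup>2)" "integrable M (\<lambda>x. (g x)\<^sup>2)"
 shows "integrable M (\<lambda>x. f x * g x)"
  and "(LINT x|M. \<bar>f x * g x\<bar>) \<le> sqrt (LINT x|M. (f x)\<^sup>2) * sqrt (LINT x|M. (g x)\<^sup>2)"
proof -
 show 1: "integrable M (\<lambda>x. f x * g x)"
 proof (rule Bochner_Integration.integrable_bound)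
  show "integrable M (\<lambda>x. (f x)\<^sup>2 + (g x)\<^sup>2)" using assms by simp
  show "AE x in M. norm (f x * g x) \<le> norm ((f x)\<^sup>2 + (g x)\<^sup>2)"
  proof (rule AE_I2)
   fix x
   have "2 * \<bar>f x\<bar> * \<bar>g x\<bar> \<le> \<bar>f x\<bar>\<^sup>2 + \<bar>g x\<bar>\<^sup>2" by (rule sum_squares_bound)
   moreover have "0 \<le> \<bar>f x\<bar> * \<bar>g x\<bar>" by simp
   ultimately have "\<bar>f x\<bar> * \<bar>g x\<bar> \<le> (f x)\<^sup>2 + (g x)\<^sup>2" unfolding power2_abs by linarith
   then show "norm (f x * g x) \<le> norm ((f x)\<^sup>2 + (g x)\<^sup>2)"
    unfolding real_norm_def abs_mult by (simp add: abs_of_nonneg)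
  qed
 qed simp
 have "(\<integral>\<^sup>+x. ennreal \<bar>f x\<bar> * ennreal \<bar>g x\<bar> \<partial>M)\<^sup>2 \<le>
   (\<integral>\<^sup>+x. ennreal \<bar>f x\<bar> ^ 2 \<partial>M) * (\<integral>\<^sup>+x. ennreal \<bar>g x\<bar> ^ 2 \<partial>M)"
  by (rule Cauchy_Schwarz_nn_integral) measurable
 also have "(\<integral>\<^sup>+x. ennreal \<bar>f x\<bar> * ennreal \<bar>g x\<bar> \<partial>M) = (\<integral>\<^sup>+x. ennreal \<bar>f x * g x\<bar> \<partial>M)"
  by (simp add: ennreal_mult abs_mult)
 also have "\<dots> = ennreal (LINT x|M. \<bar>f x * g x\<bar>)"
  using 1 by (intro nn_integral_eq_integral) auto
 also have "(\<integral>\<^sup>+x. ennreal \<bar>f x\<bar> ^ 2 \<partial>M) = ennreal (LINT x|M. (f x)\<^sup>2)"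
  using assms(3) by (simp add: ennreal_power nn_integral_eq_integral)
 also have "(\<integral>\<^sup>+x. ennreal \<bar>g x\<bar> ^ 2 \<partial>M) = ennreal (LINT x|M. (g x)\<^sup>2)"
  using assms(4) by (simp add: ennreal_power nn_integral_eq_integral)
 finally have "(LINT x|M. \<bar>f x * g x\<bar>)\<^sup>2 \<le> (LINT x|M. (f x)\<^sup>2) * (LINT x|M. (g x)\<^sup>2)"
  by (simp add: ennreal_power ennreal_mult'[symmetric])
 then show "(LINT x|M. \<bar>f x * g x\<bar>) \<le> sqrt (LINT x|M. (f x)\<^sup>2) * sqrt (LINT x|M. (g x)\<^sup>2)"
  by (subst real_sqrt_mult[symmetric]) (rule real_le_rsqrt)
qed

lemma integrable_sqint_mult:
 assumes "sqint f" "sqint g"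
 shows "integrable lborel (\<lambda>x. f x * g x)" "integrable lborel (\<lambda>x. cmod (f x * g x))"
proof -
 note [measurable] = sqint_measurable[OF assms(1)] sqint_measurable[OF assms(2)]
 have "integrable lborel (\<lambda>x. cmod (f x) * cmod (g x))"
  using assms by (intro Cauchy_Schwarz_real) (auto simp: sqint_def)
 then show "integrable lborel (\<lambda>x. cmod (f x * g x))"
  by (simp add: norm_mult)
 then show "integrable lborel (\<lambda>x. f x * g x)"
  by (subst (asm) integrable_norm_iff) auto
qed

lemma Cauchy_Schwarz_cmod:
 assumes "sqint f" "sqint g"
 shows "(LINT x|lborel. cmod (f x * g x)) \<le> nrm f * nrm g"
 using Cauchy_Schwarz_real(2)[of "\<lambda>x. cmod (f x)" lborel "\<lambda>x. cmod (g x)"] assms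
 by (auto simp: sqint_def nrm_def norm_mult)

lemma Cauchy_Schwarz_sqint:
 assumes "sqint f" "sqint g"
 shows "cmod (LINT x|lborel. f x * g x) \<le> nrm f * nrm g"
 using integral_norm_bound[of lborel "\<lambda>x. f x * g x"] Cauchy_Schwarz_cmod[OF assms] by linarith

lemma nrm_triangle:
 assumes "sqint f" "sqint g"
 shows "nrm (\<lambda>x. f x + g x) \<le> nrm f + nrm g"
proof -
 note [measurable] = sqint_measurable[OF assms(1)] sqint_measurable[OF assms(2)]
 note int = sqint_integrable[OF assms(1)] sqint_integrable[OF assms(2)]
 have "(nrm (\<lambda>x. f x + g x))\<^sup>2 \<le> (LINT x|lborel. (cmod (f x))\<^sup>2 + (cmod (g x))\<^sup>2 + 2 * cmod (f x * g x))"
  unfolding nrm_power2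
 proof (rule integral_mono)
  show "integrable lborel (\<lambda>x. (cmod (f x + g x))\<^sup>2)"
   using sqint_add[OF assms] by (simp add: sqint_def)
  show "integrable lborel (\<lambda>x. (cmod (f x))\<^sup>2 + (cmod (g x))\<^sup>2 + 2 * cmod (f x * g x))"
   using int integrable_sqint_mult(2)[OF assms] by simp
  fix x
  have "(cmod (f x + g x))\<^sup>2 \<le> (cmod (f x) + cmod (g x))\<^sup>2"
   by (intro power_mono norm_triangle_ineq) auto
  then show "(cmod (f x + g x))\<^sup>2 \<le> (cmod (f x))\<^sup>2 + (cmod (g x))\<^sup>2 + 2 * cmod (f x * g x)"
   by (simp add: power2_sum norm_mult)
 qed
 also have "\<dots> = (nrm f)\<^sup>2 + (nrm g)\<^sup>2 + 2 * (LINT x|lborel. cmod (f x * g x))"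
  using int integrable_sqint_mult(2)[OF assms] by (simp add: nrm_power2)
 also have "\<dots> \<le> (nrm f + nrm g)\<^sup>2"
  using Cauchy_Schwarz_cmod[OF assms] by (simp add: power2_sum)
 finally show ?thesis
  by (rule power2_le_imp_le) simp
qed

lemma nrm_triangle3:
 assumes "sqint f" "sqint g" "sqint h"
 shows "nrm (\<lambda>x. f x - h x) \<le> nrm (\<lambda>x. f x - g x) + nrm (\<lambda>x. g x - h x)"
 using nrm_triangle[OF sqint_diff[OF assms(1,2)] sqint_diff[OF assms(2,3)]] by simp

lemma nrm_diff_abs:
 assumes "sqint f" "sqint g"
 shows "\<bar>nrm f - nrm g\<bar> \<le> nrm (\<lambda>x. f x - g x)"
 using nrm_triangle3[OF assms(1,2) sqint_zero] nrm_triangle3[OF assms(2,1) sqint_zero]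
 by (simp add: nrm_commute[of f g] abs_le_iff)

section \<open>Limits of square integrable functions\<close>

lemma nrm_dominated:
 assumes "\<And>n. f n \<in> borel_measurable borel" "sqint g" "sqint h"
  and "AE x in lborel. (\<lambda>n. f n x) \<longlonglongrightarrow> g x"
  and "\<And>n. AE x in lborel. cmod (f n x) \<le> cmod (h x)"
 shows "(\<lambda>n. nrm (\<lambda>x. f n x - g x)) \<longlonglongrightarrow> 0"
proof -
 note [measurable] = assms(1) sqint_measurable[OF assms(2)] sqint_measurable[OF assms(3)]
 have "(\<lambda>n. LINT x|lborel. (cmod (f n x - g x))\<^sup>2) \<longlonglongrightarrow> (LINT x|(lborel::'a measure). 0)"
 proof (rule integral_dominated_convergence)
  show "integrable lborel (\<lambda>x. 2 * (cmod (h x))\<^sup>2 + 2 * (cmod (g x))\<^sup>2)"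
   using assms(2,3) by (simp add: sqint_def)
  show "AE x in lborel. (\<lambda>n. (cmod (f n x - g x))\<^sup>2) \<longlonglongrightarrow> 0"
   using assms(4)
  proof eventually_elim
   case (elim x)
   then have "(\<lambda>n. (cmod (f n x - g x))\<^sup>2) \<longlonglongrightarrow> (cmod (g x - g x))\<^sup>2"
    by (intro tendsto_intros)
   then show ?case by simp
  qed
  show "AE x in lborel. norm ((cmod (f n x - g x))\<^sup>2) \<le> 2 * (cmod (h x))\<^sup>2 + 2 * (cmod (g x))\<^sup>2" for n
   using assms(5)[of n]
  proof eventually_elim
   case (elim x)
   have "(cmod (f n x - g x))\<^sup>2 \<le> (cmod (h x) + cmod (g x))\<^sup>2"
    using elim norm_triangle_ineq4[of "f n x" "g x"] by (intro power_mono) auto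
   also have "\<dots> \<le> 2 * (cmod (h x))\<^sup>2 + 2 * (cmod (g x))\<^sup>2"
    using sum_squares_bound[of "cmod (h x)" "cmod (g x)"] by (simp add: power2_sum)
   finally show ?case by simp
  qed
 qed measurable
 then have "(\<lambda>n. sqrt (LINT x|lborel. (cmod (f n x - g x))\<^sup>2)) \<longlonglongrightarrow> sqrt 0"
  by (intro tendsto_real_sqrt) simp
 then show ?thesis by (simp add: nrm_def)
qed

text \<open>Fatou's lemma for the squared moduli. It yields membership of the limit where no
  dominating function is at hand, as when the Gaussian regularisation of a transform is
  removed.\<close>

lemma nrm_Fatou:
 assumes "\<And>n. sqint (f n)" "g \<in> borel_measurable borel"
  and "AE x in lborel. (\<lambda>n. f n x) \<longlonglongrightarrow> g x"
  and "\<And>n. nrm (f n) \<le> B"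
 shows "sqint g" "nrm g \<le> B"
proof -
 note [measurable] = sqint_measurable[OF assms(1)] assms(2)
 have B: "0 \<le> B" using assms(4)[of 0] nrm_nonneg[of "f 0"] by linarith
 have "(\<integral>\<^sup>+x. ennreal ((cmod (g x))\<^sup>2) \<partial>lborel) = (\<integral>\<^sup>+x. liminf (\<lambda>n. ennreal ((cmod (f n x))\<^sup>2)) \<partial>lborel)"
 proof (rule nn_integral_cong_AE)
  show "AE x in lborel. ennreal ((cmod (g x))\<^sup>2) = liminf (\<lambda>n. ennreal ((cmod (f n x))\<^sup>2))"
   using assms(3)
  proof eventually_elim
   case (elim x)
   then have "(\<lambda>n. ennreal ((cmod (f n x))\<^sup>2)) \<longlonglongrightarrow> ennreal ((cmod (g x))\<^sup>2)"
    by (intro tendsto_intros tendsto_ennrealI)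
   then show ?case using lim_imp_Liminf[OF sequentially_bot] by metis
  qed
 qed
 also have "\<dots> \<le> liminf (\<lambda>n. \<integral>\<^sup>+x. ennreal ((cmod (f n x))\<^sup>2) \<partial>lborel)"
  by (rule nn_integral_liminf) measurable
 also have "\<dots> \<le> ennreal (B\<^sup>2)"
 proof (rule Liminf_le)
  show "\<forall>\<^sub>F n in sequentially. (\<integral>\<^sup>+x. ennreal ((cmod (f n x))\<^sup>2) \<partial>lborel) \<le> ennreal (B\<^sup>2)"
  proof (rule always_eventually, rule allI)
   fix n
   have "(\<integral>\<^sup>+x. ennreal ((cmod (f n x))\<^sup>2) \<partial>lborel) = ennreal ((nrm (f n))\<^sup>2)"
    using assms(1)[of n] by (simp add: nrm_power2 nn_integral_eq_integral sqint_def)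
   also have "\<dots> \<le> ennreal (B\<^sup>2)"
    using assms(4)[of n] by (intro ennreal_leI power_mono) auto
   finally show "(\<integral>\<^sup>+x. ennreal ((cmod (f n x))\<^sup>2) \<partial>lborel) \<le> ennreal (B\<^sup>2)" .
  qed
 qed simp
 finally have *: "(\<integral>\<^sup>+x. ennreal ((cmod (g x))\<^sup>2) \<partial>lborel) \<le> ennreal (B\<^sup>2)" .
 then have int: "integrable lborel (\<lambda>x. (cmod (g x))\<^sup>2)"
  by (intro integrableI_bounded) (auto simp: le_less_trans)
 then show "sqint g" by (simp add: sqint_def)
 have "ennreal ((nrm g)\<^sup>2) \<le> ennreal (B\<^sup>2)"
  using * int by (simp add: nn_integral_eq_integral nrm_power2)
 then show "nrm g \<le> B"
  using B by - (rule power2_le_imp_le, auto)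
qed

text \<open>Riesz-Fischer: along a subsequence whose increments have norm below
  \<open>(1/2)^k\<close> the sum of the absolute increments has norm at most 2, so it is finite
  almost everywhere and the subsequence converges pointwise. Fatou's lemma then turns this into norm
  convergence of the whole sequence.\<close>

lemma sqint_complete:
 fixes f :: "nat => 'a::euclidean_space => complex"
 assumes f: "\<And>n. sqint (f n)"
  and cauchy: "\<And>e. e > 0 \<Longrightarrow> \<exists>N. \<forall>m\<ge>N. \<forall>n\<ge>N. nrm (\<lambda>x. f m x - f n x) < e"
 shows "\<exists>g. sqint g \<and> (\<lambda>n. nrm (\<lambda>x. f n x - g x)) \<longlonglongrightarrow> 0"
proof -
 note [measurable] = sqint_measurable[OF f]
 have "\<exists>r. \<forall>k. (\<forall>m\<ge>r k. \<forall>n\<ge>r k. nrm (\<lambda>x. f m x - f n x) < (1/2)^k) \<and> r k < r (Suc k)"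
 proof (rule dependent_nat_choice)
  show "\<exists>x. \<forall>m\<ge>x. \<forall>n\<ge>x. nrm (\<lambda>y. f m y - f n y) < (1/2)^0"
   using cauchy[of 1] by auto
  fix x k
  obtain N where N: "\<forall>m\<ge>N. \<forall>n\<ge>N. nrm (\<lambda>x. f m x - f n x) < (1/2)^Suc k"
   using cauchy[of "(1/2)^Suc k"] by auto
  show "\<exists>y. (\<forall>m\<ge>y. \<forall>n\<ge>y. nrm (\<lambda>x. f m x - f n x) < (1/2)^Suc k) \<and> x < y"
   using N by (intro exI[of _ "max N (Suc x)"]) auto
 qed
 then obtain r where r: "\<And>k m n. m \<ge> r k \<Longrightarrow> n \<ge> r k \<Longrightarrow> nrm (\<lambda>x. f m x - f n x) < (1/2)^k"
  and rS: "\<And>k. r k < r (Suc k)"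
  by blast
 define d where "d k x = cmod (f (r (Suc k)) x - f (r k) x)" for k x
 have [measurable]: "d k \<in> borel_measurable borel" for k
  unfolding d_def by measurable
 have D: "sqint (\<lambda>x. of_real (\<Sum>k<n. d k x)) \<and> nrm (\<lambda>x. of_real (\<Sum>k<n. d k x)) \<le> (\<Sum>k<n. (1/2)^k)" for n
 proof (induction n)
  case (Suc n)
  have d: "sqint (\<lambda>x. of_real (d n x))"
   by (rule sqint_bound[OF sqint_diff[OF f f, of "r (Suc n)" "r n"], where c=1]) (auto simp: d_def)
  have "nrm (\<lambda>x. of_real (d n x)) = nrm (\<lambda>x. f (r (Suc n)) x - f (r n) x)"
   by (simp add: nrm_def d_def)
  also have "\<dots> \<le> (1/2)^n"
   using r[of n "r (Suc n)" "r n"] rS[of n] by simp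
  finally have "nrm (\<lambda>x. of_real (d n x)) \<le> (1/2)^n" .
  then show ?case
   using Suc d sqint_add[OF conjunct1[OF Suc] d] nrm_triangle[OF conjunct1[OF Suc] d]
   by simp
 qed simp
 have sum2: "(\<Sum>k<n. (1/2)^k) \<le> (2::real)" for n
  using sum_le_suminf[of "\<lambda>k. (1/2::real)^k" "{..<n}"] suminf_geometric[of "1/2::real"] summable_geometric[of "1/2::real"]
  by simp
 \<comment> \<open>Monotone convergence is applied to the squares of the partial sums, whose
   integrals are uniformly bounded.\<close>
 have fin: "AE x in lborel. summable (\<lambda>k. d k x)"
 proof -
  have "(\<integral>\<^sup>+x. (\<Sum>k. ennreal (d k x))\<^sup>2 \<partial>lborel) = (\<integral>\<^sup>+x. (SUP n. (ennreal (\<Sum>k<n. d k x))\<^sup>2) \<partial>lborel)"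
  proof (rule nn_integral_cong)
   fix x
   have "(\<lambda>n. (\<Sum>k<n. ennreal (d k x))\<^sup>2) \<longlonglongrightarrow> (\<Sum>k. ennreal (d k x))\<^sup>2"
    unfolding power2_eq_square
    by (intro tendsto_mult_ennreal summable_LIMSEQ) (auto simp: zero_less_iff_neq_zero)
   moreover have "(\<lambda>n. (\<Sum>k<n. ennreal (d k x))\<^sup>2) \<longlonglongrightarrow> (SUP n. (\<Sum>k<n. ennreal (d k x))\<^sup>2)"
    by (intro LIMSEQ_SUP) (auto simp: incseq_def intro!: power_mono sum_mono2)
   ultimately have "(\<Sum>k. ennreal (d k x))\<^sup>2 = (SUP n. (\<Sum>k<n. ennreal (d k x))\<^sup>2)"
    by (rule LIMSEQ_unique)
   then show "(\<Sum>k. ennreal (d k x))\<^sup>2 = (SUP n. (ennreal (\<Sum>k<n. d k x))\<^sup>2)"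
    by (simp add: d_def sum_nonneg sum_ennreal)
  qed
  also have "\<dots> = (SUP n. \<integral>\<^sup>+x. (ennreal (\<Sum>k<n. d k x))\<^sup>2 \<partial>lborel)"
   by (rule nn_integral_monotone_convergence_SUP)
     (auto simp: incseq_def le_fun_def d_def intro!: power_mono ennreal_leI sum_mono2)
  also have "\<dots> \<le> ennreal (2\<^sup>2)"
  proof (rule SUP_least)
   fix n
   have nn: "0 \<le> (\<Sum>k<n. d k x)" for x by (simp add: d_def sum_nonneg)
   have int: "integrable lborel (\<lambda>x. (\<Sum>k<n. d k x)\<^sup>2)"
    using D[of n] sqint_integrable[of "\<lambda>x. of_real (\<Sum>k<n. d k x)"]
    by (simp del: of_real_sum)
   have "(\<integral>\<^sup>+x. (ennreal (\<Sum>k<n. d k x))\<^sup>2 \<partial>lborel) = ennreal ((nrm (\<lambda>x. of_real (\<Sum>k<n. d k x)))\<^sup>2)"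
    using nn int by (simp add: ennreal_power nrm_power2 nn_integral_eq_integral del: of_real_sum)
   also have "\<dots> \<le> ennreal (2\<^sup>2)"
    using D[of n] sum2[of n] by (intro ennreal_leI power_mono) auto
   finally show "(\<integral>\<^sup>+x. (ennreal (\<Sum>k<n. d k x))\<^sup>2 \<partial>lborel) \<le> ennreal (2\<^sup>2)" .
  qed
  finally have "(\<integral>\<^sup>+x. (\<Sum>k. ennreal (d k x))\<^sup>2 \<partial>lborel) \<noteq> \<infinity>"
   by (auto simp: top_unique)
  then have "AE x in lborel. (\<Sum>k. ennreal (d k x))\<^sup>2 \<noteq> \<infinity>"
   by (intro nn_integral_PInf_AE) measurable
  then show ?thesis
  proof eventually_elim
   case (elim x)
   then have "(\<Sum>k. ennreal (d k x)) \<noteq> top"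
    by (auto simp: power2_eq_square ennreal_top_mult)
   then show ?case
    by (intro summable_suminf_not_top) (auto simp: d_def)
  qed
 qed
 define g where "g x = lim (\<lambda>k. f (r k) x)" for x
 have [measurable]: "g \<in> borel_measurable borel"
  unfolding g_def by measurable
 have lim: "AE x in lborel. (\<lambda>k. f (r k) x) \<longlonglongrightarrow> g x"
  using fin
 proof eventually_elim
  case (elim x)
  then have "summable (\<lambda>k. f (r (Suc k)) x - f (r k) x)"
   unfolding d_def by (rule summable_norm_cancel)
  then have "convergent (\<lambda>n. \<Sum>k<n. f (r (Suc k)) x - f (r k) x)"
   by (simp add: summable_iff_convergent)
  then have "convergent (\<lambda>n. f (r n) x - f (r 0) x)"
   using sum_lessThan_telescope[of "\<lambda>k. f (r k) x"] by simp
  then have "convergent (\<lambda>n. (f (r n) x - f (r 0) x) + f (r 0) x)"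
   by (intro convergent_add convergent_const)
  then show ?case unfolding g_def by (simp add: convergent_LIMSEQ_iff)
 qed
 have rge: "k \<le> r k" for k
 proof (induction k)
  case (Suc k) then show ?case using rS[of k] by simp
 qed simp
 have rmono: "r k \<le> r (k + j)" for k j
 proof (induction j)
  case (Suc j) then show ?case using rS[of "k + j"] by simp
 qed simp
 \<comment> \<open>For fixed \<open>m\<close> Fatou's lemma is applied in the other index, along the
   tail of the subsequence.\<close>
 have bd: "sqint (\<lambda>x. f m x - g x) \<and> nrm (\<lambda>x. f m x - g x) \<le> (1/2)^k" if "m \<ge> r k" for m k
 proof -
  have a: "AE x in lborel. (\<lambda>j. f m x - f (r (k + j)) x) \<longlonglongrightarrow> f m x - g x"
   using lim
  proof eventually_elim
   case (elim x)
   then have "(\<lambda>j. f (r (j + k)) x) \<longlonglongrightarrow> g x"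
    by (rule LIMSEQ_ignore_initial_segment)
   then show ?case by (intro tendsto_intros) (simp add: add.commute)
  qed
  have b: "nrm (\<lambda>x. f m x - f (r (k + j)) x) \<le> (1/2)^k" for j
   using r[OF that, of "r (k + j)"] rmono[of k j] by simp
  have m: "(\<lambda>x. f m x - g x) \<in> borel_measurable borel" by measurable
  show ?thesis
   using nrm_Fatou[OF sqint_diff[OF f f] m a b] by blast
 qed
 have "sqint (\<lambda>x. f (r 0) x - (f (r 0) x - g x))"
  using bd[of 0 "r 0"] sqint_diff[OF f, of "\<lambda>x. f (r 0) x - g x" "r 0"] by blast
 then have "sqint g" by simp
 moreover have "(\<lambda>n. nrm (\<lambda>x. f n x - g x)) \<longlonglongrightarrow> 0"
 proof (rule LIMSEQ_I)
  fix e :: real assume "e > 0"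
  then obtain k where k: "(1/2)^k < e"
   using real_arch_pow_inv[of e "1/2"] by auto
  show "\<exists>no. \<forall>n\<ge>no. norm (nrm (\<lambda>x. f n x - g x) - 0) < e"
   using bd k by (intro exI[of _ "r k"]) (auto intro: le_less_trans)
 qed
 ultimately show ?thesis by blast
qed

section \<open>Translations and convolutions\<close>

lemma lborel_distr_reflect: "distr lborel borel (\<lambda>y. x - y) = (lborel :: 'a::euclidean_space measure)"
 using lborel_affine[of "-1" x] by (simp add: density_1)

lemma nn_integral_reflect:
 fixes f :: "'a::euclidean_space => ennreal"
 assumes [measurable]: "f \<in> borel_measurable borel"
 shows "(\<integral>\<^sup>+y. f (x - y) \<partial>lborel) = (\<integral>\<^sup>+y. f y \<partial>lborel)"
 by (subst (2) lborel_distr_reflect[of x, symmetric]) (simp add: nn_integral_distr)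

lemma nn_integral_translate:
 fixes f :: "'a::euclidean_space => ennreal"
 assumes [measurable]: "f \<in> borel_measurable borel"
 shows "(\<integral>\<^sup>+y. f (y - x) \<partial>lborel) = (\<integral>\<^sup>+y. f y \<partial>lborel)"
 by (subst (2) lborel_distr_plus[of "-x", symmetric]) (simp add: nn_integral_distr)

lemma integrable_translate_iff:
 fixes f :: "'a::euclidean_space => 'b::{banach,second_countable_topology}"
 assumes [measurable]: "f \<in> borel_measurable borel"
 shows "integrable lborel (\<lambda>y. f (y - x)) \<longleftrightarrow> integrable lborel f"
 by (subst (2) lborel_distr_plus[of "-x", symmetric]) (simp add: integrable_distr_eq)

lemma integral_translate:
 fixes f :: "'a::euclidean_space => 'b::{banach,second_countable_topology}"
 assumes [measurable]: "f \<in> borel_measurable borel"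
 shows "(LINT y|lborel. f (y - x)) = (LINT y|lborel. f y)"
 by (subst (2) lborel_distr_plus[of "-x", symmetric]) (simp add: integral_distr)

lemma integrable_reflect_iff:
 fixes f :: "'a::euclidean_space => 'b::{banach,second_countable_topology}"
 assumes [measurable]: "f \<in> borel_measurable borel"
 shows "integrable lborel (\<lambda>y. f (x - y)) \<longleftrightarrow> integrable lborel f"
 by (subst (2) lborel_distr_reflect[of x, symmetric]) (simp add: integrable_distr_eq)

lemma integral_reflect':
 fixes f :: "'a::euclidean_space => 'b::{banach,second_countable_topology}"
 assumes [measurable]: "f \<in> borel_measurable borel"
 shows "(LINT y|lborel. f (x - y)) = (LINT y|lborel. f y)"
 by (subst (2) lborel_distr_reflect[of x, symmetric]) (simp add: integral_distr)

lemma AE_reflect: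
 fixes P :: "'a::euclidean_space => bool"
 assumes "AE y in lborel. P y"
 shows "AE y in lborel. P (x - y)"
proof -
 obtain N where N: "{y. \<not> P y} \<subseteq> N" "N \<in> null_sets lborel"
  using assms by (auto elim!: AE_E simp: null_setsI)
 have [measurable]: "N \<in> sets borel" using N(2) by auto
 have "AE y in lborel. y \<notin> N" using N(2) by (simp add: AE_not_in)
 then have "AE y in distr lborel borel (\<lambda>y. x - y). y \<notin> N"
  by (simp only: lborel_distr_reflect)
 then have "AE y in lborel. x - y \<notin> N"
  by (subst (asm) AE_distr_iff) auto
 then show ?thesis using N(1) by (auto elim: eventually_mono)
qed

lemma sqint_reflect: "sqint f \<Longrightarrow> sqint (\<lambda>y. f (x - y))"
 unfolding sqint_def using integrable_reflect_iff[of "\<lambda>y. (cmod (f y))\<^sup>2" x] by auto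

lemma nrm_reflect: "f \<in> borel_measurable borel \<Longrightarrow> nrm (\<lambda>y. f (x - y)) = nrm f"
 unfolding nrm_def using integral_reflect'[of "\<lambda>y. (cmod (f y))\<^sup>2" x] by simp

section \<open>Trilinear convolution integrals\<close>

lemma nn_CS:
 fixes f g :: "'a => real"
 assumes [measurable]: "f \<in> borel_measurable M" "g \<in> borel_measurable M"
  and "\<And>x. 0 \<le> f x" "\<And>x. 0 \<le> g x"
  and "integrable M (\<lambda>x. (f x)\<^sup>2)" "integrable M (\<lambda>x. (g x)\<^sup>2)"
 shows "(\<integral>\<^sup>+x. ennreal (f x * g x) \<partial>M) \<le> ennreal (sqrt (LINT x|M. (f x)\<^sup>2) * sqrt (LINT x|M. (g x)\<^sup>2))"
proof -
 have "(\<integral>\<^sup>+x. ennreal (f x * g x) \<partial>M) = ennreal (LINT x|M. \<bar>f x * g x\<bar>)"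
  using assms Cauchy_Schwarz_real(1)[OF assms(1,2,5,6)] by (simp add: nn_integral_eq_integral)
 then show ?thesis
  using Cauchy_Schwarz_real(2)[OF assms(1,2,5,6)] by (simp add: ennreal_leI)
qed

text \<open>Fubini with the \<open>x\<close> integral innermost: for fixed \<open>y\<close>,
  Cauchy-Schwarz and translation invariance bound it independently of \<open>y\<close> apart from
  the factor \<open>h y\<close>. The three variants differ in the factor that is merely integrable;
  the commutator kernel calls for all three.\<close>

lemma trilinear_L1_right:
 fixes f g h :: "'a::euclidean_space => real"
 assumes [measurable]: "f \<in> borel_measurable borel" "g \<in> borel_measurable borel" "h \<in> borel_measurable borel"
  and nn: "\<And>x. 0 \<le> f x" "\<And>x. 0 \<le> g x" "\<And>x. 0 \<le> h x"
  and int: "integrable lborel (\<lambda>x. (f x)\<^sup>2)" "integrable lborel (\<lambda>x. (g x)\<^sup>2)" "integrable lborel h"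
 shows "(\<integral>\<^sup>+x. \<integral>\<^sup>+y. ennreal (f x * g (x - y) * h y) \<partial>lborel \<partial>lborel)
  \<le> ennreal (sqrt (LINT x|lborel. (f x)\<^sup>2) * sqrt (LINT x|lborel. (g x)\<^sup>2) * (LINT x|lborel. h x))"
proof -
 let ?FG = "sqrt (LINT x|lborel. (f x)\<^sup>2) * sqrt (LINT x|lborel. (g x)\<^sup>2)"
 have "(\<integral>\<^sup>+x. \<integral>\<^sup>+y. ennreal (f x * g (x - y) * h y) \<partial>lborel \<partial>lborel)
   = (\<integral>\<^sup>+y. \<integral>\<^sup>+x. ennreal (f x * g (x - y) * h y) \<partial>lborel \<partial>lborel)"
  by (rule lborel_pair.Fubini') measurable
 also have "\<dots> \<le> (\<integral>\<^sup>+y. ennreal ?FG * ennreal (h y) \<partial>lborel)"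
 proof (rule nn_integral_mono)
  fix y
  have "(\<integral>\<^sup>+x. ennreal (f x * g (x - y) * h y) \<partial>lborel) = (\<integral>\<^sup>+x. ennreal (f x * g (x - y)) \<partial>lborel) * ennreal (h y)"
   using nn by (subst nn_integral_multc[symmetric]) (auto simp: ennreal_mult)
  also have "(\<integral>\<^sup>+x. ennreal (f x * g (x - y)) \<partial>lborel) \<le>
    ennreal (sqrt (LINT x|lborel. (f x)\<^sup>2) * sqrt (LINT x|lborel. (g (x - y))\<^sup>2))"
   using nn int integrable_translate_iff[of "\<lambda>x. (g x)\<^sup>2" y] by (intro nn_CS) auto
  also have "(LINT x|lborel. (g (x - y))\<^sup>2) = (LINT x|lborel. (g x)\<^sup>2)"
   using integral_translate[of "\<lambda>x. (g x)\<^sup>2" y] by simp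
  finally show "(\<integral>\<^sup>+x. ennreal (f x * g (x - y) * h y) \<partial>lborel) \<le> ennreal ?FG * ennreal (h y)"
   by (simp add: mult_right_mono)
 qed
 also have "\<dots> = ennreal ?FG * (\<integral>\<^sup>+y. ennreal (h y) \<partial>lborel)"
  by (rule nn_integral_cmult) measurable
 also have "\<dots> = ennreal (?FG * (LINT x|lborel. h x))"
  using nn int by (simp add: nn_integral_eq_integral ennreal_mult)
 finally show ?thesis .
qed

text \<open>Exchanging the variables turns the first factor into the last one and reflects
  \<open>g\<close>.\<close>

lemma trilinear_L1_left:
 fixes f g h :: "'a::euclidean_space => real"
 assumes [measurable]: "f \<in> borel_measurable borel" "g \<in> borel_measurable borel" "h \<in> borel_measurable borel"
  and nn: "\<And>x. 0 \<le> f x" "\<And>x. 0 \<le> g x" "\<And>x. 0 \<le> h x"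
  and int: "integrable lborel f" "integrable lborel (\<lambda>x. (g x)\<^sup>2)" "integrable lborel (\<lambda>x. (h x)\<^sup>2)"
 shows "(\<integral>\<^sup>+x. \<integral>\<^sup>+y. ennreal (f x * g (x - y) * h y) \<partial>lborel \<partial>lborel)
  \<le> ennreal ((LINT x|lborel. f x) * sqrt (LINT x|lborel. (g x)\<^sup>2) * sqrt (LINT x|lborel. (h x)\<^sup>2))"
proof -
 have "(\<integral>\<^sup>+x. \<integral>\<^sup>+y. ennreal (f x * g (x - y) * h y) \<partial>lborel \<partial>lborel)
   = (\<integral>\<^sup>+y. \<integral>\<^sup>+x. ennreal (h y * g (- (y - x)) * f x) \<partial>lborel \<partial>lborel)"
 proof -
  have "f x * g (x - y) * h y = h y * g (- (y - x)) * f x" for x y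
   by simp
  then show ?thesis
   using lborel_pair.Fubini'[of "\<lambda>x y. ennreal (f x * g (x - y) * h y)"]
   by (simp add: mult_ac)
 qed
 also have "\<dots> \<le> ennreal (sqrt (LINT x|lborel. (h x)\<^sup>2) * sqrt (LINT x|lborel. (g (- x))\<^sup>2) * (LINT x|lborel. f x))"
  using nn int integrable_reflect_iff[of "\<lambda>x. (g x)\<^sup>2" 0] by (intro trilinear_L1_right) auto
 also have "(LINT x|lborel. (g (- x))\<^sup>2) = (LINT x|lborel. (g x)\<^sup>2)"
  using integral_reflect'[of "\<lambda>x. (g x)\<^sup>2" 0] by simp
 finally show ?thesis by (simp add: mult_ac)
qed

text \<open>The substitution of \<open>x - y\<close> for \<open>y\<close> exchanges the last two
  factors.\<close>

lemma trilinear_L1_mid: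
 fixes f g h :: "'a::euclidean_space => real"
 assumes [measurable]: "f \<in> borel_measurable borel" "g \<in> borel_measurable borel" "h \<in> borel_measurable borel"
  and nn: "\<And>x. 0 \<le> f x" "\<And>x. 0 \<le> g x" "\<And>x. 0 \<le> h x"
  and int: "integrable lborel (\<lambda>x. (f x)\<^sup>2)" "integrable lborel g" "integrable lborel (\<lambda>x. (h x)\<^sup>2)"
 shows "(\<integral>\<^sup>+x. \<integral>\<^sup>+y. ennreal (f x * g (x - y) * h y) \<partial>lborel \<partial>lborel)
  \<le> ennreal (sqrt (LINT x|lborel. (f x)\<^sup>2) * (LINT x|lborel. g x) * sqrt (LINT x|lborel. (h x)\<^sup>2))"
proof -
 have "(\<integral>\<^sup>+x. \<integral>\<^sup>+y. ennreal (f x * g (x - y) * h y) \<partial>lborel \<partial>lborel)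
   = (\<integral>\<^sup>+x. \<integral>\<^sup>+y. ennreal (f x * h (x - y) * g y) \<partial>lborel \<partial>lborel)"
 proof (rule nn_integral_cong)
  fix x
  show "(\<integral>\<^sup>+y. ennreal (f x * g (x - y) * h y) \<partial>lborel) = (\<integral>\<^sup>+y. ennreal (f x * h (x - y) * g y) \<partial>lborel)"
   using nn_integral_reflect[of "\<lambda>y. ennreal (f x * h (x - y) * g y)" x] by (simp add: mult_ac)
 qed
 also have "\<dots> \<le> ennreal (sqrt (LINT x|lborel. (f x)\<^sup>2) * sqrt (LINT x|lborel. (h x)\<^sup>2) * (LINT x|lborel. g x))"
  using nn int by (intro trilinear_L1_right) auto
 finally show ?thesis by (simp add: mult_ac)
qed

section \<open>Smooth functions\<close>

text \<open>Working form of the successor clause: an explicitly known derivative stands in for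
  \<open>frechet_derivative\<close>, which is a choice.\<close>

lemma Ck_SucI:
 assumes "\<And>x. (f has_derivative D x) (at x)" "\<And>v. Ck k (\<lambda>x. D x v)"
 shows "Ck (Suc k) f"
proof -
 have "frechet_derivative f (at x) = D x" for x
  using assms(1) frechet_derivative_at by metis
 then show ?thesis
  using assms by (auto simp: differentiable_on_def differentiable_def)
qed

lemma Ck_Suc_has_derivative:
 "Ck (Suc k) f \<Longrightarrow> (f has_derivative frechet_derivative f (at x)) (at x)"
 by (simp add: differentiable_on_def frechet_derivative_works)

lemma Ck_Suc_derivative: "Ck (Suc k) f \<Longrightarrow> Ck k (\<lambda>x. frechet_derivative f (at x) v)"
 by simp

lemma Ck_mono: "Ck (Suc k) f \<Longrightarrow> Ck k f"
proof (induction k arbitrary: f)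
 case 0
 then show ?case by (auto intro: differentiable_imp_continuous_on)
next
 case (Suc k)
 show ?case
 proof (rule Ck_SucI)
  show "(f has_derivative frechet_derivative f (at x)) (at x)" for x
   by (rule Ck_Suc_has_derivative[OF Suc.prems])
  show "Ck k (\<lambda>x. frechet_derivative f (at x) v)" for v
   using Suc.IH[OF Ck_Suc_derivative[OF Suc.prems]] .
 qed
qed

lemma Ck_continuous: "Ck k f \<Longrightarrow> continuous_on UNIV f"
 by (cases k) (auto intro: differentiable_imp_continuous_on)

lemma Ck_const: "Ck k (\<lambda>x. c)"
proof (induction k arbitrary: c)
 case (Suc k)
 show ?case by (rule Ck_SucI[where D="\<lambda>x v. 0"]) (auto intro: Suc)
qed simp

lemma Ck_linear:
 assumes "bounded_linear L" shows "Ck k (\<lambda>x. L x)"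
proof (cases k)
 case 0
 then show ?thesis using assms by (simp add: linear_continuous_on)
next
 case (Suc j)
 then show ?thesis
  using assms by (auto intro!: Ck_SucI[where D="\<lambda>x. L"] Ck_const bounded_linear_imp_has_derivative simp del: Ck.simps)
qed

lemma Ck_bounded_linear:
 assumes "bounded_linear L" "Ck k f" shows "Ck k (\<lambda>x. L (f x))"
 using assms(2)
proof (induction k arbitrary: f)
 case 0
 then show ?case using assms(1)
  by (simp add: bounded_linear.continuous_on)
next
 case (Suc k)
 show ?case
 proof (rule Ck_SucI)
  show "((\<lambda>x. L (f x)) has_derivative (\<lambda>v. L (frechet_derivative f (at x) v))) (at x)" for x
   by (rule bounded_linear.has_derivative[OF assms(1) Ck_Suc_has_derivative[OF Suc.prems]])
 qed (use Suc in auto)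
qed

lemma Ck_add:
 assumes "Ck k f" "Ck k g" shows "Ck k (\<lambda>x. f x + g x)"
 using assms
proof (induction k arbitrary: f g)
 case 0
 then show ?case by (auto intro: continuous_intros)
next
 case (Suc k)
 show ?case
 proof (rule Ck_SucI)
  show "((\<lambda>x. f x + g x) has_derivative (\<lambda>v. frechet_derivative f (at x) v + frechet_derivative g (at x) v)) (at x)" for x
   by (intro has_derivative_add Ck_Suc_has_derivative[OF Suc.prems(1)] Ck_Suc_has_derivative[OF Suc.prems(2)])
 qed (use Suc in auto)
qed

text \<open>One induction by the Leibniz rule serves products, scalar multiples and inner products
  alike. \<open>Ck_mono\<close> enters because the factor that is not differentiated has to be of
  the lower class as well.\<close>

lemma Ck_bilinear:
 assumes "bounded_bilinear p" "Ck k f" "Ck k g" shows "Ck k (\<lambda>x. p (f x) (g x))"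
 using assms(2,3)
proof (induction k arbitrary: f g)
 case 0
 then show ?case using assms(1) by (auto intro: bounded_bilinear.continuous_on)
next
 case (Suc k)
 note fg = Ck_mono[OF Suc.prems(1)] Ck_mono[OF Suc.prems(2)]
 show ?case
 proof (rule Ck_SucI)
  show "((\<lambda>x. p (f x) (g x)) has_derivative
    (\<lambda>v. p (f x) (frechet_derivative g (at x) v) + p (frechet_derivative f (at x) v) (g x))) (at x)" for x
   by (rule bounded_bilinear.FDERIV[OF assms(1) Ck_Suc_has_derivative[OF Suc.prems(1)] Ck_Suc_has_derivative[OF Suc.prems(2)]])
 qed (use Suc fg in \<open>auto intro!: Ck_add\<close>)
qed

lemma Ck_affine_comp:
 assumes "bounded_linear L" "Ck k f" shows "Ck k (\<lambda>x. f (c + L x))"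
 using assms(2)
proof (induction k arbitrary: f)
 case 0
 then show ?case using assms(1)
  using continuous_on_compose2[of UNIV f "UNIV" "\<lambda>x. c + L x"] linear_continuous_on[OF assms(1)]
  using continuous_on_add[OF continuous_on_const[of UNIV c], of L] by simp
next
 case (Suc k)
 show ?case
 proof (rule Ck_SucI)
  show "((\<lambda>x. f (c + L x)) has_derivative (\<lambda>v. frechet_derivative f (at (c + L x)) (L v))) (at x)" for x
  proof -
   have "((\<lambda>x. c + L x) has_derivative L) (at x)"
    using has_derivative_add[OF has_derivative_const bounded_linear_imp_has_derivative[OF assms(1)]] by simp
   from has_derivative_compose[OF this Ck_Suc_has_derivative[OF Suc.prems]]
   show ?thesis .
  qed
 qed (use Suc in auto)
qed

lemma Ck_mult: "Ck k f \<Longrightarrow> Ck k g \<Longrightarrow> Ck k (\<lambda>x. f x * g x :: real)"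
 by (rule Ck_bilinear[OF bounded_bilinear_mult])

lemma Ck_scaleR: "Ck k f \<Longrightarrow> Ck k g \<Longrightarrow> Ck k (\<lambda>x. f x *\<^sub>R g x)"
 by (rule Ck_bilinear[OF bounded_bilinear_scaleR])

lemma Ck_inner: "Ck k f \<Longrightarrow> Ck k g \<Longrightarrow> Ck k (\<lambda>x. f x \<bullet> g x)"
 by (rule Ck_bilinear[OF bounded_bilinear_inner])

lemma Ck_cmult: "Ck k f \<Longrightarrow> Ck k (\<lambda>x. c * f x :: real)"
 by (intro Ck_mult Ck_const)

lemma Ck_minus: "Ck k f \<Longrightarrow> Ck k (\<lambda>x. - f x)"
 by (rule Ck_bounded_linear[OF bounded_linear_minus[OF bounded_linear_ident]])

lemma Ck_diff: "Ck k f \<Longrightarrow> Ck k g \<Longrightarrow> Ck k (\<lambda>x. f x - g x)"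
 using Ck_add[of k f "\<lambda>x. - g x"] Ck_minus[of k g] by simp

lemma Ck_ident: "Ck k (\<lambda>x. x)"
 by (rule Ck_linear[OF bounded_linear_ident])

lemma Ck_sum: "(\<And>i. i \<in> I \<Longrightarrow> Ck k (f i)) \<Longrightarrow> Ck k (\<lambda>x. \<Sum>i\<in>I. f i x)"
 by (induction I rule: infinite_finite_induct) (auto intro: Ck_add Ck_const)

lemma Ck_prod: "(\<And>i. i \<in> I \<Longrightarrow> Ck k (f i)) \<Longrightarrow> Ck k (\<lambda>x. \<Prod>i\<in>I. f i x :: real)"
 by (induction I rule: infinite_finite_induct) (auto intro: Ck_mult Ck_const)

section \<open>A smooth function that vanishes to infinite order\<close>

definition flat :: "nat => real => real" where
 "flat n x = (if x \<le> 0 then 0 else exp (- 1 / x) / x ^ n)"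

lemma flat_nonpos [simp]: "x \<le> 0 \<Longrightarrow> flat n x = 0"
 by (simp add: flat_def)

lemma flat_pos: "x > 0 \<Longrightarrow> flat n x > 0"
 by (simp add: flat_def)

lemma flat_nonneg: "flat n x \<ge> 0"
 by (simp add: flat_def)

lemma flat_le_1: "flat 0 x \<le> 1"
 by (simp add: flat_def)

lemma power_le_fact_exp: "0 \<le> x \<Longrightarrow> x ^ n / fact n \<le> exp (x::real)"
proof -
 assume x: "0 \<le> x"
 have "(\<Sum>m\<in>{n}. x ^ m /\<^sub>R fact m) \<le> (\<Sum>m. x ^ m /\<^sub>R fact m)"
  using x by (intro sum_le_suminf summable_exp_generic) auto
 then show ?thesis by (simp add: exp_def divide_inverse mult.commute)
qed

text \<open>The exponential of \<open>1 / x\<close> dominates every power of \<open>1 / x\<close>,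
  so each member of the family is quadratically small at the origin; this makes its derivative there
  vanish.\<close>

lemma flat_bound: "\<bar>flat n x\<bar> \<le> fact (n + 2) * x\<^sup>2"
proof (cases "x \<le> 0")
 case False
 then have x: "x > 0" by simp
 have "(1 / x) ^ (n + 2) / fact (n + 2) \<le> exp (1 / x)"
  using x by (intro power_le_fact_exp) simp
 then have "exp (- (1 / x)) \<le> fact (n + 2) * x ^ (n + 2)"
  using x by (simp add: exp_minus field_simps del: fact_Suc)
 then have "exp (- (1 / x)) / x ^ n \<le> fact (n + 2) * x ^ (n + 2) / x ^ n"
  using x by (intro divide_right_mono) auto
 also have "\<dots> = fact (n + 2) * x\<^sup>2"
  using x by (simp add: power_add power2_eq_square)
 finally show ?thesis using x by (simp add: flat_def)
qed simp

text \<open>The linear span of the family over all \<open>n\<close> is closed under differentiation,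
  which is why the negative powers are built into \<open>flat\<close>: smoothness becomes an
  induction over all indices at once.\<close>

lemma flat_has_derivative:
 "(flat n has_real_derivative (flat (n + 2) x - real n * flat (n + 1) x)) (at x)"
proof -
 consider "x < 0" | "x = 0" | "x > 0" by linarith
 then show ?thesis
 proof cases
  case 1
  have "(flat n has_real_derivative 0) (at x)"
  proof (rule DERIV_cong_ev[THEN iffD1, OF refl _ refl])
   show "((\<lambda>x. 0) has_real_derivative 0) (at x)" by simp
   show "\<forall>\<^sub>F y in nhds x. 0 = flat n y"
    using 1 eventually_nhds_in_open[of "{..<0}" x] by (auto elim: eventually_mono)
  qed
  then show ?thesis using 1 by simp
 next
  case 2
  have "((\<lambda>h. (flat n (0 + h) - flat n 0) / h) \<longlongrightarrow> 0) (at 0)"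
  proof (rule Lim_null_comparison)
   show "\<forall>\<^sub>F h in at 0. norm ((flat n (0 + h) - flat n 0) / h) \<le> fact (n + 2) * \<bar>h\<bar>"
   proof (rule eventually_mono[OF eventually_neq_at_within[of 0]])
    fix h :: real assume "h \<noteq> 0"
    then show "norm ((flat n (0 + h) - flat n 0) / h) \<le> fact (n + 2) * \<bar>h\<bar>"
     using flat_bound[of n h] by (simp add: field_simps power2_eq_square del: fact_Suc)
   qed
   have "((\<lambda>h. fact (n + 2) * \<bar>h\<bar>) \<longlongrightarrow> fact (n + 2) * \<bar>0::real\<bar>) (at 0)"
    by (intro tendsto_intros)
   then show "((\<lambda>h. fact (n + 2) * \<bar>h\<bar>) \<longlongrightarrow> (0::real)) (at 0)" by simp
  qed
  then show ?thesis using 2 by (simp add: DERIV_def)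
 next
  case 3
  have "((\<lambda>x. exp (- 1 / x) / x ^ n) has_real_derivative
    (flat (n + 2) x - real n * flat (n + 1) x)) (at x)"
   using 3
   by (auto intro!: derivative_eq_intros simp: flat_def field_simps power2_eq_square power_add)
     (cases n; simp add: field_simps)
  then show ?thesis
  proof (rule DERIV_cong_ev[THEN iffD1, OF refl _ refl, rotated])
   show "\<forall>\<^sub>F y in nhds x. exp (- 1 / y) / y ^ n = flat n y"
    using 3 eventually_nhds_in_open[of "{0<..}" x] by (auto elim!: eventually_mono simp: flat_def)
  qed
 qed
qed

text \<open>The index \<open>n\<close> is arbitrary in the induction because differentiation raises
  it. The first-order chain rule then suffices and the formula for higher derivatives of a
  composition is avoided.\<close>

lemma Ck_flat_comp:
 assumes "\<And>k. Ck k q" shows "Ck k (\<lambda>x. flat n (q x))"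
proof (induction k arbitrary: n)
 case 0
 have "continuous_on UNIV (flat n)"
  using flat_has_derivative DERIV_isCont by (blast intro: continuous_at_imp_continuous_on)
 then show ?case using assms[of 0]
  by (auto intro: continuous_on_compose2[of UNIV "flat n"])
next
 case (Suc k)
 show ?case
 proof (rule Ck_SucI)
  fix x
  have "(q has_derivative frechet_derivative q (at x)) (at x)"
   using Ck_Suc_has_derivative[OF assms] .
  from has_derivative_compose[OF this flat_has_derivative[unfolded has_field_derivative_def]]
  show "((\<lambda>x. flat n (q x)) has_derivative
    (\<lambda>v. (flat (n + 2) (q x) - real n * flat (n + 1) (q x)) * frechet_derivative q (at x) v)) (at x)" .
 next
  fix v
  show "Ck k (\<lambda>x. (flat (n + 2) (q x) - real n * flat (n + 1) (q x)) * frechet_derivative q (at x) v)"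
   by (intro Ck_mult Ck_diff Ck_const Suc Ck_Suc_derivative assms)
 qed
qed

section \<open>Test functions determine locally integrable functions\<close>

lemma test_function_continuous: "test_function D phi \<Longrightarrow> continuous_on UNIV phi"
 using Ck_continuous unfolding test_function_def by blast

lemma test_functionI:
 assumes "\<And>k. Ck k phi" "\<And>x. x \<notin> K \<Longrightarrow> phi x = 0" "compact K" "K \<subseteq> D"
 shows "test_function D phi"
proof -
 have "closure {x. phi x \<noteq> 0} \<subseteq> K"
  using assms(2,3) by (intro closure_minimal) (auto simp: compact_imp_closed)
 moreover from this have "compact (closure {x. phi x \<noteq> 0})"
  using assms(3) by (meson bounded_subset closed_closure compact_eq_bounded_closed)
 ultimately show ?thesis using assms(1,4) by (auto simp: test_function_def)
qed

lemma test_function_bounded: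
 assumes "test_function D phi"
 shows "\<exists>R>0. (\<forall>x. phi x \<noteq> 0 \<longrightarrow> norm x < R) \<and> (\<forall>x. norm (phi x) \<le> R)"
proof -
 let ?K = "closure {x. phi x \<noteq> 0}"
 have K: "compact ?K" using assms by (simp add: test_function_def)
 have c: "continuous_on UNIV phi" using assms by (rule test_function_continuous)
 have "bounded (phi ` ?K)"
  using K c by (meson compact_continuous_image compact_imp_bounded continuous_on_subset subset_UNIV)
 then obtain B where B: "\<And>x. x \<in> ?K \<Longrightarrow> norm (phi x) \<le> B"
  by (auto simp: bounded_iff)
 obtain A where A: "\<And>x. x \<in> ?K \<Longrightarrow> norm x \<le> A"
  using compact_imp_bounded[OF K] by (auto simp: bounded_iff)
 have *: "phi x = 0 \<or> x \<in> ?K" for x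
  using closure_subset[of "{x. phi x \<noteq> 0}"] by auto
 show ?thesis
 proof (intro exI conjI allI impI)
  show "0 < \<bar>A\<bar> + \<bar>B\<bar> + 1" by simp
  show "norm x < \<bar>A\<bar> + \<bar>B\<bar> + 1" if "phi x \<noteq> 0" for x
   using A[of x] *[of x] that by auto
  show "norm (phi x) \<le> \<bar>A\<bar> + \<bar>B\<bar> + 1" for x
   using B[of x] *[of x] by auto
 qed
qed

text \<open>\<open>flat 0\<close> increases to one at infinity, so stretching its argument by
  \<open>Suc n\<close> makes the product tend to the indicator of the open box, without a plateau
  having to be constructed.\<close>

definition box_bump :: "'a::euclidean_space => 'a => nat => 'a => real" where
 "box_bump a b n x = (\<Prod>i\<in>Basis. flat 0 (real (Suc n) * (x \<bullet> i - a \<bullet> i)) * flat 0 (real (Suc n) * (b \<bullet> i - x \<bullet> i)))"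

lemma box_bump_outside: "x \<notin> box a b \<Longrightarrow> box_bump a b n x = 0"
proof -
 assume "x \<notin> box a b"
 then obtain i where i: "i \<in> Basis" "x \<bullet> i \<le> a \<bullet> i \<or> b \<bullet> i \<le> x \<bullet> i"
  by (auto simp: mem_box not_less)
 then have "flat 0 (real (Suc n) * (x \<bullet> i - a \<bullet> i)) * flat 0 (real (Suc n) * (b \<bullet> i - x \<bullet> i)) = 0"
  by (auto simp: mult_nonneg_nonpos simp del: of_nat_Suc)
 then show ?thesis
  using i(1) unfolding box_bump_def by (intro prod_zero) auto
qed

lemma test_function_box_bump: "test_function UNIV (box_bump a b n)"
proof (rule test_functionI[where K="cbox a b"])
 show "Ck k (box_bump a b n)" for k
  unfolding box_bump_def[abs_def]
  by (intro Ck_prod Ck_mult Ck_flat_comp Ck_cmult Ck_diff Ck_const Ck_inner Ck_ident)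
 show "x \<notin> cbox a b \<Longrightarrow> box_bump a b n x = 0" for x
  using box_bump_outside box_subset_cbox by blast
qed auto

lemma box_bump_le_1: "0 \<le> box_bump a b n x" "box_bump a b n x \<le> 1"
 unfolding box_bump_def
 by (auto intro!: prod_nonneg prod_le_1 mult_le_one simp: flat_nonneg flat_le_1 simp del: of_nat_Suc)

lemma flat_scaled_tendsto: "0 < y \<Longrightarrow> (\<lambda>n. flat 0 (real (Suc n) * y)) \<longlonglongrightarrow> 1"
proof -
 assume y: "0 < y"
 have "(\<lambda>n. exp (- (1 / y) * inverse (real (Suc n)))) \<longlonglongrightarrow> exp (- (1 / y) * 0)"
  by (intro tendsto_intros LIMSEQ_inverse_real_of_nat)
 moreover have "flat 0 (real (Suc n) * y) = exp (- (1 / y) * inverse (real (Suc n)))" for n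
  using y by (simp add: flat_def field_simps mult_less_0_iff not_le del: of_nat_Suc)
 ultimately show ?thesis by simp
qed

lemma box_bump_tendsto: "(\<lambda>n. box_bump a b n x) \<longlonglongrightarrow> indicator (box a b) x"
proof (cases "x \<in> box a b")
 case True
 have "(\<lambda>n. box_bump a b n x) \<longlonglongrightarrow> (\<Prod>i\<in>(Basis::'a set). 1 * 1)"
  unfolding box_bump_def using True
  by (intro tendsto_prod tendsto_mult flat_scaled_tendsto) (auto simp: mem_box)
 then show ?thesis using True by simp
qed (simp add: box_bump_outside)

lemma Borel_representative_real:
 fixes k :: "'a::euclidean_space => real"
 assumes "k \<in> borel_measurable lebesgue"
 obtains k' where "k' \<in> borel_measurable borel" "AE x in lborel. k x = k' x"
 using completion_ex_borel_measurable_real[OF assms] by auto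

lemma test_function_measurable_lebesgue:
 "test_function D phi \<Longrightarrow> phi \<in> borel_measurable borel"
 using test_function_continuous borel_measurable_continuous_onI by blast

lemma box_Int_stable: "Int_stable (range (\<lambda>(a, b). box a b :: 'a::euclidean_space set))"
 by (auto simp: Int_stable_def box_Int_box)

lemma subset_Pow_UNIV: "X \<subseteq> Pow UNIV"
 by simp

text \<open>Bumps converge boundedly to indicators of open boxes, so \<open>k\<close> has integral
  zero over every box. Boxes form an intersection stable generator of the Borel sets, and vanishing
  of the integral passes to complements and countable disjoint unions. An integrable function whose
  integral over every Borel set is zero vanishes almost everywhere.\<close>

lemma fundamental_lemma_variations:
 fixes k :: "'a::euclidean_space => real"
 assumes loc: "locally_integrable k"
  and zero: "\<And>phi::'a => real. test_function UNIV phi \<Longrightarrow> (LINT x|lebesgue. phi x * k x) = 0"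
 shows "AE x in lebesgue. k x = 0"
proof -
 have kbox: "(LINT x|lebesgue. indicator (box a b) x * k x) = 0" for a b
 proof -
  have int: "integrable lebesgue (\<lambda>x. indicator (cbox a b) x * k x)"
   using loc unfolding locally_integrable_def set_integrable_def by auto
  have eq: "box_bump a b n x * k x = box_bump a b n x * (indicator (cbox a b) x * k x)" for n x
   using box_bump_outside[of x a b n] box_subset_cbox[of a b] by (auto simp: indicator_def)
  have eq2: "indicator (box a b) x * k x = indicator (box a b) x * (indicator (cbox a b) x * k x)" for x
   using box_subset_cbox[of a b] by (auto simp: indicator_def)
  have [measurable]: "box_bump a b n \<in> borel_measurable borel" for n
   by (rule test_function_measurable_lebesgue[OF test_function_box_bump])
  have [measurable]: "box_bump a b n \<in> borel_measurable lebesgue" for n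
   by (rule measurable_completion) simp
  have m: "(\<lambda>x. indicator (cbox a b) x * k x) \<in> borel_measurable lebesgue"
   using int by (rule borel_measurable_integrable)
  have "(\<lambda>n. LINT x|lebesgue. box_bump a b n x * (indicator (cbox a b) x * k x))
    \<longlonglongrightarrow> (LINT x|lebesgue. indicator (box a b) x * (indicator (cbox a b) x * k x))"
  proof (rule integral_dominated_convergence)
   show "integrable lebesgue (\<lambda>x. norm (indicator (cbox a b) x * k x))" using int by simp
   show "AE x in lebesgue. (\<lambda>n. box_bump a b n x * (indicator (cbox a b) x * k x)) \<longlonglongrightarrow>
     indicator (box a b) x * (indicator (cbox a b) x * k x)"
    by (intro AE_I2 tendsto_intros box_bump_tendsto)
   show "AE x in lebesgue. norm (box_bump a b n x * (indicator (cbox a b) x * k x)) \<le>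
     norm (indicator (cbox a b) x * k x)" for n
    using box_bump_le_1[of a b n] by (auto simp: abs_mult intro!: AE_I2 mult_left_le_one_le)
  qed (intro borel_measurable_times m borel_measurable_indicator; simp)+
  moreover have "(LINT x|lebesgue. box_bump a b n x * (indicator (cbox a b) x * k x)) = 0" for n
   using zero[OF test_function_box_bump, of a b n] by (simp only: eq)
  ultimately have "(\<lambda>n::nat. 0::real) \<longlonglongrightarrow> (LINT x|lebesgue. indicator (box a b) x * k x)"
   by (simp only: eq2)
  then show ?thesis using LIMSEQ_unique tendsto_const by metis
 qed
 \<comment> \<open>Cutting down to a bounded box makes the function integrable on the whole space,
   which the case of complements below relies on.\<close>
 have N: "AE x in lebesgue. x \<in> box (- real n *\<^sub>R One) (real n *\<^sub>R One) \<longrightarrow> k x = 0" for n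
 proof -
  let ?J = "box (- real n *\<^sub>R One) (real n *\<^sub>R One) :: 'a set"
  have int: "integrable lebesgue (\<lambda>x. indicator ?J x * k x)"
  proof -
   have "integrable lebesgue (\<lambda>x. indicator (cbox (- real n *\<^sub>R One) (real n *\<^sub>R One)) x *\<^sub>R k x)"
    using loc unfolding locally_integrable_def set_integrable_def by auto
   then have "integrable lebesgue (\<lambda>x. indicator ?J x *\<^sub>R (indicator (cbox (- real n *\<^sub>R One) (real n *\<^sub>R One)) x *\<^sub>R k x))"
    by (rule integrable_mult_indicator[rotated]) auto
   also have "(\<lambda>x. indicator ?J x *\<^sub>R (indicator (cbox (- real n *\<^sub>R One) (real n *\<^sub>R One)) x *\<^sub>R k x)) = (\<lambda>x. indicator ?J x * k x)"
    using box_subset_cbox[of "- real n *\<^sub>R One :: 'a" "real n *\<^sub>R One"] by (auto simp: indicator_def fun_eq_iff)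
   finally show ?thesis .
  qed
  obtain k' where k' [measurable]: "k' \<in> borel_measurable borel"
   and kk': "AE x in lborel. indicator ?J x * k x = k' x"
   using Borel_representative_real int by blast
  have kk'2: "AE x in lebesgue. indicator ?J x * k x = k' x"
   using kk' by (simp add: AE_completion_iff)
  note Jm = borel_measurable_integrable[OF int]
  have k'm: "k' \<in> borel_measurable lebesgue" using k' by (auto intro: measurable_completion)
  have int': "integrable lborel k'"
  proof -
   have "integrable lebesgue k'"
    using int integrable_cong_AE[OF Jm k'm kk'2] by simp
   then show ?thesis by (simp add: integrable_completion)
  qed
  have "AE x in lborel. k' x = 0"
  proof (rule sigma_finite_measure.density_zero[OF sigma_finite_lborel int'])
   fix A :: "'a set" assume "A \<in> sets lborel"
   then have "A \<in> sigma_sets UNIV (range (\<lambda>(a, b). box a b))"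
    by (simp add: borel_eq_box)
   with box_Int_stable subset_Pow_UNIV show "set_lebesgue_integral lborel A k' = 0"
   proof (induction rule: sigma_sets_induct_disjoint)
    case (basic A)
    then obtain a b where A: "A = box a b" by auto
    obtain c d where cd: "A \<inter> ?J = box c d" using A by (auto simp: box_Int_box)
    have "set_lebesgue_integral lborel A k' = (LINT x|lebesgue. indicator A x * k' x)"
     by (simp add: set_lebesgue_integral_def integral_completion A)
    also have "\<dots> = (LINT x|lebesgue. indicator (box c d) x * k x)"
    proof (rule integral_cong_AE)
     have "(\<lambda>x. indicator A x * (indicator ?J x * k x)) \<in> borel_measurable lebesgue"
      unfolding A by (intro borel_measurable_times Jm borel_measurable_indicator) simp
     also have "(\<lambda>x. indicator A x * (indicator ?J x * k x)) = (\<lambda>x. indicator (box c d) x * k x)"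
      by (auto simp: cd[symmetric] indicator_def)
     finally show "(\<lambda>x. indicator (box c d) x * k x) \<in> borel_measurable lebesgue" .
     show "(\<lambda>x. indicator A x * k' x) \<in> borel_measurable lebesgue"
      unfolding A by (rule measurable_completion) simp
     show "AE x in lebesgue. indicator A x * k' x = indicator (box c d) x * k x"
      using kk'2 by eventually_elim (auto simp: cd[symmetric] indicator_def)
    qed
    finally show ?case using kbox by simp
   next
    case empty then show ?case by (simp add: set_lebesgue_integral_def)
   next
    case (compl A)
    then have A: "A \<in> sets lborel" by (simp add: borel_eq_box)
    have "(LINT x|lborel. indicator A x *\<^sub>R k' x) + (LINT x|lborel. indicator (UNIV - A) x *\<^sub>R k' x) = (LINT x|lborel. k' x)"
    proof (subst Bochner_Integration.integral_add[symmetric])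
     show "integrable lborel (\<lambda>x. indicator A x *\<^sub>R k' x)" "integrable lborel (\<lambda>x. indicator (UNIV - A) x *\<^sub>R k' x)"
      using A by (intro integrable_mult_indicator int'; simp)+
    qed (auto intro!: Bochner_Integration.integral_cong simp: indicator_def)
    \<comment> \<open>The total integral is the integral of \<open>k\<close> over the single box
      \<open>?J\<close>, already known to vanish.\<close>
    moreover have "(LINT x|lborel. k' x) = 0"
    proof -
     have "(LINT x|lborel. k' x) = (LINT x|lebesgue. k' x)"
      by (simp add: integral_completion)
     also have "\<dots> = (LINT x|lebesgue. indicator ?J x * k x)"
      using integral_cong_AE[OF Jm k'm kk'2] by simp
     finally show ?thesis using kbox by simp
    qed
    ultimately show ?case using compl by (simp add: set_lebesgue_integral_def)
   next
    case (union F)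
    then have F: "\<And>i. F i \<in> sets lborel" by (auto simp: borel_eq_box)
    have "set_lebesgue_integral lborel (\<Union>i. F i) k' = (\<Sum>i. set_lebesgue_integral lborel (F i) k')"
    proof (rule lebesgue_integral_countable_add)
     show "set_integrable lborel (\<Union>i. F i) k'"
      unfolding set_integrable_def using F int' by (intro integrable_mult_indicator) auto
     show "\<And>i j. i \<noteq> j \<Longrightarrow> F i \<inter> F j = {}"
      using union by (auto simp: disjoint_family_on_def)
    qed (use F in auto)
    then show ?case using union by simp
   qed
  qed
  then have "AE x in lebesgue. k' x = 0" by (simp add: AE_completion_iff)
  with kk'2 show ?thesis
   by eventually_elim (auto simp: indicator_def split: if_splits)
 qed
 have "AE x in lebesgue. \<forall>n. x \<in> box (- real n *\<^sub>R One) (real n *\<^sub>R One) \<longrightarrow> k x = 0"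
  unfolding AE_all_countable using N by blast
 then show ?thesis
 proof eventually_elim
  case (elim x)
  have "x \<in> (\<Union>n. box (- (real n *\<^sub>R One)) (real n *\<^sub>R One))"
   using UN_box_eq_UNIV by auto
  then show ?case using elim by auto
 qed
qed

section \<open>The Fourier transform of integrable functions\<close>

lemma borel_measurable_cis [measurable]: "cis \<in> borel_measurable borel"
 by (intro borel_measurable_continuous_onI continuous_intros)

text \<open>The normalisation that makes the transform an isometry and the Gaussian its fixed point;
  the type argument carries the dimension.\<close>

definition fconst :: "'a::euclidean_space itself => real" where
 "fconst _ = (2 * pi) powr (- real DIM('a) / 2)"

lemma fconst_pos: "fconst TYPE('a::euclidean_space) > 0"
 by (simp add: fconst_def)

lemma fourier_integral_borel:
 fixes f :: "'a::euclidean_space => complex"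
 assumes [measurable]: "f \<in> borel_measurable borel"
 shows "fourier_integral f xi = of_real (fconst TYPE('a)) * (LINT x|lborel. cis (- (x \<bullet> xi)) * f x)"
 unfolding fourier_integral_def fconst_def by (subst integral_completion) auto

lemma fourier_integral_measurable [measurable]:
 fixes f :: "'a::euclidean_space => complex"
 assumes [measurable]: "f \<in> borel_measurable borel"
 shows "fourier_integral f \<in> borel_measurable borel"
proof -
 have "fourier_integral f = (\<lambda>xi. of_real (fconst TYPE('a)) * (LINT x|lborel. cis (- (x \<bullet> xi)) * f x))"
  by (simp add: fourier_integral_borel fun_eq_iff)
 then show ?thesis by simp
qed

lemma integrable_cis_mult:
 fixes f :: "'a::euclidean_space => complex"
 assumes "integrable lborel f"
 shows "integrable lborel (\<lambda>x. cis (x \<bullet> xi) * f x)" "integrable lborel (\<lambda>x. cis (- (x \<bullet> xi)) * f x)"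
proof -
 have [measurable]: "f \<in> borel_measurable borel" using assms by auto
 show "integrable lborel (\<lambda>x. cis (x \<bullet> xi) * f x)" "integrable lborel (\<lambda>x. cis (- (x \<bullet> xi)) * f x)"
  by (rule Bochner_Integration.integrable_bound[OF assms]; simp add: norm_mult)+
qed

lemma fourier_integral_bound:
 fixes f :: "'a::euclidean_space => complex"
 assumes "integrable lborel f"
 shows "cmod (fourier_integral f xi) \<le> fconst TYPE('a) * (LINT x|lborel. cmod (f x))"
proof -
 have [measurable]: "f \<in> borel_measurable borel" using assms by auto
 have "cmod (LINT x|lborel. cis (- (x \<bullet> xi)) * f x) \<le> (LINT x|lborel. cmod (cis (- (x \<bullet> xi)) * f x))"
  by (rule integral_norm_bound)
 then show ?thesis
  using fconst_pos[where 'a='a] by (simp add: fourier_integral_borel norm_mult)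
qed

lemma fourier_integral_add:
 fixes f g :: "'a::euclidean_space => complex"
 assumes "integrable lborel f" "integrable lborel g"
 shows "fourier_integral (\<lambda>x. f x + g x) xi = fourier_integral f xi + fourier_integral g xi"
proof -
 have [measurable]: "f \<in> borel_measurable borel" "g \<in> borel_measurable borel" using assms by auto
 show ?thesis
  using integrable_cis_mult[OF assms(1)] integrable_cis_mult[OF assms(2)]
  by (simp add: fourier_integral_borel distrib_left)
qed

lemma fourier_integral_cmult:
 "fourier_integral (\<lambda>x. c * f x) xi = c * fourier_integral f xi"
 unfolding fourier_integral_def by (simp add: mult.left_commute[of _ c])

lemma fourier_integral_diff:
 fixes f g :: "'a::euclidean_space => complex"
 assumes "integrable lborel f" "integrable lborel g"
 shows "fourier_integral (\<lambda>x. f x - g x) xi = fourier_integral f xi - fourier_integral g xi"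
 using fourier_integral_add[OF assms(1), of "\<lambda>x. (-1) * g x"] assms(2)
 by (simp only: fourier_integral_cmult) simp

lemma fourier_integral_cnj:
 fixes f :: "'a::euclidean_space => complex"
 shows "fourier_integral (\<lambda>x. cnj (f x)) (- xi) = cnj (fourier_integral f xi)"
proof -
 have "(LINT x|lebesgue. cis (- (x \<bullet> - xi)) * cnj (f x)) = cnj (LINT x|lebesgue. cis (- (x \<bullet> xi)) * f x)"
  using Bochner_Integration.integral_cnj[of lebesgue "\<lambda>x. cis (- (x \<bullet> xi)) * f x"] by (simp add: cis_cnj del: Bochner_Integration.integral_cnj)
 then show ?thesis
  unfolding fourier_integral_def by simp
qed

lemma integrable_tensor:
 fixes f g :: "'a::euclidean_space => complex"
 assumes "integrable lborel f" "integrable lborel g"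
 shows "integrable (lborel \<Otimes>\<^sub>M lborel) (\<lambda>(x, y). f x * g y)"
proof -
 have [measurable]: "f \<in> borel_measurable borel" "g \<in> borel_measurable borel" using assms by auto
 show ?thesis
  by (rule lborel_pair.Fubini_integrable) (use assms in \<open>auto simp: norm_mult intro!: integrable_mult_left integrable_mult_right\<close>)
qed

text \<open>The multiplication formula. It is Fubini for a double integral whose oscillating factor
  is symmetric in the two variables.\<close>

lemma fourier_integral_dual:
 fixes f g :: "'a::euclidean_space => complex"
 assumes "integrable lborel f" "integrable lborel g"
 shows "(LINT x|lborel. fourier_integral f x * g x) = (LINT x|lborel. f x * fourier_integral g x)"
proof -
 have [measurable]: "f \<in> borel_measurable borel" "g \<in> borel_measurable borel" using assms by auto
 let ?c = "of_real (fconst TYPE('a)) :: complex"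
 have int: "integrable (lborel \<Otimes>\<^sub>M lborel) (\<lambda>(x, y). cis (- (x \<bullet> y)) * (f x * g y))"
  by (rule Bochner_Integration.integrable_bound[OF integrable_tensor[OF assms]])
    (auto simp: norm_mult)
 have "(LINT y|lborel. fourier_integral f y * g y) = ?c * (LINT y|lborel. LINT x|lborel. cis (- (x \<bullet> y)) * (f x * g y))"
 proof -
  have "fourier_integral f y * g y = ?c * (LINT x|lborel. cis (- (x \<bullet> y)) * (f x * g y))" for y
   by (simp add: fourier_integral_borel mult.assoc[symmetric])
  then show ?thesis by simp
 qed
 also have "(LINT y|lborel. LINT x|lborel. cis (- (x \<bullet> y)) * (f x * g y)) =
   (LINT x|lborel. LINT y|lborel. cis (- (x \<bullet> y)) * (f x * g y))"
  using lborel_pair.Fubini_integral[of "\<lambda>x y. cis (- (x \<bullet> y)) * (f x * g y)"] int by simp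
 also have "?c * \<dots> = (LINT x|lborel. f x * fourier_integral g x)"
 proof -
  have "f x * fourier_integral g x = ?c * (LINT y|lborel. cis (- (x \<bullet> y)) * (f x * g y))" for x
   by (simp add: fourier_integral_borel mult.left_commute[of _ "f x"] inner_commute[of x])
  then show ?thesis by simp
 qed
 finally show ?thesis .
qed

section \<open>Gaussians\<close>

text \<open>\<open>lborel\<close> is the image of a product measure under the coordinate
  isomorphism. The lemma reduces both the Gaussian and the integrability of powers of the bracket to
  one dimension.\<close>

lemma integral_prod_Basis:
 fixes f :: "'a::euclidean_space => real => 'c::{real_normed_field,banach,second_countable_topology}"
 assumes f: "\<And>b. b \<in> Basis \<Longrightarrow> integrable lborel (f b)"
 shows "integrable lborel (\<lambda>x::'a. \<Prod>b\<in>Basis. f b (x \<bullet> b))"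
  and "(LINT x|(lborel::'a measure). (\<Prod>b\<in>Basis. f b (x \<bullet> b))) = (\<Prod>b\<in>Basis. (LINT y|lborel. f b y))"
proof -
 interpret product_sigma_finite "\<lambda>_::'a. lborel :: real measure" ..
 have [measurable]: "b \<in> Basis \<Longrightarrow> f b \<in> borel_measurable borel" for b using f by auto
 have *: "(\<Prod>b\<in>Basis. f b ((\<Sum>c\<in>Basis. y c *\<^sub>R c) \<bullet> b)) = (\<Prod>b\<in>Basis. f b (y b))" for y
  by (intro prod.cong refl) (simp add: inner_sum_left inner_Basis if_distrib cong: if_cong)
 have m: "(\<lambda>x::'a. \<Prod>b\<in>Basis. f b (x \<bullet> b)) \<in> borel_measurable borel" by measurable
 have i: "integrable (\<Pi>\<^sub>M b\<in>Basis. lborel) (\<lambda>y. \<Prod>b\<in>(Basis::'a set). f b (y b))"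
  by (rule product_integrable_prod) (use f in auto)
 show "integrable lborel (\<lambda>x::'a. \<Prod>b\<in>Basis. f b (x \<bullet> b))"
  using i m by (subst lborel_eq) (simp add: integrable_distr_eq *)
 show "(LINT x|(lborel::'a measure). (\<Prod>b\<in>Basis. f b (x \<bullet> b))) = (\<Prod>b\<in>Basis. (LINT y|lborel. f b y))"
  using m by (subst lborel_eq) (simp add: integral_distr * product_integral_prod f)
qed

definition gauss :: "'a::euclidean_space => real" where
 "gauss x = exp (- ((norm x)\<^sup>2 / 2))"

lemma gauss_measurable [measurable]: "gauss \<in> borel_measurable borel"
 unfolding gauss_def by measurable

lemma gauss_pos: "gauss x > 0" and gauss_le_1: "gauss x \<le> 1" and gauss_minus [simp]: "gauss (- x) = gauss x"
 by (auto simp: gauss_def)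

text \<open>The characteristic function of the standard normal distribution, freed from the constant
  of its density.\<close>

lemma gauss_1d:
 "integrable lborel (\<lambda>y. cis (t * y) * of_real (exp (- (y\<^sup>2 / 2))))"
 "(LINT y|lborel. cis (t * y) * of_real (exp (- (y\<^sup>2 / 2)))) = of_real (sqrt (2 * pi) * exp (- (t\<^sup>2 / 2)))"
proof -
 have eq: "cis (t * y) * of_real (exp (- (y\<^sup>2 / 2))) = of_real (sqrt (2 * pi)) * (std_normal_density y *\<^sub>R cis (t * y))" for y
  by (simp add: std_normal_density_def scaleR_conv_of_real)
 have int: "integrable lborel (\<lambda>y. std_normal_density y *\<^sub>R cis (t * y))"
  by (rule Bochner_Integration.integrable_bound[OF integrable_normal_density[of 1 0]]) auto
 show "integrable lborel (\<lambda>y. cis (t * y) * of_real (exp (- (y\<^sup>2 / 2))))"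
  unfolding eq by (rule integrable_mult_right[OF int])
 have "(LINT y|lborel. std_normal_density y *\<^sub>R cis (t * y)) = char std_normal_distribution t"
  unfolding char_def by (subst integral_density) (auto simp: cis_conv_exp)
 also have "\<dots> = of_real (exp (- (t\<^sup>2 / 2)))" by (simp add: char_std_normal_distribution)
 finally show "(LINT y|lborel. cis (t * y) * of_real (exp (- (y\<^sup>2 / 2)))) = of_real (sqrt (2 * pi) * exp (- (t\<^sup>2 / 2)))"
  unfolding eq integral_mult_right_zero by simp
qed

lemma gauss_prod: "gauss (x::'a::euclidean_space) = (\<Prod>b\<in>Basis. exp (- ((x \<bullet> b)\<^sup>2 / 2)))"
proof -
 have "(norm x)\<^sup>2 = (\<Sum>b\<in>Basis. (x \<bullet> b)\<^sup>2)"
  unfolding power2_norm_eq_inner by (subst euclidean_inner) (simp add: power2_eq_square)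
 then show ?thesis
  by (simp add: gauss_def exp_sum[symmetric] sum_negf sum_divide_distrib)
qed

text \<open>The exponential and the Gaussian both factor over the coordinates.\<close>

lemma gauss_fourier:
 fixes w :: "'a::euclidean_space"
 shows "integrable lborel (\<lambda>x. cis (w \<bullet> x) * of_real (gauss x))"
  "of_real (fconst TYPE('a)) * (LINT x|lborel. cis (w \<bullet> x) * of_real (gauss x)) = of_real (gauss w)"
proof -
 have cis_sum: "cis (\<Sum>i\<in>I. a i) = (\<Prod>i\<in>I. cis (a i))" for I :: "'a set" and a
  by (induction I rule: infinite_finite_induct) (auto simp: cis_mult[symmetric])
 have eq: "cis (w \<bullet> x) * of_real (gauss x) =
   (\<Prod>b\<in>Basis. cis ((w \<bullet> b) * (x \<bullet> b)) * of_real (exp (- ((x \<bullet> b)\<^sup>2 / 2))))" for x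
  by (subst euclidean_inner) (simp add: cis_sum gauss_prod prod.distrib)
 note * = integral_prod_Basis[of "\<lambda>b y. cis ((w \<bullet> b) * y) * of_real (exp (- (y\<^sup>2 / 2)))", OF gauss_1d(1)]
 show "integrable lborel (\<lambda>x. cis (w \<bullet> x) * of_real (gauss x))"
  unfolding eq by (rule *(1))
 have "(LINT x|lborel. cis (w \<bullet> x) * of_real (gauss x)) = (\<Prod>b\<in>(Basis::'a set). of_real (sqrt (2 * pi) * exp (- ((w \<bullet> b)\<^sup>2 / 2))))"
  unfolding eq by (subst *(2)) (simp only: gauss_1d(2))
 also have "\<dots> = of_real (sqrt (2 * pi) ^ DIM('a) * gauss w)"
  by (simp add: prod.distrib gauss_prod)
 also have "sqrt (2 * pi) ^ DIM('a) = (2 * pi) powr (real DIM('a) / 2)"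
  by (simp add: powr_half_sqrt[symmetric] powr_realpow[symmetric] powr_powr)
 finally show "of_real (fconst TYPE('a)) * (LINT x|lborel. cis (w \<bullet> x) * of_real (gauss x)) = of_real (gauss w)"
  by (simp add: fconst_def powr_add[symmetric] of_real_mult[symmetric] mult.assoc[symmetric] del: of_real_mult)
qed

lemma gauss_integrable: "integrable lborel (gauss :: 'a::euclidean_space => real)"
 using integrable_Re[OF gauss_fourier(1)[of "0::'a"]] by simp

lemma gauss_integral: "fconst TYPE('a) * (LINT x|lborel. gauss (x::'a::euclidean_space)) = 1"
proof -
 have "of_real (fconst TYPE('a)) * (LINT x|lborel. complex_of_real (gauss (x::'a))) = 1"
  using gauss_fourier(2)[of "0::'a"] by (simp add: gauss_def)
 then have "complex_of_real (fconst TYPE('a) * (LINT x|lborel. gauss (x::'a))) = 1" by simp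
 then show ?thesis by (simp only: of_real_eq_1_iff)
qed

lemma integral_scale:
 fixes f :: "'a::euclidean_space => 'b::{banach,second_countable_topology}"
 assumes [measurable]: "f \<in> borel_measurable borel" and c: "c \<noteq> 0"
 shows "(LINT y|lborel. f y) = \<bar>c\<bar> ^ DIM('a) *\<^sub>R (LINT w|lborel. f (t + c *\<^sub>R w))"
  and "integrable lborel f \<longleftrightarrow> integrable lborel (\<lambda>w. f (t + c *\<^sub>R w))"
proof -
 have nn: "AE x in distr lborel borel (\<lambda>x. t + c *\<^sub>R x). 0 \<le> \<bar>c\<bar> ^ DIM('a)" by simp
 show "(LINT y|lborel. f y) = \<bar>c\<bar> ^ DIM('a) *\<^sub>R (LINT w|lborel. f (t + c *\<^sub>R w))"
  apply (subst lborel_affine[OF c, of t])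
  apply (subst integral_density)
  by (auto simp: integral_distr)
 show "integrable lborel f \<longleftrightarrow> integrable lborel (\<lambda>w. f (t + c *\<^sub>R w))"
 proof -
  have "integrable lborel f \<longleftrightarrow> integrable lborel (\<lambda>w. \<bar>c\<bar> ^ DIM('a) *\<^sub>R f (t + c *\<^sub>R w))"
   apply (subst lborel_affine[OF c, of t])
   apply (subst integrable_density)
   by (auto simp: integrable_distr_eq)
  also have "\<dots> \<longleftrightarrow> integrable lborel (\<lambda>w. f (t + c *\<^sub>R w))"
  proof
   assume "integrable lborel (\<lambda>w. \<bar>c\<bar> ^ DIM('a) *\<^sub>R f (t + c *\<^sub>R w))"
   then have "integrable lborel (\<lambda>w. inverse (\<bar>c\<bar> ^ DIM('a)) *\<^sub>R (\<bar>c\<bar> ^ DIM('a) *\<^sub>R f (t + c *\<^sub>R w)))"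
    by (rule integrable_scaleR_right)
   then show "integrable lborel (\<lambda>w. f (t + c *\<^sub>R w))" using c by simp
  qed auto
  finally show ?thesis .
 qed
qed

text \<open>The Gaussian summability kernel: the Fourier transform of \<open>\<xi> \<mapsto> gauss (\<xi> / Suc n)\<close>.\<close>

definition gkernel :: "nat => 'a::euclidean_space => real" where
 "gkernel n z = fconst TYPE('a) * real (Suc n) ^ DIM('a) * gauss (real (Suc n) *\<^sub>R z)"

lemma gkernel_measurable [measurable]: "gkernel n \<in> borel_measurable borel"
 unfolding gkernel_def by measurable

lemma gkernel_nonneg: "gkernel n z \<ge> 0"
 unfolding gkernel_def
 by (intro mult_nonneg_nonneg less_imp_le[OF fconst_pos] less_imp_le[OF gauss_pos]) auto

text \<open>Substituting \<open>y = x - w / Suc n\<close> moves the dependence on \<open>n\<close>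
  from the kernel into the argument of \<open>phi\<close>, so that limits in \<open>n\<close> can be
  taken under a fixed Gaussian weight.\<close>

lemma gkernel_convolution:
 fixes phi :: "'a::euclidean_space => complex"
 assumes [measurable]: "phi \<in> borel_measurable borel"
 shows "(LINT y|lborel. phi y * of_real (gkernel n (x - y))) =
   (LINT w|lborel. of_real (fconst TYPE('a) * gauss w) * phi (x + (- inverse (real (Suc n))) *\<^sub>R w))"
  (is "_ = ?R")
proof -
 have "(LINT y|lborel. phi y * of_real (gkernel n (x - y))) = \<bar>- inverse (real (Suc n))\<bar> ^ DIM('a) *\<^sub>R
   (LINT w|lborel. phi (x + (- inverse (real (Suc n))) *\<^sub>R w) * of_real (gkernel n (x - (x + (- inverse (real (Suc n))) *\<^sub>R w))))"
  by (rule integral_scale) (auto simp del: of_nat_Suc)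
 also have "\<dots> = (LINT w|lborel. \<bar>- inverse (real (Suc n))\<bar> ^ DIM('a) *\<^sub>R
   (phi (x + (- inverse (real (Suc n))) *\<^sub>R w) * of_real (gkernel n (x - (x + (- inverse (real (Suc n))) *\<^sub>R w)))))"
  by (simp only: integral_scaleR_right)
 also have "\<dots> = ?R"
 proof (rule Bochner_Integration.integral_cong[OF refl])
  fix w :: 'a
  have "inverse (real (Suc n)) ^ DIM('a) * real (Suc n) ^ DIM('a) = 1"
   by (simp add: power_mult_distrib[symmetric] del: of_nat_Suc)
  then have "\<bar>- inverse (real (Suc n))\<bar> ^ DIM('a) * gkernel n (x - (x + (- inverse (real (Suc n))) *\<^sub>R w)) = fconst TYPE('a) * gauss w"
   by (simp add: gkernel_def del: of_nat_Suc)
  then show "\<bar>- inverse (real (Suc n))\<bar> ^ DIM('a) *\<^sub>R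
   (phi (x + (- inverse (real (Suc n))) *\<^sub>R w) * of_real (gkernel n (x - (x + (- inverse (real (Suc n))) *\<^sub>R w))))
   = of_real (fconst TYPE('a) * gauss w) * phi (x + (- inverse (real (Suc n))) *\<^sub>R w)"
   by (simp only: scaleR_conv_of_real mult.commute[of "phi _"] mult.assoc[symmetric] of_real_mult[symmetric])
 qed
 finally show ?thesis .
qed

lemma gkernel_integral:
 "integrable lborel (gkernel n :: 'a::euclidean_space => real)" "(LINT x|lborel. gkernel n (x::'a)) = 1"
proof -
 have "integrable lborel (\<lambda>x::'a. gauss (0 + real (Suc n) *\<^sub>R x))"
  using gauss_integrable[where 'a='a] by (subst integral_scale(2)[symmetric]) (auto simp del: of_nat_Suc)
 then show "integrable lborel (gkernel n :: 'a => real)"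
  unfolding gkernel_def by (auto simp del: of_nat_Suc)
 have "complex_of_real (LINT x|lborel. gkernel n (x::'a)) = (LINT y|lborel. 1 * of_real (gkernel n (0 - (y::'a))))"
  by (simp add: gkernel_def del: of_nat_Suc)
 also have "\<dots> = (LINT w|lborel. of_real (fconst TYPE('a) * gauss (w::'a)) * 1)"
  by (rule gkernel_convolution) simp
 also have "\<dots> = 1" using gauss_integral[where 'a='a] by (simp del: of_real_mult)
 finally show "(LINT x|lborel. gkernel n (x::'a)) = 1" by simp
qed

lemma gkernel_convolution_tendsto:
 fixes phi :: "'a::euclidean_space => complex"
 assumes c: "continuous_on UNIV phi" and B: "\<And>x. cmod (phi x) \<le> B"
 shows "(\<lambda>n. LINT y|lborel. phi y * of_real (gkernel n (x - y))) \<longlonglongrightarrow> phi x"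
  and "cmod (LINT y|lborel. phi y * of_real (gkernel n (x - y))) \<le> B"
proof -
 have [measurable]: "phi \<in> borel_measurable borel" by (rule borel_measurable_continuous_onI[OF c])
 let ?G = "\<lambda>w::'a. fconst TYPE('a) * gauss w"
 have G: "integrable lborel ?G" "(LINT w|lborel. ?G w) = 1" "\<And>w. ?G w \<ge> 0"
  using gauss_integrable gauss_integral[where 'a='a]
  by (auto intro!: mult_nonneg_nonneg less_imp_le[OF fconst_pos] less_imp_le[OF gauss_pos])
 have bd: "norm (of_real (?G w) * phi y) \<le> B * ?G w" for w y
  using mult_right_mono[OF B[of y] G(3)[of w]] G(3)[of w] by (simp add: norm_mult mult.commute del: of_real_mult)
 have "(\<lambda>n. LINT w|lborel. of_real (?G w) * phi (x + (- inverse (real (Suc n))) *\<^sub>R w)) \<longlonglongrightarrow>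
   (LINT w|lborel. of_real (?G w) * phi x)"
 proof (rule integral_dominated_convergence)
  show "integrable lborel (\<lambda>w. B * ?G w)" using G(1) by simp
  show "AE w in lborel. (\<lambda>n. of_real (?G w) * phi (x + (- inverse (real (Suc n))) *\<^sub>R w)) \<longlonglongrightarrow> of_real (?G w) * phi x"
  proof (rule AE_I2, rule tendsto_mult[OF tendsto_const])
   fix w :: 'a
   have "(\<lambda>n. x + (- inverse (real (Suc n))) *\<^sub>R w) \<longlonglongrightarrow> x + (- 0) *\<^sub>R w"
    by (intro tendsto_intros LIMSEQ_inverse_real_of_nat)
   then show "(\<lambda>n. phi (x + (- inverse (real (Suc n))) *\<^sub>R w)) \<longlonglongrightarrow> phi x"
    using continuous_on_tendsto_compose[OF c, of _ x sequentially] by simp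
  qed
  show "AE w in lborel. norm (of_real (?G w) * phi (x + (- inverse (real (Suc n))) *\<^sub>R w)) \<le> B * ?G w" for n
   using bd by auto
 qed measurable
 moreover have "(LINT w|lborel. of_real (?G w) * phi x) = phi x"
  using G by (simp del: of_real_mult)
 ultimately show "(\<lambda>n. LINT y|lborel. phi y * of_real (gkernel n (x - y))) \<longlonglongrightarrow> phi x"
  by (simp only: gkernel_convolution[OF \<open>phi \<in> borel_measurable borel\<close>])
 have "cmod (LINT w|lborel. of_real (?G w) * phi (x + (- inverse (real (Suc n))) *\<^sub>R w)) \<le> (LINT w|lborel. B * ?G w)"
 proof (rule Bochner_Integration.integral_norm_bound_integral)
  show "integrable lborel (\<lambda>w. B * ?G w)" using G(1) by simp
  show "integrable lborel (\<lambda>w. of_real (?G w) * phi (x + (- inverse (real (Suc n))) *\<^sub>R w))"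
   by (rule Bochner_Integration.integrable_bound[of _ "\<lambda>w. B * ?G w"])
     (use G(1) bd in \<open>auto intro!: AE_I2 order_trans[OF bd] simp del: of_real_mult\<close>)
 qed (rule bd)
 also have "\<dots> = B" using G by simp
 finally show "cmod (LINT y|lborel. phi y * of_real (gkernel n (x - y))) \<le> B"
  by (simp only: gkernel_convolution[OF \<open>phi \<in> borel_measurable borel\<close>])
qed

abbreviation gdil :: "nat => 'a::euclidean_space => real" where
 "gdil n xi \<equiv> gauss (inverse (real (Suc n)) *\<^sub>R xi)"

lemma gdil_integrable: "integrable lborel (\<lambda>xi::'a::euclidean_space. gdil n xi)"
 using gauss_integrable[where 'a='a]
  integral_scale(2)[of "gauss :: 'a => real" "inverse (real (Suc n))" 0] by (simp del: of_nat_Suc)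

lemma gdil_fourier:
 fixes x y :: "'a::euclidean_space"
 shows "of_real (fconst TYPE('a)) * fourier_integral (\<lambda>xi. cis (x \<bullet> xi) * of_real (gdil n xi)) y = of_real (gkernel n (x - y))"
proof -
 let ?N = "real (Suc n)" and ?c = "complex_of_real (fconst TYPE('a))"
 have "(LINT xi|lborel. cis (- (xi \<bullet> y)) * (cis (x \<bullet> xi) * of_real (gdil n xi)))
   = (LINT xi|lborel. cis ((x - y) \<bullet> xi) * of_real (gdil n xi))"
  by (intro Bochner_Integration.integral_cong)
    (auto simp: cis_mult mult.assoc[symmetric] inner_diff_right inner_commute)
 also have "\<dots> = \<bar>?N\<bar> ^ DIM('a) *\<^sub>R (LINT w|lborel. cis ((x - y) \<bullet> (0 + ?N *\<^sub>R w)) * of_real (gdil n (0 + ?N *\<^sub>R w)))"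
  by (rule integral_scale) (auto simp del: of_nat_Suc)
 also have "\<dots> = of_real (?N ^ DIM('a)) * (LINT w|lborel. cis ((?N *\<^sub>R (x - y)) \<bullet> w) * of_real (gauss w))"
  by (simp add: scaleR_conv_of_real del: of_nat_Suc)
 finally have *: "(LINT xi|lborel. cis (- (xi \<bullet> y)) * (cis (x \<bullet> xi) * of_real (gdil n xi))) =
   of_real (?N ^ DIM('a)) * (LINT w|lborel. cis ((?N *\<^sub>R (x - y)) \<bullet> w) * of_real (gauss w))" .
 have "?c * (?c * (of_real (?N ^ DIM('a)) * (LINT w|lborel. cis ((?N *\<^sub>R (x - y)) \<bullet> w) * of_real (gauss w))))
   = ?c * of_real (?N ^ DIM('a)) * (?c * (LINT w|lborel. cis ((?N *\<^sub>R (x - y)) \<bullet> w) * of_real (gauss w)))"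
  by (simp only: mult_ac)
 also have "\<dots> = of_real (gkernel n (x - y))"
  by (simp only: gauss_fourier(2) gkernel_def of_real_mult)
 finally show ?thesis
  using * by (subst fourier_integral_borel) auto
qed

section \<open>The Plancherel theorem\<close>

lemma integral_norm_le_nn_integral:
 fixes f :: "_ => 'b::{banach,second_countable_topology}"
 shows "ennreal (norm (integral\<^sup>L M f)) \<le> (\<integral>\<^sup>+x. norm (f x) \<partial>M)"
 by (cases "integrable M f") (auto intro: integral_norm_bound_ennreal simp: not_integrable_integral_eq)

lemma measurable_pred_ball [measurable]:
 "Measurable.pred borel (\<lambda>x. x \<in> ball (a :: 'a::euclidean_space) r)"
 unfolding pred_def by simp

lemma fourier_integral_diff_fun:
 fixes f g :: "'a::euclidean_space => complex"
 assumes "integrable lborel f" "integrable lborel g"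
 shows "fourier_integral (\<lambda>x. f x - g x) = (\<lambda>xi. fourier_integral f xi - fourier_integral g xi)"
 by (rule ext) (rule fourier_integral_diff[OF assms])

text \<open>The transform of \<open>g\<close> need not be integrable; the Gaussian factor makes it
  so, and the multiplication formula becomes applicable. By \<open>gdil_fourier\<close> the factor
  returns on the other side as an approximate identity.\<close>

lemma fourier_integral_regularized:
 fixes f g :: "'a::euclidean_space => complex"
 assumes f: "integrable lborel f" and g: "integrable lborel g"
 shows "(LINT xi|lborel. fourier_integral f xi * (fourier_integral g (- xi) * of_real (gdil n xi))) =
  (LINT x|lborel. f x * (LINT y|lborel. g y * of_real (gkernel n (x - y))))"
proof -
 have [measurable]: "f \<in> borel_measurable borel" "g \<in> borel_measurable borel" using assms by auto
 have gd: "integrable lborel (\<lambda>xi::'a. of_real (gdil n xi) :: complex)"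
  using gdil_integrable[of n, where 'a='a] by (rule integrable_of_real)
 have gd2: "integrable lborel (\<lambda>xi::'a. cis (x \<bullet> xi) * of_real (gdil n xi))" for x
  using integrable_cis_mult(1)[OF gd, of x] by (simp add: inner_commute)
 have int: "integrable lborel (\<lambda>xi. fourier_integral g (- xi) * of_real (gdil n xi))"
 proof (rule Bochner_Integration.integrable_bound)
  show "integrable lborel (\<lambda>xi::'a. (fconst TYPE('a) * (LINT x|lborel. cmod (g x))) * gdil n xi)"
   using gdil_integrable[of n, where 'a='a] by simp
  show "AE xi in lborel. norm (fourier_integral g (- xi) * of_real (gdil n xi)) \<le>
    norm ((fconst TYPE('a) * (LINT x|lborel. cmod (g x))) * gdil n xi)"
  proof (rule AE_I2)
   fix xi :: 'a
   have "cmod (fourier_integral g (- xi)) \<le> fconst TYPE('a) * (LINT x|lborel. cmod (g x))"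
    by (rule fourier_integral_bound[OF g])
   moreover from this have "0 \<le> fconst TYPE('a) * (LINT x|lborel. cmod (g x))"
    by (rule order_trans[OF norm_ge_zero])
   ultimately show "norm (fourier_integral g (- xi) * of_real (gdil n xi)) \<le>
    norm ((fconst TYPE('a) * (LINT x|lborel. cmod (g x))) * gdil n xi)"
    unfolding norm_mult[of "fourier_integral _ _"] norm_mult[of "fconst _ * _"] using gauss_pos[of "inverse (real (Suc n)) *\<^sub>R xi"]
    by (intro mult_mono) (auto simp del: of_nat_Suc)
  qed
 qed measurable
 have inner: "fourier_integral (\<lambda>xi. fourier_integral g (- xi) * of_real (gdil n xi)) x =
   (LINT y|lborel. g y * of_real (gkernel n (x - y)))" for x
 proof -
  let ?c = "complex_of_real (fconst TYPE('a))"
  let ?H = "\<lambda>xi. cis (- (xi \<bullet> x)) * (fourier_integral g (- xi) * of_real (gdil n xi))"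
  have "fourier_integral (\<lambda>xi. fourier_integral g (- xi) * of_real (gdil n xi)) x = ?c * (LINT xi|lborel. ?H xi)"
   by (subst fourier_integral_borel) auto
  also have "(LINT xi|lborel. ?H xi) = (LINT xi|lborel. ?H (0 - xi))"
   by (rule integral_reflect'[symmetric]) measurable
  also have "\<dots> = (LINT xi|lborel. fourier_integral g xi * (cis (x \<bullet> xi) * of_real (gdil n xi)))"
   by (rule Bochner_Integration.integral_cong) (auto simp: inner_commute mult_ac)
  also have "\<dots> = (LINT y|lborel. g y * fourier_integral (\<lambda>xi. cis (x \<bullet> xi) * of_real (gdil n xi)) y)"
   by (rule fourier_integral_dual[OF g gd2])
  also have "?c * \<dots> = (LINT y|lborel. ?c * (g y * fourier_integral (\<lambda>xi. cis (x \<bullet> xi) * of_real (gdil n xi)) y))"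
   by (rule integral_mult_right_zero[symmetric])
  also have "\<dots> = (LINT y|lborel. g y * of_real (gkernel n (x - y)))"
   by (simp only: mult.left_commute[of ?c] gdil_fourier)
  finally show ?thesis .
 qed
 show ?thesis
  using fourier_integral_dual[OF f int] by (simp only: inner)
qed

lemma gdil_tendsto: "(\<lambda>n. gdil n xi) \<longlonglongrightarrow> 1"
proof -
 have "(\<lambda>n. gauss (inverse (real (Suc n)) *\<^sub>R xi)) \<longlonglongrightarrow> exp (- ((norm (0 *\<^sub>R xi))\<^sup>2 / 2))"
  unfolding gauss_def by (intro tendsto_intros LIMSEQ_inverse_real_of_nat) simp
 then show ?thesis by simp
qed

text \<open>The regularised identity is applied to \<open>f\<close> and its conjugate. The kernel
  has total mass one, so the trilinear bound gives the squared norm of \<open>f\<close>, and Fatou's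
  lemma removes the regularisation. An inequality is enough to extend the transform to all square
  integrable functions; equality of the norms is a consequence of inversion.\<close>

lemma fourier_integral_L2_bound:
 fixes f :: "'a::euclidean_space => complex"
 assumes f: "integrable lborel f" and f2: "sqint f"
 shows "sqint (fourier_integral f)" "nrm (fourier_integral f) \<le> nrm f"
proof -
 have [measurable]: "f \<in> borel_measurable borel" using assms by auto
 \<comment> \<open>The square root is taken so that the squared modulus carries exactly one Gaussian
   factor.\<close>
 define h where "h n xi = fourier_integral f xi * of_real (sqrt (gdil n xi))" for n xi
 have [measurable]: "h n \<in> borel_measurable borel" for n unfolding h_def by measurable
 have sq: "(cmod (h n xi))\<^sup>2 = (cmod (fourier_integral f xi))\<^sup>2 * gdil n xi" for n xi
  using gauss_pos[of "inverse (real (Suc n)) *\<^sub>R xi"]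
  by (simp add: h_def norm_mult power_mult_distrib del: of_nat_Suc)
 have hs: "sqint (h n)" for n
 proof -
  have "integrable lborel (\<lambda>xi. (cmod (h n xi))\<^sup>2)"
  proof (rule Bochner_Integration.integrable_bound)
   show "integrable lborel (\<lambda>xi::'a. (fconst TYPE('a) * (LINT x|lborel. cmod (f x)))\<^sup>2 * gdil n xi)"
    using gdil_integrable[of n, where 'a='a] by simp
   show "AE xi in lborel. norm ((cmod (h n xi))\<^sup>2) \<le> norm ((fconst TYPE('a) * (LINT x|lborel. cmod (f x)))\<^sup>2 * gdil n xi)"
   proof (rule AE_I2)
    fix xi :: 'a
    have "(cmod (fourier_integral f xi))\<^sup>2 \<le> (fconst TYPE('a) * (LINT x|lborel. cmod (f x)))\<^sup>2"
     by (intro power_mono fourier_integral_bound[OF f]) auto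
    then show "norm ((cmod (h n xi))\<^sup>2) \<le> norm ((fconst TYPE('a) * (LINT x|lborel. cmod (f x)))\<^sup>2 * gdil n xi)"
     unfolding sq using gauss_pos[of "inverse (real (Suc n)) *\<^sub>R xi"]
     by (simp add: abs_mult mult_right_mono del: of_nat_Suc)
   qed
  qed measurable
  then show ?thesis by (simp add: sqint_def)
 qed
 have hb: "nrm (h n) \<le> nrm f" for n
 proof -
  have "complex_of_real ((nrm (h n))\<^sup>2) = (LINT xi|lborel. of_real ((cmod (h n xi))\<^sup>2))"
   by (simp only: nrm_power2 integral_complex_of_real)
  also have "\<dots> = (LINT xi|lborel. fourier_integral f xi * (fourier_integral (\<lambda>x. cnj (f x)) (- xi) * of_real (gdil n xi)))"
   by (intro Bochner_Integration.integral_cong refl)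
     (simp only: sq fourier_integral_cnj of_real_mult mult.assoc[symmetric] complex_norm_square)
  also have "\<dots> = (LINT x|lborel. f x * (LINT y|lborel. cnj (f y) * of_real (gkernel n (x - y))))"
   using f by (intro fourier_integral_regularized) auto
  finally have eq: "complex_of_real ((nrm (h n))\<^sup>2) = (LINT x|lborel. f x * (LINT y|lborel. cnj (f y) * of_real (gkernel n (x - y))))" .
  have "ennreal ((nrm (h n))\<^sup>2) = ennreal (cmod (complex_of_real ((nrm (h n))\<^sup>2)))"
   by (simp only: norm_of_real abs_power2)
  also have "\<dots> \<le> (\<integral>\<^sup>+x. norm (f x * (LINT y|lborel. cnj (f y) * of_real (gkernel n (x - y)))) \<partial>lborel)"
   unfolding eq by (rule integral_norm_le_nn_integral)
  also have "\<dots> \<le> (\<integral>\<^sup>+x. \<integral>\<^sup>+y. ennreal (cmod (f x) * gkernel n (x - y) * cmod (f y)) \<partial>lborel \<partial>lborel)"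
  proof (rule nn_integral_mono)
   fix x
   have "ennreal (norm (LINT y|lborel. cnj (f y) * of_real (gkernel n (x - y)))) \<le>
     (\<integral>\<^sup>+y. norm (cnj (f y) * of_real (gkernel n (x - y))) \<partial>lborel)"
    by (rule integral_norm_le_nn_integral)
   then have "ennreal (cmod (f x)) * ennreal (norm (LINT y|lborel. cnj (f y) * of_real (gkernel n (x - y)))) \<le>
     ennreal (cmod (f x)) * (\<integral>\<^sup>+y. norm (cnj (f y) * of_real (gkernel n (x - y))) \<partial>lborel)"
    by (rule mult_left_mono) simp
   also have "\<dots> = (\<integral>\<^sup>+y. ennreal (cmod (f x)) * norm (cnj (f y) * of_real (gkernel n (x - y))) \<partial>lborel)"
    by (rule nn_integral_cmult[symmetric]) measurable
   also have "\<dots> = (\<integral>\<^sup>+y. ennreal (cmod (f x) * gkernel n (x - y) * cmod (f y)) \<partial>lborel)"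
    by (intro nn_integral_cong) (simp add: norm_mult ennreal_mult'[symmetric] gkernel_nonneg mult_ac)
   finally show "ennreal (norm (f x * (LINT y|lborel. cnj (f y) * of_real (gkernel n (x - y)))))
     \<le> (\<integral>\<^sup>+y. ennreal (cmod (f x) * gkernel n (x - y) * cmod (f y)) \<partial>lborel)"
    by (simp add: norm_mult ennreal_mult)
  qed
  also have "\<dots> \<le> ennreal (sqrt (LINT x|lborel. (cmod (f x))\<^sup>2) * (LINT x|lborel. gkernel n (x::'a)) * sqrt (LINT x|lborel. (cmod (f x))\<^sup>2))"
   using f2 by (intro trilinear_L1_mid gkernel_integral gkernel_nonneg) (auto simp: sqint_def)
  also have "\<dots> = ennreal ((nrm f)\<^sup>2)"
   by (simp add: gkernel_integral nrm_def power2_eq_square[symmetric])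
  finally have "(nrm (h n))\<^sup>2 \<le> (nrm f)\<^sup>2" by simp
  then show ?thesis by (rule power2_le_imp_le) simp
 qed
 have lim: "AE xi in lborel. (\<lambda>n. h n xi) \<longlonglongrightarrow> fourier_integral f xi"
 proof (rule AE_I2)
  fix xi :: 'a
  have "(\<lambda>n. h n xi) \<longlonglongrightarrow> fourier_integral f xi * of_real (sqrt 1)"
   unfolding h_def by (intro tendsto_intros gdil_tendsto)
  then show "(\<lambda>n. h n xi) \<longlonglongrightarrow> fourier_integral f xi" by simp
 qed
 have m: "fourier_integral f \<in> borel_measurable borel" by measurable
 show "sqint (fourier_integral f)" "nrm (fourier_integral f) \<le> nrm f"
  using nrm_Fatou[OF hs m lim hb] by auto
qed

text \<open>Limit of the regularised identity. Continuity of \<open>phi\<close> gives pointwise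
  convergence of its Gaussian means, and boundedness of \<open>phi\<close> gives the
  majorant.\<close>

lemma fourier_integral_pairing:
 fixes f phi :: "'a::euclidean_space => complex"
 assumes f: "integrable lborel f" "sqint f" and phi: "integrable lborel phi" "sqint phi"
  and c: "continuous_on UNIV phi" and B: "\<And>x. cmod (phi x) \<le> B"
 shows "(LINT xi|lborel. fourier_integral f xi * fourier_integral phi (- xi)) = (LINT x|lborel. f x * phi x)"
proof -
 have [measurable]: "f \<in> borel_measurable borel" "phi \<in> borel_measurable borel" using assms by auto
 have 1: "(\<lambda>n. LINT xi|lborel. fourier_integral f xi * (fourier_integral phi (- xi) * of_real (gdil n xi)))
   \<longlonglongrightarrow> (LINT xi|lborel. fourier_integral f xi * (fourier_integral phi (- xi) * of_real 1))"
 proof (rule integral_dominated_convergence)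
  show "integrable lborel (\<lambda>xi. cmod (fourier_integral f xi * fourier_integral phi (0 - xi)))"
   by (intro integrable_sqint_mult(2) sqint_reflect fourier_integral_L2_bound f phi)
  show "AE xi in lborel. (\<lambda>n. fourier_integral f xi * (fourier_integral phi (- xi) * of_real (gdil n xi)))
    \<longlonglongrightarrow> fourier_integral f xi * (fourier_integral phi (- xi) * of_real 1)"
   by (intro AE_I2 tendsto_intros gdil_tendsto)
  show "AE xi in lborel. norm (fourier_integral f xi * (fourier_integral phi (- xi) * of_real (gdil n xi)))
    \<le> cmod (fourier_integral f xi * fourier_integral phi (0 - xi))" for n
   by (intro AE_I2) (auto simp: norm_mult mult.assoc[symmetric] abs_of_pos[OF gauss_pos] gauss_le_1 simp del: of_nat_Suc intro!: mult_left_le)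
 qed measurable
 have 2: "(\<lambda>n. LINT x|lborel. f x * (LINT y|lborel. phi y * of_real (gkernel n (x - y)))) \<longlonglongrightarrow> (LINT x|lborel. f x * phi x)"
 proof (rule integral_dominated_convergence)
  show "integrable lborel (\<lambda>x. B * cmod (f x))" using f by simp
  show "AE x in lborel. (\<lambda>n. f x * (LINT y|lborel. phi y * of_real (gkernel n (x - y)))) \<longlonglongrightarrow> f x * phi x"
   by (intro AE_I2 tendsto_intros gkernel_convolution_tendsto[OF c B])
  show "AE x in lborel. norm (f x * (LINT y|lborel. phi y * of_real (gkernel n (x - y)))) \<le> B * cmod (f x)" for n
   unfolding norm_mult using gkernel_convolution_tendsto(2)[OF c B, of n]
   by (intro AE_I2) (subst mult.commute, rule mult_right_mono, auto)
 qed measurable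
 show ?thesis
  using LIMSEQ_unique[OF 1 2[unfolded fourier_integral_regularized[OF f(1) phi(1), symmetric]]] by simp
qed

section \<open>The Fourier transform on square integrable functions\<close>

abbreviation trunc :: "real => ('a::euclidean_space => complex) => 'a => complex" where
 "trunc R f \<equiv> (\<lambda>x. indicator (ball 0 R) x * f x)"

lemma sqint_trunc: "sqint f \<Longrightarrow> sqint (trunc R f)"
 by (rule sqint_indicator) auto

text \<open>The indicator of a bounded set is itself square integrable, so this is a product of two
  square integrable functions.\<close>

lemma integrable_sqint_bounded_set:
 assumes "sqint f" "A \<in> sets borel" "bounded A"
 shows "integrable lborel (\<lambda>x. indicator A x * f x)"
proof -
 have "sqint (\<lambda>x. indicator A x :: complex)"
 proof -
  have "integrable lborel (indicat_real A)"
   using assms(2,3) emeasure_bounded_finite[OF assms(3)] by (simp add: integrable_indicator_iff)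
  moreover have "(cmod (indicator A x))\<^sup>2 = indicat_real A x" for x by (simp add: indicator_def)
  ultimately show ?thesis using assms(2) by (simp add: sqint_def)
 qed
 from integrable_sqint_mult(1)[OF this assms(1)] show ?thesis .
qed

lemma integrable_trunc: "sqint f \<Longrightarrow> integrable lborel (trunc R f)"
 by (rule integrable_sqint_bounded_set) auto

lemma trunc_tendsto:
 fixes f :: "'a::euclidean_space => complex"
 assumes "sqint f" shows "(\<lambda>n. nrm (\<lambda>x. trunc (real n) f x - f x)) \<longlonglongrightarrow> 0"
proof (rule nrm_dominated)
 show "AE x in lborel. (\<lambda>n. trunc (real n) f x) \<longlonglongrightarrow> f x"
 proof (rule AE_I2)
  fix x :: 'a
  obtain N where "norm x < real N" using reals_Archimedean2 by blast
  then have "\<forall>\<^sub>F n in sequentially. trunc (real n) f x = f x"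
   by (intro eventually_sequentiallyI[of N]) auto
  then show "(\<lambda>n. trunc (real n) f x) \<longlonglongrightarrow> f x"
   by (rule tendsto_eventually)
 qed
qed (use assms sqint_trunc[OF assms] in \<open>auto simp: norm_mult indicator_def intro: sqint_measurable\<close>)

lemma nrm_trunc_diff_mono:
 assumes "sqint f" "r \<le> R" shows "nrm (\<lambda>x. trunc R f x - f x) \<le> nrm (\<lambda>x. trunc r f x - f x)"
proof -
 have "nrm (\<lambda>x. trunc R f x - f x) \<le> 1 * nrm (\<lambda>x. trunc r f x - f x)"
  by (rule nrm_bound[OF sqint_diff[OF sqint_trunc[OF assms(1)] assms(1)]])
    (use assms in \<open>auto simp: indicator_def intro: sqint_measurable\<close>)
 then show ?thesis by simp
qed

section \<open>From Lebesgue measurable functions to Borel representatives\<close>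

lemma L2_norm_borel:
 "f \<in> borel_measurable borel \<Longrightarrow> L2_norm f = nrm f"
 unfolding L2_norm_def nrm_def by (subst integral_completion) auto

lemma L2_borel: "f \<in> borel_measurable borel \<Longrightarrow> L2 f \<longleftrightarrow> sqint f"
 unfolding L2_def sqint_def by (simp add: integrable_completion measurable_completion)

lemma Borel_representative:
 fixes f :: "'a::euclidean_space => complex"
 assumes "f \<in> borel_measurable lebesgue"
 obtains f' where "f' \<in> borel_measurable borel" "AE x in lborel. f x = f' x"
proof -
 obtain r where r: "r \<in> borel_measurable borel" "AE x in lborel. Re (f x) = r x"
  using Borel_representative_real[of "\<lambda>x. Re (f x)"] assms by auto
 obtain i where i: "i \<in> borel_measurable borel" "AE x in lborel. Im (f x) = i x"
  using Borel_representative_real[of "\<lambda>x. Im (f x)"] assms by auto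
 show thesis
 proof (rule that)
  show "(\<lambda>x. Complex (r x) (i x)) \<in> borel_measurable borel"
   using r(1) i(1) by (simp add: Complex_eq)
  show "AE x in lborel. f x = Complex (r x) (i x)"
   using r(2) i(2) by eventually_elim (simp add: complex_eq_iff)
 qed
qed

lemma L2_cong_AE:
 assumes "f \<in> borel_measurable lebesgue" "g \<in> borel_measurable lebesgue" "AE x in lborel. f x = g x"
 shows "L2 f \<longleftrightarrow> L2 g" "L2_norm f = L2_norm g"
proof -
 have ae: "AE x in lebesgue. (cmod (f x))\<^sup>2 = (cmod (g x))\<^sup>2"
  using assms(3) by (auto simp: AE_completion_iff elim: eventually_mono)
 have m: "(\<lambda>x. (cmod (f x))\<^sup>2) \<in> borel_measurable lebesgue" "(\<lambda>x. (cmod (g x))\<^sup>2) \<in> borel_measurable lebesgue"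
  using assms by auto
 show "L2 f \<longleftrightarrow> L2 g" unfolding L2_def using assms integrable_cong_AE[OF m ae] by auto
 show "L2_norm f = L2_norm g" unfolding L2_norm_def using integral_cong_AE[OF m ae] by simp
qed

text \<open>The bridge between \<open>L2\<close>, which uses Lebesgue measurability, and
  \<open>sqint\<close>, which asks for Borel measurability. The latter is the working notion because
  it is stable under translation and reflection and fits Fubini on products of
  \<open>lborel\<close>.\<close>

lemma L2_representative:
 assumes "L2 f"
 obtains f' where "sqint f'" "AE x in lborel. f x = f' x" "nrm f' = L2_norm f"
proof -
 have m: "f \<in> borel_measurable lebesgue" using assms by (simp add: L2_def)
 obtain f' where f': "f' \<in> borel_measurable borel" "AE x in lborel. f x = f' x"
  using Borel_representative[OF m] .
 have m': "f' \<in> borel_measurable lebesgue" using f'(1) by (simp add: measurable_completion)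
 show thesis
  using that[of f'] f' assms L2_cong_AE[OF m m' f'(2)] L2_borel[OF f'(1)] L2_norm_borel[OF f'(1)] by simp
qed

lemma fourier_integral_cong_AE:
 fixes f g :: "'a::euclidean_space => complex"
 assumes "f \<in> borel_measurable lebesgue" "g \<in> borel_measurable lebesgue" "AE x in lborel. f x = g x"
 shows "fourier_integral f = fourier_integral g"
proof
 fix xi :: 'a
 have "(\<lambda>x. cis (- (x \<bullet> xi))) \<in> borel_measurable lebesgue"
  by (rule measurable_completion) measurable
 then have "(LINT x|lebesgue. cis (- (x \<bullet> xi)) * f x) = (LINT x|lebesgue. cis (- (x \<bullet> xi)) * g x)"
  using assms by (intro integral_cong_AE) (auto simp: AE_completion_iff elim: eventually_mono)
 then show "fourier_integral f xi = fourier_integral g xi" by (simp add: fourier_integral_def)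
qed

text \<open>The conclusion is equality of functions, not only up to null sets:
  \<open>fourier\<close> is chosen by a property that mentions \<open>f\<close> through Fourier
  integrals alone, and these do not see null sets.\<close>

lemma fourier_cong_AE:
 fixes f g :: "'a::euclidean_space => complex"
 assumes "f \<in> borel_measurable lebesgue" "g \<in> borel_measurable lebesgue" "AE x in lborel. f x = g x"
 shows "fourier f = fourier g"
proof -
 have m: "(\<lambda>x::'a. indicator (ball 0 R) x :: complex) \<in> borel_measurable lebesgue" for R
  by (rule measurable_completion) measurable
 have "fourier_integral (trunc R f) = fourier_integral (trunc R g)" for R
  using assms m[of R] by (intro fourier_integral_cong_AE) (auto elim: eventually_mono)
 then show ?thesis unfolding fourier_def by simp
qed

text \<open>Truncations are integrable, and by the bound in L^2 the differences of their transforms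
  are controlled by the tails of \<open>f\<close>. Completeness supplies the limit along integer
  radii.\<close>

lemma fourier_exists:
 assumes f: "sqint f"
 shows "\<exists>g. sqint g \<and> ((\<lambda>R. nrm (\<lambda>xi. g xi - fourier_integral (trunc R f) xi)) \<longlongrightarrow> 0) at_top"
proof -
 have s: "sqint (fourier_integral (trunc R f))" for R
  by (intro fourier_integral_L2_bound sqint_trunc integrable_trunc f)
 define e where "e R = nrm (\<lambda>x. trunc R f x - f x)" for R
 have bd: "nrm (\<lambda>xi. fourier_integral (trunc R f) xi - fourier_integral (trunc S f) xi) \<le> e R + e S" for R S
 proof -
  have "nrm (\<lambda>xi. fourier_integral (trunc R f) xi - fourier_integral (trunc S f) xi)
    = nrm (fourier_integral (\<lambda>x. trunc R f x - trunc S f x))"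
   by (simp only: fourier_integral_diff_fun[OF integrable_trunc[OF f] integrable_trunc[OF f]])
  also have "\<dots> \<le> nrm (\<lambda>x. trunc R f x - trunc S f x)"
   by (intro fourier_integral_L2_bound sqint_diff sqint_trunc f Bochner_Integration.integrable_diff integrable_trunc)
  also have "\<dots> \<le> nrm (\<lambda>x. trunc R f x - f x) + nrm (\<lambda>x. f x - trunc S f x)"
   by (intro nrm_triangle3 sqint_trunc f)
  finally show ?thesis by (simp only: e_def nrm_commute[of f])
 qed
 have elim: "(\<lambda>n. e (real n)) \<longlonglongrightarrow> 0" unfolding e_def by (rule trunc_tendsto[OF f])
 have emono: "r \<le> R \<Longrightarrow> e R \<le> e r" for r R unfolding e_def by (rule nrm_trunc_diff_mono[OF f])
 have "\<exists>g. sqint g \<and> (\<lambda>n. nrm (\<lambda>xi. fourier_integral (trunc (real n) f) xi - g xi)) \<longlonglongrightarrow> 0"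
 proof (rule sqint_complete[OF s])
  fix \<epsilon> :: real assume "\<epsilon> > 0"
  then obtain N where N: "\<And>n. n \<ge> N \<Longrightarrow> e (real n) < \<epsilon> / 2"
   using LIMSEQ_D[OF elim, of "\<epsilon> / 2"] by fastforce
  show "\<exists>N. \<forall>m\<ge>N. \<forall>n\<ge>N. nrm (\<lambda>xi. fourier_integral (trunc (real m) f) xi - fourier_integral (trunc (real n) f) xi) < \<epsilon>"
  proof (intro exI[of _ N] allI impI)
   fix m n assume "N \<le> m" "N \<le> n"
   then show "nrm (\<lambda>xi. fourier_integral (trunc (real m) f) xi - fourier_integral (trunc (real n) f) xi) < \<epsilon>"
    using N[of m] N[of n] bd[of "real m" "real n"] by linarith
  qed
 qed
 then obtain g where g: "sqint g" and glim: "(\<lambda>n. nrm (\<lambda>xi. fourier_integral (trunc (real n) f) xi - g xi)) \<longlonglongrightarrow> 0"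
  by blast
 \<comment> \<open>The tail error decreases in the radius, so convergence along integers extends to
   real radii.\<close>
 have "((\<lambda>R. nrm (\<lambda>xi. g xi - fourier_integral (trunc R f) xi)) \<longlongrightarrow> 0) at_top"
 proof (rule tendstoI)
  fix \<epsilon> :: real assume \<epsilon>: "\<epsilon> > 0"
  have "\<forall>\<^sub>F n in sequentially. e (real n) < \<epsilon> / 4 \<and> nrm (\<lambda>xi. fourier_integral (trunc (real n) f) xi - g xi) < \<epsilon> / 2"
   using order_tendstoD(2)[OF elim, of "\<epsilon> / 4"] order_tendstoD(2)[OF glim, of "\<epsilon> / 2"] \<epsilon>
   by (auto intro: eventually_conj)
  then obtain n where n: "e (real n) < \<epsilon> / 4" "nrm (\<lambda>xi. fourier_integral (trunc (real n) f) xi - g xi) < \<epsilon> / 2"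
   by (auto simp: eventually_sequentially)
  show "\<forall>\<^sub>F R in at_top. dist (nrm (\<lambda>xi. g xi - fourier_integral (trunc R f) xi)) 0 < \<epsilon>"
   using eventually_ge_at_top[of "real n"]
  proof eventually_elim
   case (elim R)
   have "nrm (\<lambda>xi. g xi - fourier_integral (trunc R f) xi) \<le>
     nrm (\<lambda>xi. g xi - fourier_integral (trunc (real n) f) xi) + nrm (\<lambda>xi. fourier_integral (trunc (real n) f) xi - fourier_integral (trunc R f) xi)"
    by (rule nrm_triangle3[OF g s s])
   then show ?case
    using n bd[of "real n" R] emono[OF elim] by (simp add: nrm_commute[of g])
  qed
 qed
 with g show ?thesis by blast
qed

text \<open>A Borel representative of \<open>fourier\<close>. Being chosen from
  \<open>fourier f\<close> alone, it takes the same value on functions that agree almost everywhere,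
  so that later changes of representative are plain equalities.\<close>

definition hat :: "('a::euclidean_space => complex) => 'a => complex" where
 "hat f = (SOME g. g \<in> borel_measurable borel \<and> (AE x in lborel. g x = fourier f x))"

lemma hat_cong_AE:
 assumes "f \<in> borel_measurable lebesgue" "g \<in> borel_measurable lebesgue" "AE x in lborel. f x = g x"
 shows "hat f = hat g"
 unfolding hat_def fourier_cong_AE[OF assms] ..

lemma fourier_sqint:
 assumes f: "sqint f"
 shows "L2 (fourier f)" "((\<lambda>R. L2_norm (\<lambda>xi. fourier f xi - fourier_integral (trunc R f) xi)) \<longlongrightarrow> 0) at_top"
proof -
 note [measurable] = sqint_measurable[OF f]
 obtain g where g: "sqint g" "((\<lambda>R. nrm (\<lambda>xi. g xi - fourier_integral (trunc R f) xi)) \<longlongrightarrow> 0) at_top"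
  using fourier_exists[OF f] by blast
 note [measurable] = sqint_measurable[OF g(1)]
 have "L2 g \<and> ((\<lambda>R. L2_norm (\<lambda>xi. g xi - fourier_integral (trunc R f) xi)) \<longlongrightarrow> 0) at_top"
 proof -
  have "(\<lambda>xi. g xi - fourier_integral (trunc R f) xi) \<in> borel_measurable borel" for R by measurable
  then show ?thesis using g L2_borel[of g] by (simp add: L2_norm_borel)
 qed
 from someI[where P="\<lambda>g. L2 g \<and> ((\<lambda>R. L2_norm (\<lambda>xi. g xi - fourier_integral (trunc R f) xi)) \<longlongrightarrow> 0) at_top", OF this]
 show "L2 (fourier f)" "((\<lambda>R. L2_norm (\<lambda>xi. fourier f xi - fourier_integral (trunc R f) xi)) \<longlongrightarrow> 0) at_top"
  unfolding fourier_def by auto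
qed

lemma hat_fourier:
 assumes f: "sqint f"
 shows "sqint (hat f)" "AE x in lborel. hat f x = fourier f x"
proof -
 obtain g where g: "sqint g" "AE x in lborel. fourier f x = g x"
  using L2_representative[OF fourier_sqint(1)[OF f]] by metis
 then have "g \<in> borel_measurable borel \<and> (AE x in lborel. g x = fourier f x)"
  by (auto elim: eventually_mono intro: sqint_measurable)
 from someI[where P="\<lambda>g. g \<in> borel_measurable borel \<and> (AE x in lborel. g x = fourier f x)", OF this]
 have h: "hat f \<in> borel_measurable borel" "AE x in lborel. hat f x = fourier f x"
  unfolding hat_def by auto
 then show "AE x in lborel. hat f x = fourier f x" by simp
 have "AE x in lborel. hat f x = g x"
  using h(2) g(2) by eventually_elim simp
 then show "sqint (hat f)" by (rule sqint_cong_AE[OF g(1) h(1)])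
qed

lemma hat_limit:
 assumes f: "sqint f"
 shows "(\<lambda>n. nrm (\<lambda>xi. hat f xi - fourier_integral (trunc (real n) f) xi)) \<longlonglongrightarrow> 0"
proof -
 note [measurable] = sqint_measurable[OF f] sqint_measurable[OF hat_fourier(1)[OF f]]
 have mf: "fourier f \<in> borel_measurable lebesgue" using fourier_sqint(1)[OF f] by (simp add: L2_def)
 have "(\<lambda>n. L2_norm (\<lambda>xi. fourier f xi - fourier_integral (trunc (real n) f) xi)) \<longlonglongrightarrow> 0"
  using filterlim_compose[OF fourier_sqint(2)[OF f] filterlim_real_sequentially] .
 moreover have "L2_norm (\<lambda>xi. fourier f xi - fourier_integral (trunc (real n) f) xi) =
   nrm (\<lambda>xi. hat f xi - fourier_integral (trunc (real n) f) xi)" for n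
 proof -
  have b: "(\<lambda>xi. hat f xi - fourier_integral (trunc (real n) f) xi) \<in> borel_measurable borel" by measurable
  have F: "fourier_integral (trunc (real n) f) \<in> borel_measurable lebesgue"
  proof -
   have "fourier_integral (trunc (real n) f) \<in> borel_measurable borel" by measurable
   then show ?thesis by (simp add: measurable_completion)
  qed
  have "L2_norm (\<lambda>xi. fourier f xi - fourier_integral (trunc (real n) f) xi) = L2_norm (\<lambda>xi. hat f xi - fourier_integral (trunc (real n) f) xi)"
  proof (rule L2_cong_AE(2))
   show "(\<lambda>xi. fourier f xi - fourier_integral (trunc (real n) f) xi) \<in> borel_measurable lebesgue"
    using mf F by (rule borel_measurable_diff)
   show "(\<lambda>xi. hat f xi - fourier_integral (trunc (real n) f) xi) \<in> borel_measurable lebesgue"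
    using b by (simp add: measurable_completion)
  qed (use hat_fourier(2)[OF f] in \<open>auto elim: eventually_mono\<close>)
  then show ?thesis using L2_norm_borel[OF b] by simp
 qed
 ultimately show ?thesis by simp
qed

text \<open>Converse of \<open>hat_limit\<close>. Linearity, conjugation and the comparison with the
  Fourier integral are all obtained by exhibiting a limit of the truncated transforms.\<close>

lemma hat_unique:
 assumes f: "sqint f" and g: "sqint g"
  and lim: "(\<lambda>n. nrm (\<lambda>xi. g xi - fourier_integral (trunc (real n) f) xi)) \<longlonglongrightarrow> 0"
 shows "AE xi in lborel. hat f xi = g xi"
proof -
 have s: "sqint (fourier_integral (trunc R f))" for R
  by (intro fourier_integral_L2_bound sqint_trunc integrable_trunc f)
 have "nrm (\<lambda>xi. hat f xi - g xi) \<le> 0"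
 proof (rule LIMSEQ_le_const[OF tendsto_add_zero[OF hat_limit[OF f] lim]], intro exI allI impI)
  fix n
  show "nrm (\<lambda>xi. hat f xi - g xi) \<le> nrm (\<lambda>xi. hat f xi - fourier_integral (trunc (real n) f) xi) + nrm (\<lambda>xi. g xi - fourier_integral (trunc (real n) f) xi)"
   using nrm_triangle3[OF hat_fourier(1)[OF f] s g, of "real n"] by (simp add: nrm_commute[of g])
 qed
 then have "nrm (\<lambda>xi. hat f xi - g xi) = 0" using nrm_nonneg order_antisym by blast
 then show ?thesis
  using nrm_eq_0_iff[OF sqint_diff[OF hat_fourier(1)[OF f] g]] by simp
qed

lemma hat_add:
 assumes f: "sqint f" and g: "sqint g"
 shows "AE xi in lborel. hat (\<lambda>x. f x + g x) xi = hat f xi + hat g xi"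
proof (rule hat_unique[OF sqint_add[OF f g] sqint_add[OF hat_fourier(1)[OF f] hat_fourier(1)[OF g]]])
 have s: "sqint (fourier_integral (trunc R f))" "sqint (fourier_integral (trunc R g))" for R
  by (intro fourier_integral_L2_bound sqint_trunc integrable_trunc f g)+
 have eq: "hat f xi + hat g xi - fourier_integral (trunc R (\<lambda>x. f x + g x)) xi =
  (hat f xi - fourier_integral (trunc R f) xi) + (hat g xi - fourier_integral (trunc R g) xi)" for R xi
  by (simp add: distrib_left fourier_integral_add integrable_trunc f g)
 show "(\<lambda>n. nrm (\<lambda>xi. hat f xi + hat g xi - fourier_integral (trunc (real n) (\<lambda>x. f x + g x)) xi)) \<longlonglongrightarrow> 0"
  unfolding eq
 proof (rule tendsto_sandwich[OF _ _ tendsto_const tendsto_add_zero[OF hat_limit[OF f] hat_limit[OF g]]])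
  show "\<forall>\<^sub>F n in sequentially. nrm (\<lambda>xi. (hat f xi - fourier_integral (trunc (real n) f) xi) + (hat g xi - fourier_integral (trunc (real n) g) xi))
    \<le> nrm (\<lambda>xi. hat f xi - fourier_integral (trunc (real n) f) xi) + nrm (\<lambda>xi. hat g xi - fourier_integral (trunc (real n) g) xi)"
   by (intro always_eventually allI nrm_triangle sqint_diff hat_fourier(1) s f g)
 qed auto
qed

lemma hat_cmult:
 assumes f: "sqint f"
 shows "AE xi in lborel. hat (\<lambda>x. c * f x) xi = c * hat f xi"
proof (rule hat_unique[OF sqint_cmult[OF f] sqint_cmult[OF hat_fourier(1)[OF f]]])
 have eq: "c * hat f xi - fourier_integral (trunc R (\<lambda>x. c * f x)) xi =
  c * (hat f xi - fourier_integral (trunc R f) xi)" for R xi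
  by (simp add: mult.left_commute[of _ c] fourier_integral_cmult right_diff_distrib)
 show "(\<lambda>n. nrm (\<lambda>xi. c * hat f xi - fourier_integral (trunc (real n) (\<lambda>x. c * f x)) xi)) \<longlonglongrightarrow> 0"
  unfolding eq nrm_cmult by (rule tendsto_mult_right_zero[OF hat_limit[OF f]])
qed

lemma hat_diff:
 assumes f: "sqint f" and g: "sqint g"
 shows "AE xi in lborel. hat (\<lambda>x. f x - g x) xi = hat f xi - hat g xi"
 using hat_add[OF f sqint_minus[OF g]] hat_cmult[OF g, of "-1"]
 by (simp, eventually_elim, simp)

lemma hat_cnj:
 assumes f: "sqint f"
 shows "AE xi in lborel. hat (\<lambda>x. cnj (f x)) xi = cnj (hat f (- xi))"
proof (rule hat_unique[OF sqint_cnj[OF f]])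
 show "sqint (\<lambda>xi. cnj (hat f (- xi)))"
  using sqint_cnj[OF sqint_reflect[OF hat_fourier(1)[OF f], of 0]] by simp
 note [measurable] = sqint_measurable[OF f] sqint_measurable[OF hat_fourier(1)[OF f]]
 have eq: "cnj (hat f (- xi)) - fourier_integral (trunc R (\<lambda>x. cnj (f x))) xi =
  cnj (hat f (- xi) - fourier_integral (trunc R f) (- xi))" for R xi
 proof -
  have *: "trunc R (\<lambda>x. cnj (f x)) = (\<lambda>x. cnj (trunc R f x))" by (auto simp: indicator_def)
  show ?thesis using fourier_integral_cnj[of "trunc R f" "- xi"] unfolding * by simp
 qed
 have "nrm (\<lambda>xi. cnj (hat f (- xi)) - fourier_integral (trunc R (\<lambda>x. cnj (f x))) xi) = nrm (\<lambda>xi. hat f xi - fourier_integral (trunc R f) xi)" for R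
 proof -
  have "(\<lambda>xi. hat f xi - fourier_integral (trunc R f) xi) \<in> borel_measurable borel" by measurable
  from nrm_reflect[OF this, of 0] show ?thesis unfolding eq nrm_cnj by simp
 qed
 then show "(\<lambda>n. nrm (\<lambda>xi. cnj (hat f (- xi)) - fourier_integral (trunc (real n) (\<lambda>x. cnj (f x))) xi)) \<longlonglongrightarrow> 0"
  using hat_limit[OF f] by simp
qed

lemma hat_nrm_le: assumes f: "sqint f" shows "nrm (hat f) \<le> nrm f"
proof (rule LIMSEQ_le_const[OF tendsto_add[OF hat_limit[OF f] tendsto_const[of "nrm f"], simplified]], intro exI allI impI)
 fix n
 have s: "sqint (fourier_integral (trunc R f))" for R
  by (intro fourier_integral_L2_bound sqint_trunc integrable_trunc f)
 have "nrm (hat f) \<le> nrm (\<lambda>xi. hat f xi - fourier_integral (trunc (real n) f) xi) + nrm (fourier_integral (trunc (real n) f))"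
  using nrm_triangle3[OF hat_fourier(1)[OF f] s sqint_zero] by simp
 moreover have "nrm (fourier_integral (trunc (real n) f)) \<le> nrm (trunc (real n) f)"
  by (intro fourier_integral_L2_bound sqint_trunc integrable_trunc f)
 moreover have "nrm (trunc (real n) f) \<le> 1 * nrm f"
  using f by (intro nrm_bound[OF f]) (auto simp: norm_mult indicator_def sqint_def)
 ultimately show "nrm (hat f) \<le> nrm (\<lambda>xi. hat f xi - fourier_integral (trunc (real n) f) xi) + nrm f"
  by simp
qed

lemma hat_eq_fourier_integral:
 assumes f: "sqint f" "integrable lborel f"
 shows "AE xi in lborel. hat f xi = fourier_integral f xi"
proof (rule hat_unique[OF f(1) fourier_integral_L2_bound(1)[OF f(2,1)]])
 have "nrm (\<lambda>xi. fourier_integral f xi - fourier_integral (trunc R f) xi) \<le> nrm (\<lambda>x. trunc R f x - f x)" for R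
 proof -
  have "nrm (\<lambda>xi. fourier_integral f xi - fourier_integral (trunc R f) xi) = nrm (fourier_integral (\<lambda>x. f x - trunc R f x))"
   by (simp only: fourier_integral_diff_fun[OF f(2) integrable_trunc[OF f(1)]])
  also have "\<dots> \<le> nrm (\<lambda>x. f x - trunc R f x)"
   by (intro fourier_integral_L2_bound sqint_diff sqint_trunc f Bochner_Integration.integrable_diff integrable_trunc)
  finally show ?thesis by (simp only: nrm_commute)
 qed
 then show "(\<lambda>n. nrm (\<lambda>xi. fourier_integral f xi - fourier_integral (trunc (real n) f) xi)) \<longlonglongrightarrow> 0"
  by (intro tendsto_sandwich[OF _ _ tendsto_const trunc_tendsto[OF f(1)]]) (auto intro: always_eventually)
qed

lemma pairing_tendsto:
 assumes "\<And>n. sqint (f n)" "sqint g" "sqint h" "(\<lambda>n. nrm (\<lambda>x. f n x - g x)) \<longlonglongrightarrow> 0"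
 shows "(\<lambda>n. LINT x|lborel. f n x * h x) \<longlonglongrightarrow> (LINT x|lborel. g x * h x)"
proof -
 have "(\<lambda>n. LINT x|lborel. (f n x - g x) * h x) \<longlonglongrightarrow> 0"
 proof (rule Lim_null_comparison)
  show "\<forall>\<^sub>F n in sequentially. norm (LINT x|lborel. (f n x - g x) * h x) \<le> nrm (\<lambda>x. f n x - g x) * nrm h"
   by (intro always_eventually allI Cauchy_Schwarz_sqint sqint_diff assms)
  show "(\<lambda>n. nrm (\<lambda>x. f n x - g x) * nrm h) \<longlonglongrightarrow> 0"
   using tendsto_mult_left_zero[OF assms(4)] .
 qed
 moreover have "(LINT x|lborel. (f n x - g x) * h x) = (LINT x|lborel. f n x * h x) - (LINT x|lborel. g x * h x)" for n
  using integrable_sqint_mult(1)[OF assms(1) assms(3), of n] integrable_sqint_mult(1)[OF assms(2,3)]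
  by (simp add: left_diff_distrib)
 ultimately show ?thesis by (simp add: LIM_zero_iff)
qed

text \<open>The formula holds for truncations. \<open>f\<close> is released first and
  \<open>g\<close> second, each time by continuity of the pairing in norm.\<close>

lemma hat_dual:
 assumes f: "sqint f" and g: "sqint g"
 shows "(LINT x|lborel. hat f x * g x) = (LINT x|lborel. f x * hat g x)"
proof -
 have s: "sqint (fourier_integral (trunc R f))" "sqint (fourier_integral (trunc R g))" for R
  by (intro fourier_integral_L2_bound sqint_trunc integrable_trunc f g)+
 have 1: "(LINT x|lborel. fourier_integral (trunc R f) x * trunc S g x) = (LINT x|lborel. trunc R f x * fourier_integral (trunc S g) x)" for R S
  by (intro fourier_integral_dual integrable_trunc f g)
 have lf: "(\<lambda>n. nrm (\<lambda>xi. fourier_integral (trunc (real n) f) xi - hat f xi)) \<longlonglongrightarrow> 0"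
  using hat_limit[OF f] by (simp add: nrm_commute[of "hat f"])
 have lg: "(\<lambda>n. nrm (\<lambda>xi. fourier_integral (trunc (real n) g) xi - hat g xi)) \<longlonglongrightarrow> 0"
  using hat_limit[OF g] by (simp add: nrm_commute[of "hat g"])
 have 2: "(LINT x|lborel. hat f x * trunc S g x) = (LINT x|lborel. f x * fourier_integral (trunc S g) x)" for S
 proof (rule LIMSEQ_unique)
  show "(\<lambda>n. LINT x|lborel. fourier_integral (trunc (real n) f) x * trunc S g x) \<longlonglongrightarrow> (LINT x|lborel. hat f x * trunc S g x)"
   by (intro pairing_tendsto s hat_fourier f sqint_trunc g lf)
  show "(\<lambda>n. LINT x|lborel. fourier_integral (trunc (real n) f) x * trunc S g x) \<longlonglongrightarrow> (LINT x|lborel. f x * fourier_integral (trunc S g) x)"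
   unfolding 1 by (intro pairing_tendsto s hat_fourier f sqint_trunc g trunc_tendsto)
 qed
 show ?thesis
 proof (rule LIMSEQ_unique)
  show "(\<lambda>n. LINT x|lborel. hat f x * trunc (real n) g x) \<longlonglongrightarrow> (LINT x|lborel. hat f x * g x)"
   unfolding mult.commute[of "hat f _"]
   by (intro pairing_tendsto s hat_fourier f sqint_trunc g trunc_tendsto)
  show "(\<lambda>n. LINT x|lborel. hat f x * trunc (real n) g x) \<longlonglongrightarrow> (LINT x|lborel. f x * hat g x)"
   unfolding 2 mult.commute[of "f _"]
   by (intro pairing_tendsto s hat_fourier f sqint_trunc g lg)
 qed
qed

lemma test_function_integrable:
 fixes phi :: "'a::euclidean_space => real"
 assumes "test_function D phi"
 shows "integrable lborel (\<lambda>x. complex_of_real (phi x))" "sqint (\<lambda>x. complex_of_real (phi x))"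
proof -
 have c: "continuous_on UNIV phi" by (rule test_function_continuous[OF assms])
 then have [measurable]: "phi \<in> borel_measurable borel" by (rule borel_measurable_continuous_onI)
 obtain R where R: "\<And>x. phi x \<noteq> 0 \<Longrightarrow> norm x < R" "\<And>x. norm (phi x) \<le> R" "R > 0"
  using test_function_bounded[OF assms] by blast
 have i: "integrable lborel (\<lambda>x. c * indicator (ball (0::'a) R) x)" for c :: real
  using emeasure_bounded_finite[of "ball (0::'a) R"] by (simp add: integrable_indicator_iff)
 show "integrable lborel (\<lambda>x. complex_of_real (phi x))"
 proof (rule Bochner_Integration.integrable_bound[OF i[of R]])
  show "AE x in lborel. norm (complex_of_real (phi x)) \<le> norm (R * indicator (ball 0 R) x)"
   using R by (intro AE_I2) (auto simp: indicator_def)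
 qed measurable
 have "integrable lborel (\<lambda>x. (cmod (complex_of_real (phi x)))\<^sup>2)"
 proof (rule Bochner_Integration.integrable_bound[OF i[of "R\<^sup>2"]])
  show "AE x in lborel. norm ((cmod (complex_of_real (phi x)))\<^sup>2) \<le> norm (R\<^sup>2 * indicator (ball 0 R) x)"
  proof (rule AE_I2)
   fix x
   have "(phi x)\<^sup>2 \<le> R\<^sup>2" using power_mono[OF R(2)[of x], of 2] by simp
   then show "norm ((cmod (complex_of_real (phi x)))\<^sup>2) \<le> norm (R\<^sup>2 * indicator (ball 0 R) x)"
    using R(1)[of x] by (auto simp: indicator_def)
  qed
 qed measurable
 then show "sqint (\<lambda>x. complex_of_real (phi x))" by (simp add: sqint_def)
qed

text \<open>Inversion in weak form. A test function is continuous and bounded, as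
  \<open>fourier_integral_pairing\<close> requires, and \<open>f\<close> is reached through its
  truncations.\<close>

lemma hat_pairing_test:
 fixes phi :: "'a::euclidean_space => real"
 assumes f: "sqint f" and phi: "test_function D phi"
 shows "(LINT xi|lborel. hat f (- xi) * hat (\<lambda>x. of_real (phi x)) xi) = (LINT x|lborel. f x * of_real (phi x))"
proof -
 let ?phi = "\<lambda>x. complex_of_real (phi x)"
 note p = test_function_integrable[OF phi]
 have s: "sqint (fourier_integral (trunc R f))" for R
  by (intro fourier_integral_L2_bound sqint_trunc integrable_trunc f)
 note [measurable] = sqint_measurable[OF f] sqint_measurable[OF hat_fourier(1)[OF f]]
  sqint_measurable[OF p(2)] sqint_measurable[OF hat_fourier(1)[OF p(2)]]
 have c: "continuous_on UNIV ?phi"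
  using test_function_continuous[OF phi] by (intro continuous_intros)
 obtain B where B: "\<And>x. cmod (?phi x) \<le> B"
  using test_function_bounded[OF phi] by auto
 have F: "sqint (\<lambda>xi. fourier_integral ?phi (- xi))"
  using sqint_reflect[OF fourier_integral_L2_bound(1)[OF p], of 0] by simp
 have 1: "(LINT xi|lborel. fourier_integral (trunc R f) xi * fourier_integral ?phi (- xi)) = (LINT x|lborel. trunc R f x * ?phi x)" for R
  by (intro fourier_integral_pairing[OF _ _ p c B] integrable_trunc sqint_trunc f)
 have lf: "(\<lambda>n. nrm (\<lambda>xi. fourier_integral (trunc (real n) f) xi - hat f xi)) \<longlonglongrightarrow> 0"
  using hat_limit[OF f] by (simp add: nrm_commute[of "hat f"])
 have 2: "(LINT xi|lborel. hat f xi * fourier_integral ?phi (- xi)) = (LINT x|lborel. f x * ?phi x)"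
 proof (rule LIMSEQ_unique)
  show "(\<lambda>n. LINT xi|lborel. fourier_integral (trunc (real n) f) xi * fourier_integral ?phi (- xi)) \<longlonglongrightarrow> (LINT xi|lborel. hat f xi * fourier_integral ?phi (- xi))"
   by (intro pairing_tendsto s hat_fourier f F lf)
  show "(\<lambda>n. LINT xi|lborel. fourier_integral (trunc (real n) f) xi * fourier_integral ?phi (- xi)) \<longlonglongrightarrow> (LINT x|lborel. f x * ?phi x)"
   unfolding 1 by (intro pairing_tendsto f p sqint_trunc trunc_tendsto)
 qed
 have "(LINT xi|lborel. hat f (- xi) * hat ?phi xi) = (LINT xi|lborel. hat f (- xi) * fourier_integral ?phi xi)"
  using hat_eq_fourier_integral[OF p(2,1)] by (intro integral_cong_AE) (auto elim: eventually_mono)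
 also have "\<dots> = (LINT xi|lborel. hat f xi * fourier_integral ?phi (- xi))"
  using integral_reflect'[of "\<lambda>xi. hat f xi * fourier_integral ?phi (- xi)" 0] by simp
 finally show ?thesis using 2 by simp
qed

lemma sqint_locally_integrable:
 assumes "sqint f" shows "locally_integrable (\<lambda>x. Re (f x))" "locally_integrable (\<lambda>x. Im (f x))"
proof -
 have "set_integrable lebesgue K (\<lambda>x. Re (f x)) \<and> set_integrable lebesgue K (\<lambda>x. Im (f x))" if "compact K" for K
 proof -
  have "integrable lborel (\<lambda>x. indicator K x * f x)"
   using that by (intro integrable_sqint_bounded_set[OF assms]) (auto simp: compact_imp_bounded compact_imp_closed)
  then have 1: "integrable lebesgue (\<lambda>x. indicator K x * f x)"
   by (subst integrable_completion) auto
  have "(\<lambda>x. indicator K x *\<^sub>R Re (f x)) = (\<lambda>x. Re (indicator K x * f x))"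
   "(\<lambda>x. indicator K x *\<^sub>R Im (f x)) = (\<lambda>x. Im (indicator K x * f x))"
   by (auto simp: indicator_def)
  then show ?thesis
   unfolding set_integrable_def using integrable_Re[OF 1] integrable_Im[OF 1] by simp
 qed
 then show "locally_integrable (\<lambda>x. Re (f x))" "locally_integrable (\<lambda>x. Im (f x))"
  by (auto simp: locally_integrable_def)
qed

text \<open>Both sides are paired with test functions: duality moves the outer transform to the test
  function, and \<open>hat_pairing_test\<close> evaluates the result. As test functions are real,
  real and imaginary parts of the difference are treated separately.\<close>

lemma hat_inversion:
 fixes f :: "'a::euclidean_space => complex"
 assumes f: "sqint f"
 shows "AE x in lborel. hat (\<lambda>xi. hat f (- xi)) x = f x"
proof -
 have r: "sqint (\<lambda>xi. hat f (- xi))" using sqint_reflect[OF hat_fourier(1)[OF f], of 0] by simp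
 define k where "k x = hat (\<lambda>xi. hat f (- xi)) x - f x" for x
 have k: "sqint k" unfolding k_def by (intro sqint_diff hat_fourier(1) r f)
 note [measurable] = sqint_measurable[OF k]
 have kz: "(LINT x|lborel. k x * of_real (phi x)) = 0" if phi: "test_function UNIV phi" for phi :: "'a => real"
 proof -
  note p = test_function_integrable[OF phi]
  have "(LINT x|lborel. hat (\<lambda>xi. hat f (- xi)) x * of_real (phi x)) = (LINT x|lborel. f x * of_real (phi x))"
   using hat_dual[OF r p(2)] hat_pairing_test[OF f phi] by simp
  then show ?thesis
   using integrable_sqint_mult(1)[OF f p(2)] integrable_sqint_mult(1)[OF hat_fourier(1)[OF r] p(2)]
   by (simp add: k_def left_diff_distrib)
 qed
 have re: "(LINT x|lebesgue. phi x * Re (k x)) = 0 \<and> (LINT x|lebesgue. phi x * Im (k x)) = 0"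
  if phi: "test_function UNIV phi" for phi :: "'a => real"
 proof -
  have [measurable]: "phi \<in> borel_measurable borel" by (rule test_function_measurable_lebesgue[OF phi])
  note i = integrable_sqint_mult(1)[OF k test_function_integrable(2)[OF phi]]
  have "(LINT x|lebesgue. phi x * Re (k x)) = (LINT x|lborel. Re (k x * of_real (phi x)))"
   by (subst integral_completion) (auto simp: mult.commute)
  moreover have "(LINT x|lebesgue. phi x * Im (k x)) = (LINT x|lborel. Im (k x * of_real (phi x)))"
   by (subst integral_completion) (auto simp: mult.commute)
  ultimately show ?thesis
   using integral_Re[OF i] integral_Im[OF i] kz[OF phi] by simp
 qed
 have "AE x in lebesgue. Re (k x) = 0" "AE x in lebesgue. Im (k x) = 0"
  using re sqint_locally_integrable[OF k] by (auto intro!: fundamental_lemma_variations)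
 then have "AE x in lborel. Re (k x) = 0" "AE x in lborel. Im (k x) = 0"
  by (simp_all add: AE_completion_iff)
 then show ?thesis
  by eventually_elim (simp add: k_def complex_eq_iff)
qed

text \<open>The transform is a contraction, and by inversion \<open>f\<close> is itself the
  transform of a reflected \<open>hat f\<close>; the reverse inequality is the same contraction
  bound.\<close>

lemma nrm_hat: assumes f: "sqint f" shows "nrm (hat f) = nrm f"
proof (rule order_antisym[OF hat_nrm_le[OF f]])
 have r: "sqint (\<lambda>xi. hat f (- xi))" using sqint_reflect[OF hat_fourier(1)[OF f], of 0] by simp
 have "nrm f = nrm (hat (\<lambda>xi. hat f (- xi)))"
  by (rule nrm_cong_AE) (use hat_inversion[OF f] f hat_fourier(1)[OF r] in \<open>auto elim: eventually_mono intro: sqint_measurable\<close>)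
 also have "\<dots> \<le> nrm (\<lambda>xi. hat f (- xi))" by (rule hat_nrm_le[OF r])
 also have "\<dots> = nrm (hat f)"
  using nrm_reflect[of "hat f" 0] sqint_measurable[OF hat_fourier(1)[OF f]] by simp
 finally show "nrm f \<le> nrm (hat f)" .
qed

lemma hat_parseval:
 assumes f: "sqint f" and g: "sqint g"
 shows "(LINT x|lborel. f x * cnj (g x)) = (LINT xi|lborel. hat f xi * cnj (hat g xi))"
proof -
 have r: "sqint (\<lambda>xi. hat f (- xi))" using sqint_reflect[OF hat_fourier(1)[OF f], of 0] by simp
 note s = hat_fourier(1)
 note [measurable] = sqint_measurable[OF f] sqint_measurable[OF g] sqint_measurable[OF s[OF f]]
  sqint_measurable[OF s[OF g]] sqint_measurable[OF s[OF r]] sqint_measurable[OF s[OF sqint_cnj[OF g]]]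
 have "(LINT x|lborel. f x * cnj (g x)) = (LINT x|lborel. hat (\<lambda>xi. hat f (- xi)) x * cnj (g x))"
  using hat_inversion[OF f] by (intro integral_cong_AE) (auto elim: eventually_mono)
 also have "\<dots> = (LINT x|lborel. hat f (- x) * hat (\<lambda>x. cnj (g x)) x)"
  by (rule hat_dual[OF r sqint_cnj[OF g]])
 also have "\<dots> = (LINT x|lborel. hat f (- x) * cnj (hat g (- x)))"
  using hat_cnj[OF g] by (intro integral_cong_AE) (auto elim: eventually_mono)
 also have "\<dots> = (LINT xi|lborel. hat f xi * cnj (hat g xi))"
  using integral_reflect'[of "\<lambda>x. hat f x * cnj (hat g x)" 0] by simp
 finally show ?thesis .
qed

text \<open>Inversion read as surjectivity. Functions with a prescribed transform are produced this
  way.\<close>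

lemma hat_surj:
 assumes p: "sqint p"
 shows "sqint (\<lambda>x. hat p (- x))" "AE xi in lborel. hat (\<lambda>x. hat p (- x)) xi = p xi"
 using sqint_reflect[OF hat_fourier(1)[OF p], of 0] hat_inversion[OF p] by auto

section \<open>Derivatives and the Fourier transform\<close>

lemma test_function_has_derivative:
 "test_function D phi \<Longrightarrow> (phi has_derivative frechet_derivative phi (at x)) (at x)"
 using Ck_Suc_has_derivative[of 0 phi] by (simp add: test_function_def del: Ck.simps)

lemma test_function_derivative:
 assumes "test_function D phi"
 shows "test_function D (\<lambda>x. frechet_derivative phi (at x) v)"
proof (rule test_functionI)
 have "Ck (Suc k) phi" for k using assms unfolding test_function_def by blast
 then show "Ck k (\<lambda>x. frechet_derivative phi (at x) v)" for k
  by (rule Ck_Suc_derivative)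
 show "compact (closure {x. phi x \<noteq> 0})" "closure {x. phi x \<noteq> 0} \<subseteq> D"
  using assms by (auto simp: test_function_def)
 fix x assume x: "x \<notin> closure {x. phi x \<noteq> 0}"
 have "(phi has_derivative (\<lambda>_. 0)) (at x)"
 proof (rule has_derivative_transform_within_open[of "\<lambda>_. 0" "\<lambda>_. 0"])
  show "open (- closure {x. phi x \<noteq> 0})" by auto
  show "x \<in> - closure {x. phi x \<noteq> 0}" using x by simp
  show "y \<in> - closure {x. phi x \<noteq> 0} \<Longrightarrow> 0 = phi y" for y
   using closure_subset[of "{x. phi x \<noteq> 0}"] by auto
 qed simp
 then have "frechet_derivative phi (at x) = (\<lambda>_. 0)"
  by (metis frechet_derivative_at)
 then show "frechet_derivative phi (at x) v = 0" by simp
qed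

lemma test_function_integrable_real:
 fixes phi :: "'a::euclidean_space => real"
 assumes "test_function D phi" shows "integrable lborel phi"
 using integrable_Re[OF test_function_integrable(1)[OF assms]] by simp

text \<open>By translation invariance the integral of every difference quotient is zero, and the
  mean value theorem dominates the quotients. Applied to products this is integration by parts in an
  arbitrary direction, without iterated integrals.\<close>

lemma integral_derivative_test_function:
 fixes g :: "'a::euclidean_space => real"
 assumes g: "test_function D g"
 shows "(LINT x|lborel. frechet_derivative g (at x) v) = 0"
proof -
 have [measurable]: "g \<in> borel_measurable borel" by (rule test_function_measurable_lebesgue[OF g])
 let ?d = "\<lambda>x. frechet_derivative g (at x) v"
 have d: "test_function D ?d" by (rule test_function_derivative[OF g])
 have [measurable]: "?d \<in> borel_measurable borel" by (rule test_function_measurable_lebesgue[OF d])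
 obtain B where B: "\<And>x. norm (?d x) \<le> B" "B > 0"
  using test_function_bounded[OF d] by blast
 obtain R where R: "\<And>x. g x \<noteq> 0 \<Longrightarrow> norm x < R" "R > 0"
  using test_function_bounded[OF g] by blast
 define q where "q n x = (g (x + inverse (real (Suc n)) *\<^sub>R v) - g x) / inverse (real (Suc n))" for n x
 have line: "((\<lambda>t. g (x + t *\<^sub>R v)) has_real_derivative frechet_derivative g (at (x + t *\<^sub>R v)) v) (at t)" for x t
 proof -
  have "((\<lambda>t. x + t *\<^sub>R v) has_derivative (\<lambda>h. h *\<^sub>R v)) (at t)"
   by (auto intro!: derivative_eq_intros)
  from has_derivative_compose[OF this test_function_has_derivative[OF g]]
  have "((\<lambda>t. g (x + t *\<^sub>R v)) has_derivative (\<lambda>h. frechet_derivative g (at (x + t *\<^sub>R v)) (h *\<^sub>R v))) (at t)" .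
  moreover have "frechet_derivative g (at y) (h *\<^sub>R v) = frechet_derivative g (at y) v * h" for y h
   using linear_scale[OF has_derivative_linear[OF test_function_has_derivative[OF g]]] by simp
  ultimately show ?thesis by (simp add: has_field_derivative_def)
 qed
 \<comment> \<open>The step lengths are at most one, so the quotient vanishes outside a ball whose
   radius is enlarged by \<open>norm v\<close>. This gives one majorant for all
   \<open>n\<close>.\<close>
 have qb: "\<bar>q n x\<bar> \<le> B * indicator (ball 0 (R + norm v)) x" for n x
 proof -
  let ?h = "inverse (real (Suc n))"
  have h: "0 < ?h" "?h \<le> 1" by (auto simp: field_simps)
  obtain z where z: "g (x + ?h *\<^sub>R v) - g (x + 0 *\<^sub>R v) = (?h - 0) * frechet_derivative g (at (x + z *\<^sub>R v)) v"
   using MVT2[OF h(1), of "\<lambda>t. g (x + t *\<^sub>R v)" "\<lambda>t. frechet_derivative g (at (x + t *\<^sub>R v)) v"] line by blast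
  then have "q n x = frechet_derivative g (at (x + z *\<^sub>R v)) v"
   using h(1) unfolding q_def by simp
  then have 1: "\<bar>q n x\<bar> \<le> B" using B(1) by simp
  show ?thesis
  proof (cases "x \<in> ball 0 (R + norm v)")
   case False
   then have x: "R + norm v \<le> norm x" by simp
   have hv: "norm (?h *\<^sub>R v) \<le> norm v" using h by (simp add: mult_left_le_one_le del: of_nat_Suc)
   have "\<not> norm x < R" using x norm_ge_zero[of v] by linarith
   then have "g x = 0" using R(1)[of x] by blast
   moreover have "norm x \<le> norm (x + ?h *\<^sub>R v) + norm (?h *\<^sub>R v)"
    by (metis add_diff_cancel norm_triangle_ineq4)
   then have "R \<le> norm (x + ?h *\<^sub>R v)" using x hv by linarith
   then have "g (x + ?h *\<^sub>R v) = 0" using R(1)[of "x + ?h *\<^sub>R v"] by force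
   ultimately show ?thesis using False by (simp add: q_def)
  qed (use 1 in simp)
 qed
 have "(\<lambda>n. LINT x|lborel. q n x) \<longlonglongrightarrow> (LINT x|lborel. ?d x)"
 proof (rule integral_dominated_convergence)
  show "integrable lborel (\<lambda>x::'a. B * indicat_real (ball 0 (R + norm v)) x)"
   using emeasure_bounded_finite[of "ball (0::'a) (R + norm v)"] by (simp add: integrable_indicator_iff)
  show "AE x in lborel. (\<lambda>n. q n x) \<longlonglongrightarrow> ?d x"
  proof (rule AE_I2)
   fix x
   have "((\<lambda>h. (g (x + (0 + h) *\<^sub>R v) - g (x + 0 *\<^sub>R v)) / h) \<longlongrightarrow> ?d x) (at 0)"
    using line[of x 0] unfolding DERIV_def by simp
   moreover have "filterlim (\<lambda>n. inverse (real (Suc n))) (at 0) sequentially"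
    using LIMSEQ_inverse_real_of_nat by (auto simp: filterlim_at)
   ultimately have "(\<lambda>n. (g (x + (0 + inverse (real (Suc n))) *\<^sub>R v) - g (x + 0 *\<^sub>R v)) / inverse (real (Suc n))) \<longlonglongrightarrow> ?d x"
    by (rule filterlim_compose)
   then show "(\<lambda>n. q n x) \<longlonglongrightarrow> ?d x" by (simp add: q_def del: of_nat_Suc)
  qed
  show "AE x in lborel. norm (q n x) \<le> B * indicat_real (ball 0 (R + norm v)) x" for n
   using qb by simp
  show "q n \<in> borel_measurable lborel" for n unfolding q_def by measurable
 qed measurable
 moreover have "(LINT x|lborel. q n x) = 0" for n
 proof -
  have i: "integrable lborel g" by (rule test_function_integrable_real[OF g])
  have "integrable lborel (\<lambda>x. g (x + inverse (real (Suc n)) *\<^sub>R v))"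
   "(LINT x|lborel. g (x + inverse (real (Suc n)) *\<^sub>R v)) = (LINT x|lborel. g x)"
   using integrable_translate_iff[of g "- (inverse (real (Suc n)) *\<^sub>R v)"]
    integral_translate[of g "- (inverse (real (Suc n)) *\<^sub>R v)"] i by auto
  then show ?thesis using i unfolding q_def by (simp del: of_nat_Suc)
 qed
 ultimately show ?thesis using LIMSEQ_unique[OF _ tendsto_const[of "0::real"]] by simp
qed

lemma Ck_trig: "Ck k (\<lambda>x. cos (x \<bullet> xi)) \<and> Ck k (\<lambda>x. sin (x \<bullet> xi))"
proof (induction k)
 case 0
 show ?case by (auto intro!: continuous_intros)
next
 case (Suc k)
 have "Ck (Suc k) (\<lambda>x. cos (x \<bullet> xi))"
 proof (rule Ck_SucI)
  show "((\<lambda>x. cos (x \<bullet> xi)) has_derivative (\<lambda>v. - (v \<bullet> xi) * sin (x \<bullet> xi))) (at x)" for x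
   by (auto intro!: derivative_eq_intros simp: fun_eq_iff)
 qed (rule Ck_cmult, use Suc in blast)
 moreover have "Ck (Suc k) (\<lambda>x. sin (x \<bullet> xi))"
 proof (rule Ck_SucI)
  show "((\<lambda>x. sin (x \<bullet> xi)) has_derivative (\<lambda>v. (v \<bullet> xi) * cos (x \<bullet> xi))) (at x)" for x
   by (auto intro!: derivative_eq_intros simp: fun_eq_iff)
 qed (rule Ck_cmult, use Suc in blast)
 ultimately show ?case by blast
qed

lemma test_function_mult:
 fixes g :: "'a::euclidean_space => real"
 assumes "test_function D phi" "\<And>k. Ck k g"
 shows "test_function D (\<lambda>x. g x *\<^sub>R phi x)"
proof (rule test_functionI)
 show "Ck k (\<lambda>x. g x *\<^sub>R phi x)" for k
  using assms by (auto intro: Ck_scaleR simp: test_function_def)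
 show "compact (closure {x. phi x \<noteq> 0})" "closure {x. phi x \<noteq> 0} \<subseteq> D"
  using assms by (auto simp: test_function_def)
 show "g x *\<^sub>R phi x = 0" if "x \<notin> closure {x. phi x \<noteq> 0}" for x
  using that closure_subset[of "{x. phi x \<noteq> 0}"] by auto
qed

text \<open>Integration by parts against cosine and sine separately, because test functions are real
  valued. Each derivative brings out the other trigonometric function, and the two identities
  combine into one complex factor.\<close>

lemma hat_derivative:
 fixes phi :: "'a::euclidean_space => real"
 assumes phi: "test_function D phi"
 shows "AE xi in lborel. hat (\<lambda>x. of_real (frechet_derivative phi (at x) v)) xi = \<i> * of_real (v \<bullet> xi) * hat (\<lambda>x. of_real (phi x)) xi"
proof -
 let ?d = "\<lambda>x. frechet_derivative phi (at x) v"
 have d: "test_function D ?d" by (rule test_function_derivative[OF phi])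
 have [measurable]: "phi \<in> borel_measurable borel" by (rule test_function_measurable_lebesgue[OF phi])
 have [measurable]: "?d \<in> borel_measurable borel" by (rule test_function_measurable_lebesgue[OF d])
 note iphi = test_function_integrable_real[OF phi]
 note id = test_function_integrable_real[OF d]
 have "fourier_integral (\<lambda>x. of_real (?d x)) xi = \<i> * of_real (v \<bullet> xi) * fourier_integral (\<lambda>x. of_real (phi x)) xi" for xi
 proof -
  have trig: "integrable lborel (\<lambda>x. cos (x \<bullet> xi) * f x)" "integrable lborel (\<lambda>x. sin (x \<bullet> xi) * f x)"
   if "integrable lborel f" for f
  proof -
   have [measurable]: "f \<in> borel_measurable borel" using that by auto
   show "integrable lborel (\<lambda>x. cos (x \<bullet> xi) * f x)" "integrable lborel (\<lambda>x. sin (x \<bullet> xi) * f x)"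
    by (rule Bochner_Integration.integrable_bound[OF that]; auto simp: abs_mult mult_left_le_one_le)+
  qed
  have fd: "frechet_derivative (\<lambda>x. cos (x \<bullet> xi) * phi x) (at x) v = - (v \<bullet> xi) * (sin (x \<bullet> xi) * phi x) + cos (x \<bullet> xi) * ?d x"
    "frechet_derivative (\<lambda>x. sin (x \<bullet> xi) * phi x) (at x) v = (v \<bullet> xi) * (cos (x \<bullet> xi) * phi x) + sin (x \<bullet> xi) * ?d x" for x
  proof -
   have "((\<lambda>x. cos (x \<bullet> xi) * phi x) has_derivative (\<lambda>v. - (v \<bullet> xi) * (sin (x \<bullet> xi) * phi x) + cos (x \<bullet> xi) * frechet_derivative phi (at x) v)) (at x)"
    by (auto intro!: derivative_eq_intros test_function_has_derivative[OF phi] simp: fun_eq_iff)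
   from frechet_derivative_at[OF this]
   show "frechet_derivative (\<lambda>x. cos (x \<bullet> xi) * phi x) (at x) v = - (v \<bullet> xi) * (sin (x \<bullet> xi) * phi x) + cos (x \<bullet> xi) * ?d x"
    by (simp add: fun_eq_iff)
   have "((\<lambda>x. sin (x \<bullet> xi) * phi x) has_derivative (\<lambda>v. (v \<bullet> xi) * (cos (x \<bullet> xi) * phi x) + sin (x \<bullet> xi) * frechet_derivative phi (at x) v)) (at x)"
    by (auto intro!: derivative_eq_intros test_function_has_derivative[OF phi] simp: fun_eq_iff)
   from frechet_derivative_at[OF this]
   show "frechet_derivative (\<lambda>x. sin (x \<bullet> xi) * phi x) (at x) v = (v \<bullet> xi) * (cos (x \<bullet> xi) * phi x) + sin (x \<bullet> xi) * ?d x"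
    by (simp add: fun_eq_iff)
  qed
  have c: "(LINT x|lborel. cos (x \<bullet> xi) * ?d x) = (v \<bullet> xi) * (LINT x|lborel. sin (x \<bullet> xi) * phi x)"
   using integral_derivative_test_function[OF test_function_mult[OF phi Ck_trig[THEN conjunct1]], of xi v]
    trig[OF iphi] trig[OF id]
   by (simp add: fd)
  have s: "(LINT x|lborel. sin (x \<bullet> xi) * ?d x) = - (v \<bullet> xi) * (LINT x|lborel. cos (x \<bullet> xi) * phi x)"
   using integral_derivative_test_function[OF test_function_mult[OF phi Ck_trig[THEN conjunct2]], of xi v]
    trig[OF iphi] trig[OF id]
   by (simp add: fd)
  have split: "(LINT x|lborel. cis (- (x \<bullet> xi)) * of_real (f x)) =
   of_real (LINT x|lborel. cos (x \<bullet> xi) * f x) - \<i> * of_real (LINT x|lborel. sin (x \<bullet> xi) * f x)"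
   if f: "integrable lborel f" for f
  proof -
   have "(LINT x|lborel. cis (- (x \<bullet> xi)) * of_real (f x)) =
    (LINT x|lborel. complex_of_real (cos (x \<bullet> xi) * f x) - \<i> * complex_of_real (sin (x \<bullet> xi) * f x))"
    by (intro Bochner_Integration.integral_cong refl) (simp add: complex_eq_iff)
   also have "\<dots> = (LINT x|lborel. complex_of_real (cos (x \<bullet> xi) * f x)) - (LINT x|lborel. \<i> * complex_of_real (sin (x \<bullet> xi) * f x))"
    using trig[OF f] by (intro Bochner_Integration.integral_diff integrable_mult_right integrable_of_real)
   finally show ?thesis by (simp only: integral_mult_right_zero integral_complex_of_real)
  qed
  show ?thesis
   by (simp add: fourier_integral_borel split[OF iphi] split[OF id] c s) (simp add: complex_eq_iff algebra_simps)
 qed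
 then show ?thesis
  using hat_eq_fourier_integral[OF test_function_integrable(2,1)[OF phi]]
   hat_eq_fourier_integral[OF test_function_integrable(2,1)[OF d]]
  by (auto elim: eventually_elim2)
qed

text \<open>Serves candidates that come from an inverse transform and are complex valued a priori:
  real pairings with all real test functions make the imaginary part vanish by the fundamental
  lemma.\<close>

lemma sqint_real_unique:
 assumes h: "sqint h" and z: "\<And>psi::'a::euclidean_space => real. test_function UNIV psi \<Longrightarrow> Im (LINT x|lborel. h x * of_real (psi x)) = 0"
 shows "AE x in lborel. of_real (Re (h x)) = h x"
proof -
 have "AE x in lebesgue. Im (h x) = 0"
 proof (rule fundamental_lemma_variations[OF sqint_locally_integrable(2)[OF h]])
  fix psi :: "'a => real" assume psi: "test_function UNIV psi"
  note [measurable] = sqint_measurable[OF h] test_function_measurable_lebesgue[OF psi]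
  have "(LINT x|lebesgue. psi x * Im (h x)) = (LINT x|lborel. Im (h x * of_real (psi x)))"
   by (subst integral_completion) (auto simp: mult.commute)
  then show "(LINT x|lebesgue. psi x * Im (h x)) = 0"
   using z[OF psi] integral_Im[OF integrable_sqint_mult(1)[OF h test_function_integrable(2)[OF psi]]] by simp
 qed
 then have "AE x in lborel. Im (h x) = 0" by (simp add: AE_completion_iff)
 then show ?thesis by eventually_elim (simp add: complex_eq_iff)
qed

text \<open>The derivative is constructed as the inverse transform of the transform of
  \<open>w\<close> times \<open>\<i> * (v \<bullet> xi)\<close>. Parseval gives the weak identity,
  and this identity, whose left side is real, shows that the candidate is real.\<close>

lemma weak_derivative_exists:
 fixes w :: "'a::euclidean_space => real"
 assumes w: "sqint (\<lambda>x. of_real (w x))" and q: "sqint (\<lambda>xi. of_real (v \<bullet> xi) * hat (\<lambda>x. of_real (w x)) xi)"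
 shows "\<exists>h::'a => real. sqint (\<lambda>x. of_real (h x)) \<and>
  (AE xi in lborel. hat (\<lambda>x. of_real (h x)) xi = \<i> * of_real (v \<bullet> xi) * hat (\<lambda>x. of_real (w x)) xi) \<and>
  (\<forall>psi::'a => real. test_function UNIV psi \<longrightarrow>
   (LINT x|lborel. frechet_derivative psi (at x) v * w x) = - (LINT x|lborel. psi x * h x))"
proof -
 let ?w = "\<lambda>x. complex_of_real (w x)"
 define Q where "Q xi = \<i> * of_real (v \<bullet> xi) * hat ?w xi" for xi
 have Q: "sqint Q" using sqint_cmult[OF q, of \<i>] by (simp add: Q_def[abs_def] mult.assoc)
 define H where "H x = hat Q (- x)" for x
 have H: "sqint H" "AE xi in lborel. hat H xi = Q xi"
  using hat_surj[OF Q] by (auto simp: H_def[abs_def])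
 note [measurable] = sqint_measurable[OF w] sqint_measurable[OF Q] sqint_measurable[OF H(1)]
  sqint_measurable[OF hat_fourier(1)[OF H(1)]] sqint_measurable[OF hat_fourier(1)[OF w]]
 have w_meas [measurable]: "w \<in> borel_measurable borel"
 proof -
  have "(\<lambda>x. Re (?w x)) \<in> borel_measurable borel" by measurable
  then show ?thesis by simp
 qed
 have pair: "complex_of_real (LINT x|lborel. frechet_derivative psi (at x) v * w x) = - (LINT x|lborel. H x * of_real (psi x))"
  if psi: "test_function UNIV psi" for psi :: "'a => real"
 proof -
  let ?d = "\<lambda>x. frechet_derivative psi (at x) v"
  have d: "test_function UNIV ?d" by (rule test_function_derivative[OF psi])
  note spsi = test_function_integrable(2)[OF psi] and sd = test_function_integrable(2)[OF d]
  note [measurable] = sqint_measurable[OF hat_fourier(1)[OF spsi]] sqint_measurable[OF hat_fourier(1)[OF sd]]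
  have "complex_of_real (LINT x|lborel. ?d x * w x) = (LINT x|lborel. ?w x * cnj (of_real (?d x)))"
   by (simp add: integral_complex_of_real[symmetric] mult.commute)
  also have "\<dots> = (LINT xi|lborel. hat ?w xi * cnj (hat (\<lambda>x. of_real (?d x)) xi))"
   by (rule hat_parseval[OF w sd])
  \<comment> \<open>Conjugating the imaginary factor produces the minus sign of integration by
    parts.\<close>
  also have "\<dots> = (LINT xi|lborel. - (hat H xi * cnj (hat (\<lambda>x. of_real (psi x)) xi)))"
  proof (rule integral_cong_AE)
   show "AE xi in lborel. hat ?w xi * cnj (hat (\<lambda>x. of_real (?d x)) xi) = - (hat H xi * cnj (hat (\<lambda>x. of_real (psi x)) xi))"
    using hat_derivative[OF psi, of v] H(2) by eventually_elim (simp add: Q_def)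
  qed measurable
  also have "\<dots> = - (LINT x|lborel. H x * cnj (of_real (psi x)))"
   using hat_parseval[OF H(1) spsi] by simp
  finally show ?thesis by simp
 qed
 have real: "AE x in lborel. of_real (Re (H x)) = H x"
 proof (rule sqint_real_unique[OF H(1)])
  fix psi :: "'a => real" assume "test_function UNIV psi"
  from pair[OF this, THEN arg_cong[where f=Im]] show "Im (LINT x|lborel. H x * of_real (psi x)) = 0" by simp
 qed
 have m: "(\<lambda>x. complex_of_real (Re (H x))) \<in> borel_measurable borel" by measurable
 show ?thesis
 proof (intro exI[of _ "\<lambda>x. Re (H x)"] conjI allI impI)
  show s: "sqint (\<lambda>x. of_real (Re (H x)))"
   by (rule sqint_cong_AE[OF H(1) m real])
  have "hat (\<lambda>x. of_real (Re (H x))) = hat H"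
   using real by (intro hat_cong_AE) (auto intro!: measurable_completion)
  then show "AE xi in lborel. hat (\<lambda>x. of_real (Re (H x))) xi = \<i> * of_real (v \<bullet> xi) * hat ?w xi"
   using H(2) by (simp add: Q_def)
  fix psi :: "'a => real" assume psi: "test_function UNIV psi"
  have "(LINT x|lborel. frechet_derivative psi (at x) v * w x) = - Re (LINT x|lborel. H x * of_real (psi x))"
   using pair[OF psi, THEN arg_cong[where f=Re]] by simp
  then show "(LINT x|lborel. frechet_derivative psi (at x) v * w x) = - (LINT x|lborel. psi x * Re (H x))"
   using integral_Re[OF integrable_sqint_mult(1)[OF H(1) test_function_integrable(2)[OF psi]]]
   by (simp add: mult.commute)
 qed
qed

section \<open>Convolutions\<close>

definition conv :: "('a::euclidean_space => complex) => ('a => complex) => 'a => complex" where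
 "conv p q xi = (LINT eta|lborel. p (xi - eta) * q eta)"

lemma conv_measurable [measurable]:
 assumes [measurable]: "p \<in> borel_measurable borel" "q \<in> borel_measurable borel"
 shows "conv p q \<in> borel_measurable borel"
 unfolding conv_def[abs_def] by measurable

text \<open>Young's inequality for one integrable and one square integrable factor: \<open>p\<close>
  is split into two square roots, Cauchy-Schwarz is applied in \<open>eta\<close>, and the rest is
  Fubini.\<close>

lemma young_nn:
 fixes p q :: "'a::euclidean_space => real"
 assumes [measurable]: "p \<in> borel_measurable borel" "q \<in> borel_measurable borel"
  and nn: "\<And>x. 0 \<le> p x" "\<And>x. 0 \<le> q x"
  and int: "integrable lborel p" "integrable lborel (\<lambda>x. (q x)\<^sup>2)"
 shows "(\<integral>\<^sup>+xi. (\<integral>\<^sup>+eta. ennreal (p (xi - eta) * q eta) \<partial>lborel)\<^sup>2 \<partial>lborel) \<le>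
  ennreal ((LINT x|lborel. p x)\<^sup>2 * (LINT x|lborel. (q x)\<^sup>2))"
proof -
 let ?P = "LINT x|lborel. p x"
 have P: "(\<integral>\<^sup>+x. ennreal (p x) \<partial>lborel) = ennreal ?P"
  using int nn by (intro nn_integral_eq_integral) auto
 have Pn: "0 \<le> ?P" using nn by (intro Bochner_Integration.integral_nonneg)
 have 1: "(\<integral>\<^sup>+eta. ennreal (p (xi - eta) * q eta) \<partial>lborel)\<^sup>2 \<le>
   ennreal ?P * (\<integral>\<^sup>+eta. ennreal (p (xi - eta) * (q eta)\<^sup>2) \<partial>lborel)" for xi
 proof -
  have "(\<integral>\<^sup>+eta. ennreal (p (xi - eta) * q eta) \<partial>lborel) =
    (\<integral>\<^sup>+eta. ennreal (sqrt (p (xi - eta))) * ennreal (sqrt (p (xi - eta)) * q eta) \<partial>lborel)"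
   using nn by (intro nn_integral_cong) (auto simp: ennreal_mult[symmetric] mult.assoc[symmetric])
  then have "(\<integral>\<^sup>+eta. ennreal (p (xi - eta) * q eta) \<partial>lborel)\<^sup>2 \<le>
    (\<integral>\<^sup>+eta. ennreal (sqrt (p (xi - eta))) ^ 2 \<partial>lborel) * (\<integral>\<^sup>+eta. ennreal (sqrt (p (xi - eta)) * q eta) ^ 2 \<partial>lborel)"
   by (simp only:) (rule Cauchy_Schwarz_nn_integral; measurable)
  also have "(\<integral>\<^sup>+eta. ennreal (sqrt (p (xi - eta))) ^ 2 \<partial>lborel) = (\<integral>\<^sup>+eta. ennreal (p (xi - eta)) \<partial>lborel)"
   using nn by (intro nn_integral_cong) (auto simp: ennreal_power)
  also have "\<dots> = ennreal ?P"
   using nn_integral_reflect[of "\<lambda>x. ennreal (p x)" xi] P by simp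
  also have "(\<integral>\<^sup>+eta. ennreal (sqrt (p (xi - eta)) * q eta) ^ 2 \<partial>lborel) = (\<integral>\<^sup>+eta. ennreal (p (xi - eta) * (q eta)\<^sup>2) \<partial>lborel)"
   using nn by (intro nn_integral_cong) (auto simp: ennreal_power power_mult_distrib)
  finally show ?thesis .
 qed
 have "(\<integral>\<^sup>+xi. (\<integral>\<^sup>+eta. ennreal (p (xi - eta) * q eta) \<partial>lborel)\<^sup>2 \<partial>lborel) \<le>
   (\<integral>\<^sup>+xi. ennreal ?P * (\<integral>\<^sup>+eta. ennreal (p (xi - eta) * (q eta)\<^sup>2) \<partial>lborel) \<partial>lborel)"
  by (rule nn_integral_mono) (rule 1)
 also have "\<dots> = ennreal ?P * (\<integral>\<^sup>+xi. \<integral>\<^sup>+eta. ennreal (p (xi - eta) * (q eta)\<^sup>2) \<partial>lborel \<partial>lborel)"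
  by (rule nn_integral_cmult) measurable
 also have "(\<integral>\<^sup>+xi. \<integral>\<^sup>+eta. ennreal (p (xi - eta) * (q eta)\<^sup>2) \<partial>lborel \<partial>lborel) =
   (\<integral>\<^sup>+eta. \<integral>\<^sup>+xi. ennreal (p (xi - eta) * (q eta)\<^sup>2) \<partial>lborel \<partial>lborel)"
  by (rule lborel_pair.Fubini') measurable
 also have "\<dots> = (\<integral>\<^sup>+eta. ennreal ?P * ennreal ((q eta)\<^sup>2) \<partial>lborel)"
 proof (rule nn_integral_cong)
  fix eta
  have "(\<integral>\<^sup>+xi. ennreal (p (xi - eta) * (q eta)\<^sup>2) \<partial>lborel) = (\<integral>\<^sup>+xi. ennreal (p (xi - eta)) \<partial>lborel) * ennreal ((q eta)\<^sup>2)"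
   using nn by (subst nn_integral_multc[symmetric]) (auto simp: ennreal_mult)
  then show "(\<integral>\<^sup>+xi. ennreal (p (xi - eta) * (q eta)\<^sup>2) \<partial>lborel) = ennreal ?P * ennreal ((q eta)\<^sup>2)"
   using nn_integral_translate[of "\<lambda>x. ennreal (p x)" eta] P by simp
 qed
 also have "\<dots> = ennreal ?P * ennreal (LINT x|lborel. (q x)\<^sup>2)"
  using int by (subst nn_integral_cmult) (auto simp: nn_integral_eq_integral)
 finally show ?thesis
  using Pn by (simp add: ennreal_mult'[symmetric] power2_eq_square mult.assoc)
qed

text \<open>A multiplier \<open>k\<close> in front of a convolution is to be absorbed by weights on
  the two factors; \<open>bd\<close> is the place where an inequality of Peetre type enters.\<close>

lemma conv_sqint_aux:
 fixes p q :: "'a::euclidean_space => complex" and k :: "'a => real"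
 assumes [measurable]: "p \<in> borel_measurable borel" "q \<in> borel_measurable borel" "k \<in> borel_measurable borel"
  "p' \<in> borel_measurable borel" "q' \<in> borel_measurable borel"
  and int: "integrable lborel p'" "integrable lborel (\<lambda>x. (q' x)\<^sup>2)"
  and nn: "\<And>x. 0 \<le> p' x" "\<And>x. 0 \<le> q' x"
  and bd: "\<And>xi eta. \<bar>k xi\<bar> * cmod (p (xi - eta)) * cmod (q eta) \<le> p' (xi - eta) * q' eta"
 shows "sqint (\<lambda>xi. of_real (k xi) * conv p q xi)"
  "nrm (\<lambda>xi. of_real (k xi) * conv p q xi) \<le> (LINT x|lborel. p' x) * sqrt (LINT x|lborel. (q' x)\<^sup>2)"
proof -
 have "(\<integral>\<^sup>+xi. ennreal ((cmod (of_real (k xi) * conv p q xi))\<^sup>2) \<partial>lborel) \<le>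
   (\<integral>\<^sup>+xi. (\<integral>\<^sup>+eta. ennreal (p' (xi - eta) * q' eta) \<partial>lborel)\<^sup>2 \<partial>lborel)"
 proof (rule nn_integral_mono)
  fix xi
  have "of_real (k xi) * conv p q xi = (LINT eta|lborel. of_real (k xi) * (p (xi - eta) * q eta))"
   by (simp add: conv_def)
  then have "ennreal (cmod (of_real (k xi) * conv p q xi)) \<le> (\<integral>\<^sup>+eta. cmod (of_real (k xi) * (p (xi - eta) * q eta)) \<partial>lborel)"
   by (simp only: integral_norm_le_nn_integral)
  also have "\<dots> \<le> (\<integral>\<^sup>+eta. ennreal (p' (xi - eta) * q' eta) \<partial>lborel)"
   by (intro nn_integral_mono ennreal_leI) (use bd in \<open>simp add: norm_mult mult.assoc\<close>)
  finally have "(ennreal (cmod (of_real (k xi) * conv p q xi)))\<^sup>2 \<le> (\<integral>\<^sup>+eta. ennreal (p' (xi - eta) * q' eta) \<partial>lborel)\<^sup>2"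
   by (rule power_mono) simp
  then show "ennreal ((cmod (of_real (k xi) * conv p q xi))\<^sup>2) \<le> (\<integral>\<^sup>+eta. ennreal (p' (xi - eta) * q' eta) \<partial>lborel)\<^sup>2"
   by (simp add: ennreal_power)
 qed
 also have "\<dots> \<le> ennreal ((LINT x|lborel. p' x)\<^sup>2 * (LINT x|lborel. (q' x)\<^sup>2))"
  using int nn by (intro young_nn) auto
 finally have *: "(\<integral>\<^sup>+xi. ennreal ((cmod (of_real (k xi) * conv p q xi))\<^sup>2) \<partial>lborel) \<le>
   ennreal ((LINT x|lborel. p' x)\<^sup>2 * (LINT x|lborel. (q' x)\<^sup>2))" .
 then have i: "integrable lborel (\<lambda>xi. (cmod (of_real (k xi) * conv p q xi))\<^sup>2)"
  by (intro integrableI_bounded) (auto simp: le_less_trans)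
 then show "sqint (\<lambda>xi. of_real (k xi) * conv p q xi)" by (simp add: sqint_def)
 have "(nrm (\<lambda>xi. of_real (k xi) * conv p q xi))\<^sup>2 \<le> (LINT x|lborel. p' x)\<^sup>2 * (LINT x|lborel. (q' x)\<^sup>2)"
  using * i by (simp add: nn_integral_eq_integral nrm_power2)
 then have "nrm (\<lambda>xi. of_real (k xi) * conv p q xi) \<le> sqrt ((LINT x|lborel. p' x)\<^sup>2 * (LINT x|lborel. (q' x)\<^sup>2))"
  by (rule real_le_rsqrt)
 also have "\<dots> = (LINT x|lborel. p' x) * sqrt (LINT x|lborel. (q' x)\<^sup>2)"
  using nn by (simp add: real_sqrt_mult Bochner_Integration.integral_nonneg)
 finally show "nrm (\<lambda>xi. of_real (k xi) * conv p q xi) \<le> (LINT x|lborel. p' x) * sqrt (LINT x|lborel. (q' x)\<^sup>2)" .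
qed

text \<open>With an integrable transform, \<open>alpha\<close> is almost everywhere an absolutely
  convergent inverse Fourier integral. The multiplication formula is applied to it and the modulated
  test function, and modulation becomes a shift of the transform.\<close>

lemma hat_product:
 fixes alpha :: "'a::euclidean_space => complex" and phi :: "'a => real"
 assumes alpha: "sqint alpha" and i: "integrable lborel (hat alpha)" and phi: "test_function D phi"
 shows "sqint (\<lambda>x. alpha x * of_real (phi x))"
  "AE xi in lborel. hat (\<lambda>x. alpha x * of_real (phi x)) xi = of_real (fconst TYPE('a)) * conv (hat alpha) (hat (\<lambda>x. of_real (phi x))) xi"
proof -
 let ?phi = "\<lambda>x. complex_of_real (phi x)" and ?c = "complex_of_real (fconst TYPE('a))"
 note p = test_function_integrable[OF phi]
 note salpha = hat_fourier(1)[OF alpha]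
 note [measurable] = sqint_measurable[OF alpha] sqint_measurable[OF p(2)] sqint_measurable[OF salpha]
  sqint_measurable[OF hat_fourier(1)[OF p(2)]]
 have [measurable]: "phi \<in> borel_measurable borel" by (rule test_function_measurable_lebesgue[OF phi])
 obtain R where R: "\<And>x. norm (phi x) \<le> R" using test_function_bounded[OF phi] by blast
 show s: "sqint (\<lambda>x. alpha x * ?phi x)"
  by (rule sqint_bound[OF alpha, where c=R])
    (use R in \<open>auto simp: norm_mult mult.commute intro!: AE_I2 mult_right_mono\<close>)
 have ialphaphi: "integrable lborel (\<lambda>x. alpha x * ?phi x)" by (rule integrable_sqint_mult(1)[OF alpha p(2)])
 have r: "sqint (\<lambda>xi. hat alpha (- xi))" "integrable lborel (\<lambda>xi. hat alpha (- xi))"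
  using sqint_reflect[OF salpha, of 0] integrable_reflect_iff[of "hat alpha" 0] i by auto
 have inv: "AE x in lborel. fourier_integral (\<lambda>xi. hat alpha (- xi)) x = alpha x"
  using hat_eq_fourier_integral[OF r] hat_inversion[OF alpha] by eventually_elim simp
 have "fourier_integral (\<lambda>x. alpha x * ?phi x) xi = ?c * conv (hat alpha) (fourier_integral ?phi) xi" for xi
 proof -
  have im: "integrable lborel (\<lambda>x. cis (- (x \<bullet> xi)) * ?phi x)" by (rule integrable_cis_mult(2)[OF p(1)])
  have shift: "fourier_integral (\<lambda>x. cis (- (x \<bullet> xi)) * ?phi x) eta = fourier_integral ?phi (xi + eta)" for eta
  proof -
   have "cis (- (x \<bullet> eta)) * (cis (- (x \<bullet> xi)) * ?phi x) = cis (- (x \<bullet> (xi + eta))) * ?phi x" for x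
    by (simp add: mult.assoc[symmetric] cis_mult inner_add_right add.commute[of "x \<bullet> xi"])
   moreover have "(\<lambda>x. cis (- (x \<bullet> xi)) * ?phi x) \<in> borel_measurable borel" by measurable
   ultimately show ?thesis
    by (simp only: fourier_integral_borel[OF sqint_measurable[OF p(2)]] fourier_integral_borel)
  qed
  have "(LINT x|lborel. cis (- (x \<bullet> xi)) * (alpha x * ?phi x)) =
    (LINT x|lborel. fourier_integral (\<lambda>xi. hat alpha (- xi)) x * (cis (- (x \<bullet> xi)) * ?phi x))"
   using inv by (intro integral_cong_AE) (auto elim: eventually_mono)
  also have "\<dots> = (LINT eta|lborel. hat alpha (- eta) * fourier_integral ?phi (xi + eta))"
   using fourier_integral_dual[OF r(2) im] by (simp only: shift)
  also have "\<dots> = (LINT eta|lborel. hat alpha (- (eta - xi)) * fourier_integral ?phi (xi + (eta - xi)))"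
   by (rule integral_translate[symmetric]) measurable
  also have "\<dots> = conv (hat alpha) (fourier_integral ?phi) xi"
   by (simp add: conv_def)
  finally show ?thesis by (simp add: fourier_integral_borel)
 qed
 moreover have "conv (hat alpha) (fourier_integral ?phi) = conv (hat alpha) (hat ?phi)"
  unfolding conv_def using hat_eq_fourier_integral[OF p(2,1)]
  by (intro ext integral_cong_AE) (auto elim: eventually_mono)
 ultimately show "AE xi in lborel. hat (\<lambda>x. alpha x * ?phi x) xi = ?c * conv (hat alpha) (hat ?phi) xi"
  using hat_eq_fourier_integral[OF s ialphaphi] by simp
qed

section \<open>Sobolev spaces on the Fourier side\<close>

definition jb :: "'a::euclidean_space => real" where
 "jb xi = sqrt (1 + (norm xi)\<^sup>2)"

text \<open>The Japanese bracket as a norm on pairs; its Lipschitz bound is then the reverse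
  triangle inequality.\<close>

lemma jb_norm: "jb xi = norm (1::real, xi)"
 by (simp add: jb_def norm_prod_def)

lemma jb_measurable [measurable]: "jb \<in> borel_measurable borel"
 unfolding jb_def by measurable

lemma jb_ge_1: "1 \<le> jb xi" and jb_pos: "0 < jb xi" and norm_le_jb: "norm xi \<le> jb xi"
 and jb_minus [simp]: "jb (- xi) = jb xi"
proof -
 show 1: "1 \<le> jb xi" by (simp add: jb_def)
 then show "0 < jb xi" by linarith
 show "norm xi \<le> jb xi" unfolding jb_def by (rule real_le_rsqrt) simp
qed (simp add: jb_def)

lemma jb_lipschitz: "\<bar>jb xi - jb eta\<bar> \<le> norm (xi - eta)"
 using norm_triangle_ineq3[of "(1::real, xi)" "(1, eta)"] by (simp add: jb_norm norm_Pair)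

lemma jb_add_le: "jb xi \<le> jb eta + jb (xi - eta)"
 using jb_lipschitz[of xi eta] norm_le_jb[of "xi - eta"] by linarith

text \<open>Peetre's inequality. Brackets are at least one, so each of the two terms of the triangle
  inequality is at most their product.\<close>

lemma jb_peetre: "jb xi \<le> 2 * jb (xi - eta) * jb eta"
proof -
 have "jb eta \<le> jb (xi - eta) * jb eta" "jb (xi - eta) \<le> jb (xi - eta) * jb eta"
  using jb_ge_1[of "xi - eta"] jb_ge_1[of eta] by simp_all
 then show ?thesis using jb_add_le[of xi eta] by linarith
qed

text \<open>Comparison with a pure power, which has an explicit primitive, where the absolute value
  of \<open>y\<close> is at least one, and with the constant one in between.\<close>

lemma integrable_powr_1d:
 assumes p: "p > 1/2"
 shows "integrable lborel (\<lambda>y::real. (1 + y\<^sup>2) powr (- p))"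
proof -
 have F: "(\<integral>\<^sup>+y. ennreal (y powr (- 2 * p)) * indicator {1..} y \<partial>lborel) = ennreal (0 - (- (1 powr (1 - 2 * p)) / (2 * p - 1)))"
 proof (rule nn_integral_FTC_atLeast[where F="\<lambda>y. - (y powr (1 - 2 * p)) / (2 * p - 1)"])
  show "((\<lambda>y. - (y powr (1 - 2 * p)) / (2 * p - 1)) has_real_derivative y powr (- 2 * p)) (at y)" if "1 \<le> y" for y
  proof -
   have "((\<lambda>y. - (y powr (1 - 2 * p)) / (2 * p - 1)) has_real_derivative
     - ((1 - 2 * p) * y powr (1 - 2 * p - 1)) / (2 * p - 1)) (at y)"
    using that by (intro DERIV_cdivide DERIV_minus has_real_derivative_powr) simp
   moreover have "- ((1 - 2 * p) * y powr (1 - 2 * p - 1)) / (2 * p - 1) = y powr (- 2 * p)"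
    using p by (simp add: field_simps)
   ultimately show ?thesis by simp
  qed
  have "((\<lambda>y. y powr (1 - 2 * p)) \<longlongrightarrow> 0) at_top"
   using p by (intro tendsto_neg_powr filterlim_ident) auto
  from tendsto_divide[OF tendsto_minus[OF this] tendsto_const[of "2 * p - 1"]] p
  show "((\<lambda>y. - (y powr (1 - 2 * p)) / (2 * p - 1)) \<longlongrightarrow> 0) at_top" by simp
 qed auto
 have 1: "integrable lborel (\<lambda>y. y powr (- 2 * p) * indicator {1..} y :: real)"
 proof (rule integrableI_nonneg)
  have "(\<integral>\<^sup>+y. ennreal (y powr (- 2 * p) * indicator {1..} y) \<partial>lborel) = (\<integral>\<^sup>+y. ennreal (y powr (- 2 * p)) * indicator {1..} y \<partial>lborel)"
   by (intro nn_integral_cong) (auto simp: indicator_def)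
  then show "(\<integral>\<^sup>+y. ennreal (y powr (- 2 * p) * indicator {1..} y) \<partial>lborel) < \<infinity>" using F by simp
 qed (auto simp: indicator_def)
 have 2: "integrable lborel (\<lambda>y. (- y) powr (- 2 * p) * indicator {1..} (- y) :: real)"
  using 1 integrable_reflect_iff[of "\<lambda>y. y powr (- 2 * p) * indicator {1..} y :: real" 0] by simp
 have 3: "integrable lborel (\<lambda>y::real. indicator {-1..1} y :: real)" by (simp add: integrable_indicator_iff)
 show ?thesis
 proof (rule Bochner_Integration.integrable_bound[OF Bochner_Integration.integrable_add[OF 3 Bochner_Integration.integrable_add[OF 1 2]]])
  show "AE y in lborel. norm ((1 + y\<^sup>2) powr (- p)) \<le>
   norm (indicator {-1..1} y + (y powr (- 2 * p) * indicator {1..} y + (- y) powr (- 2 * p) * indicator {1..} (- y)) :: real)"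
  proof (rule AE_I2)
   fix y :: real
   have a: "(1 + y\<^sup>2) powr (- p) \<le> 1"
    using p by (simp add: powr_minus inverse_le_1_iff ge_one_powr_ge_zero)
   have b: "(1 + y\<^sup>2) powr (- p) \<le> \<bar>y\<bar> powr (- 2 * p)" if "1 \<le> \<bar>y\<bar>"
   proof -
    have "(1 + y\<^sup>2) powr (- p) \<le> (\<bar>y\<bar>\<^sup>2) powr (- p)"
     using p that by (intro powr_mono2') auto
    also have "\<dots> = \<bar>y\<bar> powr (- 2 * p)"
    proof -
     have "\<bar>y\<bar>\<^sup>2 = \<bar>y\<bar> powr 2" using that by (simp add: powr_realpow[of _ 2, simplified])
     then show ?thesis by (simp only: powr_powr) simp
    qed
    finally show ?thesis .
   qed
   consider "\<bar>y\<bar> \<le> 1" | "1 < y" | "1 < - y" by linarith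
   then show "norm ((1 + y\<^sup>2) powr (- p)) \<le>
    norm (indicator {-1..1} y + (y powr (- 2 * p) * indicator {1..} y + (- y) powr (- 2 * p) * indicator {1..} (- y)) :: real)"
   proof cases
    case 1
    then have "1 \<le> indicator {-1..1} y + (y powr (- 2 * p) * indicator {1..} y + (- y) powr (- 2 * p) * indicator {1..} (- y) :: real)"
     by (auto simp: indicator_def abs_le_iff)
    then show ?thesis using a by simp
   next
    case 2
    then show ?thesis using b by (simp add: indicator_def)
   next
    case 3
    then show ?thesis using b by (simp add: indicator_def)
   qed
  qed
 qed measurable
qed

text \<open>Polar coordinates are avoided by sharing the power equally among the coordinates: each
  of the \<open>DIM('a)\<close> equal factors is at most a function of one coordinate with exponent
  \<sigma> / d, and \<sigma> > d/2 makes every one-dimensional integral finite.\<close>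

lemma integrable_jb_powr:
 fixes \<sigma> :: real
 assumes "\<sigma> > real DIM('a::euclidean_space) / 2"
 shows "integrable lborel (\<lambda>xi::'a. jb xi powr (- 2 * \<sigma>))"
proof -
 let ?d = "real DIM('a)"
 have d: "?d > 0" by simp
 have \<sigma>: "\<sigma> > 0" using assms d by linarith
 have "\<sigma> / ?d > 1/2" using assms d by (simp add: field_simps)
 then have i: "integrable lborel (\<lambda>y::real. (1 + y\<^sup>2) powr (- (\<sigma> / ?d)))"
  by (rule integrable_powr_1d)
 have i': "integrable lborel (\<lambda>xi::'a. \<Prod>b\<in>Basis. (1 + (xi \<bullet> b)\<^sup>2) powr (- (\<sigma> / ?d)))"
  by (rule integral_prod_Basis(1)[of "\<lambda>b y. (1 + y\<^sup>2) powr (- (\<sigma> / ?d))", OF i])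
 show ?thesis
 proof (rule Bochner_Integration.integrable_bound[OF i'])
  show "AE xi::'a in lborel. norm (jb xi powr (- 2 * \<sigma>)) \<le> norm (\<Prod>b\<in>Basis. (1 + (xi \<bullet> b)\<^sup>2) powr (- (\<sigma> / ?d)))"
  proof (rule AE_I2)
   fix xi :: 'a
   have "jb xi powr (- 2 * \<sigma>) = (1 + (norm xi)\<^sup>2) powr (- \<sigma>)"
    by (simp add: jb_def powr_half_sqrt[symmetric] powr_powr add_nonneg_nonneg)
   also have "\<dots> = (\<Prod>b\<in>(Basis::'a set). (1 + (norm xi)\<^sup>2) powr (- (\<sigma> / ?d)))"
    using add_pos_nonneg[OF zero_less_one zero_le_power2[of "norm xi"]]
    by (simp add: powr_realpow[symmetric] powr_powr)
   also have "\<dots> \<le> (\<Prod>b\<in>Basis. (1 + (xi \<bullet> b)\<^sup>2) powr (- (\<sigma> / ?d)))"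
   proof (intro prod_mono conjI powr_mono2')
    fix b :: 'a assume "b \<in> Basis"
    then have "\<bar>xi \<bullet> b\<bar> \<le> norm xi" by (rule Basis_le_norm)
    then have "\<bar>xi \<bullet> b\<bar>\<^sup>2 \<le> (norm xi)\<^sup>2" by (intro power_mono) auto
    then show "1 + (xi \<bullet> b)\<^sup>2 \<le> 1 + (norm xi)\<^sup>2" by simp
   qed (use \<sigma> d in \<open>auto simp: add_pos_nonneg\<close>)
   finally show "norm (jb xi powr (- 2 * \<sigma>)) \<le> norm (\<Prod>b\<in>Basis. (1 + (xi \<bullet> b)\<^sup>2) powr (- (\<sigma> / ?d)))"
    by simp
  qed
 qed measurable
qed

section \<open>The transform of Lebesgue measurable functions\<close>

lemma L2_hat:
 fixes f :: "'a::euclidean_space => complex"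
 assumes "L2 f"
 shows "sqint (hat f)" "nrm (hat f) = L2_norm f" "AE x in lborel. hat f x = fourier f x"
  "\<exists>f'. sqint f' \<and> (AE x in lborel. f x = f' x) \<and> hat f = hat f'"
proof -
 obtain f' where f': "sqint f'" "AE x in lborel. f x = f' x" "nrm f' = L2_norm f"
  using L2_representative[OF assms] .
 have m: "f \<in> borel_measurable lebesgue" "f' \<in> borel_measurable lebesgue"
  using assms sqint_measurable[OF f'(1)] by (auto simp: L2_def measurable_completion)
 have e: "hat f = hat f'" "fourier f = fourier f'"
  using hat_cong_AE[OF m f'(2)] fourier_cong_AE[OF m f'(2)] .
 show "sqint (hat f)" "nrm (hat f) = L2_norm f" "AE x in lborel. hat f x = fourier f x"
  "\<exists>f'. sqint f' \<and> (AE x in lborel. f x = f' x) \<and> hat f = hat f'"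
  using hat_fourier[OF f'(1)] nrm_hat[OF f'(1)] f' e by auto
qed

lemma L2_measurable: "L2 f \<Longrightarrow> f \<in> borel_measurable lebesgue"
 by (simp add: L2_def)

lemma L2_of_AE_sqint:
 fixes f :: "'a::euclidean_space => complex"
 assumes "sqint g" "AE x in lborel. f x = g x"
 shows "L2 f" "L2_norm f = nrm g" "hat f = hat g"
proof -
 have g: "g \<in> borel_measurable borel" by (rule sqint_measurable[OF assms(1)])
 then have gm: "g \<in> borel_measurable lebesgue" by (simp add: measurable_completion)
 have fm: "f \<in> borel_measurable lebesgue"
  by (rule borel_measurable_AE[OF gm]) (use assms(2) in \<open>auto simp: AE_completion_iff elim: eventually_mono\<close>)
 show "L2 f" "L2_norm f = nrm g" "hat f = hat g"
  using L2_cong_AE[OF fm gm assms(2)] L2_borel[OF g] L2_norm_borel[OF g] assms(1) hat_cong_AE[OF fm gm assms(2)] by auto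
qed

lemma L2_hat_add:
 assumes "L2 f" "L2 g"
 shows "L2 (\<lambda>x. f x + g x)" "AE xi in lborel. hat (\<lambda>x. f x + g x) xi = hat f xi + hat g xi"
proof -
 obtain f' where f': "sqint f'" "AE x in lborel. f x = f' x" "hat f = hat f'" using L2_hat(4)[OF assms(1)] by blast
 obtain g' where g': "sqint g'" "AE x in lborel. g x = g' x" "hat g = hat g'" using L2_hat(4)[OF assms(2)] by blast
 have "AE x in lborel. f x + g x = f' x + g' x" using f'(2) g'(2) by eventually_elim simp
 from L2_of_AE_sqint[OF sqint_add[OF f'(1) g'(1)] this] hat_add[OF f'(1) g'(1)] f' g'
 show "L2 (\<lambda>x. f x + g x)" "AE xi in lborel. hat (\<lambda>x. f x + g x) xi = hat f xi + hat g xi" by auto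
qed

lemma L2_hat_cmult:
 assumes "L2 f"
 shows "L2 (\<lambda>x. c * f x)" "AE xi in lborel. hat (\<lambda>x. c * f x) xi = c * hat f xi"
proof -
 obtain f' where f': "sqint f'" "AE x in lborel. f x = f' x" "hat f = hat f'" using L2_hat(4)[OF assms(1)] by blast
 have "AE x in lborel. c * f x = c * f' x" using f'(2) by eventually_elim simp
 from L2_of_AE_sqint[OF sqint_cmult[OF f'(1)] this] hat_cmult[OF f'(1)] f'
 show "L2 (\<lambda>x. c * f x)" "AE xi in lborel. hat (\<lambda>x. c * f x) xi = c * hat f xi" by auto
qed

lemma L2_hat_sum:
 assumes "\<And>i. i \<in> I \<Longrightarrow> L2 (f i)"
 shows "L2 (\<lambda>x. \<Sum>i\<in>I. f i x) \<and> (AE xi in lborel. hat (\<lambda>x. \<Sum>i\<in>I. f i x) xi = (\<Sum>i\<in>I. hat (f i) xi))"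
 using assms
proof (induction I rule: infinite_finite_induct)
 case (insert i I)
 then have *: "L2 (f i)" "L2 (\<lambda>x. \<Sum>i\<in>I. f i x)" "AE xi in lborel. hat (\<lambda>x. \<Sum>i\<in>I. f i x) xi = (\<Sum>i\<in>I. hat (f i) xi)"
  by auto
 have "AE xi in lborel. hat (\<lambda>x. f i x + (\<Sum>i\<in>I. f i x)) xi = hat (f i) xi + (\<Sum>i\<in>I. hat (f i) xi)"
  using L2_hat_add(2)[OF *(1,2)] *(3) by eventually_elim simp
 then show ?case using insert L2_hat_add(1)[OF *(1,2)] by simp
next
 have z: "L2 (\<lambda>x::'b. 0)" by (simp add: L2_def)
 have "AE xi in lborel. hat (\<lambda>x::'b. 0) xi = 0"
  using L2_hat_cmult(2)[OF z, of 0] by simp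
 then show "L2 (\<lambda>x. \<Sum>i\<in>I. f i x) \<and> (AE xi in lborel. hat (\<lambda>x. \<Sum>i\<in>I. f i x) xi = (\<Sum>i\<in>I. hat (f i) xi))"
  if "infinite I" for I using that z by simp
 show "L2 (\<lambda>x. \<Sum>i\<in>{}. f i x) \<and> (AE xi in lborel. hat (\<lambda>x. \<Sum>i\<in>{}. f i x) xi = (\<Sum>i\<in>{}. hat (f i) xi))"
  using \<open>AE xi in lborel. hat (\<lambda>x::'b. 0) xi = 0\<close> z by simp
qed

lemma L2_hat_diff:
 assumes "L2 f" "L2 g"
 shows "L2 (\<lambda>x. f x - g x)" "AE xi in lborel. hat (\<lambda>x. f x - g x) xi = hat f xi - hat g xi"
proof -
 note m = L2_hat_cmult[OF assms(2), of "-1"]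
 show "L2 (\<lambda>x. f x - g x)" using L2_hat_add(1)[OF assms(1) m(1)] by simp
 show "AE xi in lborel. hat (\<lambda>x. f x - g x) xi = hat f xi - hat g xi"
  using L2_hat_add(2)[OF assms(1) m(1)] m(2) by (simp, eventually_elim, simp)
qed

lemma L2_parseval:
 assumes "L2 f" "L2 g"
 shows "integrable lebesgue (\<lambda>x. f x * cnj (g x))"
  "(LINT x|lebesgue. f x * cnj (g x)) = (LINT xi|lborel. hat f xi * cnj (hat g xi))"
proof -
 obtain f' where f': "sqint f'" "AE x in lborel. f x = f' x" "hat f = hat f'" using L2_hat(4)[OF assms(1)] by blast
 obtain g' where g': "sqint g'" "AE x in lborel. g x = g' x" "hat g = hat g'" using L2_hat(4)[OF assms(2)] by blast
 note [measurable] = sqint_measurable[OF f'(1)] sqint_measurable[OF g'(1)]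
 have b: "(\<lambda>x. f' x * cnj (g' x)) \<in> borel_measurable borel" by measurable
 have cn: "cnj \<in> borel_measurable borel" by measurable
 have fm: "(\<lambda>x. f x * cnj (g x)) \<in> borel_measurable lebesgue"
  using L2_measurable[OF assms(1)] measurable_compose[OF L2_measurable[OF assms(2)] cn] by (rule borel_measurable_times)
 have gm: "(\<lambda>x. f' x * cnj (g' x)) \<in> borel_measurable lebesgue" using b by (simp add: measurable_completion)
 have ae: "AE x in lebesgue. f x * cnj (g x) = f' x * cnj (g' x)"
  using f'(2) g'(2) unfolding AE_completion_iff by eventually_elim simp
 have "integrable lborel (\<lambda>x. f' x * cnj (g' x))"
  by (intro integrable_sqint_mult(1) f' sqint_cnj g')
 then show "integrable lebesgue (\<lambda>x. f x * cnj (g x))"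
  using integrable_cong_AE[OF fm gm ae] b by (simp add: integrable_completion)
 show "(LINT x|lebesgue. f x * cnj (g x)) = (LINT xi|lborel. hat f xi * cnj (hat g xi))"
  using integral_cong_AE[OF fm gm ae] b hat_parseval[OF f'(1) g'(1)] f'(3) g'(3)
  by (simp add: integral_completion)
qed

abbreviation jbs :: "real => ('a::euclidean_space => complex) => 'a => complex" where
 "jbs s f \<equiv> (\<lambda>xi. of_real (jb xi powr s) * f xi)"

text \<open>Plancherel removes the inverse transform from the norm, and the reflection hidden in
  \<open>inv_fourier\<close> preserves it. From here on Sobolev norms are weighted norms of
  transforms.\<close>

lemma weighted_fourier_hat:
 fixes f :: "'a::euclidean_space => complex"
 assumes f: "L2 f"
 shows "L2 (weighted_fourier s f) \<longleftrightarrow> sqint (jbs s (hat f))"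
  "L2 (weighted_fourier s f) \<Longrightarrow> L2_norm (inv_fourier (weighted_fourier s f)) = nrm (jbs s (hat f))"
proof -
 note [measurable] = sqint_measurable[OF L2_hat(1)[OF f]]
 have eq: "(1 + (norm xi)\<^sup>2) powr (s / 2) = jb xi powr s" for xi :: 'a
  by (simp add: jb_def powr_half_sqrt[symmetric] powr_powr add_nonneg_nonneg)
 have ae: "AE xi in lborel. weighted_fourier s f xi = jbs s (hat f) xi"
  using L2_hat(3)[OF f] by eventually_elim (simp add: weighted_fourier_def eq)
 have b: "jbs s (hat f) \<in> borel_measurable borel" by measurable
 show iff: "L2 (weighted_fourier s f) \<longleftrightarrow> sqint (jbs s (hat f))"
 proof
  assume w: "L2 (weighted_fourier s f)"
  have "jbs s (hat f) \<in> borel_measurable lebesgue" using b by (simp add: measurable_completion)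
  then show "sqint (jbs s (hat f))"
   using L2_cong_AE(1)[OF L2_measurable[OF w] _ ae] w L2_borel[OF b] by simp
 qed (rule L2_of_AE_sqint(1)[OF _ ae])
 assume w: "L2 (weighted_fourier s f)"
 then have s: "sqint (jbs s (hat f))" by (simp add: iff)
 note h = L2_hat[OF w]
 have r: "sqint (\<lambda>x. hat (weighted_fourier s f) (- x))" using sqint_reflect[OF h(1), of 0] by simp
 have "AE x in lborel. hat (weighted_fourier s f) (0 - x) = fourier (weighted_fourier s f) (0 - x)"
  by (rule AE_reflect[OF h(3)])
 then have "AE x in lborel. inv_fourier (weighted_fourier s f) x = hat (weighted_fourier s f) (- x)"
  by (auto simp: inv_fourier_def elim: eventually_mono)
 from L2_of_AE_sqint(2)[OF r this]
 have "L2_norm (inv_fourier (weighted_fourier s f)) = nrm (hat (weighted_fourier s f))"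
  using nrm_reflect[OF sqint_measurable[OF h(1)], of 0] by simp
 then show "L2_norm (inv_fourier (weighted_fourier s f)) = nrm (jbs s (hat f))"
  using h(2) L2_of_AE_sqint(2)[OF s ae] by simp
qed

lemma sobolev_iff:
 "u \<in> sobolev s \<longleftrightarrow> (\<forall>b\<in>Basis. L2 (component b u) \<and> sqint (jbs s (hat (component b u))))"
 unfolding sobolev_def using weighted_fourier_hat(1) by blast

lemma sobolev_norm_hat:
 assumes "u \<in> sobolev s"
 shows "sobolev_norm s u = L2_set (\<lambda>b. nrm (jbs s (hat (component b u)))) Basis"
 using assms weighted_fourier_hat(2) unfolding sobolev_norm_def L2_set_def
 by (intro arg_cong[where f=sqrt] sum.cong refl arg_cong[where f="\<lambda>x. x\<^sup>2"]) (auto simp: sobolev_def)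

lemma sobolev_norm_nonneg: "0 \<le> sobolev_norm s u"
 unfolding sobolev_norm_def by (simp add: sum_nonneg)

lemma sobolev_linear:
 fixes u v :: "'a::euclidean_space => 'b::euclidean_space"
 assumes u: "u \<in> sobolev s" and v: "v \<in> sobolev s"
 shows "(\<lambda>x. u x - v x) \<in> sobolev s" "(\<lambda>x. u x + v x) \<in> sobolev s" "(\<lambda>x. c *\<^sub>R u x) \<in> sobolev s"
  "\<And>b. b \<in> Basis \<Longrightarrow> AE xi in lborel. hat (component b (\<lambda>x. u x - v x)) xi = hat (component b u) xi - hat (component b v) xi"
proof -
 have cu: "L2 (component b u)" "sqint (jbs s (hat (component b u)))"
  and cv: "L2 (component b v)" "sqint (jbs s (hat (component b v)))" if "b \<in> Basis" for b
  using u v that by (auto simp: sobolev_iff)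
 have d: "component b (\<lambda>x. u x - v x) = (\<lambda>x. component b u x - component b v x)"
  and a: "component b (\<lambda>x. u x + v x) = (\<lambda>x. component b u x + component b v x)"
  and m: "component b (\<lambda>x. c *\<^sub>R u x) = (\<lambda>x. of_real c * component b u x)" for b
  by (auto simp: component_def inner_diff_left inner_add_left)
 show "AE xi in lborel. hat (component b (\<lambda>x. u x - v x)) xi = hat (component b u) xi - hat (component b v) xi" if "b \<in> Basis" for b
  unfolding d using L2_hat_diff[OF cu(1) cv(1), OF that that] by simp
 show "(\<lambda>x. u x - v x) \<in> sobolev s"
  unfolding sobolev_iff d
 proof (intro ballI conjI)
  fix b :: 'b assume b: "b \<in> Basis"
  note h = L2_hat_diff[OF cu(1)[OF b] cv(1)[OF b]]
  show "L2 (\<lambda>x. component b u x - component b v x)" by (rule h)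
  note [measurable] = sqint_measurable[OF L2_hat(1)[OF h(1)]]
  show "sqint (jbs s (hat (\<lambda>x. component b u x - component b v x)))"
   by (rule sqint_cong_AE[OF sqint_diff[OF cu(2)[OF b] cv(2)[OF b]]])
     (use h(2) in \<open>auto simp: right_diff_distrib elim: eventually_mono\<close>)
 qed
 show "(\<lambda>x. u x + v x) \<in> sobolev s"
  unfolding sobolev_iff a
 proof (intro ballI conjI)
  fix b :: 'b assume b: "b \<in> Basis"
  note h = L2_hat_add[OF cu(1)[OF b] cv(1)[OF b]]
  show "L2 (\<lambda>x. component b u x + component b v x)" by (rule h)
  note [measurable] = sqint_measurable[OF L2_hat(1)[OF h(1)]]
  show "sqint (jbs s (hat (\<lambda>x. component b u x + component b v x)))"
   by (rule sqint_cong_AE[OF sqint_add[OF cu(2)[OF b] cv(2)[OF b]]])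
     (use h(2) in \<open>auto simp: distrib_left elim: eventually_mono\<close>)
 qed
 show "(\<lambda>x. c *\<^sub>R u x) \<in> sobolev s"
  unfolding sobolev_iff m
 proof (intro ballI conjI)
  fix b :: 'b assume b: "b \<in> Basis"
  note h = L2_hat_cmult[OF cu(1)[OF b], of "of_real c"]
  show "L2 (\<lambda>x. of_real c * component b u x)" by (rule h)
  note [measurable] = sqint_measurable[OF L2_hat(1)[OF h(1)]]
  show "sqint (jbs s (hat (\<lambda>x. of_real c * component b u x)))"
   by (rule sqint_cong_AE[OF sqint_cmult[OF cu(2)[OF b], of "of_real c"]])
     (use h(2) in \<open>auto elim: eventually_mono\<close>)
 qed
qed

text \<open>The reverse triangle inequality in each component and Minkowski's inequality across the
  components. It makes the norm Lipschitz, hence measurable along strongly measurable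
  functions.\<close>

lemma sobolev_norm_diff_abs:
 assumes u: "u \<in> sobolev s" and v: "v \<in> sobolev s"
 shows "\<bar>sobolev_norm s u - sobolev_norm s v\<bar> \<le> sobolev_norm s (\<lambda>x. u x - v x)"
proof -
 let ?n = "\<lambda>w b. nrm (jbs s (hat (component b w)))" and ?d = "\<lambda>x. u x - v x"
 note d = sobolev_linear(1)[OF u v]
 have e: "?n ?d b = nrm (\<lambda>xi. jbs s (hat (component b u)) xi - jbs s (hat (component b v)) xi)"
  if b: "b \<in> Basis" for b
 proof (rule nrm_cong_AE)
  show "AE xi in lborel. jbs s (hat (component b ?d)) xi = jbs s (hat (component b u)) xi - jbs s (hat (component b v)) xi"
   using sobolev_linear(4)[OF u v b] by eventually_elim (simp add: right_diff_distrib)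
 qed (use u v d b in \<open>auto simp: sobolev_iff intro!: sqint_measurable sqint_diff\<close>)
 have "\<bar>?n u b - ?n v b\<bar> \<le> ?n ?d b" if b: "b \<in> Basis" for b
  unfolding e[OF b] using u v b by (intro nrm_diff_abs) (auto simp: sobolev_iff)
 then have 1: "?n u b \<le> ?n v b + ?n ?d b" "?n v b \<le> ?n u b + ?n ?d b" if "b \<in> Basis" for b
  using that by (auto simp: abs_le_iff algebra_simps)
 have "sobolev_norm s u \<le> sobolev_norm s v + sobolev_norm s ?d" if u: "u \<in> sobolev s" and v: "v \<in> sobolev s"
  and 1: "\<And>b. b \<in> Basis \<Longrightarrow> ?n u b \<le> ?n v b + ?n ?d b" for u v
  unfolding sobolev_norm_hat[OF u] sobolev_norm_hat[OF v] sobolev_norm_hat[OF d]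
  by (rule order_trans[OF L2_set_mono L2_set_triangle_ineq]) (use 1 in auto)
 from this[OF u v 1(1)] this[OF v u 1(2)] show ?thesis by (simp add: abs_le_iff)
qed

lemma sobolev_norm_component_le:
 assumes "u \<in> sobolev s" "b \<in> Basis"
 shows "nrm (jbs s (hat (component b u))) \<le> sobolev_norm s u"
 unfolding sobolev_norm_hat[OF assms(1)] using assms(2) by (intro member_le_L2_set) auto

section \<open>The transport pairing on the Fourier side\<close>

lemma integrable_vecI:
 fixes f :: "'a => real^'n"
 assumes "\<And>j. integrable M (\<lambda>x. f x $ j)"
 shows "integrable M f" "(LINT x|M. f x) $ j = (LINT x|M. f x $ j)"
proof -
 have eq: "f x = (\<Sum>j\<in>UNIV. (f x $ j) *\<^sub>R axis j 1)" for x
  by (simp add: vec_eq_iff axis_def if_distrib[of "\<lambda>y. _ * y"] cong: if_cong)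
 show i: "integrable M f"
  by (subst eq[abs_def]) (intro Bochner_Integration.integrable_sum integrable_scaleR_left assms)
 show "(LINT x|M. f x) $ j = (LINT x|M. f x $ j)"
  using Bochner_Integration.integral_inner_left[OF i, of "axis j 1"] by (simp add: inner_axis)
qed

lemma integrable_vec_nth:
 fixes f :: "'a => real^'n"
 assumes "integrable M f"
 shows "integrable M (\<lambda>x. f x $ j)"
 using Bochner_Integration.integrable_inner_left[OF assms, of "axis j 1"] by (simp add: inner_axis)

lemma locally_integrable_vec:
 fixes f :: "real^'d => real^'n"
 shows "locally_integrable f \<longleftrightarrow> (\<forall>j. locally_integrable (\<lambda>x. f x $ j))"
proof -
 have "integrable lebesgue (\<lambda>x. indicator K x *\<^sub>R f x) \<longleftrightarrow> (\<forall>j. integrable lebesgue (\<lambda>x. indicator K x *\<^sub>R f x $ j))" for K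
  using integrable_vecI(1)[of lebesgue "\<lambda>x. indicator K x *\<^sub>R f x"]
   integrable_vec_nth[of lebesgue "\<lambda>x. indicator K x *\<^sub>R f x"] by simp blast
 then show ?thesis
  unfolding locally_integrable_def set_integrable_def by blast
qed

lemma locally_integrable_mult_test:
 fixes h :: "'a::euclidean_space => real"
 assumes h: "locally_integrable h" and psi: "test_function D (psi :: 'a => real)"
 shows "integrable lebesgue (\<lambda>x. psi x * h x)"
proof -
 let ?K = "closure {x. psi x \<noteq> 0}"
 have i: "integrable lebesgue (\<lambda>x. indicator ?K x * h x)"
  using h psi unfolding locally_integrable_def set_integrable_def test_function_def by auto
 obtain B where B: "\<And>x. norm (psi x) \<le> B" "B > 0" using test_function_bounded[OF psi] by blast
 have m: "psi \<in> borel_measurable lebesgue"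
  using test_function_measurable_lebesgue[OF psi] by (simp add: measurable_completion)
 have "integrable lebesgue (\<lambda>x. psi x * (indicator ?K x * h x))"
 proof (rule Bochner_Integration.integrable_bound[OF integrable_mult_right[OF i, of B]])
  show "(\<lambda>x. psi x * (indicator ?K x * h x)) \<in> borel_measurable lebesgue"
   by (intro borel_measurable_times m borel_measurable_integrable[OF i])
  show "AE x in lebesgue. norm (psi x * (indicator ?K x * h x)) \<le> norm (B * (indicator ?K x * h x))"
   using B unfolding norm_mult by (intro AE_I2 mult_right_mono) auto
 qed
 also have "(\<lambda>x. psi x * (indicator ?K x * h x)) = (\<lambda>x. psi x * h x)"
  using closure_subset[of "{x. psi x \<noteq> 0}"] by (auto simp: indicator_def fun_eq_iff)
 finally show ?thesis .
qed

lemma L2_locally_integrable: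
 fixes f :: "'a::euclidean_space => real"
 assumes "L2 (\<lambda>x. of_real (f x))"
 shows "locally_integrable f"
proof -
 obtain f' where f': "sqint f'" "AE x in lborel. of_real (f x) = f' x" using L2_hat(4)[OF assms] by blast
 have ae: "AE x in lebesgue. f x = Re (f' x)"
  using f'(2) unfolding AE_completion_iff by eventually_elim (simp add: complex_eq_iff)
 have m: "f \<in> borel_measurable lebesgue"
  using measurable_compose[OF L2_measurable[OF assms] borel_measurable_Re] by simp
 show ?thesis
  unfolding locally_integrable_def set_integrable_def
 proof (intro allI impI)
  fix K :: "'a set" assume K: "compact K"
  then have [measurable]: "K \<in> sets borel" by (simp add: compact_imp_closed)
  have Km: "(indicator K :: 'a => real) \<in> borel_measurable lebesgue" by (intro borel_measurable_indicator) auto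
  have i: "integrable lebesgue (\<lambda>x. indicator K x *\<^sub>R Re (f' x))"
   using sqint_locally_integrable(1)[OF f'(1)] K unfolding locally_integrable_def set_integrable_def by blast
  have "AE x in lebesgue. indicator K x *\<^sub>R Re (f' x) = indicator K x *\<^sub>R f x"
   using ae by eventually_elim simp
  from integrable_cong_AE_imp[OF i borel_measurable_scaleR[OF Km m]] this
  show "integrable lebesgue (\<lambda>x. indicator K x *\<^sub>R f x)" by (auto elim: eventually_mono)
 qed
qed

text \<open>The choice in \<open>weak_partial\<close> is justified by a candidate built component by
  component on the Fourier side. By the fundamental lemma the chosen function agrees with it almost
  everywhere and therefore has the same transform.\<close>

lemma weak_partial_hat:
 fixes g :: "real^'d => real^'n" and a :: "'d::finite"
 assumes g: "\<And>j. L2 (\<lambda>x. of_real (g x $ j))"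
  and dg: "\<And>j. sqint (\<lambda>xi. of_real (xi $ a) * hat (\<lambda>x. of_real (g x $ j)) xi)"
 shows "L2 (\<lambda>x. of_real (weak_partial a g x $ j))"
  "AE xi in lborel. hat (\<lambda>x. of_real (weak_partial a g x $ j)) xi = \<i> * of_real (xi $ a) * hat (\<lambda>x. of_real (g x $ j)) xi"
proof -
 define P where "P h \<longleftrightarrow> locally_integrable h \<and>
   (\<forall>psi::real^'d => real. test_function UNIV psi \<longrightarrow>
    (LINT x|lebesgue. frechet_derivative psi (at x) (axis a 1) *\<^sub>R g x) =
    - (LINT x|lebesgue. psi x *\<^sub>R h x))" for h :: "real^'d => real^'n"
 have gl: "locally_integrable (\<lambda>x. g x $ j)" for j by (rule L2_locally_integrable[OF g])
 define Q where "Q j h \<longleftrightarrow> sqint (\<lambda>x. of_real (h x)) \<and>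
   (AE xi in lborel. hat (\<lambda>x. of_real (h x)) xi = \<i> * of_real (xi $ a) * hat (\<lambda>x. of_real (g x $ j)) xi) \<and>
   (\<forall>psi::real^'d => real. test_function UNIV psi \<longrightarrow>
    (LINT x|lebesgue. frechet_derivative psi (at x) (axis a 1) * g x $ j) = - (LINT x|lebesgue. psi x * h x))" for j and h :: "real^'d => real"
 have "\<exists>h. Q j h" for j
 proof -
  obtain w' where w': "sqint w'" "AE x in lborel. of_real (g x $ j) = w' x" "hat (\<lambda>x. of_real (g x $ j)) = hat w'"
   using L2_hat(4)[OF g[of j]] by blast
  note [measurable] = sqint_measurable[OF w'(1)]
  define w where "w x = Re (w' x)" for x
  have [measurable]: "w \<in> borel_measurable borel" unfolding w_def by measurable
  have ww': "AE x in lborel. complex_of_real (w x) = w' x"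
   using w'(2) by eventually_elim (simp add: complex_eq_iff w_def)
  have w: "sqint (\<lambda>x. complex_of_real (w x))"
   by (rule sqint_cong_AE[OF w'(1) _ ww']) measurable
  have hw: "hat (\<lambda>x. complex_of_real (w x)) = hat (\<lambda>x. of_real (g x $ j))"
   using L2_of_AE_sqint(3)[OF w'(1) ww'] w'(3) by simp
  have gw: "AE x in lebesgue. g x $ j = w x"
   using w'(2) unfolding AE_completion_iff by eventually_elim (simp add: complex_eq_iff w_def)
  have gm: "(\<lambda>x. g x $ j) \<in> borel_measurable lebesgue"
   using measurable_compose[OF L2_measurable[OF g[of j]] borel_measurable_Re] by simp
  have wm: "w \<in> borel_measurable lebesgue" by (rule measurable_completion) simp
  have "sqint (\<lambda>xi. of_real (axis a 1 \<bullet> xi) * hat (\<lambda>x. of_real (w x)) xi)"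
   using dg[of j] by (simp add: hw inner_axis')
  from weak_derivative_exists[OF w this]
  obtain h :: "real^'d => real" where h: "sqint (\<lambda>x. of_real (h x))"
   "AE xi in lborel. hat (\<lambda>x. of_real (h x)) xi = \<i> * of_real (xi $ a) * hat (\<lambda>x. of_real (g x $ j)) xi"
   "\<And>psi::real^'d => real. test_function UNIV psi \<Longrightarrow>
    (LINT x|lborel. frechet_derivative psi (at x) (axis a 1) * w x) = - (LINT x|lborel. psi x * h x)"
   by (auto simp: hw inner_axis')
  have [measurable]: "h \<in> borel_measurable borel"
  proof -
   have "(\<lambda>x. Re (complex_of_real (h x))) \<in> borel_measurable borel"
    using measurable_compose[OF sqint_measurable[OF h(1)] borel_measurable_Re] .
   then show ?thesis by simp
  qed
  have "(LINT x|lebesgue. frechet_derivative psi (at x) (axis a 1) * g x $ j) = - (LINT x|lebesgue. psi x * h x)"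
   if psi: "test_function UNIV psi" for psi :: "real^'d => real"
  proof -
   have [measurable]: "psi \<in> borel_measurable borel" by (rule test_function_measurable_lebesgue[OF psi])
   have dm: "(\<lambda>x. frechet_derivative psi (at x) (axis a 1)) \<in> borel_measurable borel"
    by (rule test_function_measurable_lebesgue[OF test_function_derivative[OF psi]])
   note [measurable] = dm
   have dm': "(\<lambda>x. frechet_derivative psi (at x) (axis a 1)) \<in> borel_measurable lebesgue"
    using dm by (simp add: measurable_completion)
   have "(LINT x|lebesgue. frechet_derivative psi (at x) (axis a 1) * g x $ j) =
     (LINT x|lebesgue. frechet_derivative psi (at x) (axis a 1) * w x)"
    using gw by (intro integral_cong_AE borel_measurable_times dm' gm wm) (auto elim: eventually_mono)
   also have "\<dots> = (LINT x|lborel. frechet_derivative psi (at x) (axis a 1) * w x)"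
    by (rule integral_completion) measurable
   also have "\<dots> = - (LINT x|lborel. psi x * h x)" by (rule h(3)[OF psi])
   also have "(LINT x|lborel. psi x * h x) = (LINT x|lebesgue. psi x * h x)"
    by (rule integral_completion[symmetric]) measurable
   finally show ?thesis .
  qed
  with h show ?thesis unfolding Q_def by blast
 qed
 then obtain h where "\<And>j. Q j (h j)"
  using choice[of Q] by blast
 then have h: "\<And>j. sqint (\<lambda>x. of_real (h j x))"
   "\<And>j. AE xi in lborel. hat (\<lambda>x. of_real (h j x)) xi = \<i> * of_real (xi $ a) * hat (\<lambda>x. of_real (g x $ j)) xi"
   "\<And>j psi. test_function UNIV psi \<Longrightarrow>
    (LINT x|lebesgue. frechet_derivative psi (at x) (axis a 1) * g x $ j) = - (LINT x|lebesgue. psi x * h j x)"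
  unfolding Q_def by blast+
 have hl: "locally_integrable (h j)" for j
  using sqint_locally_integrable(1)[OF h(1)[of j]] by simp
 have int1: "integrable lebesgue (\<lambda>x. (frechet_derivative psi (at x) (axis a 1) *\<^sub>R g x) $ j)"
  if "test_function UNIV psi" for psi :: "real^'d => real" and j
  using locally_integrable_mult_test[OF gl test_function_derivative[OF that]] by simp
 have "P (\<lambda>x. \<chi> j. h j x)"
  unfolding P_def
 proof (intro conjI allI impI)
  show "locally_integrable (\<lambda>x. \<chi> j. h j x)" using hl by (simp add: locally_integrable_vec)
  fix psi :: "real^'d => real" assume psi: "test_function UNIV psi"
  have "integrable lebesgue (\<lambda>x. (psi x *\<^sub>R (\<chi> j. h j x)) $ j)" for j
   using locally_integrable_mult_test[OF hl psi] by simp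
  from integrable_vecI(2)[OF this] integrable_vecI(2)[OF int1[OF psi]] h(3)[OF psi]
  show "(LINT x|lebesgue. frechet_derivative psi (at x) (axis a 1) *\<^sub>R g x) = - (LINT x|lebesgue. psi x *\<^sub>R (\<chi> j. h j x))"
   by (simp add: vec_eq_iff)
 qed
 then have PW: "P (weak_partial a g)"
  unfolding weak_partial_def P_def[symmetric] by (rule someI[of P])
 have W: "AE x in lebesgue. weak_partial a g x $ j = h j x" for j
 proof -
  have Wl: "locally_integrable (\<lambda>x. weak_partial a g x $ j)" for j
   using PW unfolding P_def locally_integrable_vec by blast
  have "AE x in lebesgue. weak_partial a g x $ j - h j x = 0"
  proof (rule fundamental_lemma_variations)
   have "set_integrable lebesgue K (\<lambda>x. weak_partial a g x $ j - h j x)" if "compact K" for K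
    using Wl[of j] hl[of j] that by (auto simp: locally_integrable_def)
   then show "locally_integrable (\<lambda>x. weak_partial a g x $ j - h j x)" by (simp add: locally_integrable_def)
   fix psi :: "real^'d => real" assume psi: "test_function UNIV psi"
   have i: "integrable lebesgue (\<lambda>x. (psi x *\<^sub>R weak_partial a g x) $ k)" for k
    using locally_integrable_mult_test[OF Wl psi] by simp
   have "(LINT x|lebesgue. frechet_derivative psi (at x) (axis a 1) *\<^sub>R g x) = - (LINT x|lebesgue. psi x *\<^sub>R weak_partial a g x)"
    using PW psi unfolding P_def by blast
   from this[THEN arg_cong[where f="\<lambda>v. v $ j"]]
   have "(LINT x|lebesgue. frechet_derivative psi (at x) (axis a 1) * g x $ j) = - (LINT x|lebesgue. psi x * weak_partial a g x $ j)"
    using integrable_vecI(2)[OF i, of j] integrable_vecI(2)[OF int1[OF psi], of j] by simp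
   then have "(LINT x|lebesgue. psi x * weak_partial a g x $ j) = (LINT x|lebesgue. psi x * h j x)"
    using h(3)[OF psi, of j] by simp
   then show "(LINT x|lebesgue. psi x * (weak_partial a g x $ j - h j x)) = 0"
    using locally_integrable_mult_test[OF Wl psi] locally_integrable_mult_test[OF hl psi]
    by (simp add: right_diff_distrib)
  qed
  then show ?thesis by eventually_elim simp
 qed
 have "AE x in lborel. complex_of_real (weak_partial a g x $ j) = of_real (h j x)"
  using W[of j] unfolding AE_completion_iff by eventually_elim simp
 from L2_of_AE_sqint(1,3)[OF h(1) this] h(2)[of j]
 show "L2 (\<lambda>x. of_real (weak_partial a g x $ j))"
  "AE xi in lborel. hat (\<lambda>x. of_real (weak_partial a g x $ j)) xi = \<i> * of_real (xi $ a) * hat (\<lambda>x. of_real (g x $ j)) xi"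
  by auto
qed

section \<open>Transforms with a weight of order one\<close>

abbreviation jb1 :: "('a::euclidean_space => complex) => 'a => complex" where
 "jb1 f \<equiv> (\<lambda>xi. of_real (jb xi) * f xi)"

lemma sqint_jb1I:
 assumes "f \<in> borel_measurable borel" "sqint (jb1 f)" shows "sqint f"
proof (rule sqint_bound[OF assms(2,1), where c=1])
 show "AE x in lborel. cmod (f x) \<le> 1 * cmod (jb1 f x)"
 proof (rule AE_I2)
  fix x show "cmod (f x) \<le> 1 * cmod (jb1 f x)"
   using mult_right_mono[OF jb_ge_1[of x], of "cmod (f x)"] jb_pos[of x] by (simp add: norm_mult)
 qed
qed

text \<open>The bracket is at most one plus the sum of the absolute coordinates, and a coordinate
  times the transform is, up to a unimodular factor, the transform of a derivative.\<close>

lemma test_function_jb1: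
 fixes phi :: "'a::euclidean_space => real"
 assumes phi: "test_function D phi"
 shows "sqint (jb1 (hat (\<lambda>x. of_real (phi x))))"
proof -
 let ?h = "hat (\<lambda>x. of_real (phi x))"
 note s = test_function_integrable(2)[OF phi]
 note hs = hat_fourier(1)[OF s]
 note [measurable] = sqint_measurable[OF hs]
 have d: "sqint (\<lambda>xi. of_real \<bar>b \<bullet> xi\<bar> * of_real (cmod (?h xi)))" for b
 proof (rule sqint_bound[OF hat_fourier(1)[OF test_function_integrable(2)[OF test_function_derivative[OF phi, of b]]], where c=1])
  show "AE xi in lborel. cmod (of_real \<bar>b \<bullet> xi\<bar> * of_real (cmod (?h xi))) \<le> 1 * cmod (hat (\<lambda>x. of_real (frechet_derivative phi (at x) b)) xi)"
   using hat_derivative[OF phi, of b] by eventually_elim (simp add: norm_mult)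
 qed measurable
 have "sqint (\<lambda>xi. of_real (cmod (?h xi)))"
  by (rule sqint_bound[OF hs, where c=1]) auto
 then have big: "sqint (\<lambda>xi. of_real (cmod (?h xi)) + (\<Sum>b\<in>Basis. of_real \<bar>b \<bullet> xi\<bar> * of_real (cmod (?h xi))))"
  by (intro sqint_add sqint_sum d)
 show ?thesis
 proof (rule sqint_bound[OF big, where c=1])
  show "AE xi in lborel. cmod (jb1 ?h xi) \<le> 1 * cmod (of_real (cmod (?h xi)) + (\<Sum>b\<in>Basis. of_real \<bar>b \<bullet> xi\<bar> * of_real (cmod (?h xi))))"
  proof (rule AE_I2)
   fix xi :: 'a
   have "jb xi \<le> 1 + norm xi"
    using jb_lipschitz[of xi 0] by (simp add: jb_def)
   also have "norm xi \<le> (\<Sum>b\<in>Basis. \<bar>b \<bullet> xi\<bar>)"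
    using norm_le_l1[of xi] by (simp add: inner_commute)
   finally have "jb xi * cmod (?h xi) \<le> (1 + (\<Sum>b\<in>Basis. \<bar>b \<bullet> xi\<bar>)) * cmod (?h xi)"
    by (intro mult_right_mono) auto
   also have "\<dots> = cmod (of_real ((1 + (\<Sum>b\<in>Basis. \<bar>b \<bullet> xi\<bar>)) * cmod (?h xi)))"
    by (simp only: norm_of_real) (simp add: sum_nonneg)
   also have "complex_of_real ((1 + (\<Sum>b\<in>Basis. \<bar>b \<bullet> xi\<bar>)) * cmod (?h xi)) =
     of_real (cmod (?h xi)) + (\<Sum>b\<in>Basis. of_real \<bar>b \<bullet> xi\<bar> * of_real (cmod (?h xi)))"
    by (simp add: distrib_right sum_distrib_right)
   finally show "cmod (jb1 ?h xi) \<le> 1 * cmod (of_real (cmod (?h xi)) + (\<Sum>b\<in>Basis. of_real \<bar>b \<bullet> xi\<bar> * of_real (cmod (?h xi))))"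
    using jb_pos[of xi] by (simp add: norm_mult)
  qed
 qed measurable
qed

lemma integrable_jb1:
 assumes [measurable]: "f \<in> borel_measurable borel" and "integrable lborel (\<lambda>xi. jb xi * cmod (f xi))"
 shows "integrable lborel f"
proof (rule Bochner_Integration.integrable_bound[OF assms(2)])
 show "AE x in lborel. norm (f x) \<le> norm (jb x * cmod (f x))"
 proof (rule AE_I2)
  fix x show "norm (f x) \<le> norm (jb x * cmod (f x))"
   using mult_right_mono[OF jb_ge_1[of x], of "cmod (f x)"] jb_pos[of x] by (simp add: norm_mult)
 qed
qed measurable

text \<open>The transforms of coefficients in \<open>H\<^sup>s\<close>, \<open>s > d/2 + 1\<close>, have this property.\<close>

definition good :: "('a::euclidean_space => complex) => bool" where
 "good alpha \<longleftrightarrow> sqint alpha \<and> integrable lborel (\<lambda>xi. jb xi * cmod (alpha xi))"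

lemma goodD: assumes "good alpha"
 shows "sqint alpha" "integrable lborel (\<lambda>xi. jb xi * cmod (alpha xi))" "integrable lborel alpha"
proof -
 show 1: "sqint alpha" and 2: "integrable lborel (\<lambda>xi. jb xi * cmod (alpha xi))"
  using assms by (simp_all add: good_def)
 show "integrable lborel alpha"
  by (rule integrable_jb1[OF sqint_measurable[OF 1] 2])
qed

text \<open>Peetre's inequality distributes a weight of order one over both factors, and Young's
  inequality applies to the weighted factors. The constant 2 is that of Peetre's inequality.\<close>

lemma conv_good:
 fixes alpha p :: "'a::euclidean_space => complex" and k :: "'a => real"
 assumes alpha: "good alpha" and p: "p \<in> borel_measurable borel" "sqint (jb1 p)"
  and k: "k \<in> borel_measurable borel" "\<And>xi. \<bar>k xi\<bar> \<le> jb xi"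
 shows "sqint (\<lambda>xi. of_real (k xi) * conv alpha p xi)"
  "nrm (\<lambda>xi. of_real (k xi) * conv alpha p xi) \<le> 2 * (LINT xi|lborel. jb xi * cmod (alpha xi)) * nrm (jb1 p)"
proof -
 note [measurable] = sqint_measurable[OF goodD(1)[OF alpha]] p(1) k(1)
 let ?p = "\<lambda>xi. 2 * (jb xi * cmod (alpha xi))" and ?q = "\<lambda>eta. jb eta * cmod (p eta)"
 have q: "(cmod (jb1 p eta))\<^sup>2 = (?q eta)\<^sup>2" for eta by (simp add: norm_mult abs_of_pos[OF jb_pos])
 have i: "integrable lborel ?p" "integrable lborel (\<lambda>eta. (?q eta)\<^sup>2)"
  using goodD(2)[OF alpha] sqint_integrable[OF p(2)] by (simp_all only: integrable_mult_right q)
 have nn: "0 \<le> ?p xi" "0 \<le> ?q xi" for xi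
  using less_imp_le[OF jb_pos[of xi]] by auto
 have bd: "\<bar>k xi\<bar> * cmod (alpha (xi - eta)) * cmod (p eta) \<le> ?p (xi - eta) * ?q eta" for xi eta
 proof -
  have "\<bar>k xi\<bar> \<le> 2 * jb (xi - eta) * jb eta" using k(2)[of xi] jb_peetre[of xi eta] by linarith
  then have "\<bar>k xi\<bar> * (cmod (alpha (xi - eta)) * cmod (p eta)) \<le> (2 * jb (xi - eta) * jb eta) * (cmod (alpha (xi - eta)) * cmod (p eta))"
   by (intro mult_right_mono) auto
  then show ?thesis by (simp add: mult_ac)
 qed
 have m: "alpha \<in> borel_measurable borel" "p \<in> borel_measurable borel" "k \<in> borel_measurable borel"
  "?p \<in> borel_measurable borel" "?q \<in> borel_measurable borel" by measurable
 show "sqint (\<lambda>xi. of_real (k xi) * conv alpha p xi)"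
  by (rule conv_sqint_aux(1)[OF m i nn bd])
 have "nrm (\<lambda>xi. of_real (k xi) * conv alpha p xi) \<le> (LINT xi|lborel. ?p xi) * sqrt (LINT eta|lborel. (?q eta)\<^sup>2)"
  by (rule conv_sqint_aux(2)[OF m i nn bd])
 then show "nrm (\<lambda>xi. of_real (k xi) * conv alpha p xi) \<le> 2 * (LINT xi|lborel. jb xi * cmod (alpha xi)) * nrm (jb1 p)"
  by (simp only: integral_mult_right_zero nrm_def q)
qed

text \<open>With \<open>alpha\<close>, \<open>v\<close> and \<open>p\<close> the transforms of a
  coefficient entry, of a component of the solution and of a component of the test function, this is
  the corresponding part of the transport pairing by Parseval. The factor \<open>xi $ a\<close>
  stays with the convolution because its product with \<open>v\<close> need not be square
  integrable.\<close>

definition TF :: "'d::finite => (real^'d => complex) => (real^'d => complex) => (real^'d => complex) => complex" where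
 "TF a alpha v p = of_real (fconst TYPE(real^'d)) *
   (LINT xi|lborel. (\<i> * v xi) * (of_real (xi $ a) * cnj (conv alpha p xi)))"

lemma hat_product_L2:
 fixes alpha :: "'a::euclidean_space => complex" and phi :: "'a => real"
 assumes alpha: "L2 alpha" and i: "integrable lborel (hat alpha)" and phi: "test_function D phi"
 shows "L2 (\<lambda>x. alpha x * of_real (phi x))"
  "AE xi in lborel. hat (\<lambda>x. alpha x * of_real (phi x)) xi = of_real (fconst TYPE('a)) * conv (hat alpha) (hat (\<lambda>x. of_real (phi x))) xi"
proof -
 obtain alpha' where alpha': "sqint alpha'" "AE x in lborel. alpha x = alpha' x" "hat alpha = hat alpha'" using L2_hat(4)[OF alpha] by blast
 have "AE x in lborel. alpha x * of_real (phi x) = alpha' x * of_real (phi x)"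
  using alpha'(2) by eventually_elim simp
 from L2_of_AE_sqint(1,3)[OF hat_product(1)[OF alpha'(1) i[unfolded alpha'(3)] phi] this]
  hat_product(2)[OF alpha'(1) i[unfolded alpha'(3)] phi] alpha'(3)
 show "L2 (\<lambda>x. alpha x * of_real (phi x))"
  "AE xi in lborel. hat (\<lambda>x. alpha x * of_real (phi x)) xi = of_real (fconst TYPE('a)) * conv (hat alpha) (hat (\<lambda>x. of_real (phi x))) xi"
  by auto
qed

lemma test_function_vec_nth:
 fixes phi :: "'a::euclidean_space => real^'n"
 assumes "test_function D phi" shows "test_function D (\<lambda>x. phi x $ i)"
proof (rule test_functionI)
 show "Ck k (\<lambda>x. phi x $ i)" for k
  using assms by (intro Ck_bounded_linear[OF bounded_linear_vec_nth]) (simp add: test_function_def)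
 show "compact (closure {x. phi x \<noteq> 0})" "closure {x. phi x \<noteq> 0} \<subseteq> D"
  using assms by (auto simp: test_function_def)
 show "phi x $ i = 0" if "x \<notin> closure {x. phi x \<noteq> 0}" for x
 proof -
  have "phi x = 0" using that closure_subset[of "{x. phi x \<noteq> 0}"] by blast
  then show ?thesis by simp
 qed
qed

text \<open>The minus sign of the pairing cancels the one from conjugating \<open>\<i>\<close>.
  Because of the transposition, entry \<open>i\<close>, \<open>j\<close> of the coefficient meets
  component \<open>i\<close> of the test function and component \<open>j\<close> of
  \<open>u\<close>.\<close>

lemma transport_pairing_TF:
 fixes A :: "real^'d => real^'n^'n" and u phi :: "real^'d => real^'n" and a :: "'d::finite"
 assumes A: "\<And>i j. L2 (\<lambda>x. of_real (A x $ i $ j))" "\<And>i j. good (hat (\<lambda>x. of_real (A x $ i $ j)))"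
  and u: "\<And>j. L2 (\<lambda>x. of_real (u x $ j))" and phi: "test_function D phi"
 shows "transport_pairing a A u phi =
  Re (\<Sum>i\<in>UNIV. \<Sum>j\<in>UNIV. TF a (hat (\<lambda>x. of_real (A x $ i $ j))) (hat (\<lambda>x. of_real (u x $ j))) (hat (\<lambda>x. of_real (phi x $ i))))"
proof -
 let ?c = "complex_of_real (fconst TYPE(real^'d))"
 let ?A = "\<lambda>i j. hat (\<lambda>x. complex_of_real (A x $ i $ j))" and ?u = "\<lambda>j. hat (\<lambda>x. complex_of_real (u x $ j))"
  and ?phi = "\<lambda>i. hat (\<lambda>x. complex_of_real (phi x $ i))"
 note phii = test_function_vec_nth[OF phi]
 define g where "g x = transpose (A x) *v phi x" for x
 have gj: "complex_of_real (g x $ j) = (\<Sum>i\<in>UNIV. of_real (A x $ i $ j) * of_real (phi x $ i))" for x j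
  by (simp add: g_def matrix_vector_mult_def transpose_def)
 note hp = hat_product_L2[OF A(1) goodD(3)[OF A(2)] phii]
 have gL: "L2 (\<lambda>x. complex_of_real (g x $ j))" for j
  unfolding gj using L2_hat_sum[of UNIV "\<lambda>i x. complex_of_real (A x $ i $ j) * complex_of_real (phi x $ i)"] hp(1) by simp
 have gh: "AE xi in lborel. hat (\<lambda>x. complex_of_real (g x $ j)) xi = (\<Sum>i\<in>UNIV. ?c * conv (?A i j) (?phi i) xi)" for j
 proof -
  have "AE xi in lborel. hat (\<lambda>x. complex_of_real (g x $ j)) xi =
   (\<Sum>i\<in>UNIV. hat (\<lambda>x. of_real (A x $ i $ j) * of_real (phi x $ i)) xi)"
   unfolding gj using L2_hat_sum[of UNIV "\<lambda>i x. complex_of_real (A x $ i $ j) * of_real (phi x $ i)"] hp(1) by simp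
  moreover have "AE xi in lborel. \<forall>i. hat (\<lambda>x. of_real (A x $ i $ j) * of_real (phi x $ i)) xi = ?c * conv (?A i j) (?phi i) xi"
   using hp(2) by (intro AE_all_countable[THEN iffD2]) auto
  ultimately show ?thesis by eventually_elim simp
 qed
 have phim: "?phi i \<in> borel_measurable borel" "sqint (jb1 (?phi i))" for i
  using hat_fourier(1)[OF test_function_integrable(2)[OF phii]] test_function_jb1[OF phii] by (auto intro: sqint_measurable)
 have dconv: "sqint (\<lambda>xi. of_real (xi $ a) * conv (?A i j) (?phi i) xi)" for i j
 proof (rule conv_good(1)[OF A(2) phim])
  show "\<bar>xi $ a\<bar> \<le> jb xi" for xi :: "real^'d"
   using component_le_norm_cart[of xi a] norm_le_jb[of xi] by linarith
 qed measurable
 have hm [measurable]: "?A i j \<in> borel_measurable borel" "?u j \<in> borel_measurable borel" "?phi i \<in> borel_measurable borel" for i j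
  using sqint_measurable[OF L2_hat(1)[OF A(1)]] sqint_measurable[OF L2_hat(1)[OF u]] phim by auto
 have gm [measurable]: "hat (\<lambda>x. complex_of_real (g x $ j)) \<in> borel_measurable borel" for j
  using sqint_measurable[OF L2_hat(1)[OF gL]] .
 have dsum: "sqint (\<lambda>xi. \<Sum>i\<in>UNIV. ?c * (of_real (xi $ a) * conv (?A i j) (?phi i) xi))" for j
  by (intro sqint_sum sqint_cmult dconv)
 have dg: "sqint (\<lambda>xi. of_real (xi $ a) * hat (\<lambda>x. complex_of_real (g x $ j)) xi)" for j
 proof (rule sqint_cong_AE[OF dsum[of j]])
  show "AE xi in lborel. of_real (xi $ a) * hat (\<lambda>x. complex_of_real (g x $ j)) xi = (\<Sum>i\<in>UNIV. ?c * (of_real (xi $ a) * conv (?A i j) (?phi i) xi))"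
   using gh[of j] by eventually_elim (simp add: sum_distrib_left mult_ac)
 qed measurable
 note W = weak_partial_hat[OF gL dg]
 have pair: "complex_of_real (LINT x|lebesgue. u x $ j * weak_partial a g x $ j) = - (\<Sum>i\<in>UNIV. TF a (?A i j) (?u j) (?phi i))"
  and pint: "integrable lebesgue (\<lambda>x. u x $ j * weak_partial a g x $ j)" for j
 proof -
  note p = L2_parseval[OF u[of j] W(1)[of j]]
  show "integrable lebesgue (\<lambda>x. u x $ j * weak_partial a g x $ j)"
   using integrable_Re[OF p(1)] by simp
  note [measurable] = sqint_measurable[OF L2_hat(1)[OF W(1)[of j]]]
  have "complex_of_real (LINT x|lebesgue. u x $ j * weak_partial a g x $ j) = (LINT xi|lborel. ?u j xi * cnj (hat (\<lambda>x. of_real (weak_partial a g x $ j)) xi))"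
   using p(2) by (simp add: integral_complex_of_real[symmetric] del: integral_complex_of_real)
  also have "\<dots> = (LINT xi|lborel. - (\<Sum>i\<in>UNIV. ?c * ((\<i> * ?u j xi) * (of_real (xi $ a) * cnj (conv (?A i j) (?phi i) xi)))))"
  proof (rule integral_cong_AE)
   show "AE xi in lborel. ?u j xi * cnj (hat (\<lambda>x. of_real (weak_partial a g x $ j)) xi) =
    - (\<Sum>i\<in>UNIV. ?c * ((\<i> * ?u j xi) * (of_real (xi $ a) * cnj (conv (?A i j) (?phi i) xi))))"
    using W(2)[of j] gh[of j]
   proof eventually_elim
    case (elim xi)
    show ?case unfolding elim by (simp add: sum_distrib_left sum_negf mult_ac)
   qed
  qed measurable
  also have "\<dots> = - (\<Sum>i\<in>UNIV. TF a (?A i j) (?u j) (?phi i))"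
  proof -
   have "integrable lborel (\<lambda>xi. (\<i> * ?u j xi) * (of_real (xi $ a) * cnj (conv (?A i j) (?phi i) xi)))" for i
    using integrable_sqint_mult(1)[OF sqint_cmult[OF L2_hat(1)[OF u]] sqint_cnj[OF dconv]] by simp
   then show ?thesis unfolding TF_def by (simp add: Bochner_Integration.integral_sum)
  qed
  finally show "complex_of_real (LINT x|lebesgue. u x $ j * weak_partial a g x $ j) = - (\<Sum>i\<in>UNIV. TF a (?A i j) (?u j) (?phi i))" .
 qed
 have "complex_of_real (transport_pairing a A u phi) = - (\<Sum>j\<in>UNIV. complex_of_real (LINT x|lebesgue. u x $ j * weak_partial a g x $ j))"
  unfolding transport_pairing_def g_def[symmetric] inner_vec_def using pint by (simp add: Bochner_Integration.integral_sum)
 also have "\<dots> = (\<Sum>j\<in>UNIV. \<Sum>i\<in>UNIV. TF a (?A i j) (?u j) (?phi i))"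
  unfolding pair by (simp add: sum_negf)
 also have "\<dots> = (\<Sum>i\<in>UNIV. \<Sum>j\<in>UNIV. TF a (?A i j) (?u j) (?phi i))"
  by (rule sum.swap)
 finally show ?thesis by (simp only: complex_eq_iff Re_complex_of_real)
qed

section \<open>Bounds for the transport form\<close>

lemma abs_nth_le_jb: "\<bar>xi $ a\<bar> \<le> jb (xi :: real^'d)"
 using component_le_norm_cart[of xi a] norm_le_jb[of xi] by linarith

lemma conv_component:
 fixes alpha p :: "real^'d => complex"
 assumes "good alpha" "p \<in> borel_measurable borel" "sqint (jb1 p)"
 shows "sqint (\<lambda>xi. of_real (xi $ a) * conv alpha p xi)"
  "nrm (\<lambda>xi. of_real (xi $ a) * conv alpha p xi) \<le> 2 * (LINT xi|lborel. jb xi * cmod (alpha xi)) * nrm (jb1 p)"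
 using conv_good[OF assms, of "\<lambda>xi. xi $ a"] abs_nth_le_jb by auto

lemma TF_integrable:
 assumes "good alpha" "sqint v" "p \<in> borel_measurable borel" "sqint (jb1 p)"
 shows "integrable lborel (\<lambda>xi. (\<i> * v xi) * (of_real (xi $ a) * cnj (conv alpha p xi)))"
 using integrable_sqint_mult(1)[OF sqint_cmult[OF assms(2), of \<i>] sqint_cnj[OF conv_component(1)[OF assms(1,3,4), of a]]]
 by simp

lemma TF_bound:
 fixes alpha v p :: "real^'d => complex"
 assumes "good alpha" "sqint v" "p \<in> borel_measurable borel" "sqint (jb1 p)"
 shows "cmod (TF a alpha v p) \<le> 2 * fconst TYPE(real^'d) * nrm v * (LINT xi|lborel. jb xi * cmod (alpha xi)) * nrm (jb1 p)"
proof -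
 let ?c = "fconst TYPE(real^'d)"
 have "cmod (LINT xi|lborel. (\<i> * v xi) * cnj (of_real (xi $ a) * conv alpha p xi)) \<le>
   nrm (\<lambda>xi. \<i> * v xi) * nrm (\<lambda>xi. cnj (of_real (xi $ a) * conv alpha p xi))"
  by (intro Cauchy_Schwarz_sqint sqint_cmult sqint_cnj conv_component assms)
 also have "\<dots> = nrm v * nrm (\<lambda>xi. of_real (xi $ a) * conv alpha p xi)"
  by (simp only: nrm_cnj nrm_cmult norm_ii mult_1)
 also have "\<dots> \<le> nrm v * (2 * (LINT xi|lborel. jb xi * cmod (alpha xi)) * nrm (jb1 p))"
  by (intro mult_left_mono conv_component assms) simp
 finally have "?c * cmod (LINT xi|lborel. (\<i> * v xi) * cnj (of_real (xi $ a) * conv alpha p xi)) \<le>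
   ?c * (nrm v * (2 * (LINT xi|lborel. jb xi * cmod (alpha xi)) * nrm (jb1 p)))"
  by (intro mult_left_mono) (auto intro: less_imp_le[OF fconst_pos])
 then show ?thesis
  using fconst_pos[where 'a="real^'d"] unfolding TF_def by (simp add: norm_mult abs_of_pos mult_ac)
qed

lemma conv_integrable: "sqint alpha \<Longrightarrow> sqint p \<Longrightarrow> integrable lborel (\<lambda>eta. alpha (xi - eta) * p eta)"
 by (rule integrable_sqint_mult(1)[OF sqint_reflect])

lemma conv_diff_right:
 "sqint alpha \<Longrightarrow> sqint p \<Longrightarrow> sqint q \<Longrightarrow> conv alpha (\<lambda>xi. p xi - q xi) xi = conv alpha p xi - conv alpha q xi"
 unfolding conv_def right_diff_distrib by (rule Bochner_Integration.integral_diff[OF conv_integrable conv_integrable])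

lemma conv_diff_left:
 "sqint alpha \<Longrightarrow> sqint beta \<Longrightarrow> sqint p \<Longrightarrow> conv (\<lambda>xi. alpha xi - beta xi) p xi = conv alpha p xi - conv beta p xi"
 unfolding conv_def left_diff_distrib by (rule Bochner_Integration.integral_diff[OF conv_integrable conv_integrable])

lemma jb1_diff: "jb1 (\<lambda>xi. p xi - q xi) = (\<lambda>xi. jb1 p xi - jb1 q xi)"
 by (simp add: right_diff_distrib)

lemma TF_diff_p:
 assumes alpha: "good alpha" and v: "sqint v" and p: "p \<in> borel_measurable borel" "sqint (jb1 p)"
  and q: "q \<in> borel_measurable borel" "sqint (jb1 q)"
 shows "TF a alpha v (\<lambda>xi. p xi - q xi) = TF a alpha v p - TF a alpha v q"
 unfolding TF_def conv_diff_right[OF goodD(1)[OF alpha] sqint_jb1I[OF p] sqint_jb1I[OF q]]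
 using TF_integrable[OF alpha v p] TF_integrable[OF alpha v q] by (simp add: right_diff_distrib)

lemma TF_diff_alpha:
 assumes alpha: "good alpha" "good beta" and v: "sqint v" and p: "p \<in> borel_measurable borel" "sqint (jb1 p)"
 shows "TF a (\<lambda>xi. alpha xi - beta xi) v p = TF a alpha v p - TF a beta v p"
 unfolding TF_def conv_diff_left[OF goodD(1)[OF alpha(1)] goodD(1)[OF alpha(2)] sqint_jb1I[OF p]]
 using TF_integrable[OF alpha(1) v p] TF_integrable[OF alpha(2) v p] by (simp add: right_diff_distrib)

lemma TF_diff_v:
 assumes alpha: "good alpha" and v: "sqint v" "sqint w" and p: "p \<in> borel_measurable borel" "sqint (jb1 p)"
 shows "TF a alpha (\<lambda>xi. v xi - w xi) p = TF a alpha v p - TF a alpha w p"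
 unfolding TF_def
 using TF_integrable[OF alpha v(1) p, of a] TF_integrable[OF alpha v(2) p, of a] by (simp add: left_diff_distrib right_diff_distrib)

lemma conv_cong_AE:
 fixes alpha p :: "'a::euclidean_space => complex"
 assumes [measurable]: "alpha \<in> borel_measurable borel" "beta \<in> borel_measurable borel"
   "p \<in> borel_measurable borel" "q \<in> borel_measurable borel"
  and "AE xi in lborel. alpha xi = beta xi" "AE xi in lborel. p xi = q xi"
 shows "conv alpha p = conv beta q"
proof
 fix xi :: 'a
 have "AE eta in lborel. alpha (xi - eta) * p eta = beta (xi - eta) * q eta"
  using AE_reflect[OF assms(5), of xi] assms(6) by eventually_elim simp
 then show "conv alpha p xi = conv beta q xi"
  unfolding conv_def by (intro integral_cong_AE) auto
qed

lemma TF_cong_AE: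
 assumes [measurable]: "alpha \<in> borel_measurable borel" "beta \<in> borel_measurable borel"
   "p \<in> borel_measurable borel" "q \<in> borel_measurable borel" "v \<in> borel_measurable borel" "w \<in> borel_measurable borel"
  and "AE xi in lborel. alpha xi = beta xi" "AE xi in lborel. v xi = w xi" "AE xi in lborel. p xi = q xi"
 shows "TF a alpha v p = TF a beta w q"
 unfolding TF_def conv_cong_AE[OF assms(1-4,7,9)]
 by (intro arg_cong2[where f="(*)"] refl integral_cong_AE) (use assms(8) in \<open>auto elim: eventually_mono\<close>)

section \<open>The commutator estimate\<close>

text \<open>The linear cutoff keeps increments of the weight controlled uniformly in \<open>R\<close>.\<close>

definition mR :: "real => real => real => real" where
 "mR \<sigma> R x = x powr (2 * \<sigma>) * max 0 (1 - x / R)"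

lemma mR_measurable [measurable]: "mR \<sigma> R \<in> borel_measurable borel"
 unfolding mR_def by measurable

lemma mR_bounds:
 assumes "0 < x" "0 < R" shows "0 \<le> mR \<sigma> R x" "mR \<sigma> R x \<le> x powr (2 * \<sigma>)"
 unfolding mR_def using assms by (auto simp: mult_left_le)

lemma mR_eq_0: "0 < R \<Longrightarrow> R \<le> x \<Longrightarrow> mR \<sigma> R x = 0"
 by (simp add: mR_def field_simps)

text \<open>The increment of the power contributes the constant \<open>2 * \<sigma>\<close> by the
  mean value theorem, the increment of the linear cutoff contributes one.\<close>

lemma mR_diff:
 assumes \<sigma>: "1 < 2 * \<sigma>" and y: "1 \<le> y" "y \<le> x" and R: "0 < R"
 shows "\<bar>mR \<sigma> R x - mR \<sigma> R y\<bar> \<le> (2 * \<sigma> + 1) * (x powr (2 * \<sigma> - 1) * (x - y))"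
proof -
 let ?k = "\<lambda>t. max 0 (1 - t / R)" and ?w = "\<lambda>t. t powr (2 * \<sigma>)"
 have k: "0 \<le> ?k t" "?k x \<le> ?k y" for t using y R by (auto simp: divide_right_mono max.coboundedI2)
 have kx1: "?k x \<le> 1" using y R by auto
 have wd: "0 \<le> ?w x - ?w y" "?w x - ?w y \<le> 2 * \<sigma> * x powr (2 * \<sigma> - 1) * (x - y)"
 proof -
  show "0 \<le> ?w x - ?w y" using y \<sigma> by (simp add: powr_mono2)
  show "?w x - ?w y \<le> 2 * \<sigma> * x powr (2 * \<sigma> - 1) * (x - y)"
  proof (cases "x = y")
   case False
   then have "y < x" using y by simp
   moreover have "(?w has_real_derivative 2 * \<sigma> * t powr (2 * \<sigma> - 1)) (at t)" if "y \<le> t" for t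
    using y that by (intro has_real_derivative_powr) auto
   ultimately obtain z where z: "y < z" "z < x" "?w x - ?w y = (x - y) * (2 * \<sigma> * z powr (2 * \<sigma> - 1))"
    using MVT2[of y x ?w "\<lambda>t. 2 * \<sigma> * t powr (2 * \<sigma> - 1)"] by blast
   have "z powr (2 * \<sigma> - 1) \<le> x powr (2 * \<sigma> - 1)" using z y \<sigma> by (intro powr_mono2) auto
   then have "(x - y) * (2 * \<sigma> * z powr (2 * \<sigma> - 1)) \<le> (x - y) * (2 * \<sigma> * x powr (2 * \<sigma> - 1))"
    using z \<sigma> by (intro mult_left_mono) auto
   then show ?thesis using z(3) by (simp add: mult_ac)
  qed simp
 qed
 \<comment> \<open>The slope \<open>1 / R\<close> of the cutoff is below \<open>1 / y\<close> as
   long as \<open>y\<close> lies where the cutoff is positive, and so \<open>R\<close> disappears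
   from the bound.\<close>
 have kd: "?w y * (?k y - ?k x) \<le> x powr (2 * \<sigma> - 1) * (x - y)"
 proof -
  have "?k y - ?k x \<le> (x - y) / y"
  proof (cases "R \<le> y")
   case True
   then have "?k y = 0" "?k x = 0" using y R by (auto simp: field_simps)
   then show ?thesis using y by simp
  next
   case False
   then have "?k y = 1 - y / R" using R by (simp add: field_simps)
   then have "?k y - ?k x \<le> (x - y) / R" by (simp add: diff_divide_distrib)
   also have "\<dots> \<le> (x - y) / y" using False y by (intro divide_left_mono) auto
   finally show ?thesis .
  qed
  then have "?w y * (?k y - ?k x) \<le> ?w y * ((x - y) / y)" by (intro mult_left_mono) auto
  also have "\<dots> = y powr (2 * \<sigma> - 1) * (x - y)" using y by (simp add: powr_diff)
  also have "\<dots> \<le> x powr (2 * \<sigma> - 1) * (x - y)" using y \<sigma> by (intro mult_right_mono powr_mono2) auto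
  finally show ?thesis .
 qed
 have eq: "mR \<sigma> R x - mR \<sigma> R y = (?w x - ?w y) * ?k x - ?w y * (?k y - ?k x)"
  by (simp add: mR_def algebra_simps)
 have 1: "(?w x - ?w y) * ?k x \<le> ?w x - ?w y" "0 \<le> (?w x - ?w y) * ?k x"
  using wd(1) kx1 k by (auto intro: mult_left_le mult_nonneg_nonneg simp del: max.absorb2)
 have 2: "0 \<le> ?w y * (?k y - ?k x)" using k by (intro mult_nonneg_nonneg) auto
 have 3: "(2 * \<sigma> + 1) * (x powr (2 * \<sigma> - 1) * (x - y)) = 2 * \<sigma> * x powr (2 * \<sigma> - 1) * (x - y) + x powr (2 * \<sigma> - 1) * (x - y)"
  by (simp add: algebra_simps)
 have 4: "0 \<le> x powr (2 * \<sigma> - 1) * (x - y)" "0 \<le> 2 * \<sigma> * x powr (2 * \<sigma> - 1) * (x - y)"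
  using y \<sigma> by auto
 show ?thesis unfolding eq 3 abs_le_iff using 1 2 wd kd 4 by linarith
qed

text \<open>\<open>xi\<close> and \<open>eta\<close> stand for one coordinate of two frequencies,
  \<open>x\<close> and \<open>y\<close> for their brackets, \<open>z\<close> for the bracket of the
  difference. Splitting off \<open>xi - eta\<close> leaves the increment of the weight, of size at
  most a constant times x^(2\<sigma> - 1) z. After x^\<sigma> y^\<sigma> is extracted a power of x/y
  remains; it is bounded if z \<le> y and otherwise paid for by z^\<sigma> y^(-\<sigma>).\<close>

lemma commutator_kernel_aux:
 assumes \<sigma>: "1 < 2 * \<sigma>" and y: "1 \<le> y" "y \<le> x" and R: "0 < R" and z: "1 \<le> z" "x - y \<le> z"
  and zeta: "\<bar>xi - eta\<bar> \<le> z" "\<bar>eta\<bar> \<le> y"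
 shows "\<bar>xi * mR \<sigma> R y - eta * mR \<sigma> R x\<bar> \<le>
  (1 + (2 * \<sigma> + 1) * 2 powr \<sigma>) * (x powr \<sigma> * y powr \<sigma> * (z + z powr (\<sigma> + 1) * y powr (- \<sigma>)))"
proof -
 let ?P = "x powr \<sigma> * y powr \<sigma>" and ?S = "z + z powr (\<sigma> + 1) * y powr (- \<sigma>)"
 have xy: "0 < x" "0 < y" using y by auto
 have "\<bar>xi * mR \<sigma> R y - eta * mR \<sigma> R x\<bar> = \<bar>(xi - eta) * mR \<sigma> R y - eta * (mR \<sigma> R x - mR \<sigma> R y)\<bar>"
  by (simp add: algebra_simps)
 also have "\<dots> \<le> \<bar>xi - eta\<bar> * mR \<sigma> R y + \<bar>eta\<bar> * \<bar>mR \<sigma> R x - mR \<sigma> R y\<bar>"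
  using mR_bounds[OF xy(2) R, of \<sigma>] by (intro order_trans[OF abs_triangle_ineq4]) (simp add: abs_mult)
 also have "\<dots> \<le> z * y powr (2 * \<sigma>) + y * ((2 * \<sigma> + 1) * (x powr (2 * \<sigma> - 1) * z))"
 proof (intro add_mono mult_mono zeta)
  show "mR \<sigma> R y \<le> y powr (2 * \<sigma>)" "0 \<le> mR \<sigma> R y" using mR_bounds[OF xy(2) R] by auto
  have "(2 * \<sigma> + 1) * (x powr (2 * \<sigma> - 1) * (x - y)) \<le> (2 * \<sigma> + 1) * (x powr (2 * \<sigma> - 1) * z)"
   using \<sigma> z by (intro mult_left_mono) auto
  then show "\<bar>mR \<sigma> R x - mR \<sigma> R y\<bar> \<le> (2 * \<sigma> + 1) * (x powr (2 * \<sigma> - 1) * z)"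
   using mR_diff[OF \<sigma> y R] by linarith
 qed (use z xy in auto)
 finally have A: "\<bar>xi * mR \<sigma> R y - eta * mR \<sigma> R x\<bar> \<le> z * y powr (2 * \<sigma>) + (2 * \<sigma> + 1) * (y * x powr (2 * \<sigma> - 1) * z)"
  by (simp add: mult_ac)
 have S: "z \<le> ?S" "z powr (\<sigma> + 1) * y powr (- \<sigma>) \<le> ?S" using z by auto
 have B: "z * y powr (2 * \<sigma>) \<le> ?P * ?S"
 proof -
  have "y powr (2 * \<sigma>) = y powr \<sigma> * y powr \<sigma>" by (simp add: powr_add[symmetric])
  also have "\<dots> \<le> ?P" using y \<sigma> by (intro mult_right_mono powr_mono2) auto
  finally have "z * y powr (2 * \<sigma>) \<le> z * ?P" using z by (intro mult_left_mono) auto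
  also have "\<dots> \<le> ?S * ?P" using S by (intro mult_right_mono) auto
  finally show ?thesis by (simp add: mult.commute)
 qed
 have C: "y * x powr (2 * \<sigma> - 1) * z \<le> 2 powr \<sigma> * (?P * ?S)"
 proof -
  have "x powr (2 * \<sigma> - 1) = x powr \<sigma> * x powr (\<sigma> - 1)" by (simp add: powr_add[symmetric])
  moreover have "y = y powr \<sigma> * y powr (1 - \<sigma>)" using xy by (simp add: powr_add[symmetric])
  ultimately have e: "y * x powr (2 * \<sigma> - 1) * z = ?P * (x powr (\<sigma> - 1) * y powr (1 - \<sigma>) * z)"
   by (metis (no_types, lifting) mult.assoc mult.commute)
  have "x powr (\<sigma> - 1) * y powr (1 - \<sigma>) = (x / y) powr (\<sigma> - 1)"
   using xy by (simp add: powr_divide powr_minus_divide[symmetric] minus_diff_eq divide_powr_uminus)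
  also have "\<dots> \<le> (x / y) powr \<sigma>" using xy y by (intro powr_mono) auto
  finally have e2: "x powr (\<sigma> - 1) * y powr (1 - \<sigma>) * z \<le> (x / y) powr \<sigma> * z" using z by (intro mult_right_mono) auto
  have e3: "(x / y) powr \<sigma> * z \<le> 2 powr \<sigma> * ?S"
  proof (cases "z \<le> y")
   case True
   then have "x / y \<le> 2" using xy z by (simp add: field_simps)
   then have "(x / y) powr \<sigma> \<le> 2 powr \<sigma>" using xy \<sigma> by (intro powr_mono2) auto
   then show ?thesis using S(1) z by (intro mult_mono) auto
  next
   \<comment> \<open>Here \<open>x \<le> y + z \<le> 2 * z\<close>, so the ratio
     \<open>x / y\<close> is at most twice \<open>z / y\<close>.\<close>
   case False
   then have "x / y \<le> 2 * (z / y)" using xy z by (simp add: field_simps)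
   then have "(x / y) powr \<sigma> \<le> (2 * (z / y)) powr \<sigma>" using xy \<sigma> by (intro powr_mono2) auto
   also have "\<dots> = 2 powr \<sigma> * (z powr \<sigma> * y powr (- \<sigma>))"
    using xy z by (simp add: powr_mult powr_divide powr_minus_divide)
   finally have "(x / y) powr \<sigma> * z \<le> 2 powr \<sigma> * (z powr \<sigma> * y powr (- \<sigma>)) * z"
    using z by (intro mult_right_mono) auto
   also have "\<dots> = 2 powr \<sigma> * (z powr (\<sigma> + 1) * y powr (- \<sigma>))"
    using z by (simp add: powr_add mult_ac)
   also have "\<dots> \<le> 2 powr \<sigma> * ?S" using S(2) by (intro mult_left_mono) auto
   finally show ?thesis .
  qed
  have "?P * (x powr (\<sigma> - 1) * y powr (1 - \<sigma>) * z) \<le> ?P * (2 powr \<sigma> * ?S)"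
   using e2 e3 by (intro mult_left_mono) auto
  then show ?thesis unfolding e by (simp add: mult_ac)
 qed
 have "(2 * \<sigma> + 1) * (y * x powr (2 * \<sigma> - 1) * z) \<le> (2 * \<sigma> + 1) * (2 powr \<sigma> * (?P * ?S))"
  using C \<sigma> by (intro mult_left_mono) auto
 moreover have "(1 + (2 * \<sigma> + 1) * 2 powr \<sigma>) * (?P * ?S) = ?P * ?S + (2 * \<sigma> + 1) * (2 powr \<sigma> * (?P * ?S))"
  by (simp only: distrib_right mult_1 mult.assoc)
 ultimately show ?thesis using A B by linarith
qed

text \<open>Exchanging the two frequencies only changes the sign, so the estimate for
  \<open>jb eta \<le> jb xi\<close> covers both cases; the last two terms of the bound belong to one
  case each.\<close>

lemma commutator_kernel:
 fixes xi eta :: "real^'d"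
 assumes \<sigma>: "1 < 2 * \<sigma>" and R: "0 < R"
 shows "\<bar>xi $ a * mR \<sigma> R (jb eta) - eta $ a * mR \<sigma> R (jb xi)\<bar> \<le>
  (1 + (2 * \<sigma> + 1) * 2 powr \<sigma>) * (jb xi powr \<sigma> * jb eta powr \<sigma> *
   (jb (xi - eta) + jb (xi - eta) powr (\<sigma> + 1) * jb eta powr (- \<sigma>) + jb (xi - eta) powr (\<sigma> + 1) * jb xi powr (- \<sigma>)))"
  (is "?L \<le> ?C * (?P * (?z + ?b + ?c))")
proof -
 have C: "0 \<le> ?C" using \<sigma> by simp
 have z: "\<bar>jb xi - jb eta\<bar> \<le> ?z" "\<bar>xi $ a - eta $ a\<bar> \<le> ?z"
  using jb_lipschitz[of xi eta] norm_le_jb[of "xi - eta"] abs_nth_le_jb[of "xi - eta" a] by auto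
 have bc: "0 \<le> ?b" "0 \<le> ?c" by auto
 show ?thesis
 proof (cases "jb eta \<le> jb xi")
  case True
  have "?L \<le> ?C * (jb xi powr \<sigma> * jb eta powr \<sigma> * (?z + ?b))"
   using z by (intro commutator_kernel_aux \<sigma> R jb_ge_1 True abs_nth_le_jb) auto
  also have "\<dots> \<le> ?C * (?P * (?z + ?b + ?c))"
   using bc C by (intro mult_left_mono) auto
  finally show ?thesis .
 next
  case False
  have "\<bar>eta $ a * mR \<sigma> R (jb xi) - xi $ a * mR \<sigma> R (jb eta)\<bar> \<le> ?C * (jb eta powr \<sigma> * jb xi powr \<sigma> * (?z + ?c))"
   using z False by (intro commutator_kernel_aux \<sigma> R jb_ge_1 abs_nth_le_jb) auto
  also have "\<dots> \<le> ?C * (jb eta powr \<sigma> * jb xi powr \<sigma> * (?z + ?b + ?c))"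
   using bc C by (intro mult_left_mono) auto
  finally show ?thesis by (simp add: abs_minus_commute mult.commute)
 qed
qed

section \<open>The symmetrized transport form\<close>

text \<open>Up to normalisation, the constant of the Sobolev embedding of order \<sigma> into
  bounded functions.\<close>

definition Kw :: "'a::euclidean_space itself => real => real" where
 "Kw _ \<sigma> = sqrt (LINT xi|(lborel :: 'a measure). jb xi powr (- 2 * \<sigma>))"

lemma Kw_nonneg: "0 \<le> Kw TYPE('a::euclidean_space) \<sigma>"
 unfolding Kw_def by simp

text \<open>Cauchy-Schwarz against the square integrable weight
  \<open>jb xi powr (- \<sigma>)\<close>. This is the Sobolev embedding in the form of an L^1 bound
  for transforms, and the source of the condition \<sigma> > d/2.\<close>

lemma weighted_L1:
 fixes w :: "'a::euclidean_space => complex"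
 assumes \<sigma>: "\<sigma> > real DIM('a) / 2" and w: "sqint w"
 shows "integrable lborel (\<lambda>xi. jb xi powr (- \<sigma>) * cmod (w xi))"
  "(LINT xi|lborel. jb xi powr (- \<sigma>) * cmod (w xi)) \<le> Kw TYPE('a) \<sigma> * nrm w"
proof -
 note [measurable] = sqint_measurable[OF w]
 have sq: "(jb xi powr (- \<sigma>))\<^sup>2 = jb xi powr (- 2 * \<sigma>)" for xi :: 'a
  by (simp add: power2_eq_square powr_add[symmetric])
 note CS = Cauchy_Schwarz_real[of "\<lambda>xi::'a. jb xi powr (- \<sigma>)" lborel "\<lambda>xi. cmod (w xi)"]
 have i: "integrable lborel (\<lambda>xi::'a. (jb xi powr (- \<sigma>))\<^sup>2)" "integrable lborel (\<lambda>xi. (cmod (w xi))\<^sup>2)"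
  using integrable_jb_powr[OF \<sigma>] sqint_integrable[OF w] by (simp_all only: sq)
 show 1: "integrable lborel (\<lambda>xi. jb xi powr (- \<sigma>) * cmod (w xi))"
  using i by (intro CS) auto
 have "(LINT xi|lborel. \<bar>jb xi powr (- \<sigma>) * cmod (w xi)\<bar>) \<le> Kw TYPE('a) \<sigma> * nrm w"
  using CS(2) i by (simp add: sq Kw_def nrm_def)
 then show "(LINT xi|lborel. jb xi powr (- \<sigma>) * cmod (w xi)) \<le> Kw TYPE('a) \<sigma> * nrm w"
  by (simp add: abs_mult)
qed

lemma sqint_jbs_mono:
 assumes f: "f \<in> borel_measurable borel" and s: "sqint (jbs s f)" and r: "r \<le> s"
 shows "sqint (jbs r f)" "nrm (jbs r f) \<le> nrm (jbs s f)"
proof -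
 note [measurable] = f
 have le: "AE xi in lborel. cmod (jbs r f xi) \<le> 1 * cmod (jbs s f xi)"
  using r jb_ge_1 by (intro AE_I2) (auto simp: norm_mult intro!: mult_right_mono powr_mono)
 show "sqint (jbs r f)" by (rule sqint_bound[OF s _ le]) measurable
 have "nrm (jbs r f) \<le> 1 * nrm (jbs s f)" by (rule nrm_bound[OF s _ le]) auto
 then show "nrm (jbs r f) \<le> nrm (jbs s f)" by simp
qed

lemma jbs_0: "jbs 0 f = f" and jbs_1: "jbs 1 f = jb1 f"
 by (simp_all add: fun_eq_iff abs_of_pos[OF jb_pos] less_imp_neq[OF jb_pos, symmetric])

lemma sqint_jbs_imp_sqint:
 assumes "f \<in> borel_measurable borel" "sqint (jbs s f)" "0 \<le> s"
 shows "sqint f" "nrm f \<le> nrm (jbs s f)"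
 using sqint_jbs_mono[OF assms] by (simp_all only: jbs_0)

text \<open>Of the \<sigma> + 1 powers of the bracket, \<sigma> buy integrability and one remains as
  a weight.\<close>

lemma good_jbs:
 fixes alpha :: "'a::euclidean_space => complex"
 assumes \<sigma>: "\<sigma> > real DIM('a) / 2" and m: "alpha \<in> borel_measurable borel" and s: "sqint (jbs (\<sigma> + 1) alpha)"
 shows "good alpha" "(LINT xi|lborel. jb xi * cmod (alpha xi)) \<le> Kw TYPE('a) \<sigma> * nrm (jbs (\<sigma> + 1) alpha)"
proof -
 have eq: "jb xi powr (- \<sigma>) * cmod (jbs (\<sigma> + 1) alpha xi) = jb xi * cmod (alpha xi)" for xi
  using jb_pos[of xi] by (simp add: norm_mult mult.assoc[symmetric] powr_add[symmetric])
 have "0 \<le> \<sigma> + 1" using \<sigma> by (smt (verit) divide_nonneg_nonneg of_nat_0_le_iff)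
 then have "sqint alpha" by (rule sqint_jbs_imp_sqint(1)[OF m s])
 then show "good alpha" "(LINT xi|lborel. jb xi * cmod (alpha xi)) \<le> Kw TYPE('a) \<sigma> * nrm (jbs (\<sigma> + 1) alpha)"
  using weighted_L1[OF \<sigma> s] unfolding eq good_def by auto
qed

text \<open>The weight vanishes once the bracket reaches \<open>R\<close>, so further powers of the
  bracket cost powers of \<open>R\<close>. Such bounds serve finiteness and the errors that vanish
  under refinement of the time partition; the final constant stays free of them.\<close>

lemma mR_jb_bound:
 assumes R: "1 \<le> R" and \<sigma>: "0 < \<sigma>" and r: "0 \<le> r"
 shows "jb eta powr r * mR \<sigma> R (jb eta) \<le> R powr (2 * \<sigma> + r)"
proof (cases "R \<le> jb eta")
 case True
 then show ?thesis using R by (simp add: mR_eq_0)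
next
 case False
 have "jb eta powr r * mR \<sigma> R (jb eta) \<le> jb eta powr r * jb eta powr (2 * \<sigma>)"
  using R jb_pos[of eta] by (intro mult_left_mono mR_bounds) auto
 also have "\<dots> \<le> R powr r * R powr (2 * \<sigma>)"
  using False \<sigma> r jb_pos[of eta] by (intro mult_mono powr_mono2) auto
 finally show ?thesis by (simp add: powr_add mult.commute)
qed

lemma sqint_mR:
 fixes f :: "'a::euclidean_space => complex"
 assumes f: "sqint f" and R: "1 \<le> R" and \<sigma>: "0 < \<sigma>" and r: "0 \<le> r"
 shows "sqint (jbs r (\<lambda>xi. of_real (mR \<sigma> R (jb xi)) * f xi))"
  "nrm (jbs r (\<lambda>xi. of_real (mR \<sigma> R (jb xi)) * f xi)) \<le> R powr (2 * \<sigma> + r) * nrm f"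
proof -
 note [measurable] = sqint_measurable[OF f]
 have le: "AE xi in lborel. cmod (jbs r (\<lambda>xi. of_real (mR \<sigma> R (jb xi)) * f xi) xi) \<le> R powr (2 * \<sigma> + r) * cmod (f xi)"
 proof (rule AE_I2)
  fix xi :: 'a
  have "0 \<le> mR \<sigma> R (jb xi)" using mR_bounds(1)[OF jb_pos, of R] R by simp
  then have "cmod (jbs r (\<lambda>xi. of_real (mR \<sigma> R (jb xi)) * f xi) xi) = (jb xi powr r * mR \<sigma> R (jb xi)) * cmod (f xi)"
   by (simp add: norm_mult)
  also have "\<dots> \<le> R powr (2 * \<sigma> + r) * cmod (f xi)"
   by (intro mult_right_mono mR_jb_bound R \<sigma> r) auto
  finally show "cmod (jbs r (\<lambda>xi. of_real (mR \<sigma> R (jb xi)) * f xi) xi) \<le> R powr (2 * \<sigma> + r) * cmod (f xi)" .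
 qed
 show "sqint (jbs r (\<lambda>xi. of_real (mR \<sigma> R (jb xi)) * f xi))"
  by (rule sqint_bound[OF f _ le]) measurable
 show "nrm (jbs r (\<lambda>xi. of_real (mR \<sigma> R (jb xi)) * f xi)) \<le> R powr (2 * \<sigma> + r) * nrm f"
  by (rule nrm_bound[OF f _ le]) auto
qed

text \<open>In each of the three terms one factor retains a power of the bracket small enough for an
  L^1 bound: the coefficient in the first, \<open>u\<close> in the second, \<open>v\<close> in the
  third. The other two factors are taken in L^2. Each term is bounded by the same quantity, hence
  the constant 3.\<close>

lemma nn_integral_trilinear_kernel:
 fixes alpha v u :: "'a::euclidean_space => complex"
 assumes \<sigma>: "\<sigma> > real DIM('a) / 2" and m [measurable]: "alpha \<in> borel_measurable borel" "v \<in> borel_measurable borel" "u \<in> borel_measurable borel"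
  and salpha: "sqint (jbs (\<sigma> + 1) alpha)" and sv: "sqint (jbs \<sigma> v)" and su: "sqint (jbs \<sigma> u)"
 shows "(\<integral>\<^sup>+xi. \<integral>\<^sup>+eta. ennreal (jb xi powr \<sigma> * jb eta powr \<sigma> *
   (jb (xi - eta) + jb (xi - eta) powr (\<sigma> + 1) * jb eta powr (- \<sigma>) + jb (xi - eta) powr (\<sigma> + 1) * jb xi powr (- \<sigma>)) *
   (cmod (v xi) * cmod (alpha (xi - eta)) * cmod (u eta))) \<partial>lborel \<partial>lborel)
  \<le> ennreal (3 * Kw TYPE('a) \<sigma> * nrm (jbs (\<sigma> + 1) alpha) * nrm (jbs \<sigma> v) * nrm (jbs \<sigma> u))"
proof -
 let ?V = "\<lambda>xi. cmod (jbs \<sigma> v xi)" and ?U = "\<lambda>xi. cmod (jbs \<sigma> u xi)" and ?A = "\<lambda>xi. cmod (jbs (\<sigma> + 1) alpha xi)"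
 let ?A1 = "\<lambda>xi. jb xi * cmod (alpha xi)" and ?V1 = "\<lambda>xi. jb xi powr (- \<sigma>) * ?V xi" and ?U1 = "\<lambda>xi. jb xi powr (- \<sigma>) * ?U xi"
 let ?K = "Kw TYPE('a) \<sigma>" and ?nA = "nrm (jbs (\<sigma> + 1) alpha)" and ?nV = "nrm (jbs \<sigma> v)" and ?nU = "nrm (jbs \<sigma> u)"
 note g = good_jbs[OF \<sigma> m(1) salpha]
 have jbn: "0 \<le> jb xi" for xi :: 'a by (rule less_imp_le[OF jb_pos])
 have eq: "jb xi powr \<sigma> * jb eta powr \<sigma> *
   (jb (xi - eta) + jb (xi - eta) powr (\<sigma> + 1) * jb eta powr (- \<sigma>) + jb (xi - eta) powr (\<sigma> + 1) * jb xi powr (- \<sigma>)) *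
   (cmod (v xi) * cmod (alpha (xi - eta)) * cmod (u eta)) =
   ?V xi * ?A1 (xi - eta) * ?U eta + (?V xi * ?A (xi - eta) * ?U1 eta + ?V1 xi * ?A (xi - eta) * ?U eta)" for xi eta
  by (simp add: norm_mult algebra_simps)
 have T1: "(\<integral>\<^sup>+xi. \<integral>\<^sup>+eta. ennreal (?V xi * ?A1 (xi - eta) * ?U eta) \<partial>lborel \<partial>lborel) \<le> ennreal (?K * ?nA * ?nV * ?nU)"
 proof -
  have "(\<integral>\<^sup>+xi. \<integral>\<^sup>+eta. ennreal (?V xi * ?A1 (xi - eta) * ?U eta) \<partial>lborel \<partial>lborel) \<le>
    ennreal (sqrt (LINT x|lborel. (?V x)\<^sup>2) * (LINT x|lborel. ?A1 x) * sqrt (LINT x|lborel. (?U x)\<^sup>2))"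
   using jbn sqint_integrable[OF sv] sqint_integrable[OF su] goodD(2)[OF g(1)]
   by (intro trilinear_L1_mid) (auto simp: mult_nonneg_nonneg)
  also have "\<dots> \<le> ennreal (?K * ?nA * ?nV * ?nU)"
  proof (rule ennreal_leI)
   have "?nV * (LINT x|lborel. ?A1 x) * ?nU \<le> ?nV * (?K * ?nA) * ?nU"
    using g(2) by (intro mult_right_mono mult_left_mono) auto
   then show "sqrt (LINT x|lborel. (?V x)\<^sup>2) * (LINT x|lborel. ?A1 x) * sqrt (LINT x|lborel. (?U x)\<^sup>2) \<le> ?K * ?nA * ?nV * ?nU"
    unfolding nrm_def[symmetric] by (simp only: mult_ac)
  qed
  finally show ?thesis .
 qed
 have T2: "(\<integral>\<^sup>+xi. \<integral>\<^sup>+eta. ennreal (?V xi * ?A (xi - eta) * ?U1 eta) \<partial>lborel \<partial>lborel) \<le> ennreal (?K * ?nA * ?nV * ?nU)"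
 proof -
  have "(\<integral>\<^sup>+xi. \<integral>\<^sup>+eta. ennreal (?V xi * ?A (xi - eta) * ?U1 eta) \<partial>lborel \<partial>lborel) \<le>
    ennreal (sqrt (LINT x|lborel. (?V x)\<^sup>2) * sqrt (LINT x|lborel. (?A x)\<^sup>2) * (LINT x|lborel. ?U1 x))"
   using sqint_integrable[OF sv] sqint_integrable[OF salpha] weighted_L1(1)[OF \<sigma> su]
   by (intro trilinear_L1_right) auto
  also have "\<dots> \<le> ennreal (?K * ?nA * ?nV * ?nU)"
  proof (rule ennreal_leI)
   have "?nV * ?nA * (LINT x|lborel. ?U1 x) \<le> ?nV * ?nA * (?K * ?nU)"
    using weighted_L1(2)[OF \<sigma> su] by (intro mult_left_mono) auto
   then show "sqrt (LINT x|lborel. (?V x)\<^sup>2) * sqrt (LINT x|lborel. (?A x)\<^sup>2) * (LINT x|lborel. ?U1 x) \<le> ?K * ?nA * ?nV * ?nU"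
    unfolding nrm_def[symmetric] by (simp only: mult_ac)
  qed
  finally show ?thesis .
 qed
 have T3: "(\<integral>\<^sup>+xi. \<integral>\<^sup>+eta. ennreal (?V1 xi * ?A (xi - eta) * ?U eta) \<partial>lborel \<partial>lborel) \<le> ennreal (?K * ?nA * ?nV * ?nU)"
 proof -
  have "(\<integral>\<^sup>+xi. \<integral>\<^sup>+eta. ennreal (?V1 xi * ?A (xi - eta) * ?U eta) \<partial>lborel \<partial>lborel) \<le>
    ennreal ((LINT x|lborel. ?V1 x) * sqrt (LINT x|lborel. (?A x)\<^sup>2) * sqrt (LINT x|lborel. (?U x)\<^sup>2))"
   using sqint_integrable[OF su] sqint_integrable[OF salpha] weighted_L1(1)[OF \<sigma> sv]
   by (intro trilinear_L1_left) auto
  also have "\<dots> \<le> ennreal (?K * ?nA * ?nV * ?nU)"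
  proof (rule ennreal_leI)
   have "(LINT x|lborel. ?V1 x) * (?nA * ?nU) \<le> (?K * ?nV) * (?nA * ?nU)"
    using weighted_L1(2)[OF \<sigma> sv] by (intro mult_right_mono) auto
   then show "(LINT x|lborel. ?V1 x) * sqrt (LINT x|lborel. (?A x)\<^sup>2) * sqrt (LINT x|lborel. (?U x)\<^sup>2) \<le> ?K * ?nA * ?nV * ?nU"
    unfolding nrm_def[symmetric] by (simp only: mult_ac)
  qed
  finally show ?thesis .
 qed
 let ?X = "?K * ?nA * ?nV * ?nU"
 have three: "0 \<le> x \<Longrightarrow> ennreal x + (ennreal x + ennreal x) = ennreal (3 * x)" for x :: real
  by (simp add: ennreal_plus[symmetric] del: ennreal_plus)
 have X: "0 \<le> ?X" by (intro mult_nonneg_nonneg Kw_nonneg nrm_nonneg zero_le_numeral)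
 have "(\<integral>\<^sup>+xi. \<integral>\<^sup>+eta. ennreal (?V xi * ?A1 (xi - eta) * ?U eta + (?V xi * ?A (xi - eta) * ?U1 eta + ?V1 xi * ?A (xi - eta) * ?U eta)) \<partial>lborel \<partial>lborel)
  = (\<integral>\<^sup>+xi. \<integral>\<^sup>+eta. ennreal (?V xi * ?A1 (xi - eta) * ?U eta) + (ennreal (?V xi * ?A (xi - eta) * ?U1 eta) + ennreal (?V1 xi * ?A (xi - eta) * ?U eta)) \<partial>lborel \<partial>lborel)"
  using jbn by (intro nn_integral_cong) (simp add: ennreal_plus[symmetric] del: ennreal_plus)
 also have "\<dots> = (\<integral>\<^sup>+xi. \<integral>\<^sup>+eta. ennreal (?V xi * ?A1 (xi - eta) * ?U eta) \<partial>lborel \<partial>lborel) +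
  ((\<integral>\<^sup>+xi. \<integral>\<^sup>+eta. ennreal (?V xi * ?A (xi - eta) * ?U1 eta) \<partial>lborel \<partial>lborel) + (\<integral>\<^sup>+xi. \<integral>\<^sup>+eta. ennreal (?V1 xi * ?A (xi - eta) * ?U eta) \<partial>lborel \<partial>lborel))"
  by (simp add: nn_integral_add)
 also have "\<dots> \<le> ennreal ?X + (ennreal ?X + ennreal ?X)"
  by (intro add_mono T1 T2 T3)
 also have "\<dots> = ennreal (3 * Kw TYPE('a) \<sigma> * nrm (jbs (\<sigma> + 1) alpha) * nrm (jbs \<sigma> v) * nrm (jbs \<sigma> u))"
  using three[OF X] by (simp only: mult.assoc)
 finally show ?thesis unfolding eq .
qed

lemma borel_measurable_vec_nth_raw [measurable (raw)]:
 fixes f :: "'a => real^'n"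
 assumes "f \<in> borel_measurable M" shows "(\<lambda>x. f x $ i) \<in> borel_measurable M"
 by (rule measurable_compose[OF assms]) (intro borel_measurable_continuous_onI continuous_intros)

text \<open>The sum is added to its conjugate, in which both the indices and the frequencies are
  exchanged. Hermitian symmetry brings the same product of \<open>alpha\<close> and \<open>u\<close>
  in front of both, and the two multipliers combine into the commutator kernel. Twice the real part
  is all that this controls.\<close>

lemma TF_symmetrized_bound:
 fixes alpha :: "'n::finite => 'n => real^'d => complex" and u :: "'n => real^'d => complex" and a :: "'d::finite"
 assumes \<sigma>: "\<sigma> > real CARD('d) / 2" and R: "1 \<le> R"
  and m [measurable]: "\<And>i j. alpha i j \<in> borel_measurable borel" "\<And>i. u i \<in> borel_measurable borel"
  and salpha: "\<And>i j. sqint (jbs (\<sigma> + 1) (alpha i j))" and su: "\<And>i. sqint (jbs \<sigma> (u i))"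
  and herm: "\<And>i j. AE zeta in lborel. alpha i j (- zeta) = cnj (alpha j i zeta)"
 shows "2 * \<bar>Re (\<Sum>i\<in>UNIV. \<Sum>j\<in>UNIV. TF a (alpha i j) (u j) (\<lambda>xi. of_real (mR \<sigma> R (jb xi)) * u i xi))\<bar> \<le>
  fconst TYPE(real^'d) * (1 + (2 * \<sigma> + 1) * 2 powr \<sigma>) *
   (\<Sum>i\<in>UNIV. \<Sum>j\<in>UNIV. 3 * Kw TYPE(real^'d) \<sigma> * nrm (jbs (\<sigma> + 1) (alpha i j)) * nrm (jbs \<sigma> (u j)) * nrm (jbs \<sigma> (u i)))"
proof -
 let ?c = "fconst TYPE(real^'d)" and ?C = "1 + (2 * \<sigma> + 1) * 2 powr \<sigma>"
 let ?P = "lborel \<Otimes>\<^sub>M lborel :: ((real^'d) \<times> (real^'d)) measure"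
 let ?M = "\<lambda>xi. mR \<sigma> R (jb xi)"
 have d: "\<sigma> > real DIM(real^'d) / 2" using \<sigma> by simp
 have "1 \<le> CARD('d)" by (simp add: Suc_le_eq)
 then have "1 \<le> real CARD('d)" by linarith
 then have \<sigma>1: "1 < 2 * \<sigma>" "0 < \<sigma>" using \<sigma> by linarith+
 have R0: "0 < R" using R by simp
 have su0: "sqint (u i)" for i
  by (rule sqint_jbs_imp_sqint(1)[OF m(2) su]) (use \<sigma>1 in simp)
 note g = good_jbs(1)[OF d m(1) salpha]
 define G where "G i j = (\<lambda>(xi, eta). (\<i> * u j xi) * (of_real (xi $ a) * (cnj (alpha i j (xi - eta)) * (of_real (?M eta) * cnj (u i eta)))))" for i j
 have [measurable]: "G i j \<in> borel_measurable ?P" for i j unfolding G_def by measurable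
 \<comment> \<open>Absolute convergence for fixed \<open>R\<close>, with a bound that grows with
   \<open>R\<close>; its purpose is to license Fubini and the splitting of integrals.\<close>
 have Gi: "integrable ?P (G i j)" for i j
 proof (rule integrableI_bounded)
  let ?Q = "2 * R powr (2 * \<sigma> + 1)"
  have le: "norm (G i j (xi, eta)) \<le> ?Q * (cmod (u j xi) * (jb (xi - eta) * cmod (alpha i j (xi - eta))) * cmod (u i eta))" for xi eta
  proof -
   have M0: "0 \<le> ?M eta" by (rule mR_bounds(1)[OF jb_pos R0])
   have "jb eta powr 1 * ?M eta \<le> R powr (2 * \<sigma> + 1)" by (rule mR_jb_bound[OF R \<sigma>1(2)]) simp
   then have jM: "jb eta * ?M eta \<le> R powr (2 * \<sigma> + 1)" using jb_pos[of eta] by simp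
   have "\<bar>xi $ a\<bar> * ?M eta \<le> 2 * jb (xi - eta) * jb eta * ?M eta"
    using abs_nth_le_jb[of xi a] jb_peetre[of xi eta] M0 by (intro mult_right_mono) auto
   also have "\<dots> = 2 * jb (xi - eta) * (jb eta * ?M eta)" by simp
   also have "\<dots> \<le> 2 * jb (xi - eta) * R powr (2 * \<sigma> + 1)"
    using jM jb_pos[of "xi - eta"] by (intro mult_left_mono) auto
   finally have "(\<bar>xi $ a\<bar> * ?M eta) * (cmod (u j xi) * cmod (alpha i j (xi - eta)) * cmod (u i eta)) \<le>
     (2 * jb (xi - eta) * R powr (2 * \<sigma> + 1)) * (cmod (u j xi) * cmod (alpha i j (xi - eta)) * cmod (u i eta))"
    by (intro mult_right_mono) auto
   then show ?thesis using M0 by (simp add: G_def norm_mult mult_ac)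
  qed
  have "(\<integral>\<^sup>+x. norm (G i j x) \<partial>?P) = (\<integral>\<^sup>+xi. \<integral>\<^sup>+eta. norm (G i j (xi, eta)) \<partial>lborel \<partial>lborel)"
   by (rule lborel.nn_integral_fst[symmetric]) measurable
  also have "\<dots> \<le> (\<integral>\<^sup>+xi. \<integral>\<^sup>+eta. ennreal ?Q * ennreal (cmod (u j xi) * (jb (xi - eta) * cmod (alpha i j (xi - eta))) * cmod (u i eta)) \<partial>lborel \<partial>lborel)"
   using le by (intro nn_integral_mono) (auto simp: ennreal_mult'[symmetric] intro!: ennreal_leI)
  also have "\<dots> = ennreal ?Q * (\<integral>\<^sup>+xi. \<integral>\<^sup>+eta. ennreal (cmod (u j xi) * (jb (xi - eta) * cmod (alpha i j (xi - eta))) * cmod (u i eta)) \<partial>lborel \<partial>lborel)"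
   by (simp add: nn_integral_cmult)
  also have "\<dots> \<le> ennreal ?Q * ennreal (sqrt (LINT x|lborel. (cmod (u j x))\<^sup>2) * (LINT x|lborel. jb x * cmod (alpha i j x)) * sqrt (LINT x|lborel. (cmod (u i x))\<^sup>2))"
   using sqint_integrable[OF su0] goodD(2)[OF g]
   by (intro mult_left_mono trilinear_L1_mid mult_nonneg_nonneg less_imp_le[OF jb_pos]) auto
  also have "\<dots> < \<infinity>" by (simp add: ennreal_mult_less_top)
  finally show "(\<integral>\<^sup>+x. norm (G i j x) \<partial>?P) < \<infinity>" .
 qed measurable
 have TFG: "TF a (alpha i j) (u j) (\<lambda>xi. of_real (?M xi) * u i xi) = of_real ?c * (LINT x|?P. G i j x)" for i j
 proof -
  have "(LINT x|?P. G i j x) = (LINT xi|lborel. LINT eta|lborel. G i j (xi, eta))"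
   by (rule lborel_pair.integral_fst'[OF Gi, symmetric])
  also have "\<dots> = (LINT xi|lborel. (\<i> * u j xi) * (of_real (xi $ a) * cnj (conv (alpha i j) (\<lambda>xi. of_real (?M xi) * u i xi) xi)))"
   unfolding conv_def by (simp add: G_def flip: Bochner_Integration.integral_cnj)
  finally show ?thesis by (simp add: TF_def)
 qed
 \<comment> \<open>The conjugate of \<open>G j i\<close> after exchange of the frequencies; the
   minus sign is that of the conjugate of \<open>\<i>\<close>.\<close>
 define G' where "G' i j = (\<lambda>(xi, eta). - ((\<i> * u j xi) * (of_real (eta $ a) * (cnj (alpha i j (xi - eta)) * (of_real (?M xi) * cnj (u i eta))))))" for i j
 have [measurable]: "G' i j \<in> borel_measurable ?P" for i j unfolding G'_def by measurable
 have ae: "AE x in ?P. cnj (G j i (snd x, fst x)) = G' i j x" for i j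
 proof (rule lborel_pair.AE_pair_measure)
  show "{x \<in> space ?P. cnj (G j i (snd x, fst x)) = G' i j x} \<in> sets ?P" by measurable
  show "AE xi in lborel. AE eta in lborel. cnj (G j i (snd (xi, eta), fst (xi, eta))) = G' i j (xi, eta)"
  proof (rule AE_I2)
   fix xi :: "real^'d"
   show "AE eta in lborel. cnj (G j i (snd (xi, eta), fst (xi, eta))) = G' i j (xi, eta)"
    using AE_reflect[OF herm[of j i], of xi] by eventually_elim (simp add: G_def G'_def)
  qed
 qed
 have Gc: "cnj (LINT x|?P. G j i x) = (LINT x|?P. G' i j x)" and G'i: "integrable ?P (G' i j)" for i j
 proof -
  have sw: "integrable ?P (\<lambda>x. G j i (snd x, fst x))"
   using lborel_pair.integrable_product_swap[OF Gi[of j i]] by (simp add: case_prod_unfold)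
  have "cnj (LINT x|?P. G j i x) = cnj (LINT x|?P. G j i (snd x, fst x))"
   using lborel_pair.integral_product_swap[of "G j i"] by (simp add: case_prod_unfold)
  also have "\<dots> = (LINT x|?P. cnj (G j i (snd x, fst x)))" by simp
  also have "\<dots> = (LINT x|?P. G' i j x)"
   by (rule integral_cong_AE[OF _ _ ae]) measurable
  finally show "cnj (LINT x|?P. G j i x) = (LINT x|?P. G' i j x)" .
  have "integrable ?P (\<lambda>x. cnj (G j i (snd x, fst x)))" using sw by simp
  moreover have "AE x in ?P. G' i j x = cnj (G j i (snd x, fst x))"
   using ae[of j i] by (auto elim: eventually_mono)
  ultimately show "integrable ?P (G' i j)"
   using integrable_cong_AE[of "\<lambda>x. cnj (G j i (snd x, fst x))" ?P "G' i j"] ae[of j i] by simp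
 qed
 define S where "S = (\<Sum>i\<in>UNIV. \<Sum>j\<in>UNIV. LINT x|?P. G i j x)"
 have "cnj S = (\<Sum>i\<in>UNIV. \<Sum>j\<in>UNIV. LINT x|?P. G' j i x)"
  unfolding S_def cnj_sum Gc ..
 also have "\<dots> = (\<Sum>i\<in>UNIV. \<Sum>j\<in>UNIV. LINT x|?P. G' i j x)" by (rule sum.swap)
 finally have "S + cnj S = (\<Sum>i\<in>UNIV. \<Sum>j\<in>UNIV. (LINT x|?P. G i j x + G' i j x))"
  unfolding S_def using Gi G'i by (simp add: sum.distrib)
 then have "cmod (S + cnj S) \<le> (\<Sum>i\<in>UNIV. \<Sum>j\<in>UNIV. cmod (LINT x|?P. G i j x + G' i j x))"
  by (simp only:) (intro order_trans[OF norm_sum] sum_mono norm_sum)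
 also have "\<dots> \<le> (\<Sum>i\<in>UNIV. \<Sum>j\<in>UNIV. ?C * (3 * Kw TYPE(real^'d) \<sigma> * nrm (jbs (\<sigma> + 1) (alpha i j)) * nrm (jbs \<sigma> (u j)) * nrm (jbs \<sigma> (u i))))"
 proof (intro sum_mono)
  fix i j
  let ?X = "3 * Kw TYPE(real^'d) \<sigma> * nrm (jbs (\<sigma> + 1) (alpha i j)) * nrm (jbs \<sigma> (u j)) * nrm (jbs \<sigma> (u i))"
  let ?k = "\<lambda>xi eta::real^'d. jb xi powr \<sigma> * jb eta powr \<sigma> *
   (jb (xi - eta) + jb (xi - eta) powr (\<sigma> + 1) * jb eta powr (- \<sigma>) + jb (xi - eta) powr (\<sigma> + 1) * jb xi powr (- \<sigma>))"
  let ?w = "\<lambda>xi eta. cmod (u j xi) * cmod (alpha i j (xi - eta)) * cmod (u i eta)"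
  have X: "0 \<le> ?X" by (intro mult_nonneg_nonneg Kw_nonneg nrm_nonneg zero_le_numeral)
  have le: "norm (G i j (xi, eta) + G' i j (xi, eta)) \<le> ?C * (?k xi eta * ?w xi eta)" for xi eta
  proof -
   have "G i j (xi, eta) + G' i j (xi, eta) = of_real (xi $ a * ?M eta - eta $ a * ?M xi) * (\<i> * u j xi * cnj (alpha i j (xi - eta)) * cnj (u i eta))"
    by (simp add: G_def G'_def algebra_simps)
   then have "norm (G i j (xi, eta) + G' i j (xi, eta)) = \<bar>xi $ a * ?M eta - eta $ a * ?M xi\<bar> * ?w xi eta"
    by (simp only: norm_mult norm_of_real norm_ii complex_mod_cnj mult_1)
   also have "\<dots> \<le> (?C * ?k xi eta) * ?w xi eta"
    by (intro mult_right_mono commutator_kernel \<sigma>1 R0) auto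
   finally show ?thesis by (simp only: mult.assoc)
  qed
  have "ennreal (cmod (LINT x|?P. G i j x + G' i j x)) \<le> (\<integral>\<^sup>+x. norm (G i j x + G' i j x) \<partial>?P)"
   by (rule integral_norm_le_nn_integral)
  also have "\<dots> = (\<integral>\<^sup>+xi. \<integral>\<^sup>+eta. norm (G i j (xi, eta) + G' i j (xi, eta)) \<partial>lborel \<partial>lborel)"
   by (rule lborel.nn_integral_fst[symmetric]) measurable
  also have "\<dots> \<le> (\<integral>\<^sup>+xi. \<integral>\<^sup>+eta. ennreal ?C * ennreal (?k xi eta * ?w xi eta) \<partial>lborel \<partial>lborel)"
  proof (intro nn_integral_mono)
   fix xi eta
   have "0 \<le> ?C" using \<sigma>1 by simp
   then have "ennreal ?C * ennreal (?k xi eta * ?w xi eta) = ennreal (?C * (?k xi eta * ?w xi eta))"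
    by (rule ennreal_mult'[symmetric])
   then show "ennreal (norm (G i j (xi, eta) + G' i j (xi, eta))) \<le> ennreal ?C * ennreal (?k xi eta * ?w xi eta)"
    using ennreal_leI[OF le] by (simp only:)
  qed
  also have "\<dots> = ennreal ?C * (\<integral>\<^sup>+xi. \<integral>\<^sup>+eta. ennreal (?k xi eta * ?w xi eta) \<partial>lborel \<partial>lborel)"
   by (simp add: nn_integral_cmult)
  also have "\<dots> \<le> ennreal ?C * ennreal ?X"
   by (intro mult_left_mono nn_integral_trilinear_kernel[OF d m(1) m(2) m(2) salpha su su]) auto
  also have "\<dots> = ennreal (?C * ?X)" using X by (simp add: ennreal_mult'')
  finally show "cmod (LINT x|?P. G i j x + G' i j x) \<le> ?C * ?X"
   using X \<sigma>1 by (subst (asm) ennreal_le_iff) auto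
 qed
 finally have fin: "cmod (S + cnj S) \<le> ?C * (\<Sum>i\<in>UNIV. \<Sum>j\<in>UNIV. 3 * Kw TYPE(real^'d) \<sigma> * nrm (jbs (\<sigma> + 1) (alpha i j)) * nrm (jbs \<sigma> (u j)) * nrm (jbs \<sigma> (u i)))"
  by (simp only: sum_distrib_left)
 have "(\<Sum>i\<in>UNIV. \<Sum>j\<in>UNIV. TF a (alpha i j) (u j) (\<lambda>xi. of_real (?M xi) * u i xi)) = of_real ?c * S"
  unfolding TFG S_def by (simp add: sum_distrib_left)
 moreover have "2 * \<bar>Re S\<bar> = cmod (S + cnj S)"
  by (simp add: complex_add_cnj norm_mult)
 ultimately have "2 * \<bar>Re (\<Sum>i\<in>UNIV. \<Sum>j\<in>UNIV. TF a (alpha i j) (u j) (\<lambda>xi. of_real (?M xi) * u i xi))\<bar> = ?c * cmod (S + cnj S)"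
  using fconst_pos[where 'a="real^'d"] by (simp add: abs_mult)
 also have "\<dots> \<le> ?c * (?C * (\<Sum>i\<in>UNIV. \<Sum>j\<in>UNIV. 3 * Kw TYPE(real^'d) \<sigma> * nrm (jbs (\<sigma> + 1) (alpha i j)) * nrm (jbs \<sigma> (u j)) * nrm (jbs \<sigma> (u i))))"
  using fconst_pos[where 'a="real^'d"] by (intro mult_left_mono fin) auto
 finally show ?thesis by (simp only: mult.assoc)
qed

section \<open>Band-limited functions and their approximation by test functions\<close>

text \<open>The inverse Fourier integral without its normalisation, which is supplied where
  \<open>bl\<close> is used.\<close>

definition bl :: "('a::euclidean_space => complex) => 'a => complex" where
 "bl p x = (LINT xi|lborel. cis (x \<bullet> xi) * p xi)"

definition band :: "real => ('a::euclidean_space => complex) => bool" where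
 "band R p \<longleftrightarrow> integrable lborel p \<and> (\<forall>xi. R \<le> norm xi \<longrightarrow> p xi = 0)"

lemma band_mult:
 fixes p :: "'a::euclidean_space => complex"
 assumes p: "band R p" and R: "0 \<le> R"
 shows "band R (\<lambda>xi. of_real (v \<bullet> xi) * p xi)"
  "(LINT xi|lborel. cmod (of_real (v \<bullet> xi) * p xi)) \<le> norm v * (R * (LINT xi|lborel. cmod (p xi)))"
proof -
 have i: "integrable lborel p" and z: "\<And>xi. R \<le> norm xi \<Longrightarrow> p xi = 0" using p by (auto simp: band_def)
 have [measurable]: "p \<in> borel_measurable borel" using i by auto
 have le: "cmod (of_real (v \<bullet> xi) * p xi) \<le> norm v * R * cmod (p xi)" for xi
 proof (cases "R \<le> norm xi")
  case False
  have "\<bar>v \<bullet> xi\<bar> \<le> norm v * norm xi" by (rule Cauchy_Schwarz_ineq2)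
  also have "\<dots> \<le> norm v * R" using False by (intro mult_left_mono) auto
  finally show ?thesis by (simp add: norm_mult mult_right_mono)
 qed (simp add: z)
 have ii: "integrable lborel (\<lambda>xi. of_real (v \<bullet> xi) * p xi)"
 proof (rule Bochner_Integration.integrable_bound[of _ "\<lambda>xi. norm v * R * cmod (p xi)"])
  show "integrable lborel (\<lambda>xi. norm v * R * cmod (p xi))" using i by simp
  show "AE xi in lborel. norm (of_real (v \<bullet> xi) * p xi) \<le> norm (norm v * R * cmod (p xi))"
   using le R by (intro AE_I2) (simp add: abs_mult)
 qed measurable
 then show "band R (\<lambda>xi. of_real (v \<bullet> xi) * p xi)" using z by (simp add: band_def)
 have "(LINT xi|lborel. cmod (of_real (v \<bullet> xi) * p xi)) \<le> (LINT xi|lborel. norm v * R * cmod (p xi))"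
  using i ii le by (intro integral_mono) auto
 then show "(LINT xi|lborel. cmod (of_real (v \<bullet> xi) * p xi)) \<le> norm v * (R * (LINT xi|lborel. cmod (p xi)))"
  by simp
qed

lemma band_cmult: "band R p \<Longrightarrow> band R (\<lambda>xi. c * p xi)"
 by (auto simp: band_def)

lemma norm_bl_le:
 assumes "band R p" shows "cmod (bl p x) \<le> (LINT xi|lborel. cmod (p xi))"
 using integral_norm_bound[of lborel "\<lambda>xi. cis (x \<bullet> xi) * p xi"] by (simp add: bl_def norm_mult)

text \<open>On the band the phase changes by at most \<open>R * norm (y - x)\<close>. The
  second-order remainder of the exponential is therefore quadratic in the displacement, uniformly in
  the frequency, and can be integrated against \<open>p\<close>.\<close>

lemma bl_has_derivative:
 fixes p :: "'a::euclidean_space => complex"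
 assumes p: "band R p" and R: "0 \<le> R"
 shows "(bl p has_derivative (\<lambda>v. bl (\<lambda>xi. \<i> * (of_real (v \<bullet> xi) * p xi)) x)) (at x)"
proof -
 have i: "integrable lborel p" using p by (auto simp: band_def)
 have [measurable]: "p \<in> borel_measurable borel" using i by auto
 have cisint: "integrable lborel (\<lambda>xi. cis (x \<bullet> xi) * q xi)" if "integrable lborel q" for q :: "'a => complex" and x
  using integrable_cis_mult(1)[OF that, of x] by (simp add: inner_commute)
 let ?L = "\<lambda>v. bl (\<lambda>xi. \<i> * (of_real (v \<bullet> xi) * p xi)) x"
 let ?I = "LINT xi|lborel. cmod (p xi)"
 have bi: "integrable lborel (\<lambda>xi. \<i> * (of_real (v \<bullet> xi) * p xi))" for v
  using band_mult(1)[OF p R, of v] by (simp add: band_def)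
 have lin: "bounded_linear ?L"
 proof (rule bounded_linear_intro)
  fix v w :: 'a and r :: real
  have "?L (v + w) = (LINT xi|lborel. cis (x \<bullet> xi) * (\<i> * (of_real (v \<bullet> xi) * p xi)) + cis (x \<bullet> xi) * (\<i> * (of_real (w \<bullet> xi) * p xi)))"
   unfolding bl_def by (intro Bochner_Integration.integral_cong refl) (simp add: inner_add_left algebra_simps)
  also have "\<dots> = ?L v + ?L w"
   unfolding bl_def by (rule Bochner_Integration.integral_add[OF cisint[OF bi] cisint[OF bi]])
  finally show "?L (v + w) = ?L v + ?L w" .
  have "?L (r *\<^sub>R v) = (LINT xi|lborel. of_real r * (cis (x \<bullet> xi) * (\<i> * (of_real (v \<bullet> xi) * p xi))))"
   unfolding bl_def by (intro Bochner_Integration.integral_cong refl) (simp add: algebra_simps)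
  then show "?L (r *\<^sub>R v) = r *\<^sub>R ?L v"
   unfolding bl_def by (simp only: integral_mult_right_zero scaleR_conv_of_real)
  show "norm (?L v) \<le> norm v * (R * ?I)"
   using norm_bl_le[OF band_cmult[OF band_mult(1)[OF p R, of v], of \<i>], of x] band_mult(2)[OF p R, of v]
   by (simp only: norm_mult[of \<i>] norm_ii mult_1)
 qed
 have est: "norm (bl p y - bl p x - ?L (y - x)) \<le> (R\<^sup>2 / 2 * ?I) * norm (y - x) ^ 2" for y
 proof -
  have "bl p y - bl p x - ?L (y - x) = (LINT xi|lborel. cis (y \<bullet> xi) * p xi - cis (x \<bullet> xi) * p xi - cis (x \<bullet> xi) * (\<i> * (of_real ((y - x) \<bullet> xi) * p xi)))"
   unfolding bl_def using cisint[OF i] cisint[OF bi] by simp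
  also have "norm \<dots> \<le> (LINT xi|lborel. (R\<^sup>2 / 2 * norm (y - x) ^ 2) * cmod (p xi))"
  proof (rule Bochner_Integration.integral_norm_bound_integral)
   show "integrable lborel (\<lambda>xi. cis (y \<bullet> xi) * p xi - cis (x \<bullet> xi) * p xi - cis (x \<bullet> xi) * (\<i> * (of_real ((y - x) \<bullet> xi) * p xi)))"
    using cisint[OF i] cisint[OF bi] by simp
   show "integrable lborel (\<lambda>xi. (R\<^sup>2 / 2 * norm (y - x) ^ 2) * cmod (p xi))" using i by simp
   fix xi
   let ?t = "(y - x) \<bullet> xi"
   have t: "cmod (cis ?t - 1 - \<i> * of_real ?t) \<le> ?t\<^sup>2 / 2"
    using iexp_approx1[of ?t 1] by (simp add: cis_conv_exp power2_eq_square algebra_simps)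
   have "cis (y \<bullet> xi) = cis (x \<bullet> xi) * cis ?t" by (simp add: cis_mult inner_diff_left)
   then have "cis (y \<bullet> xi) * p xi - cis (x \<bullet> xi) * p xi - cis (x \<bullet> xi) * (\<i> * (of_real ?t * p xi)) = cis (x \<bullet> xi) * (cis ?t - 1 - \<i> * of_real ?t) * p xi"
    by (simp add: algebra_simps)
   then have e: "norm (cis (y \<bullet> xi) * p xi - cis (x \<bullet> xi) * p xi - cis (x \<bullet> xi) * (\<i> * (of_real ?t * p xi))) = cmod (cis ?t - 1 - \<i> * of_real ?t) * cmod (p xi)"
    by (simp only: norm_mult norm_cis mult_1)
   show "norm (cis (y \<bullet> xi) * p xi - cis (x \<bullet> xi) * p xi - cis (x \<bullet> xi) * (\<i> * (of_real ?t * p xi))) \<le> (R\<^sup>2 / 2 * norm (y - x) ^ 2) * cmod (p xi)"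
   proof (cases "R \<le> norm xi")
    case True
    then have "p xi = 0" using p by (simp add: band_def)
    then show ?thesis by simp
   next
    case False
    have "\<bar>?t\<bar> \<le> norm (y - x) * norm xi" by (rule Cauchy_Schwarz_ineq2)
    also have "\<dots> \<le> norm (y - x) * R" using False by (intro mult_left_mono) auto
    finally have "\<bar>?t\<bar>\<^sup>2 \<le> (norm (y - x) * R)\<^sup>2" by (intro power_mono) auto
    then have "?t\<^sup>2 / 2 \<le> R\<^sup>2 / 2 * norm (y - x) ^ 2" by (simp add: power_mult_distrib mult.commute)
    then show ?thesis unfolding e using t by (intro mult_right_mono) auto
   qed
  qed
  also have "\<dots> = (R\<^sup>2 / 2 * ?I) * norm (y - x) ^ 2" by simp
  finally show ?thesis .
 qed
 show ?thesis
  unfolding has_derivative_iff_norm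
 proof (intro conjI lin)
  let ?C = "R\<^sup>2 / 2 * ?I"
  show "((\<lambda>y. norm (bl p y - bl p x - ?L (y - x)) / norm (y - x)) \<longlongrightarrow> 0) (at x)"
  proof (rule Lim_null_comparison)
   show "\<forall>\<^sub>F y in at x. norm (norm (bl p y - bl p x - ?L (y - x)) / norm (y - x)) \<le> ?C * norm (y - x)"
   proof (rule eventually_mono[OF eventually_neq_at_within[of x]])
    fix y assume "y \<noteq> x"
    then show "norm (norm (bl p y - bl p x - ?L (y - x)) / norm (y - x)) \<le> ?C * norm (y - x)"
     using est[of y] by (simp add: divide_le_eq power2_eq_square mult.assoc)
   qed
   have "((\<lambda>y. ?C * norm (y - x)) \<longlongrightarrow> ?C * norm (x - x)) (at x)" by (intro tendsto_intros)
   then show "((\<lambda>y. ?C * norm (y - x)) \<longlongrightarrow> 0) (at x)" by simp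
  qed
 qed
qed

text \<open>Differentiation multiplies the density by a linear factor and keeps it in the same band,
  so the induction repeats the first derivative.\<close>

lemma Ck_bl: "band R p \<Longrightarrow> 0 \<le> R \<Longrightarrow> Ck k (bl p)"
proof (induction k arbitrary: p)
 case 0
 have "continuous (at x) (bl p)" for x
  by (rule has_derivative_continuous[OF bl_has_derivative[OF 0]])
 then show ?case by (simp add: continuous_on_eq_continuous_at)
next
 case (Suc k)
 show ?case
  by (rule Ck_SucI[OF bl_has_derivative[OF Suc.prems]])
    (intro Suc.IH band_cmult band_mult(1) Suc.prems)
qed

lemma sqint_bl:
 fixes p :: "'a::euclidean_space => complex"
 assumes p: "band R p" and s: "sqint p" and R: "0 \<le> R"
 shows "sqint (\<lambda>x. of_real (fconst TYPE('a)) * bl p x)" "AE xi in lborel. hat (\<lambda>x. of_real (fconst TYPE('a)) * bl p x) xi = p xi"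
proof -
 have [measurable]: "bl p \<in> borel_measurable borel"
  by (rule borel_measurable_continuous_onI[OF Ck_continuous[OF Ck_bl[OF p R, of 0]]])
 note [measurable] = sqint_measurable[OF s]
 have "AE x in lborel. hat p (0 - x) = fourier_integral p (0 - x)"
  using p by (intro AE_reflect hat_eq_fourier_integral s) (simp add: band_def)
 then have ae: "AE x in lborel. of_real (fconst TYPE('a)) * bl p x = hat p (- x)"
  by eventually_elim (simp add: fourier_integral_borel bl_def inner_commute)
 note r = hat_surj[OF s]
 show sq: "sqint (\<lambda>x. of_real (fconst TYPE('a)) * bl p x)"
  by (rule sqint_cong_AE[OF r(1) _ ae]) measurable
 show "AE xi in lborel. hat (\<lambda>x. of_real (fconst TYPE('a)) * bl p x) xi = p xi"
  using L2_of_AE_sqint(3)[OF r(1) ae] r(2) by simp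
qed

text \<open>\<open>w\<close> and its conjugate have the same transform and hence coincide almost
  everywhere.\<close>

lemma hat_real_of_symmetric:
 assumes w: "sqint w" and sym: "AE xi in lborel. hat w (- xi) = cnj (hat w xi)"
 shows "AE x in lborel. of_real (Re (w x)) = w x"
proof -
 note c = sqint_cnj[OF w]
 have "AE xi in lborel. hat (\<lambda>x. w x - cnj (w x)) xi = 0"
  using hat_diff[OF w c] hat_cnj[OF w] sym by eventually_elim simp
 then have "nrm (\<lambda>x. w x - cnj (w x)) = 0"
  using nrm_hat[OF sqint_diff[OF w c]] nrm_eq_0_iff[OF hat_fourier(1)[OF sqint_diff[OF w c]]] by simp
 then have "AE x in lborel. w x - cnj (w x) = 0"
  using nrm_eq_0_iff[OF sqint_diff[OF w c]] by simp
 then show ?thesis by eventually_elim (simp add: complex_eq_iff)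
qed

text \<open>The factor \<open>exp 1\<close> normalises the value at the origin to one, and using the
  squared radius keeps the function smooth there.\<close>

definition cutoff :: "nat => 'a::euclidean_space => real" where
 "cutoff n x = exp 1 * flat 0 (1 - inverse (real (Suc n)) ^ 2 * (x \<bullet> x))"

lemma Ck_cutoff: "Ck k (cutoff n)"
 unfolding cutoff_def[abs_def]
 by (intro Ck_cmult Ck_flat_comp Ck_diff Ck_const Ck_inner Ck_ident)

lemma cutoff_tendsto: "(\<lambda>n. cutoff n x) \<longlonglongrightarrow> 1"
proof -
 have c: "isCont (flat 0) 1" using flat_has_derivative DERIV_isCont by blast
 have "(\<lambda>n. 1 - inverse (real (Suc n)) ^ 2 * (x \<bullet> x)) \<longlonglongrightarrow> 1 - 0 ^ 2 * (x \<bullet> x)"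
  by (intro tendsto_intros LIMSEQ_inverse_real_of_nat)
 then have "(\<lambda>n. exp 1 * flat 0 (1 - inverse (real (Suc n)) ^ 2 * (x \<bullet> x))) \<longlonglongrightarrow> exp 1 * flat 0 1"
  using c by (intro tendsto_intros isCont_tendsto_compose[OF c]) auto
 then show ?thesis by (simp add: cutoff_def flat_def exp_minus)
qed

lemma cutoff_bounded: "\<bar>cutoff n x\<bar> \<le> exp 1"
 using flat_nonneg[of 0] flat_le_1 by (simp add: cutoff_def abs_mult)

lemma cutoff_support: "x \<notin> cball 0 (real (Suc n)) \<Longrightarrow> cutoff n x = 0"
proof -
 assume "x \<notin> cball 0 (real (Suc n))"
 then have "real (Suc n) ^ 2 \<le> norm x ^ 2" by (intro power_mono) auto
 then have "1 \<le> inverse (real (Suc n)) ^ 2 * (x \<bullet> x)"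
  by (simp add: power2_norm_eq_inner[symmetric] power_inverse field_simps del: of_nat_Suc)
 then show ?thesis by (simp add: cutoff_def del: of_nat_Suc)
qed

text \<open>All cutoffs are dilations of \<open>cutoff 0\<close>, so the chain rule gains the factor
  \<open>1 / Suc n\<close>.\<close>

lemma cutoff_derivative:
 "\<exists>B. \<forall>n (x::'a::euclidean_space). \<bar>frechet_derivative (cutoff n) (at x) v\<bar> \<le> B * inverse (real (Suc n))"
proof -
 have t: "test_function UNIV (cutoff 0 :: 'a => real)"
  by (rule test_functionI[where K="cball 0 (real (Suc 0))"]) (auto intro: Ck_cutoff cutoff_support)
 obtain B where B: "\<And>x::'a. norm (frechet_derivative (cutoff 0) (at x) v) \<le> B"
  using test_function_bounded[OF test_function_derivative[OF t, of v]] by blast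
 have fd: "frechet_derivative (cutoff n) (at x) v = inverse (real (Suc n)) * frechet_derivative (cutoff 0) (at (inverse (real (Suc n)) *\<^sub>R x)) v" for n and x :: 'a
 proof -
  let ?h = "inverse (real (Suc n))"
  have eq: "cutoff n = (\<lambda>x::'a. cutoff 0 (?h *\<^sub>R x))"
  proof
   fix x :: 'a
   have "?h\<^sup>2 * (x \<bullet> x) = inverse (real (Suc 0)) ^ 2 * ((?h *\<^sub>R x) \<bullet> (?h *\<^sub>R x))"
    by (simp add: power2_eq_square)
   then show "cutoff n x = cutoff 0 (?h *\<^sub>R x)" unfolding cutoff_def by (simp only:)
  qed
  have "((\<lambda>x::'a. ?h *\<^sub>R x) has_derivative (\<lambda>v. ?h *\<^sub>R v)) (at x)" by (auto intro!: derivative_eq_intros)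
  from has_derivative_compose[OF this test_function_has_derivative[OF t]]
  have "(cutoff n has_derivative (\<lambda>v. frechet_derivative (cutoff 0) (at (?h *\<^sub>R x)) (?h *\<^sub>R v))) (at x)"
   unfolding eq .
  from frechet_derivative_at[OF this, symmetric]
  have "frechet_derivative (cutoff n) (at x) v = frechet_derivative (cutoff 0) (at (?h *\<^sub>R x)) (?h *\<^sub>R v)"
   by (rule fun_cong)
  then show ?thesis
   using linear_scale[OF has_derivative_linear[OF test_function_has_derivative[OF t]]] by simp
 qed
 have "\<bar>frechet_derivative (cutoff n) (at x) v\<bar> \<le> B * inverse (real (Suc n))" for n and x :: 'a
 proof -
  have "\<bar>frechet_derivative (cutoff 0) (at y) v\<bar> * inverse (real (Suc n)) \<le> B * inverse (real (Suc n))" for y :: 'a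
   using B[of y] by (intro mult_right_mono) auto
  then show ?thesis
   by (subst fd) (simp add: abs_mult mult.commute del: of_nat_Suc)
 qed
 then show ?thesis by blast
qed

lemma nrm_jb1_le:
 fixes f :: "'a::euclidean_space => complex"
 assumes f: "sqint f" and d: "\<And>b. b \<in> Basis \<Longrightarrow> sqint (\<lambda>xi. of_real (b \<bullet> xi) * f xi)"
 shows "sqint (jb1 f)" "nrm (jb1 f) \<le> nrm f + (\<Sum>b\<in>Basis. nrm (\<lambda>xi. of_real (b \<bullet> xi) * f xi))"
proof -
 note [measurable] = sqint_measurable[OF f]
 have ab: "sqint (\<lambda>xi. of_real (cmod (g xi)))" "nrm (\<lambda>xi. of_real (cmod (g xi))) = nrm g" if "sqint g" for g :: "'a => complex"
 proof -
  note [measurable] = sqint_measurable[OF that]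
  show "sqint (\<lambda>xi. of_real (cmod (g xi)))" by (rule sqint_bound[OF that, where c=1]) auto
 qed (simp add: nrm_def)
 let ?g = "\<lambda>b xi. complex_of_real (cmod (of_real (b \<bullet> xi) * f xi))"
 have sum: "sqint (\<lambda>xi. \<Sum>b\<in>I. ?g b xi) \<and> nrm (\<lambda>xi. \<Sum>b\<in>I. ?g b xi) \<le> (\<Sum>b\<in>I. nrm (\<lambda>xi. of_real (b \<bullet> xi) * f xi))"
  if "finite I" "I \<subseteq> Basis" for I
  using that
 proof (induction I)
  case (insert b I)
  then have IH: "sqint (\<lambda>xi. \<Sum>b\<in>I. ?g b xi)" "nrm (\<lambda>xi. \<Sum>b\<in>I. ?g b xi) \<le> (\<Sum>b\<in>I. nrm (\<lambda>xi. of_real (b \<bullet> xi) * f xi))" by auto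
  have b: "sqint (?g b)" "nrm (?g b) = nrm (\<lambda>xi. of_real (b \<bullet> xi) * f xi)" using ab[OF d[of b]] insert by auto
  show ?case
   using sqint_add[OF b(1) IH(1)] nrm_triangle[OF b(1) IH(1)] b(2) IH(2) insert by (simp del: of_real_mult)
 qed simp
 note S = sum[OF finite_Basis subset_refl]
 have big: "sqint (\<lambda>xi. of_real (cmod (f xi)) + (\<Sum>b\<in>Basis. ?g b xi))"
  by (intro sqint_add ab f conjunct1[OF S])
 have le: "AE xi in lborel. cmod (jb1 f xi) \<le> 1 * cmod (of_real (cmod (f xi)) + (\<Sum>b\<in>Basis. ?g b xi))"
 proof (rule AE_I2)
  fix xi :: 'a
  have "jb xi \<le> 1 + norm xi" using jb_lipschitz[of xi 0] by (simp add: jb_def)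
  also have "norm xi \<le> (\<Sum>b\<in>Basis. \<bar>b \<bullet> xi\<bar>)" using norm_le_l1[of xi] by (simp add: inner_commute)
  finally have "jb xi * cmod (f xi) \<le> (1 + (\<Sum>b\<in>Basis. \<bar>b \<bullet> xi\<bar>)) * cmod (f xi)" by (intro mult_right_mono) auto
  also have "\<dots> = cmod (of_real (cmod (f xi) + (\<Sum>b\<in>Basis. cmod (of_real (b \<bullet> xi) * f xi))))"
   by (simp only: norm_of_real) (simp add: norm_mult distrib_right sum_distrib_right sum_nonneg)
  finally show "cmod (jb1 f xi) \<le> 1 * cmod (of_real (cmod (f xi)) + (\<Sum>b\<in>Basis. ?g b xi))"
   using jb_pos[of xi] by (simp only: norm_mult[of "of_real (jb xi)"] norm_of_real abs_of_pos[OF jb_pos] mult_1 of_real_add of_real_sum)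
 qed
 show "sqint (jb1 f)" by (rule sqint_bound[OF big _ le]) measurable
 have "nrm (jb1 f) \<le> 1 * nrm (\<lambda>xi. of_real (cmod (f xi)) + (\<Sum>b\<in>Basis. ?g b xi))"
  by (rule nrm_bound[OF big _ le]) auto
 then show "nrm (jb1 f) \<le> nrm f + (\<Sum>b\<in>Basis. nrm (\<lambda>xi. of_real (b \<bullet> xi) * f xi))"
  using nrm_triangle[OF ab(1)[OF f] conjunct1[OF S]] ab(2)[OF f] conjunct2[OF S] by simp
qed

text \<open>The weighted transforms that the energy method uses in place of test functions are not
  transforms of test functions. Their inverse transforms are smooth and, by the symmetry, real;
  spatial cutoffs make them test functions. Convergence includes the first derivatives, which is the
  norm in which the transport form is continuous.\<close>

lemma bandlimited_approx:
 fixes p :: "'a::euclidean_space => complex"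
 assumes p: "band R p" and s: "sqint p" and R: "0 \<le> R"
  and sym: "AE xi in lborel. p (- xi) = cnj (p xi)"
 shows "\<exists>phi. (\<forall>n::nat. test_function UNIV (phi n :: 'a => real)) \<and>
  (\<lambda>n. nrm (jb1 (\<lambda>xi. hat (\<lambda>x. of_real (phi n x)) xi - p xi))) \<longlonglongrightarrow> 0"
proof -
 let ?c = "complex_of_real (fconst TYPE('a))"
 define psi where "psi x = Re (?c * bl p x)" for x
 note w = sqint_bl[OF p s R]
 have Ckpsi: "Ck k psi" for k
  unfolding psi_def[abs_def]
  by (intro Ck_bounded_linear[OF bounded_linear_Re] Ck_bounded_linear[OF bounded_linear_mult_right] Ck_bl[OF p R])
 have [measurable]: "psi \<in> borel_measurable borel"
  by (rule borel_measurable_continuous_onI[OF Ck_continuous[OF Ckpsi[of 0]]])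
 define D where "D v x = frechet_derivative psi (at x) v" for v x
 have psiD: "(psi has_derivative (\<lambda>v. D v x)) (at x)" for x
  using Ck_Suc_has_derivative[OF Ckpsi, of x] by (simp add: D_def[abs_def])
 have [measurable]: "D v \<in> borel_measurable borel" for v
  unfolding D_def[abs_def] by (rule borel_measurable_continuous_onI[OF Ck_continuous[OF Ck_Suc_derivative[OF Ckpsi[of 1, simplified One_nat_def]]]])
 have real: "AE x in lborel. of_real (psi x) = ?c * bl p x"
 proof -
  have "AE xi in lborel. hat (\<lambda>x. ?c * bl p x) (0 - xi) = p (0 - xi)" by (rule AE_reflect[OF w(2)])
  then have "AE xi in lborel. hat (\<lambda>x. ?c * bl p x) (- xi) = cnj (hat (\<lambda>x. ?c * bl p x) xi)"
   using w(2) sym by eventually_elim simp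
  from hat_real_of_symmetric[OF w(1) this] show ?thesis by (simp only: psi_def)
 qed
 have spsi: "sqint (\<lambda>x. of_real (psi x))" by (rule sqint_cong_AE[OF w(1) _ real]) measurable
 have hpsi: "AE xi in lborel. hat (\<lambda>x. of_real (psi x)) xi = p xi"
  using L2_of_AE_sqint(3)[OF w(1) real] w(2) by simp
 have sD: "sqint (\<lambda>x. of_real (D v x))" and hD: "AE xi in lborel. hat (\<lambda>x. of_real (D v x)) xi = \<i> * (of_real (v \<bullet> xi) * p xi)" for v
 proof -
  let ?q = "\<lambda>xi. \<i> * (of_real (v \<bullet> xi) * p xi)"
  have q: "band R ?q" by (intro band_cmult band_mult(1) p R)
  note [measurable] = sqint_measurable[OF s]
  have sq: "sqint ?q"
  proof (rule sqint_bound[OF s, where c="norm v * R"])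
   show "AE xi in lborel. cmod (?q xi) \<le> norm v * R * cmod (p xi)"
   proof (rule AE_I2)
    fix xi show "cmod (?q xi) \<le> norm v * R * cmod (p xi)"
    proof (cases "R \<le> norm xi")
     case True then show ?thesis using p by (simp add: band_def)
    next
     case False
     have "\<bar>v \<bullet> xi\<bar> \<le> norm v * norm xi" by (rule Cauchy_Schwarz_ineq2)
     also have "\<dots> \<le> norm v * R" using False by (intro mult_left_mono) auto
     finally show ?thesis by (simp add: norm_mult mult_right_mono)
    qed
   qed
  qed measurable
  note w' = sqint_bl[OF q sq R]
  have D: "D v x = Re (?c * bl ?q x)" for x
  proof -
   have "((\<lambda>x. Re (?c * bl p x)) has_derivative (\<lambda>v. Re (?c * bl (\<lambda>xi. \<i> * (of_real (v \<bullet> xi) * p xi)) x))) (at x)"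
    by (intro bounded_linear.has_derivative[OF bounded_linear_Re] has_derivative_mult_right bl_has_derivative[OF p R])
   then have "(\<lambda>v. D v x) = (\<lambda>v. Re (?c * bl (\<lambda>xi. \<i> * (of_real (v \<bullet> xi) * p xi)) x))"
    using has_derivative_unique[OF psiD[of x]] by (simp add: psi_def[abs_def])
   then show ?thesis by (rule fun_cong)
  qed
  have real': "AE x in lborel. of_real (D v x) = ?c * bl ?q x"
  proof -
   have "AE xi in lborel. hat (\<lambda>x. ?c * bl ?q x) (0 - xi) = ?q (0 - xi)" by (rule AE_reflect[OF w'(2)])
   then have "AE xi in lborel. hat (\<lambda>x. ?c * bl ?q x) (- xi) = cnj (hat (\<lambda>x. ?c * bl ?q x) xi)"
    using w'(2) sym by eventually_elim simp
   from hat_real_of_symmetric[OF w'(1) this] show ?thesis by (simp only: D)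
  qed
  show "sqint (\<lambda>x. of_real (D v x))" by (rule sqint_cong_AE[OF w'(1) _ real']) measurable
  show "AE xi in lborel. hat (\<lambda>x. of_real (D v x)) xi = ?q xi"
   using L2_of_AE_sqint(3)[OF w'(1) real'] w'(2) by simp
 qed
 define phi where "phi n x = cutoff n x * psi x" for n :: nat and x
 have [measurable]: "cutoff n \<in> borel_measurable borel" for n :: nat
  by (rule borel_measurable_continuous_onI[OF Ck_continuous[OF Ck_cutoff[of 0]]])
 have t: "test_function UNIV (phi n)" for n
 proof (rule test_functionI[where K="cball 0 (real (Suc n))"])
  show "Ck k (phi n)" for k unfolding phi_def[abs_def] by (intro Ck_mult Ck_cutoff Ckpsi)
  show "x \<notin> cball 0 (real (Suc n)) \<Longrightarrow> phi n x = 0" for x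
   using cutoff_support[of x n] by (simp only: phi_def mult_zero_left simp_thms)
 qed auto
 note sphi = test_function_integrable(2)[OF t]
 let ?e = "\<lambda>n xi. hat (\<lambda>x. of_real (phi n x)) xi - p xi"
 have se: "sqint (?e n)" for n by (intro sqint_diff hat_fourier(1) sphi s)
 have e0: "nrm (?e n) = nrm (\<lambda>x. of_real (phi n x) - of_real (psi x))" for n
 proof -
  note d = sqint_diff[OF sphi[of n] spsi]
  have "AE xi in lborel. ?e n xi = hat (\<lambda>x. of_real (phi n x) - of_real (psi x)) xi"
   using hat_diff[OF sphi[of n] spsi] hpsi by eventually_elim simp
  from nrm_cong_AE[OF sqint_measurable[OF se] sqint_measurable[OF hat_fourier(1)[OF d]] this]
  show ?thesis using nrm_hat[OF d] by simp
 qed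
 have e1: "sqint (\<lambda>xi. of_real (v \<bullet> xi) * ?e n xi)"
  "nrm (\<lambda>xi. of_real (v \<bullet> xi) * ?e n xi) = nrm (\<lambda>x. of_real (frechet_derivative (phi n) (at x) v) - of_real (D v x))" for n v
 proof -
  note sd = test_function_integrable(2)[OF test_function_derivative[OF t[of n], of v]]
  note d = sqint_diff[OF sd sD[of v]]
  note [measurable] = sqint_measurable[OF se]
  have ae: "AE xi in lborel. of_real (v \<bullet> xi) * ?e n xi = - \<i> * hat (\<lambda>x. of_real (frechet_derivative (phi n) (at x) v) - of_real (D v x)) xi"
   using hat_diff[OF sd sD[of v]] hD[of v] hat_derivative[OF t[of n], of v]
  proof eventually_elim
   case (elim xi)
   show ?case unfolding elim(1) elim(2) elim(3) by (simp add: right_diff_distrib mult.assoc[symmetric])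
  qed
  note sc = sqint_cmult[OF hat_fourier(1)[OF d], of "- \<i>"]
  show "sqint (\<lambda>xi. of_real (v \<bullet> xi) * ?e n xi)"
   by (rule sqint_cong_AE[OF sc _ ae]) measurable
  then show "nrm (\<lambda>xi. of_real (v \<bullet> xi) * ?e n xi) = nrm (\<lambda>x. of_real (frechet_derivative (phi n) (at x) v) - of_real (D v x))"
   using nrm_cong_AE[OF sqint_measurable sqint_measurable[OF sc] ae] nrm_hat[OF d] by (simp only: nrm_cmult) simp
 qed
 have l0: "(\<lambda>n. nrm (\<lambda>x. of_real (phi n x) - of_real (psi x))) \<longlonglongrightarrow> 0"
 proof (rule nrm_dominated[OF _ spsi sqint_cmult[OF spsi, of "exp 1"]])
  show "AE x in lborel. (\<lambda>n. complex_of_real (phi n x)) \<longlonglongrightarrow> of_real (psi x)"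
  proof (rule AE_I2)
   fix x
   have "(\<lambda>n. complex_of_real (cutoff n x * psi x)) \<longlonglongrightarrow> of_real (1 * psi x)"
    by (intro tendsto_intros cutoff_tendsto)
   then show "(\<lambda>n. complex_of_real (phi n x)) \<longlonglongrightarrow> of_real (psi x)" by (simp add: phi_def)
  qed
  show "AE x in lborel. cmod (of_real (phi n x)) \<le> cmod (exp 1 * of_real (psi x))" for n
   using cutoff_bounded by (intro AE_I2) (auto simp: phi_def norm_mult abs_mult intro!: mult_right_mono)
  show "(\<lambda>x. complex_of_real (phi n x)) \<in> borel_measurable borel" for n unfolding phi_def by measurable
 qed
 \<comment> \<open>By the product rule, the derivative of the cutoff multiplies the square
   integrable function \<open>psi\<close> and tends to zero; the remaining term converges as before.
   One majorant serves both.\<close>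
 have l1: "(\<lambda>n. nrm (\<lambda>x. of_real (frechet_derivative (phi n) (at x) v) - of_real (D v x))) \<longlonglongrightarrow> 0" for v
 proof -
  obtain B where B: "\<And>n (x::'a). \<bar>frechet_derivative (cutoff n) (at x) v\<bar> \<le> B * inverse (real (Suc n))"
   using cutoff_derivative by blast
  have B0: "0 \<le> B" using order_trans[OF abs_ge_zero B[of 0 0]] by simp
  have fd: "frechet_derivative (phi n) (at x) v = cutoff n x * D v x + frechet_derivative (cutoff n) (at x) v * psi x" for n x
  proof -
   have "(phi n has_derivative (\<lambda>v. cutoff n x * D v x + frechet_derivative (cutoff n) (at x) v * psi x)) (at x)"
    unfolding phi_def[abs_def] by (intro has_derivative_mult psiD Ck_Suc_has_derivative[OF Ck_cutoff])
   from frechet_derivative_at[OF this, symmetric] show ?thesis by (rule fun_cong)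
  qed
  have sbig: "sqint (\<lambda>x. of_real (exp 1) * of_real (cmod (of_real (D v x))) + of_real B * of_real (cmod (of_real (psi x))))"
  proof (intro sqint_add sqint_cmult)
   show "sqint (\<lambda>x. complex_of_real (cmod (of_real (D v x))))" by (rule sqint_bound[OF sD[of v], where c=1]) auto
   show "sqint (\<lambda>x. complex_of_real (cmod (of_real (psi x))))" by (rule sqint_bound[OF spsi, where c=1]) auto
  qed
  show ?thesis
  proof (rule nrm_dominated[OF _ sD sbig])
   show "(\<lambda>x. complex_of_real (frechet_derivative (phi n) (at x) v)) \<in> borel_measurable borel" for n
    using sqint_measurable[OF test_function_integrable(2)[OF test_function_derivative[OF t]]] .
   show "AE x in lborel. (\<lambda>n. complex_of_real (frechet_derivative (phi n) (at x) v)) \<longlonglongrightarrow> of_real (D v x)"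
   proof (rule AE_I2)
    fix x
    have "(\<lambda>n. frechet_derivative (cutoff n) (at x) v) \<longlonglongrightarrow> 0"
    proof (rule Lim_null_comparison)
     show "\<forall>\<^sub>F n in sequentially. norm (frechet_derivative (cutoff n) (at x) v) \<le> B * inverse (real (Suc n))"
      using B by (intro always_eventually) simp
     show "(\<lambda>n. B * inverse (real (Suc n))) \<longlonglongrightarrow> 0"
      by (rule tendsto_mult_right_zero[OF LIMSEQ_inverse_real_of_nat])
    qed
    then have "(\<lambda>n. complex_of_real (cutoff n x * D v x + frechet_derivative (cutoff n) (at x) v * psi x)) \<longlonglongrightarrow> of_real (1 * D v x + 0 * psi x)"
     by (intro tendsto_intros cutoff_tendsto)
    then show "(\<lambda>n. complex_of_real (frechet_derivative (phi n) (at x) v)) \<longlonglongrightarrow> of_real (D v x)" by (simp add: fd)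
   qed
   show "AE x in lborel. cmod (of_real (frechet_derivative (phi n) (at x) v)) \<le>
    cmod (of_real (exp 1) * of_real (cmod (of_real (D v x))) + of_real B * of_real (cmod (of_real (psi x))))" for n
   proof (rule AE_I2)
    fix x
    have i1: "inverse (real (Suc n)) \<le> 1" by (simp add: field_simps)
    have "\<bar>frechet_derivative (cutoff n) (at x) v\<bar> \<le> B"
     using B[of n x] mult_left_mono[OF i1 B0] by linarith
    then have "\<bar>cutoff n x * D v x + frechet_derivative (cutoff n) (at x) v * psi x\<bar> \<le> exp 1 * \<bar>D v x\<bar> + B * \<bar>psi x\<bar>"
     using cutoff_bounded[of n x]
     by (intro order_trans[OF abs_triangle_ineq] add_mono) (auto simp: abs_mult intro!: mult_right_mono)
    also have "\<dots> = cmod (of_real (exp 1 * \<bar>D v x\<bar> + B * \<bar>psi x\<bar>))"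
     using B0 by (simp only: norm_of_real) simp
    also have "complex_of_real (exp 1 * \<bar>D v x\<bar> + B * \<bar>psi x\<bar>) =
      of_real (exp 1) * of_real (cmod (of_real (D v x))) + of_real B * of_real (cmod (of_real (psi x)))"
     by (simp only: norm_of_real of_real_add of_real_mult)
    finally show "cmod (of_real (frechet_derivative (phi n) (at x) v)) \<le>
     cmod (of_real (exp 1) * of_real (cmod (of_real (D v x))) + of_real B * of_real (cmod (of_real (psi x))))"
     unfolding fd norm_of_real[of "cutoff n x * D v x + frechet_derivative (cutoff n) (at x) v * psi x"] .
   qed
  qed
 qed
 show ?thesis
 proof (intro exI[of _ phi] conjI allI t)
  have lim: "(\<lambda>n. nrm (\<lambda>x. of_real (phi n x) - of_real (psi x)) +
    (\<Sum>b\<in>(Basis::'a set). nrm (\<lambda>x. of_real (frechet_derivative (phi n) (at x) b) - of_real (D b x)))) \<longlonglongrightarrow> 0 + (\<Sum>b\<in>(Basis::'a set). 0)"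
   by (intro tendsto_add l0 tendsto_sum l1)
  show "(\<lambda>n. nrm (jb1 (?e n))) \<longlonglongrightarrow> 0"
  proof (rule tendsto_sandwich[OF _ _ tendsto_const lim[simplified]])
   show "\<forall>\<^sub>F n in sequentially. nrm (jb1 (?e n)) \<le> nrm (\<lambda>x. of_real (phi n x) - of_real (psi x)) +
    (\<Sum>b\<in>Basis. nrm (\<lambda>x. of_real (frechet_derivative (phi n) (at x) b) - of_real (D b x)))"
    using nrm_jb1_le(2)[OF se e1(1)] by (intro always_eventually) (simp only: e0 e1(2) simp_thms)
  qed auto
 qed
qed

section \<open>Integrals in time\<close>

text \<open>Completeness of Lebesgue measure. It is what allows functions of time that are known
  only almost everywhere to be measurable.\<close>

lemma lebesgue_on_AE_measurable:
 fixes f g :: "real => real"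
 assumes S: "S \<in> sets lebesgue" and f: "f \<in> borel_measurable (lebesgue_on S)"
  and ae: "AE t in lebesgue_on S. f t = g t"
 shows "g \<in> borel_measurable (lebesgue_on S)"
proof -
 have 1: "(\<lambda>t. if t \<in> S then f t else 0) \<in> borel_measurable lebesgue"
  using borel_measurable_if[OF S, of f] f by simp
 have "AE t in lebesgue. t \<in> S \<longrightarrow> f t = g t"
  using ae S by (subst (asm) AE_restrict_space_iff) auto
 then have 2: "AE t in lebesgue. (if t \<in> S then f t else 0) = (if t \<in> S then g t else 0)"
  by (auto elim: eventually_mono)
 show ?thesis
  using borel_measurable_AE[OF 1 2] borel_measurable_if[OF S, of g] by simp
qed

lemma lebesgue_on_LIMSEQ_measurable:
 fixes f :: "real => real"
 assumes S: "S \<in> sets lebesgue" and g: "\<And>n::nat. g n \<in> borel_measurable (lebesgue_on S)"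
  and ae: "AE t in lebesgue_on S. (\<lambda>n. g n t) \<longlonglongrightarrow> f t"
 shows "f \<in> borel_measurable (lebesgue_on S)"
proof (rule lebesgue_on_AE_measurable[OF S])
 show "(\<lambda>t. lim (\<lambda>n. g n t)) \<in> borel_measurable (lebesgue_on S)"
  using g by (rule borel_measurable_lim_metric)
 show "AE t in lebesgue_on S. lim (\<lambda>n. g n t) = f t"
  using ae by eventually_elim (rule limI)
qed

lemma lebesgue_on_integral_cong_AE:
 fixes f g :: "real => real"
 assumes S: "S \<in> sets lebesgue" and f: "f \<in> borel_measurable (lebesgue_on S)"
  and ae: "AE t in lebesgue_on S. f t = g t"
 shows "integral\<^sup>L (lebesgue_on S) f = integral\<^sup>L (lebesgue_on S) g"
 using lebesgue_on_AE_measurable[OF assms] by (intro integral_cong_AE f ae)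

section \<open>Integrals over subintervals and Gronwall's lemma\<close>

abbreviation II :: "real => real => (real => real) => real" where
 "II s t g \<equiv> integral\<^sup>L (lebesgue_on {s..t}) g"

lemma AE_lebesgue_on_subset:
 assumes "AE t in lebesgue_on {a..b::real}. P t" "a \<le> s" "t \<le> b"
 shows "AE t in lebesgue_on {s..t}. P t"
proof -
 have "AE x in lebesgue. x \<in> {a..b} \<longrightarrow> P x"
  using assms(1) by (subst (asm) AE_restrict_space_iff) auto
 then have "AE x in lebesgue. x \<in> {s..t} \<longrightarrow> P x"
  using assms(2,3) by (auto elim: eventually_mono)
 then show ?thesis by (subst AE_restrict_space_iff) auto
qed

lemma integrable_lebesgue_on_subset:
 fixes g :: "real => real"
 assumes "integrable (lebesgue_on {a..b}) g" "a \<le> s" "t \<le> b"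
 shows "integrable (lebesgue_on {s..t}) g"
proof -
 have "set_integrable lebesgue {a..b} g" using assms(1) by (simp add: integrable_restrict_space set_integrable_def)
 then have "set_integrable lebesgue {s..t} g" by (rule set_integrable_subset) (use assms in auto)
 then show ?thesis by (simp add: integrable_restrict_space set_integrable_def)
qed

lemma II_combine:
 assumes g: "integrable (lebesgue_on {a..c}) g" and "a \<le> b" "b \<le> c"
 shows "II a b g + II b c g = II a c g"
proof -
 have i: "integrable (lebesgue_on {a..b}) g" "integrable (lebesgue_on {b..c}) g"
  using integrable_lebesgue_on_subset[OF g] assms(2,3) by auto
 have "g integrable_on {a..c}" using g by (simp add: integrable_on_lebesgue_on)
 then show ?thesis
  using Henstock_Kurzweil_Integration.integral_combine[OF assms(2,3)] i g
  by (simp add: lebesgue_integral_eq_integral)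
qed

lemma finite_measure_lebesgue_on: "finite_measure (lebesgue_on {s..t::real})"
 by (rule finite_measureI) (simp add: emeasure_restrict_space emeasure_lborel_Icc_eq)

lemma II_const: "s \<le> t \<Longrightarrow> II s t (\<lambda>_. c) = c * (t - s)"
 by (simp add: measure_restrict_space)

lemma integrable_lebesgue_on_bounded:
 fixes g :: "real => real"
 assumes "g \<in> borel_measurable (lebesgue_on {s..t})" "AE x in lebesgue_on {s..t}. \<bar>g x\<bar> \<le> K"
 shows "integrable (lebesgue_on {s..t}) g"
 using finite_measure.integrable_const_bound[OF finite_measure_lebesgue_on, of g K s t] assms by simp

lemma II_mono:
 assumes "integrable (lebesgue_on {s..t}) f" "integrable (lebesgue_on {s..t}) g"
  "AE x in lebesgue_on {s..t}. f x \<le> g x"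
 shows "II s t f \<le> II s t g"
 by (rule integral_mono_AE[OF assms])

lemma integrable_lebesgue_on_const: "integrable (lebesgue_on {s..t::real}) (\<lambda>_. c :: real)"
 by (rule integrable_lebesgue_on_bounded[of _ _ _ "\<bar>c\<bar>"]) auto

lemma II_same: "II s s g = 0"
proof -
 have "AE x in lebesgue. x \<noteq> s" by (simp add: AE_completion_iff AE_lborel_singleton)
 then have "AE x in lebesgue. x \<in> {s..s} \<longrightarrow> g x = 0" by (rule eventually_mono) simp
 then have "AE x in lebesgue_on {s..s}. g x = 0" by (subst AE_restrict_space_iff) auto
 then show ?thesis by (rule integral_eq_zero_AE)
qed

lemma II_le_const:
 assumes "s \<le> t" "integrable (lebesgue_on {s..t}) f" "AE x in lebesgue_on {s..t}. f x \<le> c"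
 shows "II s t f \<le> c * (t - s)"
 using II_mono[OF assms(2) integrable_lebesgue_on_const assms(3)] unfolding II_const[OF assms(1)] .

text \<open>On \<open>Suc n\<close> equal pieces the integrals add up exactly, while the quadratic
  errors sum to \<open>K * t\<^sup>2 / Suc n\<close>. This takes the place of a differential
  inequality, as \<open>E\<close> need not be differentiable.\<close>

lemma telescoping:
 fixes E h :: "real => real"
 assumes t: "0 \<le> t" and h: "integrable (lebesgue_on {0..t}) h"
  and E: "\<And>r s. 0 \<le> r \<Longrightarrow> r \<le> s \<Longrightarrow> s \<le> t \<Longrightarrow> E s - E r \<le> II r s h + K * (s - r)\<^sup>2"
 shows "E t - E 0 \<le> II 0 t h"
proof -
 have bd: "E t - E 0 \<le> II 0 t h + K * t\<^sup>2 * inverse (real (Suc n))" for n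
 proof -
  define tau where "tau k = real k * (t / real (Suc n))" for k
  have "E (tau k) - E 0 \<le> II 0 (tau k) h + real k * (K * (t / real (Suc n))\<^sup>2)" if "k \<le> Suc n" for k
   using that
  proof (induction k)
   case 0
   then show ?case using II_same[of 0 h] by (simp add: tau_def)
  next
   case (Suc k)
   have d: "tau (Suc k) - tau k = t / real (Suc n)" by (simp only: tau_def of_nat_Suc distrib_right mult_1_left add_diff_cancel_right')
   have "0 \<le> t / real (Suc n)" using t by simp
   then have a: "0 \<le> tau k" "tau k \<le> tau (Suc k)" using d t by (simp add: tau_def, linarith)
   have "tau (Suc k) \<le> real (Suc n) * (t / real (Suc n))"
    unfolding tau_def using Suc.prems t by (intro mult_right_mono) auto
   then have b: "tau (Suc k) \<le> t" by simp
   have "E (tau (Suc k)) - E (tau k) \<le> II (tau k) (tau (Suc k)) h + K * (t / real (Suc n))\<^sup>2"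
    using E[OF a b] by (simp only: d)
   moreover have "II 0 (tau k) h + II (tau k) (tau (Suc k)) h = II 0 (tau (Suc k)) h"
    by (rule II_combine[OF integrable_lebesgue_on_subset[OF h]]) (use a b in auto)
   moreover have "real (Suc k) * (K * (t / real (Suc n))\<^sup>2) = real k * (K * (t / real (Suc n))\<^sup>2) + K * (t / real (Suc n))\<^sup>2"
    by (simp add: distrib_right)
   ultimately show ?case using Suc by simp
  qed
  from this[of "Suc n"] have "E t - E 0 \<le> II 0 t h + real (Suc n) * (K * (t / real (Suc n))\<^sup>2)"
   by (simp add: tau_def)
  also have "real (Suc n) * (K * (t / real (Suc n))\<^sup>2) = K * t\<^sup>2 * inverse (real (Suc n))"
  proof -
   have "m * (K * (t / m)\<^sup>2) = K * t\<^sup>2 * inverse m" if "m \<noteq> 0" for m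
    using that by (simp add: power2_eq_square field_simps)
   then show ?thesis by simp
  qed
  finally show ?thesis .
 qed
 have "(\<lambda>n. II 0 t h + K * t\<^sup>2 * inverse (real (Suc n))) \<longlonglongrightarrow> II 0 t h + K * t\<^sup>2 * 0"
  by (intro tendsto_intros LIMSEQ_inverse_real_of_nat)
 then show ?thesis
  using LIMSEQ_le_const[of _ "II 0 t h" "E t - E 0"] bd by auto
qed

text \<open>The coefficient is merely bounded and measurable, so nothing is differentiated: the
  majorant \<open>Y\<close> multiplied by the damping exponential has increments bounded by a
  quadratic error, and \<open>telescoping\<close> yields \<open>Z t \<le> Z 0\<close>.\<close>

lemma gronwall:
 fixes e a f :: "real => real"
 assumes t: "0 \<le> t" and e0: "0 \<le> e\<^sub>0"
  and e: "e \<in> borel_measurable (lebesgue_on {0..t})" "AE x in lebesgue_on {0..t}. e x \<le> B" "\<And>x. x \<in> {0..t} \<Longrightarrow> 0 \<le> e x"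
  and a: "a \<in> borel_measurable (lebesgue_on {0..t})" "AE x in lebesgue_on {0..t}. a x \<le> A" "\<And>x. 0 \<le> a x"
  and f: "integrable (lebesgue_on {0..t}) f" "\<And>x. 0 \<le> f x"
  and ineq: "\<And>s. s \<in> {0..t} \<Longrightarrow> e s \<le> e\<^sub>0 + II 0 s (\<lambda>x. a x * e x + f x)"
 shows "e t \<le> exp (II 0 t a) * (e\<^sub>0 + II 0 t f)"
proof -
 have aeI: "AE x in lebesgue_on {0..t}. 0 \<le> e x" using e(3) by (intro AE_I2) (simp add: space_restrict_space)
 have ai: "integrable (lebesgue_on {0..t}) a"
 proof (rule integrable_lebesgue_on_bounded[OF a(1), of A])
  show "AE x in lebesgue_on {0..t}. \<bar>a x\<bar> \<le> A" using a(2) by eventually_elim (use a(3) in simp)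
 qed
 \<comment> \<open>The bounds \<open>A\<close> and \<open>B\<close> are not assumed nonnegative;
   maxima with zero keep products monotone.\<close>
 define B' where "B' = max B 0"
 define A' where "A' = max A 0"
 have AB: "0 \<le> A'" "0 \<le> B'" by (auto simp: A'_def B'_def)
 have ae: "AE x in lebesgue_on {0..t}. a x * e x \<le> A' * B' \<and> 0 \<le> a x * e x"
  using a(2) e(2) aeI
 proof eventually_elim
  case (elim x)
  then show ?case using a(3)[of x] AB by (auto simp: A'_def B'_def intro!: mult_mono mult_nonneg_nonneg)
 qed
 have aei: "integrable (lebesgue_on {0..t}) (\<lambda>x. a x * e x)"
 proof (rule integrable_lebesgue_on_bounded[where K="A' * B'"])
  show "(\<lambda>x. a x * e x) \<in> borel_measurable (lebesgue_on {0..t})" using a(1) e(1) by (rule borel_measurable_times)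
  show "AE x in lebesgue_on {0..t}. \<bar>a x * e x\<bar> \<le> A' * B'" using ae by eventually_elim simp
 qed
 define H where "H = e\<^sub>0 + II 0 t f"
 have H0: "0 \<le> H" unfolding H_def using e0 f(2) by (intro add_nonneg_nonneg Bochner_Integration.integral_nonneg) auto
 \<comment> \<open>\<open>H\<close> already contains the integral of \<open>f\<close> up to the
   final time. Hence \<open>Y\<close> majorises \<open>e\<close>, and its increments involve only
   \<open>a * e\<close>.\<close>
 define Y where "Y s = H + II 0 s (\<lambda>x. a x * e x)" for s
 have IIpos: "0 \<le> II r s g" if "AE x in lebesgue_on {r..s}. 0 \<le> g x" for r s and g :: "real => real"
  by (rule integral_nonneg_AE[OF that])
 have Y0: "0 \<le> Y s" if "s \<in> {0..t}" for s
 proof -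
  have "AE x in lebesgue_on {0..t}. 0 \<le> a x * e x" using ae by eventually_elim simp
  then have "AE x in lebesgue_on {0..s}. 0 \<le> a x * e x" by (rule AE_lebesgue_on_subset) (use that in auto)
  then show ?thesis unfolding Y_def by (intro add_nonneg_nonneg H0 IIpos)
 qed
 have Ydiff: "Y s - Y r = II r s (\<lambda>x. a x * e x)" if "0 \<le> r" "r \<le> s" "s \<le> t" for r s
  using II_combine[of 0 s "\<lambda>x. a x * e x" r] integrable_lebesgue_on_subset[OF aei, of 0 s] that by (simp add: Y_def)
 have eY: "e s \<le> Y s" if s: "s \<in> {0..t}" for s
 proof -
  have i: "integrable (lebesgue_on {0..s}) (\<lambda>x. a x * e x)" "integrable (lebesgue_on {0..s}) f"
   using integrable_lebesgue_on_subset[OF aei, of 0 s] integrable_lebesgue_on_subset[OF f(1), of 0 s] s by auto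
  have "e s \<le> e\<^sub>0 + (II 0 s (\<lambda>x. a x * e x) + II 0 s f)"
   using ineq[OF s] i by simp
  moreover have "0 \<le> II s t f" using f(2) by (intro IIpos) auto
  then have "II 0 s f \<le> II 0 t f" using II_combine[OF f(1), of s] s by auto
  ultimately show ?thesis by (simp add: Y_def H_def)
 qed
 define Z where "Z s = exp (- II 0 s a) * Y s" for s
 have "Z t - Z 0 \<le> II 0 t (\<lambda>_. 0)"
 proof (rule telescoping[OF t integrable_lebesgue_on_const, where K="A' * (A' * B')"])
  fix r s assume rs: "0 \<le> r" "r \<le> s" "s \<le> t"
  let ?b = "II r s a" and ?K = "A' * (A' * B')"
  have ars: "integrable (lebesgue_on {r..s}) a" "integrable (lebesgue_on {r..s}) (\<lambda>x. a x * e x)"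
   using integrable_lebesgue_on_subset[OF ai, of r s] integrable_lebesgue_on_subset[OF aei, of r s] rs by auto
  have aers: "AE x in lebesgue_on {r..s}. a x * e x \<le> A' * B' \<and> 0 \<le> a x * e x" "AE x in lebesgue_on {r..s}. a x \<le> A"
   using AE_lebesgue_on_subset[OF ae, of r s] AE_lebesgue_on_subset[OF a(2), of r s] rs by auto
  have b0: "0 \<le> ?b" using a(3) by (intro IIpos) auto
  have b1: "?b \<le> A' * (s - r)"
  proof (rule II_le_const[OF rs(2) ars(1)])
   show "AE x in lebesgue_on {r..s}. a x \<le> A'" using aers(2) by eventually_elim (simp add: A'_def)
  qed
  have Yx: "Y x \<le> Y r + A' * B' * (s - r)" if "x \<in> {r..s}" for x
  proof -
   have "Y x - Y r = II r x (\<lambda>x. a x * e x)" using that rs by (intro Ydiff) auto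
   also have "\<dots> \<le> A' * B' * (x - r)"
   proof (rule II_le_const)
    show "integrable (lebesgue_on {r..x}) (\<lambda>x. a x * e x)"
     using that rs by (intro integrable_lebesgue_on_subset[OF aei]) auto
    have "AE x in lebesgue_on {0..t}. a x * e x \<le> A' * B'" using ae by eventually_elim simp
    then show "AE x in lebesgue_on {r..x}. a x * e x \<le> A' * B'"
     by (rule AE_lebesgue_on_subset) (use that rs in auto)
   qed (use that in auto)
   also have "\<dots> \<le> A' * B' * (s - r)" using that AB by (intro mult_left_mono) auto
   finally show ?thesis by simp
  qed
  let ?c = "Y r + A' * B' * (s - r)"
  have "Y s - Y r = II r s (\<lambda>x. a x * e x)" by (rule Ydiff[OF rs])
  also have "\<dots> \<le> II r s (\<lambda>x. a x * ?c)"
  proof (rule II_mono[OF ars(2)])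
   show "integrable (lebesgue_on {r..s}) (\<lambda>x. a x * ?c)" using ars(1) by simp
   show "AE x in lebesgue_on {r..s}. a x * e x \<le> a x * ?c"
   proof (rule AE_I2)
    fix x assume "x \<in> space (lebesgue_on {r..s})"
    then have x: "x \<in> {r..s}" by (simp add: space_restrict_space)
    then have "e x \<le> ?c" using eY[of x] Yx[OF x] rs by auto
    then show "a x * e x \<le> a x * ?c" using a(3) by (intro mult_left_mono)
   qed
  qed
  also have "\<dots> = ?b * ?c" by simp
  also have "\<dots> = ?b * Y r + ?b * (A' * B' * (s - r))" by (simp add: distrib_left)
  also have "?b * (A' * B' * (s - r)) \<le> (A' * (s - r)) * (A' * B' * (s - r))"
   using b1 AB rs by (intro mult_right_mono) auto
  also have "(A' * (s - r)) * (A' * B' * (s - r)) = ?K * (s - r)\<^sup>2" by (simp add: power2_eq_square mult_ac)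
  finally have "Y s \<le> (1 + ?b) * Y r + ?K * (s - r)\<^sup>2" by (simp add: algebra_simps)
  moreover have "(1 + ?b) * Y r \<le> exp ?b * Y r"
   using Y0[of r] rs exp_ge_add_one_self[of ?b] by (intro mult_right_mono) auto
  ultimately have Ys: "Y s \<le> exp ?b * Y r + ?K * (s - r)\<^sup>2" by linarith
  have comb: "II 0 r a + ?b = II 0 s a"
   by (rule II_combine[OF integrable_lebesgue_on_subset[OF ai]]) (use rs in auto)
  have "0 \<le> II 0 s a" using a(3) by (intro IIpos) auto
  then have ex: "exp (- II 0 s a) \<le> 1" by simp
  have "Z s \<le> exp (- II 0 s a) * (exp ?b * Y r + ?K * (s - r)\<^sup>2)"
   unfolding Z_def by (intro mult_left_mono Ys) simp
  also have "\<dots> = (exp (- II 0 s a) * exp ?b) * Y r + exp (- II 0 s a) * (?K * (s - r)\<^sup>2)"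
   by (simp only: distrib_left mult.assoc)
  also have "exp (- II 0 s a) * exp ?b = exp (- II 0 r a)"
   unfolding comb[symmetric] by (simp add: mult_exp_exp)
  also have "exp (- II 0 r a) * Y r = Z r" by (simp add: Z_def)
  also have "Z r + exp (- II 0 s a) * (?K * (s - r)\<^sup>2) \<le> Z r + 1 * (?K * (s - r)\<^sup>2)"
   using ex AB by (intro add_left_mono mult_right_mono) auto
  finally show "Z s - Z r \<le> II r s (\<lambda>_. 0) + ?K * (s - r)\<^sup>2" by simp
 qed
 moreover have "Z 0 = H"
  using II_same[of 0 a] II_same[of 0 "\<lambda>x. a x * e x"] by (simp add: Z_def Y_def)
 ultimately have "exp (- II 0 t a) * Y t \<le> H" by (simp add: Z_def)
 then have "Y t \<le> exp (II 0 t a) * H" by (simp add: exp_minus field_simps)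
 then show ?thesis using eY[of t] t by (simp add: H_def)
qed

section \<open>Smooth cutoffs in time\<close>

lemma Ck_inverse:
 fixes g :: "real => real"
 assumes g: "\<And>k. Ck k g" "\<And>x. g x \<noteq> 0"
 shows "Ck k (\<lambda>x. inverse (g x))"
proof (induction k)
 case 0
 show ?case using g(1)[of 0] g(2) by (auto intro!: continuous_intros)
next
 case (Suc k)
 show ?case
 proof (rule Ck_SucI)
  show "((\<lambda>x. inverse (g x)) has_derivative (\<lambda>v. - (inverse (g x) * frechet_derivative g (at x) v * inverse (g x)))) (at x)" for x
   by (rule Deriv.has_derivative_inverse[OF g(2) Ck_Suc_has_derivative[OF g(1)]])
  show "Ck k (\<lambda>x. - (inverse (g x) * frechet_derivative g (at x) v * inverse (g x)))" for v
   by (intro Ck_minus Ck_mult Suc Ck_Suc_derivative g(1))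
 qed
qed

text \<open>A smooth transition that takes place between 1/4 and 3/4. The margins on both sides keep
  supports built from it inside an open interval even when the plateau is meant to reach its
  ends.\<close>

definition step :: "real => real" where
 "step x = flat 0 (x - 1/4) * inverse (flat 0 (x - 1/4) + flat 0 (3/4 - x))"

lemma step_denominator: "0 < flat 0 (x - 1/4) + flat 0 (3/4 - x)"
proof (cases "x > 1/4")
 case True
 then show ?thesis using flat_pos[of "x - 1/4" 0] flat_nonneg[of 0 "3/4 - x"] by linarith
next
 case False
 then show ?thesis using flat_pos[of "3/4 - x" 0] flat_nonneg[of 0 "x - 1/4"] by linarith
qed

lemma Ck_step: "Ck k step"
 unfolding step_def[abs_def]
proof (intro Ck_mult Ck_inverse Ck_add Ck_flat_comp Ck_diff Ck_const Ck_ident)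
 show "flat 0 (x - 1/4) + flat 0 (3/4 - x) \<noteq> 0" for x using step_denominator[of x] by simp
qed

lemma step_0: "x \<le> 1/4 \<Longrightarrow> step x = 0"
 by (simp add: step_def)

lemma step_1: "3/4 \<le> x \<Longrightarrow> step x = 1"
 using step_denominator[of x] by (simp add: step_def)

lemma step_bounds: "0 \<le> step x" "step x \<le> 1"
 using step_denominator[of x] flat_nonneg[of 0 "x - 1/4"] flat_nonneg[of 0 "3/4 - x"]
 by (auto simp: step_def divide_inverse[symmetric])

definition step' :: "real => real" where
 "step' x = frechet_derivative step (at x) 1"

lemma step_has_derivative: "(step has_real_derivative step' x) (at x)"
proof -
 have d: "(step has_derivative frechet_derivative step (at x)) (at x)"
  by (rule Ck_Suc_has_derivative[OF Ck_step])
 have "frechet_derivative step (at x) v = step' x * v" for v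
  using linear_scale[OF has_derivative_linear[OF d], of v 1] by (simp add: step'_def)
 then have "frechet_derivative step (at x) = (*) (step' x)" by auto
 then show ?thesis using d by (simp add: has_field_derivative_def)
qed

lemma step'_continuous: "continuous_on UNIV step'"
 unfolding step'_def[abs_def] using Ck_continuous[OF Ck_Suc_derivative[OF Ck_step[of 1, simplified One_nat_def]]] .

lemma step'_0: "x \<notin> {0..1} \<Longrightarrow> step' x = 0"
proof -
 assume x: "x \<notin> {0..1}"
 have "(step has_real_derivative 0) (at x)"
 proof (cases "x < 0")
  case True
  show ?thesis
  proof (rule DERIV_cong_ev[THEN iffD1, OF refl _ refl])
   show "((\<lambda>_. 0) has_real_derivative 0) (at x)" by simp
   show "\<forall>\<^sub>F y in nhds x. 0 = step y"
    using True eventually_nhds_in_open[of "{..<0}" x] by (auto elim!: eventually_mono simp: step_0)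
  qed
 next
  case False
  then have x1: "1 < x" using x by auto
  show ?thesis
  proof (rule DERIV_cong_ev[THEN iffD1, OF refl _ refl])
   show "((\<lambda>_. 1) has_real_derivative 0) (at x)" by simp
   show "\<forall>\<^sub>F y in nhds x. 1 = step y"
    using x1 eventually_nhds_in_open[of "{1<..}" x] by (auto elim!: eventually_mono simp: step_1)
  qed
 qed
 then show "step' x = 0" using step_has_derivative DERIV_unique by blast
qed

lemma step'_integral: "integrable lborel step'" "(LINT x|lborel. step' x) = 1"
proof -
 have c: "continuous_on {0..1} step'" using step'_continuous continuous_on_subset by blast
 have eq: "(\<lambda>x. indicator {0..1} x *\<^sub>R step' x) = step'"
 proof
  show "indicator {0..1} x *\<^sub>R step' x = step' x" for x using step'_0[of x] by (cases "x \<in> {0..1}") auto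
 qed
 have i: "set_integrable lborel {0..1} step'" by (rule borel_integrable_atLeastAtMost'[OF c])
 then show "integrable lborel step'" unfolding set_integrable_def eq .
 have "(LBINT x. indicator {0..1} x *\<^sub>R step' x) = step 1 - step 0"
 proof (rule integral_FTC_Icc[OF _ _ c])
  show "(step has_vector_derivative step' x) (at x within {0..1})" for x
   using step_has_derivative[of x] by (simp add: has_real_derivative_iff_has_vector_derivative has_vector_derivative_at_within)
 qed simp
 then show "(LINT x|lborel. step' x) = 1" unfolding eq by (simp add: step_0 step_1)
qed

text \<open>Test functions tending to the indicator of the interval from \<open>a\<close> to
  \<open>b\<close> have derivatives that concentrate at the endpoints with mass one and minus one;
  continuity of \<open>f\<close> evaluates these limits, also when \<open>a\<close> is zero or
  \<open>b\<close> is \<open>T\<close>.\<close>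

lemma du_Bois_Reymond:
 fixes f G :: "real => real"
 assumes f: "continuous_on {0..T} f" and G: "integrable (lebesgue_on {0..T}) G"
  and weak: "\<And>theta::real => real. test_function {0<..<T} theta \<Longrightarrow>
   - (LINT t|lebesgue_on {0..T}. frechet_derivative theta (at t) 1 * f t) = (LINT t|lebesgue_on {0..T}. theta t * G t)"
  and ab: "0 \<le> a" "a \<le> b" "b \<le> T"
 shows "f b - f a = II a b G"
proof (cases "a = b")
 case True
 then show ?thesis
  using II_same[of a G] by simp
next
 case False
 then have ab': "a < b" using ab by simp
 \<comment> \<open>Clamping the argument extends \<open>f\<close> continuously and boundedly to the
   line, where integrals can be rescaled freely.\<close>
 define g where "g t = f (max 0 (min T t))" for t
 have gc: "continuous_on UNIV g"
  unfolding g_def by (rule continuous_on_compose2[OF f]) (use ab in \<open>auto intro!: continuous_intros\<close>)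
 have gf: "g t = f t" if "t \<in> {0..T}" for t using that by (simp add: g_def)
 have [measurable]: "g \<in> borel_measurable borel" "step' \<in> borel_measurable borel"
  using gc step'_continuous by (auto intro: borel_measurable_continuous_onI)
 obtain B where B: "\<And>t. \<bar>g t\<bar> \<le> B"
 proof -
  have "bounded (f ` {0..T})" by (intro compact_imp_bounded compact_continuous_image f) simp
  then obtain B where "\<forall>x\<in>{0..T}. \<bar>f x\<bar> \<le> B" by (auto simp: bounded_iff)
  then have "\<bar>g t\<bar> \<le> B" for t unfolding g_def using ab by auto
  then show ?thesis using that by blast
 qed
 \<comment> \<open>For \<open>1 \<le> n * (b - a)\<close> the two transitions do not overlap, and
   the sum minus one is a plateau function.\<close>
 define theta where "theta n t = step (real n * (t - a)) + step (real n * (b - t)) - 1" for n :: nat and t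
 define theta' where "theta' n t = real n * step' (real n * (t - a)) - real n * step' (real n * (b - t))" for n :: nat and t
 have Cktheta: "Ck k (theta n)" for k n
 proof -
  have "Ck k (\<lambda>t. step (real n * (- a) + real n * t))"
   by (rule Ck_affine_comp[OF bounded_linear_mult_right Ck_step])
  moreover have "Ck k (\<lambda>t. step (real n * b + (- real n) * t))"
   by (rule Ck_affine_comp[OF bounded_linear_mult_right Ck_step])
  ultimately have "Ck k (\<lambda>t. step (real n * (- a) + real n * t) + step (real n * b + (- real n) * t) - 1)"
   by (intro Ck_diff Ck_add Ck_const)
  then show ?thesis by (simp add: theta_def[abs_def] algebra_simps)
 qed
 have dtheta: "(theta n has_real_derivative theta' n t) (at t)" for n t
 proof -
  have 1: "((\<lambda>t. real n * (t - a)) has_real_derivative real n) (at t)" by (auto intro!: derivative_eq_intros)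
  have 2: "((\<lambda>t. real n * (b - t)) has_real_derivative - real n) (at t)" by (auto intro!: derivative_eq_intros)
  have "(theta n has_real_derivative (step' (real n * (t - a)) * real n + step' (real n * (b - t)) * - real n - 0)) (at t)"
   unfolding theta_def[abs_def]
   by (intro DERIV_diff DERIV_add DERIV_const DERIV_chain2[OF step_has_derivative 1] DERIV_chain2[OF step_has_derivative 2])
  then show ?thesis by (simp add: theta'_def mult.commute)
 qed
 have ttheta: "test_function {0<..<T} (theta n)" if n: "1 \<le> real n * (b - a)" for n
 proof (rule test_functionI[where K="{a + 1 / (4 * real n)..b - 1 / (4 * real n)}"])
  have n0: "0 < real n" using n by (cases n) auto
  show "{a + 1 / (4 * real n)..b - 1 / (4 * real n)} \<subseteq> {0<..<T}"
  proof
   fix x assume x: "x \<in> {a + 1 / (4 * real n)..b - 1 / (4 * real n)}"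
   have "0 < 1 / (4 * real n)" using n0 by simp
   then show "x \<in> {0<..<T}" using x ab unfolding atLeastAtMost_iff greaterThanLessThan_iff by linarith
  qed
  fix t assume "t \<notin> {a + 1 / (4 * real n)..b - 1 / (4 * real n)}"
  then consider "t < a + 1 / (4 * real n)" | "b - 1 / (4 * real n) < t" by fastforce
  then show "theta n t = 0"
  proof cases
   case 1
   then have u: "real n * (t - a) < 1/4" using n0 by (simp add: field_simps)
   then have "3/4 \<le> real n * (b - t)" using n by (simp add: algebra_simps)
   then show ?thesis using u by (simp add: theta_def step_0 step_1)
  next
   case 2
   then have u: "real n * (b - t) < 1/4" using n0 by (simp add: field_simps)
   then have "3/4 \<le> real n * (t - a)" using n by (simp add: algebra_simps)
   then show ?thesis using u by (simp add: theta_def step_0 step_1)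
  qed
 qed (use Cktheta in auto)
 have lhs: "(LINT t|lebesgue_on {0..T}. frechet_derivative (theta n) (at t) 1 * f t) =
   (LINT y|lborel. step' y * g (a + inverse (real n) * y)) - (LINT y|lborel. step' y * g (b - inverse (real n) * y))"
  if n: "1 \<le> real n * (b - a)" for n
 proof -
  have n0: "0 < real n" using n by (cases n) auto
  have fd: "frechet_derivative (theta n) (at t) 1 = theta' n t" for t
   using frechet_derivative_at[OF dtheta[unfolded has_field_derivative_def], symmetric] by (metis mult.right_neutral)
  have [measurable]: "theta' n \<in> borel_measurable borel" unfolding theta'_def by measurable
  have z: "theta' n t = 0" if "t \<notin> {0..T}" for t
  proof -
   have "test_function {0<..<T} (\<lambda>t. frechet_derivative (theta n) (at t) 1)"
    by (rule test_function_derivative[OF ttheta[OF n]])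
   then have "closure {t. theta' n t \<noteq> 0} \<subseteq> {0<..<T}" unfolding fd test_function_def by simp
   then show ?thesis using that closure_subset[of "{t. theta' n t \<noteq> 0}"] by force
  qed
  have "(LINT t|lebesgue_on {0..T}. frechet_derivative (theta n) (at t) 1 * f t) = (LINT t|lebesgue. indicator {0..T} t *\<^sub>R (theta' n t * f t))"
   by (simp add: fd integral_restrict_space)
  also have "\<dots> = (LINT t|lebesgue. theta' n t * g t)"
   using z gf by (intro Bochner_Integration.integral_cong refl) (auto simp: indicator_def)
  also have "\<dots> = (LINT t|lborel. theta' n t * g t)" by (rule integral_completion) measurable
  also have "\<dots> = (LINT t|lborel. real n * step' (real n * (t - a)) * g t - real n * step' (real n * (b - t)) * g t)"
   by (simp add: theta'_def left_diff_distrib)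
  also have "\<dots> = (LINT t|lborel. real n * step' (real n * (t - a)) * g t) - (LINT t|lborel. real n * step' (real n * (b - t)) * g t)"
  proof (rule Bochner_Integration.integral_diff)
   have bdd: "integrable lborel (\<lambda>t. h t * g t)" if "integrable lborel h" for h
   proof (rule Bochner_Integration.integrable_bound[of _ "\<lambda>t. B * h t"])
    show "integrable lborel (\<lambda>t. B * h t)" using that by simp
    show "(\<lambda>t. h t * g t) \<in> borel_measurable lborel" using that by measurable
    show "AE t in lborel. norm (h t * g t) \<le> norm (B * h t)"
    proof (rule AE_I2)
     fix t
     have "\<bar>g t\<bar> * \<bar>h t\<bar> \<le> \<bar>B\<bar> * \<bar>h t\<bar>" using B[of t] by (intro mult_right_mono) auto
     then show "norm (h t * g t) \<le> norm (B * h t)" by (simp add: abs_mult mult.commute)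
    qed
   qed
   have "integrable lborel (\<lambda>t. step' (real n * (t - a)))" "integrable lborel (\<lambda>t. step' (real n * (b - t)))"
    using integral_scale(2)[of step' "real n" "- real n * a"] integral_scale(2)[of step' "- real n" "real n * b"] n0 step'_integral(1)
    by (simp_all add: algebra_simps)
   then show "integrable lborel (\<lambda>t. real n * step' (real n * (t - a)) * g t)" "integrable lborel (\<lambda>t. real n * step' (real n * (b - t)) * g t)"
    by (auto intro!: bdd)
  qed
  finally have pre: "(LINT t|lebesgue_on {0..T}. frechet_derivative (theta n) (at t) 1 * f t) =
   (LINT t|lborel. real n * step' (real n * (t - a)) * g t) - (LINT t|lborel. real n * step' (real n * (b - t)) * g t)" .
  have cancel: "real n * (inverse (real n) * w) = w" "inverse (real n) * (real n * w) = w" for w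
   using n0 by auto
  have "(LINT t|lebesgue_on {0..T}. frechet_derivative (theta n) (at t) 1 * f t) =
   (LINT t|lborel. real n * step' (real n * (t - a)) * g t) - (LINT t|lborel. real n * step' (real n * (b - t)) * g t)" by (rule pre)
  also have "(LINT t|lborel. real n * step' (real n * (t - a)) * g t) = (LINT y|lborel. step' y * g (a + inverse (real n) * y))"
   using integral_scale(1)[of "\<lambda>t. real n * step' (real n * (t - a)) * g t" "inverse (real n)" a] n0 by (simp add: cancel mult.assoc)
  also have "(LINT t|lborel. real n * step' (real n * (b - t)) * g t) = (LINT y|lborel. step' y * g (b - inverse (real n) * y))"
   using integral_scale(1)[of "\<lambda>t. real n * step' (real n * (b - t)) * g t" "- inverse (real n)" b] n0 by (simp add: cancel mult.assoc)
  finally show ?thesis .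
 qed
 have lim1: "(\<lambda>n. LINT y|lborel. step' y * g (c + d * inverse (real n) * y)) \<longlonglongrightarrow> g c" for c d
 proof -
  have "(\<lambda>n. LINT y|lborel. step' y * g (c + d * inverse (real n) * y)) \<longlonglongrightarrow> (LINT y|lborel. step' y * g c)"
  proof (rule integral_dominated_convergence)
   show "integrable lborel (\<lambda>y. B * norm (step' y))" using step'_integral(1) by simp
   show "AE y in lborel. (\<lambda>n. step' y * g (c + d * inverse (real n) * y)) \<longlonglongrightarrow> step' y * g c"
   proof (rule AE_I2, rule tendsto_mult[OF tendsto_const])
    fix y
    have "(\<lambda>n. c + d * inverse (real n) * y) \<longlonglongrightarrow> c + d * 0 * y"
     by (intro tendsto_intros lim_inverse_n)
    then show "(\<lambda>n. g (c + d * inverse (real n) * y)) \<longlonglongrightarrow> g c"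
     using continuous_on_tendsto_compose[OF gc, of _ c sequentially] by simp
   qed
   show "AE y in lborel. norm (step' y * g (c + d * inverse (real n) * y)) \<le> B * norm (step' y)" for n
   proof (rule AE_I2)
    fix y
    have "\<bar>g (c + d * inverse (real n) * y)\<bar> * \<bar>step' y\<bar> \<le> B * \<bar>step' y\<bar>"
     by (intro mult_right_mono B) simp
    then show "norm (step' y * g (c + d * inverse (real n) * y)) \<le> B * norm (step' y)"
     by (simp add: abs_mult mult.commute)
   qed
  qed measurable
  then show ?thesis using step'_integral by simp
 qed
 have L: "(\<lambda>n. - ((LINT y|lborel. step' y * g (a + inverse (real n) * y)) - (LINT y|lborel. step' y * g (b - inverse (real n) * y)))) \<longlonglongrightarrow> - (g a - g b)"
  using lim1[of a 1] lim1[of b "-1"] by (intro tendsto_minus tendsto_diff) auto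
 have Gm: "G \<in> borel_measurable (lebesgue_on {0..T})" using G by auto
 have Rl: "(\<lambda>n. LINT t|lebesgue_on {0..T}. theta n t * G t) \<longlonglongrightarrow> (LINT t|lebesgue_on {0..T}. indicator {a<..<b} t * G t)"
 proof (rule integral_dominated_convergence)
  show "integrable (lebesgue_on {0..T}) (\<lambda>t. norm (G t))" using G by simp
  show "AE t in lebesgue_on {0..T}. norm (theta n t * G t) \<le> norm (G t)" for n
  proof (rule AE_I2)
   fix t
   have "\<bar>theta n t\<bar> \<le> 1" using step_bounds[of "real n * (t - a)"] step_bounds[of "real n * (b - t)"] by (simp add: theta_def abs_le_iff)
   then show "norm (theta n t * G t) \<le> norm (G t)" by (simp add: abs_mult mult_left_le_one_le)
  qed
  show "AE t in lebesgue_on {0..T}. (\<lambda>n. theta n t * G t) \<longlonglongrightarrow> indicator {a<..<b} t * G t"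
  proof (rule AE_I2, rule tendsto_mult[OF _ tendsto_const])
   fix t
   have big: "\<forall>\<^sub>F n in sequentially. 1 \<le> real n * c" if "0 < c" for c
   proof -
    obtain N where "1 / c < real N" using reals_Archimedean2 by blast
    then have N1: "1 \<le> real N * c" using that by (simp add: field_simps)
    show ?thesis
    proof (rule eventually_sequentiallyI[of N])
     fix n assume "N \<le> n"
     then have "real N * c \<le> real n * c" using that by (intro mult_right_mono) auto
     then show "1 \<le> real n * c" using N1 by linarith
    qed
   qed
   have "\<forall>\<^sub>F n in sequentially. theta n t = indicator {a<..<b} t"
   proof (cases "t \<in> {a<..<b}")
    case True
    then have "\<forall>\<^sub>F n in sequentially. 1 \<le> real n * (t - a) \<and> 1 \<le> real n * (b - t)"
     by (intro eventually_conj big) auto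
    then show ?thesis using True by (auto elim!: eventually_mono simp: theta_def step_1)
   next
    case False
    have "\<forall>\<^sub>F n in sequentially. 1 \<le> real n * (b - a)" using ab' by (intro big) auto
    then show ?thesis
    proof (rule eventually_mono)
     fix n assume n: "1 \<le> real n * (b - a)"
     show "theta n t = indicator {a<..<b} t"
     proof (cases "t \<le> a")
      case True
      then have "real n * (t - a) \<le> 0" by (simp add: mult_nonneg_nonpos)
      moreover from True have "real n * (b - a) \<le> real n * (b - t)" by (intro mult_left_mono) auto
      ultimately show ?thesis using n True by (simp add: theta_def step_0 step_1)
     next
      case F: False
      then have tb: "b \<le> t" using False by auto
      then have "real n * (b - t) \<le> 0" by (simp add: mult_nonneg_nonpos)
      moreover from tb have "real n * (b - a) \<le> real n * (t - a)" by (intro mult_left_mono) auto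
      ultimately show ?thesis using n tb by (simp add: theta_def step_0 step_1)
     qed
    qed
   qed
   then show "(\<lambda>n. theta n t) \<longlonglongrightarrow> indicator {a<..<b} t" by (rule tendsto_eventually)
  qed
  have lm: "h \<in> borel_measurable (lebesgue_on {0..T})" if "h \<in> borel_measurable borel" for h :: "real => real"
   using that by (intro measurable_restrict_space1) (simp add: measurable_completion)
  have "theta n \<in> borel_measurable borel" for n by (rule borel_measurable_continuous_onI[OF Ck_continuous[OF Cktheta[of 0]]])
  then show "(\<lambda>t. theta n t * G t) \<in> borel_measurable (lebesgue_on {0..T})" for n by (intro borel_measurable_times lm Gm)
  show "(\<lambda>t. indicator {a<..<b} t * G t) \<in> borel_measurable (lebesgue_on {0..T})" by (intro borel_measurable_times lm Gm) simp
 qed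
 have "\<forall>\<^sub>F n in sequentially. 1 \<le> real n * (b - a)"
 proof -
  obtain N where N: "1 / (b - a) < real N" using reals_Archimedean2 by blast
  show ?thesis
  proof (rule eventually_sequentiallyI[of N])
   fix n assume "N \<le> n"
   then have "1 / (b - a) < real n" using N by linarith
   then show "1 \<le> real n * (b - a)" using ab' by (simp add: field_simps)
  qed
 qed
 then have "\<forall>\<^sub>F n in sequentially. - ((LINT y|lborel. step' y * g (a + inverse (real n) * y)) - (LINT y|lborel. step' y * g (b - inverse (real n) * y))) =
   (LINT t|lebesgue_on {0..T}. theta n t * G t)"
 proof (rule eventually_mono)
  fix n assume n: "1 \<le> real n * (b - a)"
  show "- ((LINT y|lborel. step' y * g (a + inverse (real n) * y)) - (LINT y|lborel. step' y * g (b - inverse (real n) * y))) =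
   (LINT t|lebesgue_on {0..T}. theta n t * G t)"
   using weak[OF ttheta[OF n]] unfolding lhs[OF n] .
 qed
 from tendsto_cong[OF this] L have "(\<lambda>n. LINT t|lebesgue_on {0..T}. theta n t * G t) \<longlonglongrightarrow> - (g a - g b)" by simp
 then have "g b - g a = (LINT t|lebesgue_on {0..T}. indicator {a<..<b} t * G t)"
  using LIMSEQ_unique[OF _ Rl] by fastforce
 also have "\<dots> = (LINT t|lebesgue. indicator {0..T} t *\<^sub>R (indicator {a<..<b} t * G t))"
  by (simp add: integral_restrict_space)
 also have "\<dots> = (LINT t|lebesgue. indicator {a..b} t *\<^sub>R G t)"
 proof (rule integral_cong_AE)
  have i1: "set_integrable lebesgue {0..T} G" using G by (simp add: integrable_restrict_space set_integrable_def)
  have "set_integrable lebesgue {a<..<b} G" "set_integrable lebesgue {a..b} G"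
   using ab by (auto intro: set_integrable_subset[OF i1])
  moreover have "(\<lambda>t. indicator {0..T} t *\<^sub>R (indicator {a<..<b} t * G t)) = (\<lambda>t. indicator {a<..<b} t *\<^sub>R G t)"
   using ab by (auto simp: indicator_def)
  ultimately show "(\<lambda>t. indicator {0..T} t *\<^sub>R (indicator {a<..<b} t * G t)) \<in> borel_measurable lebesgue"
   "(\<lambda>t. indicator {a..b} t *\<^sub>R G t) \<in> borel_measurable lebesgue"
   unfolding set_integrable_def by auto
  have "AE t in lebesgue. t \<noteq> a" "AE t in lebesgue. t \<noteq> b"
   by (simp_all add: AE_completion_iff AE_lborel_singleton)
  then show "AE t in lebesgue. indicator {0..T} t *\<^sub>R (indicator {a<..<b} t * G t) = indicator {a..b} t *\<^sub>R G t"
   by eventually_elim (use ab in \<open>auto simp: indicator_def\<close>)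
 qed
 also have "\<dots> = II a b G" by (simp add: integral_restrict_space)
 finally show ?thesis using gf[of a] gf[of b] ab by simp
qed

section \<open>The equation in the frequency variable\<close>

abbreviation vh :: "(real^'d => real^'n) => 'n::finite => real^'d => complex" where
 "vh u j \<equiv> hat (\<lambda>x. complex_of_real (u x $ j))"

abbreviation mh :: "(real^'d => real^'n^'n) => 'n::finite => 'n => real^'d => complex" where
 "mh A i j \<equiv> hat (\<lambda>x. complex_of_real (A x $ i $ j))"

section \<open>Components of vector and matrix fields\<close>

lemma component_axis: "component (axis j 1) u = (\<lambda>x. of_real (u x $ j))"
 by (simp add: component_def fun_eq_iff inner_axis)

lemma component_axis_axis: "component (axis i (axis j 1)) A = (\<lambda>x. of_real (A x $ i $ j))"
 by (simp add: component_def fun_eq_iff inner_axis)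

lemma sum_Basis_vec: "sum f (Basis :: (real^'n) set) = (\<Sum>j\<in>UNIV. f (axis j 1))"
proof -
 have 1: "(Basis :: (real^'n) set) = range (\<lambda>j::'n. axis j (1::real))" by (auto simp: Basis_vec_def)
 have 2: "inj (\<lambda>j::'n. axis j (1::real))" by (auto simp: inj_on_def axis_eq_axis)
 show ?thesis unfolding 1 sum.reindex[OF 2] o_def ..
qed

lemma sobolev_vecD:
 fixes u :: "real^'d => real^'n"
 assumes "u \<in> sobolev r"
 shows "L2 (\<lambda>x. complex_of_real (u x $ j))" "sqint (vh u j)" "vh u j \<in> borel_measurable borel"
  "sqint (jbs r (vh u j))" "nrm (jbs r (vh u j)) \<le> sobolev_norm r u"
proof -
 have b: "axis j (1::real) \<in> Basis" by (simp add: axis_in_Basis_iff)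
 show L: "L2 (\<lambda>x. complex_of_real (u x $ j))" and "sqint (jbs r (vh u j))"
  using assms b unfolding sobolev_iff component_axis[symmetric] by blast+
 show "sqint (vh u j)" by (rule L2_hat(1)[OF L])
 then show "vh u j \<in> borel_measurable borel" by (rule sqint_measurable)
 show "nrm (jbs r (vh u j)) \<le> sobolev_norm r u"
  using sobolev_norm_component_le[OF assms b] unfolding component_axis .
qed

lemma sobolev_vec_norm:
 fixes u :: "real^'d => real^'n"
 assumes "u \<in> sobolev r"
 shows "(sobolev_norm r u)\<^sup>2 = (\<Sum>j\<in>UNIV. (nrm (jbs r (vh u j)))\<^sup>2)"
 unfolding sobolev_norm_hat[OF assms] L2_set_def sum_Basis_vec component_axis
 by (simp add: sum_nonneg)

lemma sobolev_vec_diff: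
 fixes u v :: "real^'d => real^'n"
 assumes "u \<in> sobolev r" "v \<in> sobolev r"
 shows "AE xi in lborel. vh (\<lambda>x. u x - v x) j xi = vh u j xi - vh v j xi"
 using sobolev_linear(4)[OF assms, of "axis j 1"] unfolding component_axis by (simp add: axis_in_Basis_iff)

lemma sobolev_matD:
 fixes A :: "real^'d => real^'n^'n"
 assumes "A \<in> sobolev r"
 shows "L2 (\<lambda>x. complex_of_real (A x $ i $ j))" "mh A i j \<in> borel_measurable borel"
  "sqint (jbs r (mh A i j))" "nrm (jbs r (mh A i j)) \<le> sobolev_norm r A"
proof -
 have b: "axis i (axis j (1::real)) \<in> Basis" by (simp add: axis_in_Basis_iff)
 show L: "L2 (\<lambda>x. complex_of_real (A x $ i $ j))" and "sqint (jbs r (mh A i j))"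
  using assms b unfolding sobolev_iff component_axis_axis[symmetric] by blast+
 show "mh A i j \<in> borel_measurable borel" by (rule sqint_measurable[OF L2_hat(1)[OF L]])
 show "nrm (jbs r (mh A i j)) \<le> sobolev_norm r A"
  using sobolev_norm_component_le[OF assms b] unfolding component_axis_axis .
qed

lemma sobolev_mat_diff:
 fixes A B :: "real^'d => real^'n^'n"
 assumes "A \<in> sobolev r" "B \<in> sobolev r"
 shows "AE xi in lborel. mh (\<lambda>x. A x - B x) i j xi = mh A i j xi - mh B i j xi"
 using sobolev_linear(4)[OF assms, of "axis i (axis j 1)"] unfolding component_axis_axis by (simp add: axis_in_Basis_iff)

lemma hat_real_sym:
 fixes g :: "'a::euclidean_space => real"
 assumes "L2 (\<lambda>x. complex_of_real (g x))"
 shows "AE xi in lborel. hat (\<lambda>x. complex_of_real (g x)) (- xi) = cnj (hat (\<lambda>x. complex_of_real (g x)) xi)"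
proof -
 obtain f where f: "sqint f" "AE x in lborel. complex_of_real (g x) = f x" "hat (\<lambda>x. complex_of_real (g x)) = hat f"
  using L2_hat(4)[OF assms] by blast
 note [measurable] = sqint_measurable[OF f(1)]
 have b: "f \<in> borel_measurable borel" "(\<lambda>x. cnj (f x)) \<in> borel_measurable borel" by measurable
 have "hat (\<lambda>x. cnj (f x)) = hat f"
 proof (rule hat_cong_AE)
  show "AE x in lborel. cnj (f x) = f x" using f(2) by eventually_elim (metis complex_cnj_complex_of_real)
 qed (use b in \<open>simp_all add: measurable_completion\<close>)
 then have "AE xi in lborel. hat f xi = cnj (hat f (- xi))" using hat_cnj[OF f(1)] by simp
 then show ?thesis unfolding f(3) by eventually_elim (metis complex_cnj_cnj)
qed

text \<open>Real entries give conjugation under reflection of the frequency, and symmetry of the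
  matrix exchanges the indices.\<close>

lemma mh_herm:
 fixes A :: "real^'d => real^'n^'n"
 assumes A: "A \<in> sobolev r" and sym: "AE x in lebesgue. transpose (A x) = A x"
 shows "AE xi in lborel. mh A i j (- xi) = cnj (mh A j i xi)"
proof -
 note L = sobolev_matD(1)[OF A]
 have "AE x in lebesgue. complex_of_real (A x $ i $ j) = complex_of_real (A x $ j $ i)"
  using sym by eventually_elim (metis (no_types, lifting) transpose_def vec_lambda_beta)
 then have "mh A i j = mh A j i"
  by (intro hat_cong_AE L2_measurable L) (simp add: AE_completion_iff)
 then show ?thesis using hat_real_sym[OF L[of j i]] by simp
qed

text \<open>The class of test objects on the Fourier side: a weight of order one suffices for the
  transport form when the transforms of the coefficients are \<open>good\<close> and the solution is
  merely square integrable.\<close>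

definition adm :: "('n => real^'d => complex) => bool" where
 "adm p \<longleftrightarrow> (\<forall>i. p i \<in> borel_measurable borel \<and> sqint (jb1 (p i)))"

lemma admD:
 assumes "adm p" shows "p i \<in> borel_measurable borel" "sqint (jb1 (p i))" "sqint (p i)"
 using assms sqint_jb1I by (auto simp: adm_def)

lemma adm_diff:
 assumes "adm p" "adm q" shows "adm (\<lambda>i xi. p i xi - q i xi)"
proof -
 have "sqint (jb1 (\<lambda>xi. p i xi - q i xi))" for i
  unfolding jb1_diff by (intro sqint_diff admD assms)
 then show ?thesis using admD(1)[OF assms(1)] admD(1)[OF assms(2)] unfolding adm_def by auto
qed

lemma nrm_le_jb1:
 assumes "p \<in> borel_measurable borel" "sqint (jb1 p)"
 shows "nrm p \<le> nrm (jb1 p)"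
 using sqint_jbs_imp_sqint(2)[OF assms(1), of 1] assms(2) by (simp only: jbs_1)

definition vpair :: "('n::finite => real^'d => complex) => ('n => real^'d => complex) => real" where
 "vpair v p = Re (\<Sum>j\<in>UNIV. LINT xi|lborel. v j xi * cnj (p j xi))"

lemma vpair_bound:
 assumes "\<And>j. sqint (v j)" "\<And>j. sqint (p j)"
 shows "\<bar>vpair v p\<bar> \<le> (\<Sum>j\<in>UNIV. nrm (v j) * nrm (p j))"
proof -
 have "\<bar>vpair v p\<bar> \<le> cmod (\<Sum>j\<in>UNIV. LINT xi|lborel. v j xi * cnj (p j xi))"
  unfolding vpair_def by (rule abs_Re_le_cmod)
 also have "\<dots> \<le> (\<Sum>j\<in>UNIV. nrm (v j) * nrm (\<lambda>xi. cnj (p j xi)))"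
  by (intro sum_norm_le Cauchy_Schwarz_sqint sqint_cnj assms)
 finally show ?thesis by (simp only: nrm_cnj)
qed

lemma vpair_diff_left:
 assumes "\<And>j. sqint (v j)" "\<And>j. sqint (w j)" "\<And>j. sqint (p j)"
 shows "vpair (\<lambda>j xi. v j xi - w j xi) p = vpair v p - vpair w p"
 using integrable_sqint_mult(1)[OF assms(1) sqint_cnj[OF assms(3)]] integrable_sqint_mult(1)[OF assms(2) sqint_cnj[OF assms(3)]]
 by (simp add: vpair_def left_diff_distrib sum_subtractf)

lemma vpair_diff_right:
 assumes "\<And>j. sqint (v j)" "\<And>j. sqint (p j)" "\<And>j. sqint (q j)"
 shows "vpair v (\<lambda>j xi. p j xi - q j xi) = vpair v p - vpair v q"
 using integrable_sqint_mult(1)[OF assms(1) sqint_cnj[OF assms(2)]] integrable_sqint_mult(1)[OF assms(1) sqint_cnj[OF assms(3)]]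
 by (simp add: vpair_def right_diff_distrib sum_subtractf)

lemma vpair_cong:
 assumes "\<And>j. sqint (v j)" "\<And>j. sqint (w j)" "\<And>j. sqint (p j)" "\<And>j. AE xi in lborel. v j xi = w j xi"
 shows "vpair v p = vpair w p"
proof -
 have "(LINT xi|lborel. v j xi * cnj (p j xi)) = (LINT xi|lborel. w j xi * cnj (p j xi))" for j
  using integrable_sqint_mult(1)[OF assms(1) sqint_cnj[OF assms(3)], of j j] integrable_sqint_mult(1)[OF assms(2) sqint_cnj[OF assms(3)], of j j]
  by (intro integral_cong_AE borel_measurable_integrable) (use assms(4)[of j] in \<open>auto elim: eventually_mono\<close>)
 then show ?thesis by (simp add: vpair_def)
qed

lemma vpair_sobolev_diff:
 assumes "u \<in> sobolev r" "v \<in> sobolev r" "\<And>j. sqint (p j)"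
 shows "vpair (vh (\<lambda>x. u x - v x)) p = vpair (vh u) p - vpair (vh v) p"
proof -
 have "vpair (vh (\<lambda>x. u x - v x)) p = vpair (\<lambda>j xi. vh u j xi - vh v j xi) p"
  using assms sobolev_linear(1)[OF assms(1,2)]
  by (intro vpair_cong sqint_diff sobolev_vec_diff[OF assms(1,2)] sobolev_vecD(2)) auto
 then show ?thesis
  using vpair_diff_left[OF sobolev_vecD(2)[OF assms(1)] sobolev_vecD(2)[OF assms(2)] assms(3)] by simp
qed

lemma vpair_sobolev_bound:
 assumes "u \<in> sobolev r" "0 \<le> r" "\<And>j. sqint (p j)"
 shows "\<bar>vpair (vh u) p\<bar> \<le> (\<Sum>j\<in>UNIV. nrm (p j)) * sobolev_norm r u"
proof -
 have "nrm (vh u j) \<le> sobolev_norm r u" for j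
  using sqint_jbs_imp_sqint(2)[OF sobolev_vecD(3)[OF assms(1)] sobolev_vecD(4)[OF assms(1)] assms(2), of j]
   sobolev_vecD(5)[OF assms(1), of j] by linarith
 then have "(\<Sum>j\<in>UNIV. nrm (vh u j) * nrm (p j)) \<le> (\<Sum>j\<in>UNIV. sobolev_norm r u * nrm (p j))"
  by (intro sum_mono mult_right_mono) auto
 also have "\<dots> = (\<Sum>j\<in>UNIV. nrm (p j)) * sobolev_norm r u"
  by (simp only: sum_distrib_left mult.commute)
 finally show ?thesis using vpair_bound[of "vh u" p, OF sobolev_vecD(2)[OF assms(1)] assms(3)] by linarith
qed

text \<open>These pairings are the functionals through which the weak continuity of the solution is
  exploited.\<close>

lemma vpair_sobolev_dual:
 assumes r: "0 \<le> r" and p: "\<And>j. sqint (p j)"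
 shows "(\<lambda>u. vpair (vh u) p) \<in> sobolev_dual r"
 unfolding sobolev_dual_def mem_Collect_eq
proof (intro conjI ballI allI exI)
 note i = integrable_sqint_mult(1)[OF sobolev_vecD(2) sqint_cnj[OF p]]
 fix u v :: "real^'b => real^'a" assume u: "u \<in> sobolev r" and v: "v \<in> sobolev r"
 have "vpair (vh (\<lambda>x. u x + v x)) p = vpair (\<lambda>j xi. vh u j xi + vh v j xi) p"
 proof (rule vpair_cong[OF sobolev_vecD(2)[OF sobolev_linear(2)[OF u v]] _ p])
  show "sqint (\<lambda>xi. vh u j xi + vh v j xi)" for j by (intro sqint_add sobolev_vecD(2)[OF u] sobolev_vecD(2)[OF v])
  show "AE xi in lborel. vh (\<lambda>x. u x + v x) j xi = vh u j xi + vh v j xi" for j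
   using L2_hat_add(2)[OF sobolev_vecD(1)[OF u] sobolev_vecD(1)[OF v], of j j] by simp
 qed
 then show "vpair (vh (\<lambda>x. u x + v x)) p = vpair (vh u) p + vpair (vh v) p"
  using i[OF u] i[OF v] by (simp add: vpair_def distrib_right sum.distrib)
next
 fix c and u :: "real^'b => real^'a" assume u: "u \<in> sobolev r"
 have "vpair (vh (\<lambda>x. c *\<^sub>R u x)) p = vpair (\<lambda>j xi. of_real c * vh u j xi) p"
 proof (rule vpair_cong[OF sobolev_vecD(2)[OF sobolev_linear(3)[OF u u]] _ p])
  show "sqint (\<lambda>xi. of_real c * vh u j xi)" for j by (intro sqint_cmult sobolev_vecD(2)[OF u])
  show "AE xi in lborel. vh (\<lambda>x. c *\<^sub>R u x) j xi = of_real c * vh u j xi" for j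
   using L2_hat_cmult(2)[OF sobolev_vecD(1)[OF u], of "of_real c" j] by simp
 qed
 also have "\<dots> = c * vpair (vh u) p"
  by (simp only: vpair_def mult.assoc integral_mult_right_zero sum_distrib_left[symmetric]) simp
 finally show "vpair (vh (\<lambda>x. c *\<^sub>R u x)) p = c * vpair (vh u) p" .
next
 fix u :: "real^'b => real^'a" assume u: "u \<in> sobolev r"
 show "\<bar>vpair (vh u) p\<bar> \<le> (\<Sum>j\<in>UNIV. nrm (p j)) * sobolev_norm r u"
  by (rule vpair_sobolev_bound[OF u r p])
qed

lemma vpair_test:
 fixes u psi :: "real^'d => real^'n"
 assumes u: "u \<in> sobolev r" and psi: "test_function D psi"
 shows "(LINT x|lebesgue. u x \<bullet> psi x) = vpair (vh u) (vh psi)"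
proof -
 have s: "sqint (\<lambda>x. complex_of_real (psi x $ j))" for j
  by (rule test_function_integrable(2)[OF test_function_vec_nth[OF psi]])
 have L: "L2 (\<lambda>x. complex_of_real (psi x $ j))" for j
  by (rule L2_of_AE_sqint(1)[OF s AE_I2]) simp
 note P = L2_parseval[OF sobolev_vecD(1)[OF u] L]
 have eq: "u x $ j * psi x $ j = Re (complex_of_real (u x $ j) * cnj (complex_of_real (psi x $ j)))" for x j by simp
 have i: "integrable lebesgue (\<lambda>x. u x $ j * psi x $ j)" for j
  unfolding eq using integrable_Re[OF P(1)] .
 have "(LINT x|lebesgue. u x \<bullet> psi x) = (\<Sum>j\<in>UNIV. LINT x|lebesgue. u x $ j * psi x $ j)"
  unfolding inner_vec_def using i by (simp add: Bochner_Integration.integral_sum)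
 also have "\<dots> = (\<Sum>j\<in>UNIV. Re (LINT x|lebesgue. complex_of_real (u x $ j) * cnj (complex_of_real (psi x $ j))))"
  unfolding eq using integral_Re[OF P(1)] by simp
 finally show ?thesis unfolding vpair_def Re_sum P(2) .
qed

section \<open>The transport term as a form in coefficients, solution and test object\<close>

definition tpair :: "('d::finite => real^'d => real^'n^'n) => (real^'d => real^'n) => ('n::finite => real^'d => complex) => real" where
 "tpair A u p = (\<Sum>a\<in>UNIV. Re (\<Sum>i\<in>UNIV. \<Sum>j\<in>UNIV. TF a (mh (A a) i j) (vh u j) (p i)))"

lemma TF_sobolev_bound:
 fixes A :: "real^'d => real^'n^'n" and u :: "real^'d => real^'n"
 assumes \<sigma>: "\<sigma> > real CARD('d) / 2" and A: "A \<in> sobolev (\<sigma> + 1)" and u: "u \<in> sobolev \<sigma>"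
  and p: "p \<in> borel_measurable borel" "sqint (jb1 p)"
 shows "cmod (TF a (mh A i j) (vh u j) p) \<le>
  2 * fconst TYPE(real^'d) * Kw TYPE(real^'d) \<sigma> * nrm (jb1 p) * (sobolev_norm (\<sigma> + 1) A * sobolev_norm \<sigma> u)"
proof -
 let ?c = "fconst TYPE(real^'d)" and ?K = "Kw TYPE(real^'d) \<sigma>"
 have d: "\<sigma> > real DIM(real^'d) / 2" using \<sigma> by simp
 have \<sigma>0: "0 \<le> \<sigma>" using \<sigma> by (meson divide_nonneg_nonneg less_imp_le of_nat_0_le_iff order_trans zero_le_numeral)
 note g = good_jbs[OF d sobolev_matD(2,3)[OF A], of i j]
 have 1: "nrm (vh u j) \<le> sobolev_norm \<sigma> u"
  using sqint_jbs_imp_sqint(2)[OF sobolev_vecD(3)[OF u] sobolev_vecD(4)[OF u] \<sigma>0, of j]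
   sobolev_vecD(5)[OF u, of j] by linarith
 have 2: "(LINT xi|lborel. jb xi * cmod (mh A i j xi)) \<le> ?K * sobolev_norm (\<sigma> + 1) A"
  using g(2) mult_left_mono[OF sobolev_matD(4)[OF A, of i j] Kw_nonneg[of \<sigma>, where 'a="real^'d"]] by linarith
 have 0: "0 \<le> (LINT xi|lborel. jb xi * cmod (mh A i j xi))"
  by (intro Bochner_Integration.integral_nonneg mult_nonneg_nonneg less_imp_le[OF jb_pos] norm_ge_zero)
 have "cmod (TF a (mh A i j) (vh u j) p) \<le>
   2 * ?c * nrm (vh u j) * (LINT xi|lborel. jb xi * cmod (mh A i j xi)) * nrm (jb1 p)"
  by (rule TF_bound[OF g(1) sobolev_vecD(2)[OF u] p])
 also have "\<dots> \<le> 2 * ?c * sobolev_norm \<sigma> u * (?K * sobolev_norm (\<sigma> + 1) A) * nrm (jb1 p)"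
  using 0 1 2 less_imp_le[OF fconst_pos[where 'a="real^'d"]] sobolev_norm_nonneg[of \<sigma> u]
  by (intro mult_right_mono mult_mono mult_nonneg_nonneg) auto
 finally show ?thesis by (simp only: mult_ac)
qed

text \<open>Splitting into a change of the coefficient and a change of the function. This is the
  estimate that makes the form measurable in time along strongly measurable data.\<close>

lemma TF_sobolev_diff:
 fixes A B :: "real^'d => real^'n^'n" and u v :: "real^'d => real^'n"
 assumes \<sigma>: "\<sigma> > real CARD('d) / 2" and A: "A \<in> sobolev (\<sigma> + 1)" and B: "B \<in> sobolev (\<sigma> + 1)"
  and u: "u \<in> sobolev \<sigma>" and v: "v \<in> sobolev \<sigma>"
  and p: "p \<in> borel_measurable borel" "sqint (jb1 p)"
 shows "cmod (TF a (mh A i j) (vh u j) p - TF a (mh B i j) (vh v j) p) \<le>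
  2 * fconst TYPE(real^'d) * Kw TYPE(real^'d) \<sigma> * nrm (jb1 p) *
   (sobolev_norm (\<sigma> + 1) (\<lambda>x. A x - B x) * sobolev_norm \<sigma> v + sobolev_norm (\<sigma> + 1) A * sobolev_norm \<sigma> (\<lambda>x. u x - v x))"
proof -
 have d: "\<sigma> > real DIM(real^'d) / 2" using \<sigma> by simp
 note gA = good_jbs(1)[OF d sobolev_matD(2,3)[OF A], of i j] and gB = good_jbs(1)[OF d sobolev_matD(2,3)[OF B], of i j]
 note su = sobolev_vecD(2)[OF u, of j] and sv = sobolev_vecD(2)[OF v, of j]
 note AB = sobolev_linear(1)[OF A B] and uv = sobolev_linear(1)[OF u v]
 have pm: "p \<in> borel_measurable borel" by (rule p)
 have "TF a (mh (\<lambda>x. A x - B x) i j) (vh v j) p = TF a (\<lambda>xi. mh A i j xi - mh B i j xi) (vh v j) p"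
  by (rule TF_cong_AE[OF sobolev_matD(2)[OF AB] borel_measurable_diff[OF sobolev_matD(2)[OF A] sobolev_matD(2)[OF B]]
     pm pm sqint_measurable[OF sv] sqint_measurable[OF sv] sobolev_mat_diff[OF A B]]) simp_all
 also have "\<dots> = TF a (mh A i j) (vh v j) p - TF a (mh B i j) (vh v j) p"
  by (rule TF_diff_alpha[OF gA gB sv p])
 finally have 1: "TF a (mh (\<lambda>x. A x - B x) i j) (vh v j) p = TF a (mh A i j) (vh v j) p - TF a (mh B i j) (vh v j) p" .
 have "TF a (mh A i j) (vh (\<lambda>x. u x - v x) j) p = TF a (mh A i j) (\<lambda>xi. vh u j xi - vh v j xi) p"
  by (rule TF_cong_AE[OF sobolev_matD(2)[OF A] sobolev_matD(2)[OF A] pm pm sobolev_vecD(3)[OF uv]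
     borel_measurable_diff[OF sobolev_vecD(3)[OF u] sobolev_vecD(3)[OF v]] _ sobolev_vec_diff[OF u v]]) simp_all
 also have "\<dots> = TF a (mh A i j) (vh u j) p - TF a (mh A i j) (vh v j) p"
  by (rule TF_diff_v[OF gA su sv p])
 finally have 2: "TF a (mh A i j) (vh (\<lambda>x. u x - v x) j) p = TF a (mh A i j) (vh u j) p - TF a (mh A i j) (vh v j) p" .
 have "TF a (mh A i j) (vh u j) p - TF a (mh B i j) (vh v j) p =
   TF a (mh (\<lambda>x. A x - B x) i j) (vh v j) p + TF a (mh A i j) (vh (\<lambda>x. u x - v x) j) p"
  unfolding 1 2 by simp
 then show ?thesis
  unfolding distrib_left
  by (simp only:) (rule norm_triangle_mono[OF TF_sobolev_bound[OF \<sigma> AB v p] TF_sobolev_bound[OF \<sigma> A uv p]])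
qed

lemma tpair_bound:
 fixes A :: "'d::finite => real^'d => real^'n^'n" and u :: "real^'d => real^'n"
 assumes \<sigma>: "\<sigma> > real CARD('d) / 2" and A: "\<And>a. A a \<in> sobolev (\<sigma> + 1)" and u: "u \<in> sobolev \<sigma>" and p: "adm p"
 shows "\<bar>tpair A u p\<bar> \<le> 2 * fconst TYPE(real^'d) * Kw TYPE(real^'d) \<sigma> * real CARD('n) *
  (\<Sum>a\<in>UNIV. sobolev_norm (\<sigma> + 1) (A a)) * sobolev_norm \<sigma> u * (\<Sum>i\<in>UNIV. nrm (jb1 (p i)))"
proof -
 let ?k = "2 * fconst TYPE(real^'d) * Kw TYPE(real^'d) \<sigma>"
 have "\<bar>tpair A u p\<bar> \<le> (\<Sum>a\<in>UNIV. \<bar>Re (\<Sum>i\<in>UNIV. \<Sum>j\<in>UNIV. TF a (mh (A a) i j) (vh u j) (p i))\<bar>)"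
  unfolding tpair_def by (rule sum_abs)
 also have "\<dots> \<le> (\<Sum>a\<in>UNIV. \<Sum>i\<in>UNIV. \<Sum>j\<in>(UNIV::'n set). ?k * nrm (jb1 (p i)) * (sobolev_norm (\<sigma> + 1) (A a) * sobolev_norm \<sigma> u))"
  by (intro sum_mono order_trans[OF abs_Re_le_cmod] sum_norm_le TF_sobolev_bound[OF \<sigma> A u] admD[OF p])
 also have "\<dots> = ?k * real CARD('n) * (\<Sum>a\<in>UNIV. sobolev_norm (\<sigma> + 1) (A a)) * sobolev_norm \<sigma> u * (\<Sum>i\<in>UNIV. nrm (jb1 (p i)))"
  by (simp add: sum_distrib_left sum_distrib_right mult_ac)
 finally show ?thesis .
qed

lemma tpair_diff:
 fixes A :: "'d::finite => real^'d => real^'n^'n" and u :: "real^'d => real^'n"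
 assumes \<sigma>: "\<sigma> > real CARD('d) / 2" and A: "\<And>a. A a \<in> sobolev (\<sigma> + 1)" and u: "u \<in> sobolev \<sigma>" and p: "adm p" and q: "adm q"
 shows "tpair A u (\<lambda>i xi. p i xi - q i xi) = tpair A u p - tpair A u q"
proof -
 have d: "\<sigma> > real DIM(real^'d) / 2" using \<sigma> by simp
 have "TF a (mh (A a) i j) (vh u j) (\<lambda>xi. p i xi - q i xi) = TF a (mh (A a) i j) (vh u j) (p i) - TF a (mh (A a) i j) (vh u j) (q i)" for a i j
  by (intro TF_diff_p good_jbs(1)[OF d] sobolev_matD(2,3)[OF A] sobolev_vecD(2)[OF u] admD[OF p] admD[OF q])
 then show ?thesis by (simp add: tpair_def sum_subtractf)
qed

text \<open>Along the approximating simple functions \<open>H\<close> takes finitely many values in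
  a measurable way, and the bilinear estimate transfers convergence in norm to \<open>H\<close>. The
  norms of the approximants of \<open>g\<close> converge, so the mixed term tends to zero.\<close>

lemma sobolev_bilinear_measurable:
 fixes f :: "real => 'a::euclidean_space => 'b::euclidean_space" and g :: "real => 'c::euclidean_space => 'e::euclidean_space"
  and H :: "('a => 'b) => ('c => 'e) => real"
 assumes f: "sobolev_measurable r T f" and g: "sobolev_measurable q T g"
  and H: "\<And>u u' w w'. u \<in> sobolev r \<Longrightarrow> u' \<in> sobolev r \<Longrightarrow> w \<in> sobolev q \<Longrightarrow> w' \<in> sobolev q \<Longrightarrow>
   \<bar>H u w - H u' w'\<bar> \<le> K * (sobolev_norm r (\<lambda>x. u x - u' x) * sobolev_norm q w' + sobolev_norm r u * sobolev_norm q (\<lambda>x. w x - w' x))"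
 shows "(\<lambda>t. H (f t) (g t)) \<in> borel_measurable (lebesgue_on {0..T})"
proof -
 from conjunct2[OF f[unfolded sobolev_measurable_def]]
 obtain S where S0: "(\<forall>n::nat. simple_function (lebesgue_on {0..T}) (S n) \<and> (\<forall>t\<in>{0..T}. S n t \<in> sobolev r)) \<and>
   (AE t in lebesgue_on {0..T}. (\<lambda>n. sobolev_norm r (\<lambda>x. f t x - S n t x)) \<longlonglongrightarrow> 0)" ..
 note S = conjunct1[OF S0, rule_format, THEN conjunct1] conjunct1[OF S0, rule_format, THEN conjunct2, rule_format]
 note Sl = conjunct2[OF S0]
 from conjunct2[OF g[unfolded sobolev_measurable_def]]
 obtain S' where S'0: "(\<forall>n::nat. simple_function (lebesgue_on {0..T}) (S' n) \<and> (\<forall>t\<in>{0..T}. S' n t \<in> sobolev q)) \<and>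
   (AE t in lebesgue_on {0..T}. (\<lambda>n. sobolev_norm q (\<lambda>x. g t x - S' n t x)) \<longlonglongrightarrow> 0)" ..
 note S' = conjunct1[OF S'0, rule_format, THEN conjunct1] conjunct1[OF S'0, rule_format, THEN conjunct2, rule_format]
 note Sl' = conjunct2[OF S'0]
 note fg = conjunct1[OF f[unfolded sobolev_measurable_def]] conjunct1[OF g[unfolded sobolev_measurable_def]]
 have sp: "AE t in lebesgue_on {0..T}. t \<in> {0..T}" by (rule AE_I2) (simp add: space_restrict_space)
 show ?thesis
 proof (rule lebesgue_on_LIMSEQ_measurable)
  show "(\<lambda>t. H (S n t) (S' n t)) \<in> borel_measurable (lebesgue_on {0..T})" for n
   by (rule borel_measurable_simple_function[OF simple_function_compose2[OF S(1) S'(1)]])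
  show "AE t in lebesgue_on {0..T}. (\<lambda>n. H (S n t) (S' n t)) \<longlonglongrightarrow> H (f t) (g t)"
   using Sl Sl' fg sp
  proof eventually_elim
   case (elim t)
   let ?d = "\<lambda>n. sobolev_norm r (\<lambda>x. f t x - S n t x)" and ?e = "\<lambda>n. sobolev_norm q (\<lambda>x. g t x - S' n t x)"
   have "(\<lambda>n. sobolev_norm q (S' n t) - sobolev_norm q (g t)) \<longlonglongrightarrow> 0"
   proof (rule Lim_null_comparison[OF _ elim(2)], rule eventuallyI)
    fix n show "norm (sobolev_norm q (S' n t) - sobolev_norm q (g t)) \<le> ?e n"
     unfolding real_norm_def by (subst abs_minus_commute) (rule sobolev_norm_diff_abs[OF elim(4) S'(2)[OF elim(5)]])
   qed
   then have lS: "(\<lambda>n. sobolev_norm q (S' n t)) \<longlonglongrightarrow> sobolev_norm q (g t)" by (rule LIM_zero_cancel)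
   have l0: "(\<lambda>n. K * (?d n * sobolev_norm q (S' n t) + sobolev_norm r (f t) * ?e n)) \<longlonglongrightarrow> 0"
    by (rule tendsto_eq_rhs[OF tendsto_mult[OF tendsto_const tendsto_add[OF tendsto_mult[OF elim(1) lS] tendsto_mult[OF tendsto_const elim(2)]]]]) simp
   have "(\<lambda>n. H (S n t) (S' n t) - H (f t) (g t)) \<longlonglongrightarrow> 0"
   proof (rule Lim_null_comparison[OF _ l0], rule eventuallyI)
    fix n show "norm (H (S n t) (S' n t) - H (f t) (g t)) \<le> K * (?d n * sobolev_norm q (S' n t) + sobolev_norm r (f t) * ?e n)"
    proof -
     have "\<bar>H (f t) (g t) - H (S n t) (S' n t)\<bar> \<le> K * (?d n * sobolev_norm q (S' n t) + sobolev_norm r (f t) * ?e n)"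
      by (rule H) (rule elim(3) S(2)[OF elim(5)] elim(4) S'(2)[OF elim(5)])+
     then show ?thesis unfolding real_norm_def abs_minus_commute[of "H (S n t) (S' n t)"] .
    qed
   qed
   then show ?case by (rule LIM_zero_cancel)
  qed
 qed simp
qed

lemma sobolev_lipschitz_measurable:
 fixes f :: "real => 'a::euclidean_space => 'b::euclidean_space"
 assumes f: "sobolev_measurable r T f"
  and H: "\<And>u u'. u \<in> sobolev r \<Longrightarrow> u' \<in> sobolev r \<Longrightarrow> \<bar>H u - H u'\<bar> \<le> K * sobolev_norm r (\<lambda>x. u x - u' x)"
 shows "(\<lambda>t. H (f t)) \<in> borel_measurable (lebesgue_on {0..T})"
proof -
 from conjunct2[OF f[unfolded sobolev_measurable_def]]
 obtain S where S0: "(\<forall>n::nat. simple_function (lebesgue_on {0..T}) (S n) \<and> (\<forall>t\<in>{0..T}. S n t \<in> sobolev r)) \<and>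
   (AE t in lebesgue_on {0..T}. (\<lambda>n. sobolev_norm r (\<lambda>x. f t x - S n t x)) \<longlonglongrightarrow> 0)" ..
 note S = conjunct1[OF S0, rule_format, THEN conjunct1] conjunct1[OF S0, rule_format, THEN conjunct2, rule_format]
 note Sl = conjunct2[OF S0]
 note fg = conjunct1[OF f[unfolded sobolev_measurable_def]]
 have sp: "AE t in lebesgue_on {0..T}. t \<in> {0..T}" by (rule AE_I2) (simp add: space_restrict_space)
 show ?thesis
 proof (rule lebesgue_on_LIMSEQ_measurable)
  show "(\<lambda>t. H (S n t)) \<in> borel_measurable (lebesgue_on {0..T})" for n
   by (rule borel_measurable_simple_function[OF simple_function_compose1[OF S(1)]])
  show "AE t in lebesgue_on {0..T}. (\<lambda>n. H (S n t)) \<longlonglongrightarrow> H (f t)"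
   using Sl fg sp
  proof eventually_elim
   case (elim t)
   have l0: "(\<lambda>n. K * sobolev_norm r (\<lambda>x. f t x - S n t x)) \<longlonglongrightarrow> 0"
    using tendsto_mult_right_zero[OF elim(1)] .
   have "(\<lambda>n. H (S n t) - H (f t)) \<longlonglongrightarrow> 0"
   proof (rule Lim_null_comparison[OF _ l0], rule eventuallyI)
    fix n show "norm (H (S n t) - H (f t)) \<le> K * sobolev_norm r (\<lambda>x. f t x - S n t x)"
    proof -
     have "\<bar>H (f t) - H (S n t)\<bar> \<le> K * sobolev_norm r (\<lambda>x. f t x - S n t x)"
      by (rule H) (rule elim(2) S(2)[OF elim(3)])+
     then show ?thesis unfolding real_norm_def abs_minus_commute[of "H (S n t)"] .
    qed
   qed
   then show ?case by (rule LIM_zero_cancel)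
  qed
 qed simp
qed

lemma sobolev_norm_measurable:
 "sobolev_measurable r T f \<Longrightarrow> (\<lambda>t. sobolev_norm r (f t)) \<in> borel_measurable (lebesgue_on {0..T})"
 by (rule sobolev_lipschitz_measurable[where K=1 and H="sobolev_norm r" and r=r]) (simp_all add: sobolev_norm_diff_abs)

lemma TF_scale:
 "TF a alpha v (\<lambda>xi. of_real c * p xi) = of_real c * TF a alpha v p"
proof -
 have "conv alpha (\<lambda>xi. of_real c * p xi) xi = of_real c * conv alpha p xi" for xi
  unfolding conv_def by (simp add: mult.left_commute[of _ "complex_of_real c"])
 then show ?thesis unfolding TF_def by (simp add: mult.left_commute[of _ "complex_of_real c"])
qed

lemma integrable_test_mult:
 fixes theta g :: "real => real"
 assumes theta: "test_function D theta" and g: "integrable (lebesgue_on {a..b}) g"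
 shows "integrable (lebesgue_on {a..b}) (\<lambda>t. theta t * g t)"
proof -
 obtain R where R: "\<And>x. norm (theta x) \<le> R" using test_function_bounded[OF theta] by blast
 have "theta \<in> borel_measurable borel"
  by (rule borel_measurable_continuous_onI[OF test_function_continuous[OF theta]])
 then have m: "theta \<in> borel_measurable (lebesgue_on {a..b})"
  by (intro measurable_restrict_space1) (simp add: measurable_completion)
 show ?thesis
 proof (rule Bochner_Integration.integrable_bound)
  show "integrable (lebesgue_on {a..b}) (\<lambda>t. R * g t)" using g by simp
  show "(\<lambda>t. theta t * g t) \<in> borel_measurable (lebesgue_on {a..b})"
   using m borel_measurable_integrable[OF g] by (rule borel_measurable_times)
  show "AE t in lebesgue_on {a..b}. norm (theta t * g t) \<le> norm (R * g t)"
  proof (rule AE_I2)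
   fix t
   have "\<bar>theta t\<bar> * \<bar>g t\<bar> \<le> \<bar>R\<bar> * \<bar>g t\<bar>" using R[of t] by (intro mult_right_mono) auto
   then show "norm (theta t * g t) \<le> norm (R * g t)" by (simp add: abs_mult)
  qed
 qed
qed

text \<open>Tensor products separate the time variable: for each spatial test function the equation
  becomes a distributional identity in time alone.\<close>

lemma test_function_tensor:
 fixes theta :: "real => real" and psi :: "'a::euclidean_space => 'b::euclidean_space"
 assumes theta: "test_function D theta" and psi: "test_function UNIV psi"
 shows "test_function (D \<times> UNIV) (\<lambda>z. theta (fst z) *\<^sub>R psi (snd z))"
  "frechet_derivative (\<lambda>z. theta (fst z) *\<^sub>R psi (snd z)) (at (t, x)) (1, 0) = frechet_derivative theta (at t) 1 *\<^sub>R psi x"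
proof -
 let ?K = "closure {x. theta x \<noteq> 0} \<times> closure {x. psi x \<noteq> 0}"
 show "test_function (D \<times> UNIV) (\<lambda>z. theta (fst z) *\<^sub>R psi (snd z))"
 proof (rule test_functionI[where K="?K"])
  show "Ck k (\<lambda>z. theta (fst z) *\<^sub>R psi (snd z))" for k
   using Ck_affine_comp[OF bounded_linear_fst, of k theta 0] Ck_affine_comp[OF bounded_linear_snd, of k psi 0] theta psi
   by (intro Ck_scaleR) (auto simp: test_function_def)
  show "compact ?K" "?K \<subseteq> D \<times> UNIV" using theta psi by (auto simp: test_function_def compact_Times)
  show "theta (fst z) *\<^sub>R psi (snd z) = 0" if "z \<notin> ?K" for z
   using that closure_subset[of "{x. theta x \<noteq> 0}"] closure_subset[of "{x. psi x \<noteq> 0}"] by (cases z) auto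
 qed
 have f: "((\<lambda>z. theta (fst z)) has_derivative (\<lambda>h. frechet_derivative theta (at t) (fst h))) (at (t, x))"
  using diff_chain_at[OF has_derivative_fst[OF has_derivative_ident] test_function_has_derivative[OF theta], of "(t, x)"]
  by (simp add: o_def)
 have s: "((\<lambda>z. psi (snd z)) has_derivative (\<lambda>h. frechet_derivative psi (at x) (snd h))) (at (t, x))"
  using diff_chain_at[OF has_derivative_snd[OF has_derivative_ident] test_function_has_derivative[OF psi], of "(t, x)"]
  by (simp add: o_def)
 note d = frechet_derivative_at[OF has_derivative_scaleR[OF f s], symmetric]
 have "frechet_derivative psi (at x) 0 = 0"
  by (rule linear_0[OF has_derivative_linear[OF test_function_has_derivative[OF psi]]])
 then show "frechet_derivative (\<lambda>z. theta (fst z) *\<^sub>R psi (snd z)) (at (t, x)) (1, 0) = frechet_derivative theta (at t) 1 *\<^sub>R psi x"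
  unfolding d by simp
qed

lemma adm_test:
 assumes "test_function D psi" shows "adm (vh psi)"
 unfolding adm_def
proof (intro allI conjI)
 note t = test_function_vec_nth[OF assms]
 show "sqint (jb1 (vh psi i))" for i by (rule test_function_jb1[OF t])
 show "vh psi i \<in> borel_measurable borel" for i
  by (rule sqint_measurable[OF hat_fourier(1)[OF test_function_integrable(2)[OF t]]])
qed

section \<open>Evolution of the pairing with a fixed test object\<close>

locale symmetric_hyperbolic =
 fixes \<sigma> T :: real and A :: "'d::finite => real => real^'d => real^'n::finite^'n"
  and F U :: "real => real^'d => real^'n"
 assumes \<sigma>: "\<sigma> > real CARD('d) / 2"
  and A: "\<And>a. Linf_sobolev (\<sigma> + 1) T (A a)"
  and sym: "\<And>a. AE t in lebesgue_on {0..T}. AE x in lebesgue. transpose (A a t x) = A a t x"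
  and F: "Linf_sobolev \<sigma> T F"
  and U: "Linf_sobolev \<sigma> T U" "weakly_continuous \<sigma> T U"
  and sol: "distributional_solution T A F U"
begin

text \<open>Collects the almost everywhere hypotheses at a single time under one common bound, so
  that pointwise estimates start from a single assumption.\<close>

definition regular :: "real => real => bool" where
 "regular K t \<longleftrightarrow> (\<forall>a. A a t \<in> sobolev (\<sigma> + 1) \<and> sobolev_norm (\<sigma> + 1) (A a t) \<le> K \<and> (AE x in lebesgue. transpose (A a t x) = A a t x)) \<and>
   F t \<in> sobolev \<sigma> \<and> sobolev_norm \<sigma> (F t) \<le> K \<and> U t \<in> sobolev \<sigma> \<and> sobolev_norm \<sigma> (U t) \<le> K"

lemma regularD:
 assumes "regular K t"
 shows "A a t \<in> sobolev (\<sigma> + 1)" "sobolev_norm (\<sigma> + 1) (A a t) \<le> K" "AE x in lebesgue. transpose (A a t x) = A a t x"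
  "F t \<in> sobolev \<sigma>" "sobolev_norm \<sigma> (F t) \<le> K" "U t \<in> sobolev \<sigma>" "sobolev_norm \<sigma> (U t) \<le> K"
 using assms by (auto simp: regular_def)

lemma \<sigma>_pos: "0 < \<sigma>"
 using \<sigma> by (meson divide_nonneg_nonneg le_less_trans of_nat_0_le_iff zero_le_numeral)

lemma ex_regular: "\<exists>K\<ge>0. AE t in lebesgue_on {0..T}. regular K t"
proof -
 have "\<forall>a. \<exists>k. AE t in lebesgue_on {0..T}. sobolev_norm (\<sigma> + 1) (A a t) \<le> k" using A by (auto simp: Linf_sobolev_def)
 then obtain k where k: "\<And>a. AE t in lebesgue_on {0..T}. sobolev_norm (\<sigma> + 1) (A a t) \<le> k a" by metis
 obtain kF where kF: "AE t in lebesgue_on {0..T}. sobolev_norm \<sigma> (F t) \<le> kF" using F by (auto simp: Linf_sobolev_def)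
 obtain kU where kU: "AE t in lebesgue_on {0..T}. sobolev_norm \<sigma> (U t) \<le> kU" using U(1) by (auto simp: Linf_sobolev_def)
 define K where "K = (\<Sum>a\<in>UNIV. \<bar>k a\<bar>) + \<bar>kF\<bar> + \<bar>kU\<bar>"
 have ka: "k a \<le> K" for a
  using member_le_sum[of a UNIV "\<lambda>a. \<bar>k a\<bar>"] unfolding K_def by simp
 have s0: "0 \<le> (\<Sum>a\<in>UNIV. \<bar>k a\<bar>)" by (rule sum_nonneg) simp
 then have K0: "0 \<le> K" "kF \<le> K" "kU \<le> K"
  unfolding K_def using abs_ge_self[of kF] abs_ge_self[of kU] abs_ge_zero[of kF] abs_ge_zero[of kU] by linarith+
 have sA: "\<And>a. AE t in lebesgue_on {0..T}. A a t \<in> sobolev (\<sigma> + 1)" and sFU: "AE t in lebesgue_on {0..T}. F t \<in> sobolev \<sigma>" "AE t in lebesgue_on {0..T}. U t \<in> sobolev \<sigma>"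
  using A F U(1) by (auto simp: Linf_sobolev_def sobolev_measurable_def)
 have "AE t in lebesgue_on {0..T}. A a t \<in> sobolev (\<sigma> + 1) \<and> sobolev_norm (\<sigma> + 1) (A a t) \<le> K \<and> (AE x in lebesgue. transpose (A a t x) = A a t x)" for a
  using k[of a] sA[of a] sym[of a] by eventually_elim (use ka[of a] in auto)
 then have "AE t in lebesgue_on {0..T}. \<forall>a. A a t \<in> sobolev (\<sigma> + 1) \<and> sobolev_norm (\<sigma> + 1) (A a t) \<le> K \<and> (AE x in lebesgue. transpose (A a t x) = A a t x)"
  by (simp add: AE_all_countable)
 then have "AE t in lebesgue_on {0..T}. regular K t"
  using kF kU sFU by eventually_elim (use K0 in \<open>auto simp: regular_def\<close>)
 then show ?thesis using K0 by blast
qed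

definition K where "K = (SOME K. K \<ge> 0 \<and> (AE t in lebesgue_on {0..T}. regular K t))"

lemma K: "0 \<le> K" "AE t in lebesgue_on {0..T}. regular K t"
 using someI_ex[OF ex_regular] by (auto simp: K_def)

text \<open>What the equation prescribes as the time derivative of the pairing of \<open>U\<close>
  with \<open>p\<close>.\<close>

definition G :: "real => ('n => real^'d => complex) => real" where
 "G t p = vpair (vh (F t)) p - tpair (\<lambda>a. A a t) (U t) p"

text \<open>\<open>K\<close> accounts for the forcing; the remaining term is the constant of
  \<open>tpair_bound\<close> with every norm of the data replaced by \<open>K\<close>.\<close>

definition KG :: real where
 "KG = K + 2 * fconst TYPE(real^'d) * Kw TYPE(real^'d) \<sigma> * real CARD('n) * (\<Sum>a\<in>(UNIV::'d set). K) * K"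

lemma KG_nonneg: "0 \<le> KG"
 unfolding KG_def using K(1) Kw_nonneg[of \<sigma>, where 'a="real^'d"] less_imp_le[OF fconst_pos[where 'a="real^'d"]]
 by (intro add_nonneg_nonneg mult_nonneg_nonneg sum_nonneg) auto

lemma G_bound:
 assumes t: "regular K t" and p: "adm p"
 shows "\<bar>G t p\<bar> \<le> KG * (\<Sum>i\<in>UNIV. nrm (jb1 (p i)))"
proof -
 let ?s = "\<Sum>i\<in>UNIV. nrm (jb1 (p i))" and ?k = "2 * fconst TYPE(real^'d) * Kw TYPE(real^'d) \<sigma> * real CARD('n)"
 note r = regularD[OF t]
 have s0: "0 \<le> ?s" by (intro sum_nonneg nrm_nonneg)
 have k0: "0 \<le> ?k" using Kw_nonneg[of \<sigma>, where 'a="real^'d"] less_imp_le[OF fconst_pos[where 'a="real^'d"]]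
  by (intro mult_nonneg_nonneg) auto
 have "\<bar>vpair (vh (F t)) p\<bar> \<le> (\<Sum>i\<in>UNIV. nrm (p i)) * sobolev_norm \<sigma> (F t)"
  by (rule vpair_sobolev_bound[OF r(4) less_imp_le[OF \<sigma>_pos] admD(3)[OF p]])
 also have "\<dots> \<le> ?s * K"
  by (intro mult_mono sum_mono nrm_le_jb1 admD[OF p] r s0 sobolev_norm_nonneg)
 finally have 1: "\<bar>vpair (vh (F t)) p\<bar> \<le> K * ?s" by (simp only: mult.commute)
 have "\<bar>tpair (\<lambda>a. A a t) (U t) p\<bar> \<le> ?k * (\<Sum>a\<in>UNIV. sobolev_norm (\<sigma> + 1) (A a t)) * sobolev_norm \<sigma> (U t) * ?s"
  by (rule tpair_bound[OF \<sigma> r(1) r(6) p])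
 also have "\<dots> \<le> ?k * (\<Sum>a\<in>(UNIV::'d set). K) * K * ?s"
  by (intro mult_right_mono mult_mono mult_left_mono sum_mono r s0 k0 mult_nonneg_nonneg sum_nonneg sobolev_norm_nonneg K(1))
 finally show ?thesis using 1 unfolding G_def KG_def distrib_right by linarith
qed

lemma G_diff:
 assumes t: "regular K t" and p: "adm p" "adm q"
 shows "G t (\<lambda>i xi. p i xi - q i xi) = G t p - G t q"
 unfolding G_def tpair_diff[OF \<sigma> regularD(1)[OF t] regularD(6)[OF t] p]
  vpair_diff_right[of "vh (F t)" p q, OF sobolev_vecD(2)[OF regularD(4)[OF t]] admD(3)[OF p(1)] admD(3)[OF p(2)]]
 by simp

lemma vpair_measurable:
 assumes f: "Linf_sobolev \<sigma> T f" and p: "adm p"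
 shows "(\<lambda>t. vpair (vh (f t)) p) \<in> borel_measurable (lebesgue_on {0..T})"
proof (rule sobolev_lipschitz_measurable[where H="\<lambda>u. vpair (vh u) p" and r=\<sigma>])
 show "sobolev_measurable \<sigma> T f" using f by (simp add: Linf_sobolev_def)
 show "\<bar>vpair (vh u) p - vpair (vh u') p\<bar> \<le> (\<Sum>j\<in>UNIV. nrm (p j)) * sobolev_norm \<sigma> (\<lambda>x. u x - u' x)"
  if "u \<in> sobolev \<sigma>" "u' \<in> sobolev \<sigma>" for u u'
  unfolding vpair_sobolev_diff[OF that admD(3)[OF p], symmetric]
  by (rule vpair_sobolev_bound[OF sobolev_linear(1)[OF that] less_imp_le[OF \<sigma>_pos] admD(3)[OF p]])
qed

lemma tpair_measurable:
 assumes p: "adm p"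
 shows "(\<lambda>t. tpair (\<lambda>a. A a t) (U t) p) \<in> borel_measurable (lebesgue_on {0..T})"
proof -
 have "(\<lambda>t. Re (TF a (mh (A a t) i j) (vh (U t) j) (p i))) \<in> borel_measurable (lebesgue_on {0..T})" for a i j
 proof (rule sobolev_bilinear_measurable[where H="\<lambda>B w. Re (TF a (mh B i j) (vh w j) (p i))" and r="\<sigma> + 1" and q=\<sigma>])
  show "sobolev_measurable (\<sigma> + 1) T (A a)" "sobolev_measurable \<sigma> T U" using A U(1) by (simp_all add: Linf_sobolev_def)
  show "\<bar>Re (TF a (mh B i j) (vh w j) (p i)) - Re (TF a (mh B' i j) (vh w' j) (p i))\<bar> \<le>
    2 * fconst TYPE(real^'d) * Kw TYPE(real^'d) \<sigma> * nrm (jb1 (p i)) *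
    (sobolev_norm (\<sigma> + 1) (\<lambda>x. B x - B' x) * sobolev_norm \<sigma> w' + sobolev_norm (\<sigma> + 1) B * sobolev_norm \<sigma> (\<lambda>x. w x - w' x))"
   if "B \<in> sobolev (\<sigma> + 1)" "B' \<in> sobolev (\<sigma> + 1)" "w \<in> sobolev \<sigma>" "w' \<in> sobolev \<sigma>" for B B' w w'
   using order_trans[OF abs_Re_le_cmod TF_sobolev_diff[OF \<sigma> that admD(1,2)[OF p], of a i j i]] by simp
 qed
 then show ?thesis unfolding tpair_def Re_sum by (intro borel_measurable_sum)
qed

lemma G_measurable: "adm p \<Longrightarrow> (\<lambda>t. G t p) \<in> borel_measurable (lebesgue_on {0..T})"
 unfolding G_def by (intro borel_measurable_diff vpair_measurable[OF F] tpair_measurable)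

lemma G_integrable:
 assumes p: "adm p"
 shows "integrable (lebesgue_on {0..T}) (\<lambda>t. G t p)"
proof (rule integrable_lebesgue_on_bounded[OF G_measurable[OF p]])
 show "AE t in lebesgue_on {0..T}. \<bar>G t p\<bar> \<le> KG * (\<Sum>i\<in>UNIV. nrm (jb1 (p i)))"
  using K(2) by eventually_elim (rule G_bound[OF _ p])
qed

text \<open>The distributional equation is tested with \<open>theta\<close> in time and
  \<open>psi\<close> in space. Weak continuity makes the pairing continuous, so the one-dimensional
  lemma converts the distributional derivative into increments that hold for all times, the
  endpoints included.\<close>

lemma weak_form_test:
 assumes psi: "test_function UNIV psi" and ab: "0 \<le> a" "a \<le> b" "b \<le> T"
 shows "vpair (vh (U b)) (vh psi) - vpair (vh (U a)) (vh psi) = II a b (\<lambda>t. G t (vh psi))"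
proof (rule du_Bois_Reymond[OF _ G_integrable[OF adm_test[OF psi]] _ ab])
 note p = adm_test[OF psi]
 let ?l = "\<lambda>t. vpair (vh (U t)) (vh psi)" and ?lF = "\<lambda>t. vpair (vh (F t)) (vh psi)"
  and ?tp = "\<lambda>t. tpair (\<lambda>a. A a t) (U t) (vh psi)"
 show c: "continuous_on {0..T} ?l"
 proof -
  have "\<forall>l\<in>sobolev_dual \<sigma>. continuous_on {0..T} (\<lambda>t. l (U t))" using U(2) by (simp add: weakly_continuous_def)
  from bspec[OF this vpair_sobolev_dual[where p="vh psi", OF less_imp_le[OF \<sigma>_pos] admD(3)[OF p]]] show ?thesis .
 qed
 fix theta :: "real => real" assume theta: "test_function {0<..<T} theta"
 let ?theta' = "\<lambda>t. frechet_derivative theta (at t) 1"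
 have theta': "test_function {0<..<T} ?theta'" by (rule test_function_derivative[OF theta])
 define phi where "phi z = theta (fst z) *\<^sub>R psi (snd z)" for z :: "real \<times> (real^'d)"
 have phi: "test_function ({0<..<T} \<times> UNIV) phi"
   "frechet_derivative phi (at (t, x)) (1, 0) = ?theta' t *\<^sub>R psi x" for t x
  unfolding phi_def[abs_def] by (rule test_function_tensor[OF theta psi])+
 have il: "integrable (lebesgue_on {0..T}) ?l"
 proof (rule integrable_lebesgue_on_bounded[OF vpair_measurable[OF U(1) p]])
  show "AE t in lebesgue_on {0..T}. \<bar>?l t\<bar> \<le> (\<Sum>j\<in>UNIV. nrm (vh psi j)) * K"
   using K(2)
  proof eventually_elim
   case (elim t)
   show ?case
    by (rule order_trans[OF vpair_sobolev_bound[where p="vh psi", OF regularD(6)[OF elim] less_imp_le[OF \<sigma>_pos] admD(3)[OF p]]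
     mult_left_mono[OF regularD(7)[OF elim]]]) (simp add: sum_nonneg)
  qed
 qed
 have ilF: "integrable (lebesgue_on {0..T}) ?lF"
 proof (rule integrable_lebesgue_on_bounded[OF vpair_measurable[OF F p]])
  show "AE t in lebesgue_on {0..T}. \<bar>?lF t\<bar> \<le> (\<Sum>j\<in>UNIV. nrm (vh psi j)) * K"
   using K(2)
  proof eventually_elim
   case (elim t)
   show ?case
    by (rule order_trans[OF vpair_sobolev_bound[where p="vh psi", OF regularD(4)[OF elim] less_imp_le[OF \<sigma>_pos] admD(3)[OF p]]
     mult_left_mono[OF regularD(5)[OF elim]]]) (simp add: sum_nonneg)
  qed
 qed
 have itp: "integrable (lebesgue_on {0..T}) ?tp"
  using Bochner_Integration.integrable_diff[OF ilF G_integrable[OF p]] by (simp add: G_def)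
 note i = integrable_test_mult[OF theta' il] integrable_test_mult[OF theta ilF] integrable_test_mult[OF theta itp]
 have "(LINT t|lebesgue_on {0..T}. - (?theta' t * ?l t) + theta t * ?tp t) =
   (LINT t|lebesgue_on {0..T}. - (LINT x|lebesgue. U t x \<bullet> frechet_derivative phi (at (t, x)) (1, 0))
      + (\<Sum>a\<in>UNIV. transport_pairing a (A a t) (U t) (\<lambda>x. phi (t, x))))"
 proof (rule lebesgue_on_integral_cong_AE)
  show "(\<lambda>t. - (?theta' t * ?l t) + theta t * ?tp t) \<in> borel_measurable (lebesgue_on {0..T})"
   using i by (intro borel_measurable_add borel_measurable_uminus borel_measurable_integrable)
  show "AE t in lebesgue_on {0..T}. - (?theta' t * ?l t) + theta t * ?tp t =
   - (LINT x|lebesgue. U t x \<bullet> frechet_derivative phi (at (t, x)) (1, 0))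
      + (\<Sum>a\<in>UNIV. transport_pairing a (A a t) (U t) (\<lambda>x. phi (t, x)))"
   using K(2)
  proof eventually_elim
   case (elim t)
   note r = regularD[OF elim]
   have d: "\<sigma> > real DIM(real^'d) / 2" using \<sigma> by simp
   have 1: "(LINT x|lebesgue. U t x \<bullet> frechet_derivative phi (at (t, x)) (1, 0)) = ?theta' t * ?l t"
    unfolding phi(2) inner_scaleR_right integral_mult_right_zero vpair_test[OF r(6) psi] ..
   have tpsi: "test_function UNIV (\<lambda>x. theta t *\<^sub>R psi x)"
   proof (rule test_functionI)
    show "Ck k (\<lambda>x. theta t *\<^sub>R psi x)" for k using psi by (intro Ck_scaleR Ck_const) (simp add: test_function_def)
    show "compact (closure {x. psi x \<noteq> 0})" "closure {x. psi x \<noteq> 0} \<subseteq> UNIV" using psi by (simp_all add: test_function_def)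
    show "theta t *\<^sub>R psi x = 0" if "x \<notin> closure {x. psi x \<noteq> 0}" for x
     using that closure_subset[of "{x. psi x \<noteq> 0}"] by auto
   qed
   have sc: "TF a (mh (A a t) i j) (vh (U t) j) (hat (\<lambda>x. complex_of_real ((theta t *\<^sub>R psi x) $ i))) =
     of_real (theta t) * TF a (mh (A a t) i j) (vh (U t) j) (vh psi i)" for a i j
   proof -
    have "AE xi in lborel. hat (\<lambda>x. complex_of_real ((theta t *\<^sub>R psi x) $ i)) xi = of_real (theta t) * vh psi i xi"
     using hat_cmult[OF test_function_integrable(2)[OF test_function_vec_nth[OF psi]], of "of_real (theta t)" i] by simp
    then have "TF a (mh (A a t) i j) (vh (U t) j) (hat (\<lambda>x. complex_of_real ((theta t *\<^sub>R psi x) $ i))) =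
      TF a (mh (A a t) i j) (vh (U t) j) (\<lambda>xi. of_real (theta t) * vh psi i xi)"
     by (intro TF_cong_AE sobolev_matD(2)[OF r(1)] sobolev_vecD(3)[OF r(6)] admD(1)[OF adm_test[OF tpsi]]
      borel_measurable_times borel_measurable_const admD(1)[OF p]) simp_all
    then show ?thesis by (simp only: TF_scale)
   qed
   have "transport_pairing a (A a t) (U t) (\<lambda>x. phi (t, x)) =
     theta t * Re (\<Sum>i\<in>UNIV. \<Sum>j\<in>UNIV. TF a (mh (A a t) i j) (vh (U t) j) (vh psi i))" for a
   proof -
    have "(\<lambda>x. phi (t, x)) = (\<lambda>x. theta t *\<^sub>R psi x)" by (simp add: phi_def)
    then have "transport_pairing a (A a t) (U t) (\<lambda>x. phi (t, x)) =
      Re (\<Sum>i\<in>UNIV. \<Sum>j\<in>UNIV. TF a (mh (A a t) i j) (vh (U t) j) (hat (\<lambda>x. complex_of_real ((theta t *\<^sub>R psi x) $ i))))"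
     using transport_pairing_TF[OF sobolev_matD(1)[OF r(1)] good_jbs(1)[OF d sobolev_matD(2,3)[OF r(1)]] sobolev_vecD(1)[OF r(6)] tpsi, of a a] by simp
    also have "\<dots> = Re (of_real (theta t) * (\<Sum>i\<in>UNIV. \<Sum>j\<in>UNIV. TF a (mh (A a t) i j) (vh (U t) j) (vh psi i)))"
     unfolding sc sum_distrib_left ..
    finally show ?thesis by simp
   qed
   then show ?case unfolding 1 tpair_def by (simp add: sum_distrib_left)
  qed
 qed simp
 also have "\<dots> = (LINT t|lebesgue_on {0..T}. LINT x|lebesgue. F t x \<bullet> phi (t, x))"
  using sol phi(1) unfolding distributional_solution_def by blast
 also have "\<dots> = (LINT t|lebesgue_on {0..T}. theta t * ?lF t)"
 proof (rule lebesgue_on_integral_cong_AE[symmetric])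
  show "(\<lambda>t. theta t * ?lF t) \<in> borel_measurable (lebesgue_on {0..T})" using i(2) by (rule borel_measurable_integrable)
  show "AE t in lebesgue_on {0..T}. theta t * ?lF t = (LINT x|lebesgue. F t x \<bullet> phi (t, x))"
   using K(2)
  proof eventually_elim
   case (elim t)
   show ?case
    unfolding phi_def fst_conv snd_conv inner_scaleR_right integral_mult_right_zero vpair_test[OF regularD(4)[OF elim] psi] ..
  qed
 qed simp
 finally show "- (LINT t|lebesgue_on {0..T}. ?theta' t * ?l t) = (LINT t|lebesgue_on {0..T}. theta t * G t (vh psi))"
  using i by (simp add: G_def right_diff_distrib)
qed

text \<open>Density: such \<open>p\<close> are limits of transforms of test functions in the norm of
  order one, and \<open>G_bound\<close> is uniform in time. The symmetry under reflection is
  demanded because test functions are real valued.\<close>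

lemma weak_form:
 assumes p: "adm p" and b: "\<And>i. band R (p i)" and R: "0 \<le> R"
  and s: "\<And>i. AE xi in lborel. p i (- xi) = cnj (p i xi)" and ab: "0 \<le> a" "a \<le> b" "b \<le> T"
 shows "vpair (vh (U b)) p - vpair (vh (U a)) p = II a b (\<lambda>t. G t p)"
proof -
 let ?P = "\<lambda>i phi. (\<forall>n::nat. test_function UNIV (phi n :: real^'d => real)) \<and>
  (\<lambda>n. nrm (jb1 (\<lambda>xi. hat (\<lambda>x. of_real (phi n x)) xi - p i xi))) \<longlonglongrightarrow> 0"
 have "\<exists>phi. ?P i phi" for i
  by (rule bandlimited_approx[OF b[of i] admD(3)[OF p, of i] R s[of i]])
 then have "\<forall>i. \<exists>phi. ?P i phi" ..
 from choice[OF this] obtain phi where P: "\<forall>i. ?P i (phi i)" ..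
 have phi: "test_function UNIV (phi i n)" for i n using P by (rule allE[of _ i]) (erule conjunct1[THEN spec])
 have phil: "(\<lambda>n. nrm (jb1 (\<lambda>xi. hat (\<lambda>x. of_real (phi i n x)) xi - p i xi))) \<longlonglongrightarrow> 0" for i
  using P by (rule allE[of _ i]) (erule conjunct2)
 \<comment> \<open>The scalar approximants of the components are assembled into one vector-valued
   test function.\<close>
 define psi where "psi n x = (\<Sum>i\<in>UNIV. phi i n x *\<^sub>R axis i (1::real))" for n x
 have psii: "psi n x $ i = phi i n x" for n x i
  by (simp add: psi_def axis_def if_distrib cong: if_cong)
 have tpsi: "test_function UNIV (psi n)" for n
 proof (rule test_functionI)
  show "Ck k (psi n)" for k
   unfolding psi_def[abs_def] using phi by (intro Ck_sum Ck_scaleR Ck_const) (simp add: test_function_def)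
  show "compact (\<Union>i. closure {x. phi i n x \<noteq> 0})" using phi by (intro compact_UN) (simp_all add: test_function_def)
  show "psi n x = 0" if "x \<notin> (\<Union>i. closure {x. phi i n x \<noteq> 0})" for x
  proof -
   have "phi i n x = 0" for i using that closure_subset[of "{x. phi i n x \<noteq> 0}"] by auto
   then show ?thesis by (simp add: psi_def)
  qed
 qed simp
 note q = adm_test[OF tpsi]
 define e where "e n = (\<Sum>i\<in>UNIV. nrm (jb1 (\<lambda>xi. vh (psi n) i xi - p i xi)))" for n
 have e: "e \<longlonglongrightarrow> 0"
  unfolding e_def psii by (rule tendsto_null_sum[OF phil])
 have Ut: "U t \<in> sobolev \<sigma>" if "t \<in> {0..T}" for t using U(2) that by (simp add: weakly_continuous_def)
 have V: "(\<lambda>n. vpair (vh (U t)) (vh (psi n))) \<longlonglongrightarrow> vpair (vh (U t)) p" if t: "t \<in> {0..T}" for t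
 proof -
  have "(\<lambda>n. vpair (vh (U t)) (vh (psi n)) - vpair (vh (U t)) p) \<longlonglongrightarrow> 0"
  proof (rule Lim_null_comparison[OF eventuallyI])
   show "(\<lambda>n. e n * sobolev_norm \<sigma> (U t)) \<longlonglongrightarrow> 0" using tendsto_mult_left_zero[OF e] .
   fix n
   note a = adm_diff[OF q[of n] p]
   have "vpair (vh (U t)) (vh (psi n)) - vpair (vh (U t)) p = vpair (vh (U t)) (\<lambda>i xi. vh (psi n) i xi - p i xi)"
    by (rule vpair_diff_right[of "vh (U t)" "vh (psi n)" p, OF sobolev_vecD(2)[OF Ut[OF t]] admD(3)[OF q] admD(3)[OF p], symmetric])
   also have "\<bar>\<dots>\<bar> \<le> (\<Sum>i\<in>UNIV. nrm (\<lambda>xi. vh (psi n) i xi - p i xi)) * sobolev_norm \<sigma> (U t)"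
    by (rule vpair_sobolev_bound[OF Ut[OF t] less_imp_le[OF \<sigma>_pos]]) (rule admD(3)[OF a])
   also have "\<dots> \<le> e n * sobolev_norm \<sigma> (U t)"
    unfolding e_def by (intro mult_right_mono sum_mono nrm_le_jb1 admD(1,2)[OF a] sobolev_norm_nonneg)
   finally show "norm (vpair (vh (U t)) (vh (psi n)) - vpair (vh (U t)) p) \<le> e n * sobolev_norm \<sigma> (U t)" by simp
  qed
  then show ?thesis by (simp only: Lim_null[symmetric])
 qed
 have Gi: "integrable (lebesgue_on {a..b}) (\<lambda>t. G t p)" if "adm p" for p
  by (rule integrable_lebesgue_on_subset[OF G_integrable[OF that]]) (use ab in auto)
 have aer: "AE t in lebesgue_on {a..b}. regular K t" by (rule AE_lebesgue_on_subset[OF K(2)]) (use ab in auto)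
 have I: "(\<lambda>n. II a b (\<lambda>t. G t (vh (psi n)))) \<longlonglongrightarrow> II a b (\<lambda>t. G t p)"
 proof -
  have "(\<lambda>n. II a b (\<lambda>t. G t (vh (psi n))) - II a b (\<lambda>t. G t p)) \<longlonglongrightarrow> 0"
  proof (rule Lim_null_comparison[OF eventuallyI])
   have "(\<lambda>n. KG * e n * (b - a)) \<longlonglongrightarrow> KG * 0 * (b - a)" by (intro tendsto_intros e)
   then show "(\<lambda>n. KG * e n * (b - a)) \<longlonglongrightarrow> 0" by simp
   fix n
   have bd: "AE t in lebesgue_on {a..b}. \<bar>G t (vh (psi n)) - G t p\<bar> \<le> KG * e n"
    using aer
   proof eventually_elim
    case (elim t)
    show ?case using G_bound[OF elim adm_diff[OF q[of n] p]] unfolding G_diff[OF elim q[of n] p] e_def .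
   qed
   have "II a b (\<lambda>t. G t (vh (psi n))) - II a b (\<lambda>t. G t p) = II a b (\<lambda>t. G t (vh (psi n)) - G t p)"
    using Gi[OF q[of n]] Gi[OF p] by simp
   also have "\<bar>\<dots>\<bar> \<le> II a b (\<lambda>t. \<bar>G t (vh (psi n)) - G t p\<bar>)"
    by (rule integral_abs_bound)
   also have "\<dots> \<le> KG * e n * (b - a)"
    using Gi[OF q[of n]] Gi[OF p] by (intro II_le_const ab bd integrable_abs Bochner_Integration.integrable_diff)
   finally show "norm (II a b (\<lambda>t. G t (vh (psi n))) - II a b (\<lambda>t. G t p)) \<le> KG * e n * (b - a)" by simp
  qed
  then show ?thesis by (simp only: Lim_null[symmetric])
 qed
 have "(\<lambda>n. vpair (vh (U b)) (vh (psi n)) - vpair (vh (U a)) (vh (psi n))) \<longlonglongrightarrow> vpair (vh (U b)) p - vpair (vh (U a)) p"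
  using ab by (intro tendsto_diff V) auto
 then have "(\<lambda>n. II a b (\<lambda>t. G t (vh (psi n)))) \<longlonglongrightarrow> vpair (vh (U b)) p - vpair (vh (U a)) p"
  unfolding weak_form_test[OF tpsi ab] .
 then show ?thesis using I LIMSEQ_unique by blast
qed

end

section \<open>The energy estimate\<close>

abbreviation Mw :: "real => real => ('n => real^'d => complex) => 'n => real^'d => complex" where
 "Mw \<sigma> R w \<equiv> \<lambda>j xi. of_real (mR \<sigma> R (jb xi)) * w j xi"

lemma Mw_adm:
 fixes w :: "'n => real^'d => complex"
 assumes w: "\<And>j. sqint (w j)" and R: "1 \<le> R" and \<sigma>: "0 < \<sigma>"
 shows "adm (Mw \<sigma> R w)"
 unfolding adm_def
proof (intro allI conjI)
 fix j
 note s = sqint_mR(1)[OF w R \<sigma>]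
 show "sqint (jb1 (Mw \<sigma> R w j))" using s[of 1] unfolding jbs_1 by simp
 show "Mw \<sigma> R w j \<in> borel_measurable borel" using sqint_measurable[OF s[of 0]] unfolding jbs_0 by simp
qed

text \<open>Integrability comes from the weighted L^1 bound: after the cutoff the norm of order
  \<sigma> of the multiplier is finite for any square integrable \<open>w\<close>.\<close>

lemma Mw_band:
 fixes w :: "'n => real^'d => complex"
 assumes w: "\<And>j. sqint (w j)" and R: "1 \<le> R" and \<sigma>: "\<sigma> > real CARD('d) / 2" "0 < \<sigma>"
 shows "band R (Mw \<sigma> R w j)"
 unfolding band_def
proof
 let ?p = "Mw \<sigma> R w j"
 have d: "\<sigma> > real DIM(real^'d) / 2" using \<sigma> by simp
 have eq: "jb xi powr (- \<sigma>) * cmod (jbs \<sigma> ?p xi) = cmod (?p xi)" for xi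
  using jb_pos[of xi] by (simp add: norm_mult mult.assoc[symmetric] powr_add[symmetric])
 have "integrable lborel (\<lambda>xi. cmod (?p xi))"
  using weighted_L1(1)[OF d sqint_mR(1)[OF w[of j] R \<sigma>(2) less_imp_le[OF \<sigma>(2)]]] unfolding eq .
 moreover have "adm (Mw \<sigma> R w)" by (rule Mw_adm[OF w R \<sigma>(2)])
 from admD(1)[OF this, of j] have "?p \<in> borel_measurable lborel" by simp
 ultimately show "integrable lborel ?p" by (simp only: integrable_norm_iff)
 show "\<forall>xi. R \<le> norm xi \<longrightarrow> ?p xi = 0"
 proof (intro allI impI)
  fix xi :: "real^'d" assume "R \<le> norm xi"
  then have "R \<le> jb xi" using norm_le_jb[of xi] by linarith
  then show "?p xi = 0" using R by (simp add: mR_eq_0)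
 qed
qed

section \<open>Quadratic forms of the cut-off weight\<close>

lemma mR_jb_nonneg: "1 \<le> R \<Longrightarrow> 0 \<le> mR \<sigma> R (jb xi)"
 by (rule mR_bounds(1)[OF jb_pos]) simp

lemma mR_jb_le: "1 \<le> R \<Longrightarrow> mR \<sigma> R (jb xi) \<le> jb xi powr (2 * \<sigma>)"
 by (rule mR_bounds(2)[OF jb_pos]) simp

lemma Mw_integral:
 fixes w :: "real^'d => complex"
 shows "Re (LINT xi|lborel. w xi * cnj (of_real (mR \<sigma> R (jb xi)) * w xi)) = (LINT xi|lborel. mR \<sigma> R (jb xi) * (cmod (w xi))\<^sup>2)"
proof -
 have "w xi * cnj (of_real (mR \<sigma> R (jb xi)) * w xi) = complex_of_real (mR \<sigma> R (jb xi) * (cmod (w xi))\<^sup>2)" for xi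
  unfolding of_real_mult complex_norm_square by simp
 then show ?thesis by (simp only: integral_complex_of_real Re_complex_of_real)
qed

lemma Mw_integrable:
 fixes w :: "real^'d => complex"
 assumes w: "sqint w" and R: "1 \<le> R" and \<sigma>: "0 < \<sigma>"
 shows "integrable lborel (\<lambda>xi. mR \<sigma> R (jb xi) * (cmod (w xi))\<^sup>2)"
proof (rule Bochner_Integration.integrable_bound)
 note [measurable] = sqint_measurable[OF w]
 show "integrable lborel (\<lambda>xi. R powr (2 * \<sigma>) * (cmod (w xi))\<^sup>2)" using sqint_integrable[OF w] by simp
 show "(\<lambda>xi. mR \<sigma> R (jb xi) * (cmod (w xi))\<^sup>2) \<in> borel_measurable lborel" by measurable
 show "AE xi in lborel. norm (mR \<sigma> R (jb xi) * (cmod (w xi))\<^sup>2) \<le> norm (R powr (2 * \<sigma>) * (cmod (w xi))\<^sup>2)"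
 proof (rule AE_I2)
  fix xi :: "real^'d"
  have "mR \<sigma> R (jb xi) \<le> R powr (2 * \<sigma>)"
   using mR_jb_bound[OF R \<sigma>, of 0 xi] jb_pos[of xi] by simp
  then show "norm (mR \<sigma> R (jb xi) * (cmod (w xi))\<^sup>2) \<le> norm (R powr (2 * \<sigma>) * (cmod (w xi))\<^sup>2)"
   using mR_jb_nonneg[OF R, of \<sigma> xi] by (simp add: abs_mult mult_right_mono)
 qed
qed

text \<open>A Bernstein inequality: of the two factors of the weight in the square, one combines
  with the squared bracket into at most a power of \<open>R\<close>, and the other stays. The norm
  of order one is thus controlled by the quadratic form itself, which lets the Lipschitz estimate
  for the solution close.\<close>

lemma Mw_jb1_bound:
 fixes w :: "real^'d => complex"
 assumes w: "sqint w" and R: "1 \<le> R" and \<sigma>: "0 < \<sigma>"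
 shows "(nrm (jb1 (\<lambda>xi. of_real (mR \<sigma> R (jb xi)) * w xi)))\<^sup>2 \<le>
  R powr (2 * \<sigma> + 2) * Re (LINT xi|lborel. w xi * cnj (of_real (mR \<sigma> R (jb xi)) * w xi))"
proof -
 let ?M = "\<lambda>xi. mR \<sigma> R (jb xi)"
 have s: "sqint (jb1 (\<lambda>xi. of_real (?M xi) * w xi))"
  using sqint_mR(1)[OF w R \<sigma>, of 1] unfolding jbs_1 by simp
 have "(LINT xi|lborel. (cmod (jb1 (\<lambda>xi. of_real (?M xi) * w xi) xi))\<^sup>2) \<le> (LINT xi|lborel. R powr (2 * \<sigma> + 2) * (?M xi * (cmod (w xi))\<^sup>2))"
 proof (rule integral_mono)
  show "integrable lborel (\<lambda>xi. (cmod (jb1 (\<lambda>xi. of_real (?M xi) * w xi) xi))\<^sup>2)" by (rule sqint_integrable[OF s])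
  show "integrable lborel (\<lambda>xi. R powr (2 * \<sigma> + 2) * (?M xi * (cmod (w xi))\<^sup>2))"
   using Mw_integrable[OF assms] by simp
  fix xi :: "real^'d"
  have "jb xi powr 2 = (jb xi)\<^sup>2" using powr_realpow[OF jb_pos, of xi 2] by simp
  then have b: "(jb xi)\<^sup>2 * ?M xi \<le> R powr (2 * \<sigma> + 2)" using mR_jb_bound[OF R \<sigma>, of 2 xi] by simp
  have "(cmod (jb1 (\<lambda>xi. of_real (?M xi) * w xi) xi))\<^sup>2 = ((jb xi)\<^sup>2 * ?M xi) * (?M xi * (cmod (w xi))\<^sup>2)"
   by (simp add: norm_mult power2_eq_square mult_ac)
  also have "\<dots> \<le> R powr (2 * \<sigma> + 2) * (?M xi * (cmod (w xi))\<^sup>2)"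
   by (intro mult_right_mono b mult_nonneg_nonneg mR_jb_nonneg[OF R]) simp
  finally show "(cmod (jb1 (\<lambda>xi. of_real (?M xi) * w xi) xi))\<^sup>2 \<le> R powr (2 * \<sigma> + 2) * (?M xi * (cmod (w xi))\<^sup>2)" .
 qed
 then show ?thesis unfolding nrm_power2 Mw_integral by simp
qed

lemma vpair_Mw_sym: "vpair v (Mw \<sigma> R w) = vpair w (Mw \<sigma> R v)"
proof -
 have "Re (LINT xi|lborel. v j xi * cnj (of_real (mR \<sigma> R (jb xi)) * w j xi)) = Re (LINT xi|lborel. w j xi * cnj (of_real (mR \<sigma> R (jb xi)) * v j xi))" for j
 proof -
  have "(\<lambda>xi. v j xi * cnj (of_real (mR \<sigma> R (jb xi)) * w j xi)) = (\<lambda>xi. cnj (w j xi * cnj (of_real (mR \<sigma> R (jb xi)) * v j xi)))"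
   by (simp add: mult_ac)
  then show ?thesis by (simp only: Bochner_Integration.integral_cnj complex_cnj cnj.sel)
 qed
 then show ?thesis by (simp only: vpair_def Re_sum)
qed

lemma Mw_diff: "Mw \<sigma> R (\<lambda>j xi. v j xi - w j xi) = (\<lambda>j xi. Mw \<sigma> R v j xi - Mw \<sigma> R w j xi)"
 by (simp add: right_diff_distrib)

text \<open>Cauchy-Schwarz over the components accounts for the factor
  \<open>CARD('n)\<close>.\<close>

lemma Mw_jb1_sum_bound:
 fixes w :: "'n::finite => real^'d => complex"
 assumes w: "\<And>j. sqint (w j)" and R: "1 \<le> R" and \<sigma>: "0 < \<sigma>"
 shows "(\<Sum>j\<in>UNIV. nrm (jb1 (Mw \<sigma> R w j)))\<^sup>2 \<le> real CARD('n) * R powr (2 * \<sigma> + 2) * vpair w (Mw \<sigma> R w)"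
proof -
 have "(\<Sum>j\<in>UNIV. nrm (jb1 (Mw \<sigma> R w j)))\<^sup>2 \<le> (\<Sum>j\<in>UNIV. (nrm (jb1 (Mw \<sigma> R w j)))\<^sup>2) * real CARD('n)"
  by (rule sum_squared_le_sum_of_squares)
 also have "\<dots> \<le> (\<Sum>j\<in>UNIV. R powr (2 * \<sigma> + 2) * Re (LINT xi|lborel. w j xi * cnj (of_real (mR \<sigma> R (jb xi)) * w j xi))) * real CARD('n)"
  by (intro mult_right_mono sum_mono Mw_jb1_bound w R \<sigma>) simp
 finally show ?thesis by (simp add: vpair_def sum_distrib_left[symmetric] mult_ac)
qed

text \<open>The weight is shared evenly between the two functions. Bounding the product by squares
  makes the forcing contribute its squared norm and raises the coefficient of the energy by
  one.\<close>

lemma vpair_Mw_le: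
 fixes f u :: "real^'d => real^'n"
 assumes f: "f \<in> sobolev \<sigma>" and u: "u \<in> sobolev \<sigma>" and R: "1 \<le> R"
 shows "2 * vpair (vh f) (Mw \<sigma> R (vh u)) \<le> (sobolev_norm \<sigma> f)\<^sup>2 + (sobolev_norm \<sigma> u)\<^sup>2"
proof -
 have "2 * Re (LINT xi|lborel. vh f j xi * cnj (of_real (mR \<sigma> R (jb xi)) * vh u j xi)) \<le> (nrm (jbs \<sigma> (vh f j)))\<^sup>2 + (nrm (jbs \<sigma> (vh u j)))\<^sup>2" for j
 proof -
  let ?q = "\<lambda>xi. of_real (jb xi powr (- \<sigma>)) * (of_real (mR \<sigma> R (jb xi)) * vh u j xi)"
  note [measurable] = sobolev_vecD(3)[OF u, of j]
  have qm: "?q \<in> borel_measurable borel" by measurable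
  have le: "cmod (?q xi) \<le> 1 * cmod (jbs \<sigma> (vh u j) xi)" for xi
  proof -
   have "jb xi powr (- \<sigma>) * mR \<sigma> R (jb xi) \<le> jb xi powr (- \<sigma>) * jb xi powr (2 * \<sigma>)"
    by (intro mult_left_mono mR_jb_le[OF R]) simp
   also have "\<dots> = jb xi powr \<sigma>" by (simp add: powr_add[symmetric])
   finally have "(jb xi powr (- \<sigma>) * mR \<sigma> R (jb xi)) * cmod (vh u j xi) \<le> jb xi powr \<sigma> * cmod (vh u j xi)"
    by (rule mult_right_mono) simp
   then show ?thesis using mR_jb_nonneg[OF R, of \<sigma> xi] by (simp add: norm_mult mult.assoc)
  qed
  have q: "sqint ?q" by (rule sqint_bound[OF sobolev_vecD(4)[OF u] qm AE_I2[OF le]])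
  have nq: "nrm ?q \<le> nrm (jbs \<sigma> (vh u j))" using nrm_bound[OF sobolev_vecD(4)[OF u] qm AE_I2[OF le]] by simp
  have eq: "vh f j xi * cnj (of_real (mR \<sigma> R (jb xi)) * vh u j xi) = jbs \<sigma> (vh f j) xi * cnj (?q xi)" for xi
  proof -
   have "jb xi powr \<sigma> * jb xi powr (- \<sigma>) = 1" using jb_pos[of xi] by (simp add: powr_add[symmetric])
   then have "complex_of_real (jb xi powr \<sigma>) * complex_of_real (jb xi powr (- \<sigma>)) = 1" by (metis of_real_mult of_real_1)
   moreover have "jbs \<sigma> (vh f j) xi * cnj (?q xi) =
     complex_of_real (jb xi powr \<sigma>) * complex_of_real (jb xi powr (- \<sigma>)) * (vh f j xi * cnj (of_real (mR \<sigma> R (jb xi)) * vh u j xi))"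
    by (simp only: complex_cnj_mult complex_cnj_complex_of_real mult_ac)
   ultimately show ?thesis by (simp only: mult_1_left)
  qed
  have "Re (LINT xi|lborel. vh f j xi * cnj (of_real (mR \<sigma> R (jb xi)) * vh u j xi)) \<le> cmod (LINT xi|lborel. jbs \<sigma> (vh f j) xi * cnj (?q xi))"
   unfolding eq by (rule complex_Re_le_cmod)
  also have "\<dots> \<le> nrm (jbs \<sigma> (vh f j)) * nrm (\<lambda>xi. cnj (?q xi))"
   by (rule Cauchy_Schwarz_sqint[OF sobolev_vecD(4)[OF f] sqint_cnj[OF q]])
  also have "\<dots> \<le> nrm (jbs \<sigma> (vh f j)) * nrm (jbs \<sigma> (vh u j))"
   unfolding nrm_cnj by (intro mult_left_mono nq nrm_nonneg)
  finally have "2 * Re (LINT xi|lborel. vh f j xi * cnj (of_real (mR \<sigma> R (jb xi)) * vh u j xi)) \<le> 2 * nrm (jbs \<sigma> (vh f j)) * nrm (jbs \<sigma> (vh u j))" by simp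
  also have "\<dots> \<le> (nrm (jbs \<sigma> (vh f j)))\<^sup>2 + (nrm (jbs \<sigma> (vh u j)))\<^sup>2" by (rule sum_squares_bound)
  finally show ?thesis .
 qed
 then have "(\<Sum>j\<in>UNIV. 2 * Re (LINT xi|lborel. vh f j xi * cnj (of_real (mR \<sigma> R (jb xi)) * vh u j xi))) \<le>
   (\<Sum>j\<in>UNIV. (nrm (jbs \<sigma> (vh f j)))\<^sup>2 + (nrm (jbs \<sigma> (vh u j)))\<^sup>2)"
  by (intro sum_mono)
 then show ?thesis unfolding sobolev_vec_norm[OF f] sobolev_vec_norm[OF u] vpair_def Re_sum sum_distrib_left[symmetric] sum.distrib .
qed

lemma vpair_Mw_le_norm:
 fixes u :: "real^'d => real^'n"
 assumes u: "u \<in> sobolev \<sigma>" and R: "1 \<le> R"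
 shows "vpair (vh u) (Mw \<sigma> R (vh u)) \<le> (sobolev_norm \<sigma> u)\<^sup>2"
 using vpair_Mw_le[OF u u R] by simp

text \<open>Dominated convergence with the full weight as majorant; this is where the cutoff is
  removed.\<close>

lemma vpair_Mw_tendsto:
 fixes u :: "real^'d => real^'n"
 assumes u: "u \<in> sobolev \<sigma>"
 shows "(\<lambda>n. vpair (vh u) (Mw \<sigma> (real (Suc n)) (vh u))) \<longlonglongrightarrow> (sobolev_norm \<sigma> u)\<^sup>2"
 unfolding sobolev_vec_norm[OF u] vpair_def Re_sum Mw_integral nrm_power2
proof (intro tendsto_sum)
 fix j
 note [measurable] = sobolev_vecD(3)[OF u, of j]
 have sq: "(cmod (jbs \<sigma> (vh u j) xi))\<^sup>2 = jb xi powr (2 * \<sigma>) * (cmod (vh u j xi))\<^sup>2" for xi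
 proof -
  have "jb xi powr (2 * \<sigma>) = jb xi powr \<sigma> * jb xi powr \<sigma>" by (simp add: powr_add[symmetric])
  then show ?thesis by (simp add: norm_mult power2_eq_square mult_ac)
 qed
 show "(\<lambda>n. LINT xi|lborel. mR \<sigma> (real (Suc n)) (jb xi) * (cmod (vh u j xi))\<^sup>2) \<longlonglongrightarrow> (LINT xi|lborel. (cmod (jbs \<sigma> (vh u j) xi))\<^sup>2)"
 proof (rule integral_dominated_convergence)
  show "integrable lborel (\<lambda>xi. (cmod (jbs \<sigma> (vh u j) xi))\<^sup>2)" by (rule sqint_integrable[OF sobolev_vecD(4)[OF u]])
  show "(\<lambda>xi. (cmod (jbs \<sigma> (vh u j) xi))\<^sup>2) \<in> borel_measurable lborel" by measurable
  show "(\<lambda>xi. mR \<sigma> (real (Suc n)) (jb xi) * (cmod (vh u j xi))\<^sup>2) \<in> borel_measurable lborel" for n by measurable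
  show "AE xi in lborel. norm (mR \<sigma> (real (Suc n)) (jb xi) * (cmod (vh u j xi))\<^sup>2) \<le> (cmod (jbs \<sigma> (vh u j) xi))\<^sup>2" for n
  proof (rule AE_I2)
   fix xi :: "real^'d"
   have "1 \<le> real (Suc n)" by simp
   note b = mR_jb_nonneg[OF this, of \<sigma> xi] mR_jb_le[OF this, of \<sigma> xi]
   have "norm (mR \<sigma> (real (Suc n)) (jb xi) * (cmod (vh u j xi))\<^sup>2) = mR \<sigma> (real (Suc n)) (jb xi) * (cmod (vh u j xi))\<^sup>2"
    using b(1) by (simp only: real_norm_def abs_mult abs_power2 abs_of_nonneg)
   also have "\<dots> \<le> jb xi powr (2 * \<sigma>) * (cmod (vh u j xi))\<^sup>2" by (intro mult_right_mono b) simp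
   finally show "norm (mR \<sigma> (real (Suc n)) (jb xi) * (cmod (vh u j xi))\<^sup>2) \<le> (cmod (jbs \<sigma> (vh u j) xi))\<^sup>2" unfolding sq .
  qed
  show "AE xi in lborel. (\<lambda>n. mR \<sigma> (real (Suc n)) (jb xi) * (cmod (vh u j xi))\<^sup>2) \<longlonglongrightarrow> (cmod (jbs \<sigma> (vh u j) xi))\<^sup>2"
  proof (rule AE_I2)
   fix xi :: "real^'d"
   have "(\<lambda>n. max 0 (1 - jb xi * inverse (real (Suc n)))) \<longlonglongrightarrow> max 0 (1 - jb xi * 0)"
    by (intro tendsto_max tendsto_diff tendsto_mult tendsto_const LIMSEQ_inverse_real_of_nat)
   then have "(\<lambda>n. mR \<sigma> (real (Suc n)) (jb xi)) \<longlonglongrightarrow> jb xi powr (2 * \<sigma>) * max 0 (1 - jb xi * 0)"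
    unfolding mR_def divide_inverse by (rule tendsto_mult[OF tendsto_const])
   then have "(\<lambda>n. mR \<sigma> (real (Suc n)) (jb xi)) \<longlonglongrightarrow> jb xi powr (2 * \<sigma>)" by simp
   then show "(\<lambda>n. mR \<sigma> (real (Suc n)) (jb xi) * (cmod (vh u j xi))\<^sup>2) \<longlonglongrightarrow> (cmod (jbs \<sigma> (vh u j) xi))\<^sup>2"
    unfolding sq by (rule tendsto_mult[OF _ tendsto_const])
  qed
 qed
qed

text \<open>The factors are the normalisation in the convolution theorem, the constant of
  \<open>commutator_kernel\<close>, the three L^1 embeddings of the trilinear bound, and the number
  of matrix entries. The final \<open>+ 1\<close> makes positivity immediate.\<close>

definition energy_const :: "'d::finite itself => 'n::finite itself => real => real" where
 "energy_const d n \<sigma> = fconst TYPE(real^'d) * (1 + (2 * \<sigma> + 1) * 2 powr \<sigma>) * (3 * Kw TYPE(real^'d) \<sigma>) * (real CARD('n))\<^sup>2 + 1"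

lemma energy_const_pos:
 assumes "0 < \<sigma>" shows "0 < energy_const TYPE('d::finite) TYPE('n::finite) \<sigma>"
proof -
 have "0 \<le> fconst TYPE(real^'d) * (1 + (2 * \<sigma> + 1) * 2 powr \<sigma>) * (3 * Kw TYPE(real^'d) \<sigma>) * (real CARD('n))\<^sup>2"
  using assms Kw_nonneg[of \<sigma>, where 'a="real^'d"] less_imp_le[OF fconst_pos[where 'a="real^'d"]]
  by (intro mult_nonneg_nonneg add_nonneg_nonneg) auto
 then show ?thesis unfolding energy_const_def by linarith
qed

section \<open>Energy increments and their summation\<close>

context symmetric_hyperbolic
begin

text \<open>A bound for the growth of the energy at one time that is free of
  \<open>R\<close>.\<close>

definition rate :: "real => real" where
 "rate t = (energy_const TYPE('d) TYPE('n) \<sigma> * (\<Sum>a\<in>UNIV. sobolev_norm (\<sigma> + 1) (A a t)) + 1) * (sobolev_norm \<sigma> (U t))\<^sup>2 + (sobolev_norm \<sigma> (F t))\<^sup>2"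

lemma U_sobolev: "t \<in> {0..T} \<Longrightarrow> U t \<in> sobolev \<sigma>"
 using U(2) by (simp add: weakly_continuous_def)

text \<open>The symmetry of the coefficients enters through \<open>mh_herm\<close> and makes the
  symmetrised bound available; the norms of the entries and components are then replaced by the full
  norms.\<close>

lemma tpair_Mw_bound:
 assumes t: "regular K t" and R: "1 \<le> R"
 shows "2 * \<bar>tpair (\<lambda>a. A a t) (U t) (Mw \<sigma> R (vh (U t)))\<bar> \<le> energy_const TYPE('d) TYPE('n) \<sigma> * (\<Sum>a\<in>UNIV. sobolev_norm (\<sigma> + 1) (A a t)) * (sobolev_norm \<sigma> (U t))\<^sup>2"
proof -
 note r = regularD[OF t]
 let ?k = "fconst TYPE(real^'d) * (1 + (2 * \<sigma> + 1) * 2 powr \<sigma>)" and ?K = "3 * Kw TYPE(real^'d) \<sigma>"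
  and ?n = "\<lambda>a. sobolev_norm (\<sigma> + 1) (A a t)" and ?u = "sobolev_norm \<sigma> (U t)"
 let ?S = "\<lambda>a. Re (\<Sum>i\<in>UNIV. \<Sum>j\<in>UNIV. TF a (mh (A a t) i j) (vh (U t) j) (Mw \<sigma> R (vh (U t)) i))"
 have k0: "0 \<le> ?k" "0 \<le> ?K"
  using \<sigma>_pos Kw_nonneg[of \<sigma>, where 'a="real^'d"] less_imp_le[OF fconst_pos[where 'a="real^'d"]]
  by (auto intro!: mult_nonneg_nonneg add_nonneg_nonneg)
 have a: "2 * \<bar>?S a\<bar> \<le> energy_const TYPE('d) TYPE('n) \<sigma> * ?n a * ?u\<^sup>2" for a
 proof -
  have "2 * \<bar>?S a\<bar> \<le> ?k * (\<Sum>i\<in>UNIV. \<Sum>j\<in>UNIV. ?K * nrm (jbs (\<sigma> + 1) (mh (A a t) i j)) * nrm (jbs \<sigma> (vh (U t) j)) * nrm (jbs \<sigma> (vh (U t) i)))"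
   by (rule TF_symmetrized_bound[OF \<sigma> R sobolev_matD(2)[OF r(1)] sobolev_vecD(3)[OF r(6)] sobolev_matD(3)[OF r(1)] sobolev_vecD(4)[OF r(6)] mh_herm[OF r(1) r(3)]])
  also have "\<dots> \<le> ?k * (\<Sum>i\<in>(UNIV::'n set). \<Sum>j\<in>(UNIV::'n set). ?K * ?n a * ?u * ?u)"
   by (intro mult_left_mono sum_mono mult_mono mult_nonneg_nonneg sobolev_matD(4)[OF r(1)] sobolev_vecD(5)[OF r(6)] k0 nrm_nonneg sobolev_norm_nonneg order_refl)
  also have "\<dots> = (energy_const TYPE('d) TYPE('n) \<sigma> - 1) * ?n a * ?u\<^sup>2" by (simp add: energy_const_def power2_eq_square)
  also have "\<dots> \<le> energy_const TYPE('d) TYPE('n) \<sigma> * ?n a * ?u\<^sup>2" by (intro mult_right_mono sobolev_norm_nonneg) auto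
  finally show ?thesis .
 qed
 have "2 * \<bar>\<Sum>a\<in>UNIV. ?S a\<bar> \<le> 2 * (\<Sum>a\<in>UNIV. \<bar>?S a\<bar>)" by (intro mult_left_mono sum_abs) simp
 also have "\<dots> = (\<Sum>a\<in>UNIV. 2 * \<bar>?S a\<bar>)" by (rule sum_distrib_left)
 also have "\<dots> \<le> (\<Sum>a\<in>UNIV. energy_const TYPE('d) TYPE('n) \<sigma> * ?n a * ?u\<^sup>2)" by (intro sum_mono a)
 also have "\<dots> = energy_const TYPE('d) TYPE('n) \<sigma> * (\<Sum>a\<in>UNIV. ?n a) * ?u\<^sup>2" by (simp only: sum_distrib_left sum_distrib_right)
 finally show ?thesis unfolding tpair_def .
qed

lemma G_rate:
 assumes t: "regular K t" and R: "1 \<le> R"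
 shows "2 * G t (Mw \<sigma> R (vh (U t))) \<le> rate t"
proof -
 have *: "2 * (x - y) \<le> (k + 1) * u + f" if "2 * x \<le> f + u" "2 * \<bar>y\<bar> \<le> k * u" for x y k u f :: real
 proof -
  have "- (2 * y) \<le> k * u" using that(2) abs_ge_minus_self[of y] by linarith
  then show ?thesis using that(1) by (simp add: algebra_simps)
 qed
 show ?thesis
  unfolding G_def rate_def
  by (rule *[OF vpair_Mw_le[OF regularD(4)[OF t] regularD(6)[OF t] R] tpair_Mw_bound[OF t R]])
qed

lemma rate_measurable: "rate \<in> borel_measurable (lebesgue_on {0..T})"
 unfolding rate_def[abs_def] using A F U(1)
 by (intro borel_measurable_add borel_measurable_times borel_measurable_power borel_measurable_sum borel_measurable_const sobolev_norm_measurable)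
   (simp_all add: Linf_sobolev_def)

lemma sum_A_measurable: "(\<lambda>t. energy_const TYPE('d) TYPE('n) \<sigma> * (\<Sum>a\<in>UNIV. sobolev_norm (\<sigma> + 1) (A a t)) + 1) \<in> borel_measurable (lebesgue_on {0..T})"
 using A by (intro borel_measurable_add borel_measurable_times borel_measurable_sum borel_measurable_const sobolev_norm_measurable)
   (simp_all add: Linf_sobolev_def)

lemma C_pos: "0 < energy_const TYPE('d) TYPE('n) \<sigma>" by (rule energy_const_pos[OF \<sigma>_pos])

lemma coefficient_bounds:
 "0 \<le> energy_const TYPE('d) TYPE('n) \<sigma> * (\<Sum>a\<in>UNIV. sobolev_norm (\<sigma> + 1) (A a t)) + 1"
 "regular K t \<Longrightarrow> energy_const TYPE('d) TYPE('n) \<sigma> * (\<Sum>a\<in>UNIV. sobolev_norm (\<sigma> + 1) (A a t)) + 1 \<le> energy_const TYPE('d) TYPE('n) \<sigma> * (\<Sum>a\<in>(UNIV::'d set). K) + 1"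
 using C_pos by (auto intro!: add_nonneg_nonneg mult_nonneg_nonneg sum_nonneg sobolev_norm_nonneg mult_left_mono sum_mono regularD(2) simp del: sum_constant)

lemma rate_integrable: "integrable (lebesgue_on {0..T}) rate"
proof (rule integrable_lebesgue_on_bounded[OF rate_measurable])
 show "AE t in lebesgue_on {0..T}. \<bar>rate t\<bar> \<le> (energy_const TYPE('d) TYPE('n) \<sigma> * (\<Sum>a\<in>(UNIV::'d set). K) + 1) * K\<^sup>2 + K\<^sup>2"
  using K(2)
 proof eventually_elim
  case (elim t)
  note r = regularD[OF elim]
  have sq: "(sobolev_norm \<sigma> (U t))\<^sup>2 \<le> K\<^sup>2" "(sobolev_norm \<sigma> (F t))\<^sup>2 \<le> K\<^sup>2"
   by (intro power_mono r sobolev_norm_nonneg)+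
  have "0 \<le> rate t" unfolding rate_def by (intro add_nonneg_nonneg mult_nonneg_nonneg coefficient_bounds(1)) auto
  moreover have "rate t \<le> (energy_const TYPE('d) TYPE('n) \<sigma> * (\<Sum>a\<in>(UNIV::'d set). K) + 1) * K\<^sup>2 + K\<^sup>2"
   unfolding rate_def
   by (intro add_mono mult_mono sq coefficient_bounds(2)[OF elim] zero_le_power2 order_trans[OF coefficient_bounds(1) coefficient_bounds(2)[OF elim]])
  ultimately show ?case by (simp only: abs_of_nonneg)
 qed
qed

lemma energy_increment:
 assumes R: "1 \<le> R" and st: "0 \<le> s" "s \<le> t" "t \<le> T"
 shows "vpair (vh (U t)) (Mw \<sigma> R (vh (U t))) - vpair (vh (U s)) (Mw \<sigma> R (vh (U s))) \<le>
  II s t rate + 3 * (KG\<^sup>2 * (real CARD('n) * R powr (2 * \<sigma> + 2))) * (t - s)\<^sup>2"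
proof -
 let ?B = "real CARD('n) * R powr (2 * \<sigma> + 2)"
 let ?v = "\<lambda>t. vh (U t)"
 let ?D = "\<lambda>tau. Mw \<sigma> R (\<lambda>j xi. ?v tau j xi - ?v s j xi)"
 let ?S = "\<lambda>tau. \<Sum>j\<in>UNIV. nrm (jb1 (?D tau j))"
 have B0: "0 \<le> ?B" by simp
 have sv: "sqint (?v tau j)" if "tau \<in> {0..T}" for tau j by (rule sobolev_vecD(2)[OF U_sobolev[OF that]])
 have sT: "s \<in> {0..T}" using st by auto
 have sd: "sqint (\<lambda>xi. ?v tau j xi - ?v s j xi)" if "tau \<in> {0..T}" for tau j by (intro sqint_diff sv that sT)
 have aP: "adm (Mw \<sigma> R (?v tau))" if "tau \<in> {0..T}" for tau by (rule Mw_adm[OF sv[OF that] R \<sigma>_pos])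
 have symv: "AE xi in lborel. ?v tau j (- xi) = cnj (?v tau j xi)" if "tau \<in> {0..T}" for tau j
  by (rule hat_real_sym[OF sobolev_vecD(1)[OF U_sobolev[OF that]]])
 have wf: "vpair (?v tau) (Mw \<sigma> R w) - vpair (?v s) (Mw \<sigma> R w) = II s tau (\<lambda>t. G t (Mw \<sigma> R w))"
  if tau: "s \<le> tau" "tau \<le> T" and w: "\<And>j. sqint (w j)" "\<And>j. AE xi in lborel. w j (- xi) = cnj (w j xi)" for tau w
 proof (rule weak_form[OF Mw_adm[OF w(1) R \<sigma>_pos] Mw_band[OF w(1) R \<sigma> \<sigma>_pos] _ _ st(1) tau])
  show "0 \<le> R" using R by simp
  show "AE xi in lborel. Mw \<sigma> R w j (- xi) = cnj (Mw \<sigma> R w j xi)" for j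
   using w(2)[of j] by eventually_elim (simp add: jb_minus)
 qed
 have aer: "AE x in lebesgue_on {s..tau}. regular K x" if "tau \<le> T" for tau
  by (rule AE_lebesgue_on_subset[OF K(2)]) (use st that in auto)
 have Gi: "integrable (lebesgue_on {s..tau}) (\<lambda>x. G x p)" if "adm p" "tau \<le> T" for p tau
  by (rule integrable_lebesgue_on_subset[OF G_integrable[OF that(1)]]) (use st that in auto)
 \<comment> \<open>The difference is tested against its own weighted copy, which is again frozen in
   time; \<open>G_bound\<close> then gives a bound linear in \<open>?S\<close> and in the elapsed
   time.\<close>
 have Y: "vpair (\<lambda>j xi. ?v tau j xi - ?v s j xi) (?D tau) \<le> KG * ?S tau * (tau - s)" if tau: "s \<le> tau" "tau \<le> T" for tau
 proof -
  have tauT: "tau \<in> {0..T}" using tau st by auto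
  have sy: "AE xi in lborel. ?v tau j (- xi) - ?v s j (- xi) = cnj (?v tau j xi - ?v s j xi)" for j
   using symv[OF tauT, of j] symv[OF sT, of j] by eventually_elim simp
  have a: "adm (?D tau)" by (rule Mw_adm[OF sd[OF tauT] R \<sigma>_pos])
  have "vpair (\<lambda>j xi. ?v tau j xi - ?v s j xi) (?D tau) = vpair (?v tau) (?D tau) - vpair (?v s) (?D tau)"
   by (rule vpair_diff_left[OF sv[OF tauT] sv[OF sT] admD(3)[OF a]])
  also have "\<dots> = II s tau (\<lambda>t. G t (?D tau))" by (rule wf[OF tau sd[OF tauT] sy])
  also have "\<dots> \<le> KG * ?S tau * (tau - s)"
  proof (rule II_le_const[OF tau(1) Gi[OF a tau(2)]])
   show "AE x in lebesgue_on {s..tau}. G x (?D tau) \<le> KG * ?S tau"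
    using aer[OF tau(2)]
   proof eventually_elim
    case (elim x)
    show ?case using G_bound[OF elim a] by linarith
   qed
  qed
  finally show ?thesis .
 qed
 \<comment> \<open>Absorption: by the Bernstein bound the square of \<open>?S\<close> is at most a
   multiple of the form, and the form is at most a multiple of \<open>?S\<close>. Cancelling one
   factor leaves the Lipschitz estimate.\<close>
 have S: "?S tau \<le> ?B * KG * (tau - s)" if tau: "s \<le> tau" "tau \<le> T" for tau
 proof (cases "?S tau \<le> 0")
  case True
  moreover have "0 \<le> ?B * KG * (tau - s)" using KG_nonneg B0 tau by (intro mult_nonneg_nonneg) auto
  ultimately show ?thesis by linarith
 next
  case False
  have tauT: "tau \<in> {0..T}" using tau st by auto
  have "(?S tau)\<^sup>2 \<le> ?B * vpair (\<lambda>j xi. ?v tau j xi - ?v s j xi) (?D tau)"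
   by (rule Mw_jb1_sum_bound[OF sd[OF tauT] R \<sigma>_pos])
  also have "\<dots> \<le> ?B * (KG * ?S tau * (tau - s))" by (intro mult_left_mono Y tau B0)
  finally have "?S tau * ?S tau \<le> ?S tau * (?B * KG * (tau - s))" by (simp only: power2_eq_square mult_ac)
  then show ?thesis using False by (simp only: mult_le_cancel_left not_le)
 qed
 let ?c = "KG\<^sup>2 * ?B"
 have tT: "t \<in> {0..T}" using st by auto
 have aD: "adm (?D t)" by (rule Mw_adm[OF sd[OF tT] R \<sigma>_pos])
 have Yt: "vpair (\<lambda>j xi. ?v t j xi - ?v s j xi) (?D t) \<le> ?c * (t - s)\<^sup>2"
 proof -
  have "KG * ?S t * (t - s) \<le> KG * (?B * KG * (t - s)) * (t - s)"
   using st KG_nonneg S[OF st(2,3)] by (intro mult_right_mono mult_left_mono) auto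
  also have "\<dots> = ?c * (t - s)\<^sup>2" by (simp add: power2_eq_square mult_ac)
  finally show ?thesis using Y[OF st(2,3)] by linarith
 qed
 have D: "?D t = (\<lambda>j xi. Mw \<sigma> R (?v t) j xi - Mw \<sigma> R (?v s) j xi)" by (rule Mw_diff)
 have "vpair (\<lambda>j xi. ?v t j xi - ?v s j xi) (?D t) = vpair (?v t) (?D t) - vpair (?v s) (?D t)"
  by (rule vpair_diff_left[OF sv[OF tT] sv[OF sT] admD(3)[OF aD]])
 moreover have "vpair (?v tau) (?D t) = vpair (?v tau) (Mw \<sigma> R (?v t)) - vpair (?v tau) (Mw \<sigma> R (?v s))" if "tau \<in> {0..T}" for tau
  unfolding D by (rule vpair_diff_right[of "?v tau" "Mw \<sigma> R (?v t)" "Mw \<sigma> R (?v s)", OF sv[OF that] admD(3)[OF aP[OF tT]] admD(3)[OF aP[OF sT]]])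
 from this[OF tT] this[OF sT] have "vpair (?v t) (?D t) = vpair (?v t) (Mw \<sigma> R (?v t)) - vpair (?v t) (Mw \<sigma> R (?v s))"
  "vpair (?v s) (?D t) = vpair (?v s) (Mw \<sigma> R (?v t)) - vpair (?v s) (Mw \<sigma> R (?v s))" .
 moreover have "vpair (?v s) (Mw \<sigma> R (?v t)) = vpair (?v t) (Mw \<sigma> R (?v s))" by (rule vpair_Mw_sym)
 moreover have "vpair (?v t) (Mw \<sigma> R (?v s)) - vpair (?v s) (Mw \<sigma> R (?v s)) = II s t (\<lambda>tau. G tau (Mw \<sigma> R (?v s)))"
  by (rule wf[OF st(2,3) sv[OF sT] symv[OF sT]])
 ultimately have E: "vpair (?v t) (Mw \<sigma> R (?v t)) - vpair (?v s) (Mw \<sigma> R (?v s)) =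
   vpair (\<lambda>j xi. ?v t j xi - ?v s j xi) (?D t) + 2 * II s t (\<lambda>tau. G tau (Mw \<sigma> R (?v s)))" by linarith
 have ri: "integrable (lebesgue_on {s..t}) rate"
  by (rule integrable_lebesgue_on_subset[OF rate_integrable]) (use st in auto)
 have "2 * II s t (\<lambda>tau. G tau (Mw \<sigma> R (?v s))) = II s t (\<lambda>tau. 2 * G tau (Mw \<sigma> R (?v s)))" by simp
 also have "\<dots> \<le> II s t (\<lambda>tau. rate tau + 2 * ?c * (t - s))"
 proof (rule II_mono)
  show "integrable (lebesgue_on {s..t}) (\<lambda>tau. 2 * G tau (Mw \<sigma> R (?v s)))" using Gi[OF aP[OF sT] st(3)] by simp
  show "integrable (lebesgue_on {s..t}) (\<lambda>tau. rate tau + 2 * ?c * (t - s))"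
   by (rule Bochner_Integration.integrable_add[OF ri integrable_lebesgue_on_const])
  have sp: "AE tau in lebesgue_on {s..t}. tau \<in> {s..t}" by (rule AE_I2) (simp add: space_restrict_space)
  show "AE tau in lebesgue_on {s..t}. 2 * G tau (Mw \<sigma> R (?v s)) \<le> rate tau + 2 * ?c * (t - s)"
   using aer[OF st(3)] sp
  proof eventually_elim
   case (elim tau)
   have tau: "s \<le> tau" "tau \<le> T" and tauT: "tau \<in> {0..T}" using elim(2) st by auto
   have "G tau (?D tau) = G tau (Mw \<sigma> R (?v tau)) - G tau (Mw \<sigma> R (?v s))"
    unfolding Mw_diff by (rule G_diff[OF elim(1) aP[OF tauT] aP[OF sT]])
   moreover have "\<bar>G tau (?D tau)\<bar> \<le> KG * ?S tau" by (rule G_bound[OF elim(1) Mw_adm[OF sd[OF tauT] R \<sigma>_pos]])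
   moreover have "KG * ?S tau \<le> KG * (?B * KG * (t - s))"
   proof (rule mult_left_mono[OF order_trans[OF S[OF tau] mult_left_mono] KG_nonneg])
    show "tau - s \<le> t - s" using elim(2) by simp
    show "0 \<le> ?B * KG" by (rule mult_nonneg_nonneg[OF B0 KG_nonneg])
   qed
   moreover have "KG * (?B * KG * (t - s)) = ?c * (t - s)" by (simp add: power2_eq_square mult_ac)
   ultimately show ?case using G_rate[OF elim(1) R] by linarith
  qed
 qed
 also have "\<dots> = II s t rate + II s t (\<lambda>tau. 2 * ?c * (t - s))"
  by (rule Bochner_Integration.integral_add[OF ri integrable_lebesgue_on_const])
 also have "II s t (\<lambda>tau. 2 * ?c * (t - s)) = 2 * ?c * (t - s) * (t - s)" by (rule II_const[OF st(2)])
 finally have "2 * II s t (\<lambda>tau. G tau (Mw \<sigma> R (?v s))) \<le> II s t rate + 2 * (?c * (t - s)\<^sup>2)"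
  by (simp only: power2_eq_square mult.assoc)
 moreover have "3 * ?c * (t - s)\<^sup>2 = ?c * (t - s)\<^sup>2 + 2 * (?c * (t - s)\<^sup>2)" by simp
 ultimately show ?thesis using E Yt by linarith
qed

text \<open>The order of limits matters: for fixed \<open>R\<close> the partition is refined, which
  removes the quadratic error with its constant growing in \<open>R\<close>; after that nothing on
  the right depends on \<open>R\<close>, and the cutoff can be released on the left.\<close>

lemma energy_inequality:
 assumes t: "t \<in> {0..T}"
 shows "(sobolev_norm \<sigma> (U t))\<^sup>2 \<le> (sobolev_norm \<sigma> (U 0))\<^sup>2 + II 0 t rate"
proof (rule LIMSEQ_le_const2[OF vpair_Mw_tendsto[OF U_sobolev[OF t]]], intro exI allI impI)
 fix n
 let ?R = "real (Suc n)"
 have R: "1 \<le> ?R" by simp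
 have z: "0 \<in> {0..T}" using t by auto
 have "vpair (vh (U t)) (Mw \<sigma> ?R (vh (U t))) - vpair (vh (U 0)) (Mw \<sigma> ?R (vh (U 0))) \<le> II 0 t rate"
 proof (rule telescoping)
  show "integrable (lebesgue_on {0..t}) rate"
   by (rule integrable_lebesgue_on_subset[OF rate_integrable]) (use t in auto)
  show "vpair (vh (U s)) (Mw \<sigma> ?R (vh (U s))) - vpair (vh (U r)) (Mw \<sigma> ?R (vh (U r))) \<le>
    II r s rate + 3 * (KG\<^sup>2 * (real CARD('n) * ?R powr (2 * \<sigma> + 2))) * (s - r)\<^sup>2"
   if "0 \<le> r" "r \<le> s" "s \<le> t" for r s
   by (rule energy_increment[OF R that(1,2)]) (use that t in auto)
 qed (use t in auto)
 then show "vpair (vh (U t)) (Mw \<sigma> ?R (vh (U t))) \<le> (sobolev_norm \<sigma> (U 0))\<^sup>2 + II 0 t rate"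
  using vpair_Mw_le_norm[OF U_sobolev[OF z] R] by linarith
qed

text \<open>Gronwall's lemma for the squared norm; \<open>rate\<close> is by design the coefficient
  times the squared norm plus the squared norm of the forcing.\<close>

theorem energy_estimate:
 assumes t: "t \<in> {0..T}"
 shows "(sobolev_norm \<sigma> (U t))\<^sup>2 \<le> exp (II 0 t (\<lambda>tau. energy_const TYPE('d) TYPE('n) \<sigma> * (\<Sum>a\<in>UNIV. sobolev_norm (\<sigma> + 1) (A a tau)) + 1)) *
  ((sobolev_norm \<sigma> (U 0))\<^sup>2 + II 0 t (\<lambda>tau. (sobolev_norm \<sigma> (F tau))\<^sup>2))"
proof (rule gronwall[where B="K\<^sup>2" and A="energy_const TYPE('d) TYPE('n) \<sigma> * (\<Sum>a\<in>(UNIV::'d set). K) + 1" and e="\<lambda>t. (sobolev_norm \<sigma> (U t))\<^sup>2"])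
 have sub: "h \<in> borel_measurable (lebesgue_on {0..t})" if "h \<in> borel_measurable (lebesgue_on {0..T})" for h :: "real => real"
  by (rule measurable_restrict_mono[OF that]) (use t in auto)
 have aer: "AE x in lebesgue_on {0..t}. regular K x"
  by (rule AE_lebesgue_on_subset[OF K(2)]) (use t in auto)
 show "0 \<le> t" using t by simp
 show "(\<lambda>t. (sobolev_norm \<sigma> (U t))\<^sup>2) \<in> borel_measurable (lebesgue_on {0..t})"
  using U(1) by (intro sub borel_measurable_power sobolev_norm_measurable) (simp add: Linf_sobolev_def)
 show "AE x in lebesgue_on {0..t}. (sobolev_norm \<sigma> (U x))\<^sup>2 \<le> K\<^sup>2"
  using aer
 proof eventually_elim
  case (elim x)
  show ?case by (intro power_mono regularD(7)[OF elim] sobolev_norm_nonneg)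
 qed
 show "(\<lambda>tau. energy_const TYPE('d) TYPE('n) \<sigma> * (\<Sum>a\<in>UNIV. sobolev_norm (\<sigma> + 1) (A a tau)) + 1) \<in> borel_measurable (lebesgue_on {0..t})"
  by (rule sub[OF sum_A_measurable])
 show "AE x in lebesgue_on {0..t}. energy_const TYPE('d) TYPE('n) \<sigma> * (\<Sum>a\<in>UNIV. sobolev_norm (\<sigma> + 1) (A a x)) + 1 \<le> energy_const TYPE('d) TYPE('n) \<sigma> * (\<Sum>a\<in>(UNIV::'d set). K) + 1"
  using aer by eventually_elim (rule coefficient_bounds(2))
 show "0 \<le> energy_const TYPE('d) TYPE('n) \<sigma> * (\<Sum>a\<in>UNIV. sobolev_norm (\<sigma> + 1) (A a x)) + 1" for x by (rule coefficient_bounds(1))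
 show "integrable (lebesgue_on {0..t}) (\<lambda>tau. (sobolev_norm \<sigma> (F tau))\<^sup>2)"
 proof (rule integrable_lebesgue_on_bounded)
  show "(\<lambda>tau. (sobolev_norm \<sigma> (F tau))\<^sup>2) \<in> borel_measurable (lebesgue_on {0..t})"
   using F by (intro sub borel_measurable_power sobolev_norm_measurable) (simp add: Linf_sobolev_def)
  show "AE x in lebesgue_on {0..t}. \<bar>(sobolev_norm \<sigma> (F x))\<^sup>2\<bar> \<le> K\<^sup>2"
   using aer
  proof eventually_elim
   case (elim x)
   show ?case unfolding abs_power2 by (intro power_mono regularD(5)[OF elim] sobolev_norm_nonneg)
  qed
 qed
 show "(sobolev_norm \<sigma> (U s))\<^sup>2 \<le> (sobolev_norm \<sigma> (U 0))\<^sup>2 +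
   II 0 s (\<lambda>x. (energy_const TYPE('d) TYPE('n) \<sigma> * (\<Sum>a\<in>UNIV. sobolev_norm (\<sigma> + 1) (A a x)) + 1) * (sobolev_norm \<sigma> (U x))\<^sup>2 + (sobolev_norm \<sigma> (F x))\<^sup>2)"
  if "s \<in> {0..t}" for s
  using energy_inequality[of s] that t unfolding rate_def[abs_def] by simp
qed simp_all

end

text \<open>The initial condition identifies \<open>U 0\<close> with the datum only up to null sets;
  equal transforms make the norms agree.\<close>

lemma sobolev_norm_cong_AE:
 fixes u v :: "real^'d => real^'n"
 assumes u: "u \<in> sobolev r" and v: "v \<in> sobolev r" and ae: "AE x in lebesgue. u x = v x"
 shows "(sobolev_norm r u)\<^sup>2 = (sobolev_norm r v)\<^sup>2"
proof -
 have "AE x in lebesgue. complex_of_real (u x $ j) = complex_of_real (v x $ j)" for j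
  using ae by eventually_elim simp
 then have "vh u j = vh v j" for j
  by (intro hat_cong_AE L2_measurable sobolev_vecD(1)[OF u] sobolev_vecD(1)[OF v]) (simp add: AE_completion_iff)
 then show ?thesis unfolding sobolev_vec_norm[OF u] sobolev_vec_norm[OF v] by simp
qed

text \<open>The energy estimate at \<sigma> = s - 1. The constant is \<open>energy_const\<close>,
  whose arguments are the two index types and the order, so it is chosen before \<open>T\<close> and
  the data.\<close>

theorem lemma2:
  fixes s :: real
  assumes "s > real CARD('d::finite) / 2 + 1"
  shows "\<exists>C>0. \<forall>T>0.
    \<forall>(A :: 'd \<Rightarrow> real \<Rightarrow> real^'d \<Rightarrow> real^'n^'n)
     (F :: real \<Rightarrow> real^'d \<Rightarrow> real^'n)
     (u0 :: real^'d \<Rightarrow> real^'n)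
     (U :: real \<Rightarrow> real^'d \<Rightarrow> real^'n).
      (\<forall>a. Linf_sobolev s T (A a)) \<longrightarrow>
      (\<forall>a. AE t in lebesgue_on {0..T}. AE x in lebesgue. transpose (A a t x) = A a t x) \<longrightarrow>
      Linf_sobolev (s - 1) T F \<longrightarrow>
      u0 \<in> sobolev (s - 1) \<longrightarrow>
      Linf_sobolev (s - 1) T U \<longrightarrow>
      weakly_continuous (s - 1) T U \<longrightarrow>
      distributional_solution T A F U \<longrightarrow>
      (AE x in lebesgue. U 0 x = u0 x) \<longrightarrow>
      (\<forall>t\<in>{0..T}.
        (sobolev_norm (s - 1) (U t))\<^sup>2 \<le>
          exp (LINT \<tau>|lebesgue_on {0..t}. C * (\<Sum>a\<in>UNIV. sobolev_norm s (A a \<tau>)) + 1) *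
          ((sobolev_norm (s - 1) u0)\<^sup>2 +
           (LINT \<tau>|lebesgue_on {0..t}. (sobolev_norm (s - 1) (F \<tau>))\<^sup>2)))"
proof (intro exI conjI allI impI ballI)
 have s0: "0 < s - 1" using assms by (smt (verit) divide_nonneg_nonneg of_nat_0_le_iff)
 show "0 < energy_const TYPE('d) TYPE('n) (s - 1)" by (rule energy_const_pos[OF s0])
 fix T :: real and A :: "'d \<Rightarrow> real \<Rightarrow> real^'d \<Rightarrow> real^'n^'n"
  and F U :: "real \<Rightarrow> real^'d \<Rightarrow> real^'n" and u0 :: "real^'d \<Rightarrow> real^'n" and t :: real
 assume T: "0 < T" and A: "\<forall>a. Linf_sobolev s T (A a)"
  and sym: "\<forall>a. AE t in lebesgue_on {0..T}. AE x in lebesgue. transpose (A a t x) = A a t x"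
  and F: "Linf_sobolev (s - 1) T F" and u0: "u0 \<in> sobolev (s - 1)"
  and U: "Linf_sobolev (s - 1) T U" "weakly_continuous (s - 1) T U" "distributional_solution T A F U"
  and init: "AE x in lebesgue. U 0 x = u0 x" and t: "t \<in> {0..T}"
 interpret symmetric_hyperbolic "s - 1" T A F U
  by unfold_locales (use assms A sym F U in auto)
 have "U 0 \<in> sobolev (s - 1)" using U_sobolev[of 0] T by simp
 from sobolev_norm_cong_AE[OF this u0 init] energy_estimate[OF t]
 show "(sobolev_norm (s - 1) (U t))\<^sup>2 \<le>
     exp (LINT \<tau>|lebesgue_on {0..t}. energy_const TYPE('d) TYPE('n) (s - 1) * (\<Sum>a\<in>UNIV. sobolev_norm s (A a \<tau>)) + 1) *
     ((sobolev_norm (s - 1) u0)\<^sup>2 + (LINT \<tau>|lebesgue_on {0..t}. (sobolev_norm (s - 1) (F \<tau>))\<^sup>2))"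
  by simp
qed

end
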